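(* Let $B>0$ and let $J\subset\sqrt{\operatorname{spec}(-\Delta_X)}\setminus\{0\}$ be an infinite set. 1. Let $\pi:\mathbb H\to X$ be an orientation-preserving locally isometric covering with deck group $\Gamma<\mathrm{Isom}^+(\mathbb H)$, let $u_B^{(s)}:=\mathrm{Asc}^{(s)}_{0\to B}(u_0^{(s)}\circ\pi)$, and suppose that $\{(u_B^{(s)},1/s)\}_{s\in J}$ has a semiclassical measure $\bar\mu^B$ on $T^*\mathbb H$. Then $\underline\mu^B:=(\phi_B)_\sharp\bar\mu^B$ is a $\Gamma$-invariant measure on $T\mathbb H$ (where $\gamma\in\Gamma$ acts on $T\mathbb H$ by its differential); thus it is a measure on $TX$. 2. As a measure on $TX$, $\underline\mu^B$ does not depend on the covering of $X$ by $\mathbb H$: if $\pi_{\rm I},\pi_{\rm II}:\mathbb H\to X$ are two such coverings and $\underline\mu^B_{\rm I},\underline\mu^B_{\rm II}$ are the measures on $T\mathbb H$ obtained as in part 1 from $\pi_{\rm I}$ and $\pi_{\rm II}$ along the same $J$, then $\underline\mu^B_{\rm I}$ and $\underline\mu^B_{\rm II}$ define the same measure on $TX$.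
   Context: Setting. $\mathbb H=\{z=x+iy: y>0\}$ is the hyperbolic plane with metric $(dx^2+dy^2)/y^2$, area $d\mathcal A=dx\,dy/y^2$. $X$ is a compact oriented hyperbolic surface without boundary. $\mathrm{Isom}^+(\mathbb H)$ is the group of orientation-preserving isometries. For each $s\in\sqrt{\operatorname{spec}(-\Delta_X)}$, $u_0^{(s)}:X\to\mathbb R$ is an eigenfunction, $-\Delta_Xu_0^{(s)}=s^2u_0^{(s)}$, with $\|u_0^{(s)}\|_{L^2(X)}=1$. Ascension. For $\tau\in\mathbb Z$, $K_\tau u=2iy\,\partial u/\partial z+\tau u$ on $C^\infty(\mathbb H)$. With $[\cdot]$ the integer part and $s>0$, $$\mathrm{Asc}^{(s)}_{0\to B}:=\frac{K_{[Bs]-1}}{\sqrt{s^2+([Bs]-1)[Bs]}}\cdots\frac{K_1}{\sqrt{s^2+1\cdot 2}}\cdot\frac{K_0}{\sqrt{s^2+0\cdot 1}}$$ (the identity if $[Bs]=0$). Semiclassical measures. Let $\hbar_k\to0^+$ and let $v_k$ be functions on $\mathbb H$ bounded in $L^2$ on every compact subset, uniformly in $k$. A non-negative measure $\mu$ on $T^*\mathbb H$ is the semiclassical measure of $\{(v_k,\hbar_k)\}$ if $\langle(\mathrm{Op}_{\hbar_k}a)v_k,v_k\rangle_{L^2(\mathbb H,d\mathcal A)}\to\int_{T^*\mathbb H}a\,d\mu$ for all $a\in C_0^\infty(T^*\mathbb H)$. Here $(\mathrm{Op}_\hbar a)u=\sum_j\psi_j\,\mathrm{Op}^{\mathbb R^2}_\hbar(a)(\psi_ju)$,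 where $\psi_j\in C_0^\infty(\mathbb H)$ are non-negative with locally finite supports and $\sum_j\psi_j^2=1$, and, in the coordinates $q=(x,y)$ with dual coordinates $\xi=(\xi_1,\xi_2)$, $\mathrm{Op}^{\mathbb R^2}_\hbar(a)u(q)=(2\pi\hbar)^{-2}\iint e^{i(q-q')\cdot\xi/\hbar}a(q,\xi)u(q')\,dq'\,d\xi$ (the limit does not depend on the choice of $\psi_j$). With $v=v_x\partial_x+v_y\partial_y$ and coordinates $(x,y,v_x,v_y)$ on $T\mathbb H$, $\phi_B(x,y,\xi_1,\xi_2):=(x,y,\,y^2\xi_1-By,\,y^2\xi_2)$. *)

theory Defs
  imports "HOL-Analysis.Analysis"
begin

section \<open>Smooth functions\<close>

text \<open>Only meaningful for open \<open>S\<close>: the derivatives are taken at points of \<open>S\<close> without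
  restriction, so the values of \<open>f\<close> outside \<open>S\<close> play no role.\<close>

primrec Ck_on :: "nat \<Rightarrow> 'a set \<Rightarrow> ('a::real_normed_vector \<Rightarrow> 'b::real_normed_vector) \<Rightarrow> bool" where
  "Ck_on 0 S f \<longleftrightarrow> continuous_on S f"
| "Ck_on (Suc k) S f \<longleftrightarrow>
     (\<forall>x\<in>S. f differentiable (at x)) \<and> (\<forall>v. Ck_on k S (\<lambda>x. frechet_derivative f (at x) v))"

definition smooth_on :: "'a set \<Rightarrow> ('a::real_normed_vector \<Rightarrow> 'b::real_normed_vector) \<Rightarrow> bool" where
  "smooth_on S f \<longleftrightarrow> (\<forall>k. Ck_on k S f)"

definition supp :: "('a::topological_space \<Rightarrow> 'b::zero) \<Rightarrow> 'a set" where
  "supp f = closure {x. f x \<noteq> 0}"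

text \<open>\<open>C\<^sub>0\<^sup>\<infinity>(S)\<close> for open \<open>S\<close>, with functions extended by zero to the whole type.\<close>

definition test_function :: "'a set \<Rightarrow> ('a::real_normed_vector \<Rightarrow> 'b::real_normed_vector) \<Rightarrow> bool" where
  "test_function S f \<longleftrightarrow> smooth_on UNIV f \<and> compact (supp f) \<and> supp f \<subseteq> S"

section \<open>The hyperbolic plane\<close>

text \<open>A point \<open>(x, y)\<close> is the complex number \<open>x + iy\<close>. Since the tangent and cotangent bundles
  of the half plane are trivialised by the coordinates, \<open>v\<^sub>x \<partial>\<^sub>x + v\<^sub>y \<partial>\<^sub>y\<close> at \<open>z\<close> is the pair
  \<open>(z, v\<^sub>x + i v\<^sub>y)\<close> and \<open>\<xi>\<^sub>1 dx + \<xi>\<^sub>2 dy\<close> at \<open>z\<close> is the pair \<open>(z, \<xi>\<^sub>1 + i \<xi>\<^sub>2)\<close>. The library inner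
  product on \<open>complex\<close> is then the Euclidean one, and \<open>lborel\<close> on \<open>complex\<close> is \<open>dx dy\<close>.\<close>

definition UHP :: "complex set" where
  "UHP = {z. Im z > 0}"

definition hyp_area :: "complex measure" where
  "hyp_area = density lborel (\<lambda>z. ennreal (indicator UHP z / (Im z)\<^sup>2))"

text \<open>Both bundles have underlying set \<open>UHP \<times> UNIV\<close>; this is its Borel structure.\<close>

definition bundle_borel :: "(complex \<times> complex) measure" where
  "bundle_borel = restrict_space borel (UHP \<times> UNIV)"

definition hyp_laplace :: "(complex \<Rightarrow> real) \<Rightarrow> complex \<Rightarrow> real" where
  "hyp_laplace f z = (Im z)\<^sup>2 *
     (frechet_derivative (\<lambda>w. frechet_derivative f (at w) 1) (at z) 1 +
      frechet_derivative (\<lambda>w. frechet_derivative f (at w) \<i>) (at z) \<i>)"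

text \<open>Orientation-preserving local isometries from an open set \<open>S\<close> to the half plane: the
  differential pulls the metric \<open>(dx\<^sup>2 + dy\<^sup>2) / y\<^sup>2\<close> back to itself and has positive determinant.\<close>

definition local_isometry_plus :: "complex set \<Rightarrow> (complex \<Rightarrow> complex) \<Rightarrow> bool" where
  "local_isometry_plus S f \<longleftrightarrow> (\<forall>z\<in>S. f z \<in> UHP \<and> f differentiable (at z) \<and>
     (let D = frechet_derivative f (at z) in
        (\<forall>v w. (D v \<bullet> D w) / (Im (f z))\<^sup>2 = (v \<bullet> w) / (Im z)\<^sup>2) \<and>
        Re (D 1) * Im (D \<i>) - Re (D \<i>) * Im (D 1) > 0))"

definition tangent_map :: "(complex \<Rightarrow> complex) \<Rightarrow> complex \<times> complex \<Rightarrow> complex \<times> complex" where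
  "tangent_map \<gamma> = (\<lambda>(z, v). (\<gamma> z, frechet_derivative \<gamma> (at z) v))"

section \<open>Compact oriented hyperbolic surfaces\<close>

text \<open>A chart is a pair of its domain and its coordinate map. The hyperbolic metric and the
  orientation are those pulled back from the half plane by the charts; that the transition maps
  are orientation-preserving local isometries makes this well defined. Charts have open image
  in the half plane, so there is no boundary.\<close>

type_synonym 'x chart = "'x set \<times> ('x \<Rightarrow> complex)"

definition chart_inv :: "'x chart \<Rightarrow> complex \<Rightarrow> 'x" where
  "chart_inv c = inv_into (fst c) (snd c)"

definition compact_hyperbolic_surface :: "'x::t2_space set \<Rightarrow> 'x chart set \<Rightarrow> bool" where
  "compact_hyperbolic_surface X A \<longleftrightarrow>
     compact X \<and> connected X \<and> (\<Union>c\<in>A. fst c) = X \<and>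
     (\<forall>(U, \<phi>)\<in>A. openin (top_of_set X) U \<and> open (\<phi> ` U) \<and> \<phi> ` U \<subseteq> UHP \<and>
        homeomorphism U (\<phi> ` U) \<phi> (chart_inv (U, \<phi>))) \<and>
     (\<forall>(U, \<phi>)\<in>A. \<forall>(V, \<psi>)\<in>A.
        local_isometry_plus (\<phi> ` (U \<inter> V)) (\<psi> \<circ> chart_inv (U, \<phi>)))"

text \<open>The area measure of the surface: the Borel measure that every chart maps to \<open>hyp_area\<close>.\<close>

definition surface_area :: "'x::t2_space set \<Rightarrow> 'x chart set \<Rightarrow> 'x measure" where
  "surface_area X A = (THE M. sets M = sets (restrict_space borel X) \<and>
     (\<forall>(U, \<phi>)\<in>A. \<forall>E\<in>sets M. E \<subseteq> U \<longrightarrow> emeasure M E = emeasure hyp_area (\<phi> ` E)))"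

definition L2_norm_surface :: "'x::t2_space set \<Rightarrow> 'x chart set \<Rightarrow> ('x \<Rightarrow> real) \<Rightarrow> real" where
  "L2_norm_surface X A u = sqrt (\<integral>p. (u p)\<^sup>2 \<partial>surface_area X A)"

text \<open>Smooth solutions of \<open>- \<Delta> u = ev u\<close> on the surface, the Laplacian being computed in charts.\<close>

definition laplace_eigen_eq :: "'x chart set \<Rightarrow> real \<Rightarrow> ('x \<Rightarrow> real) \<Rightarrow> bool" where
  "laplace_eigen_eq A ev u \<longleftrightarrow> (\<forall>c\<in>A. smooth_on (snd c ` fst c) (u \<circ> chart_inv c) \<and>
     (\<forall>p\<in>fst c. - hyp_laplace (u \<circ> chart_inv c) (snd c p) = ev * u p))"

text \<open>On a compact surface the spectrum of \<open>- \<Delta>\<close> consists of the eigenvalues, with smooth real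
  eigenfunctions.\<close>

definition laplace_spec :: "'x set \<Rightarrow> 'x chart set \<Rightarrow> real set" where
  "laplace_spec X A = {ev. \<exists>u. laplace_eigen_eq A ev u \<and> (\<exists>p\<in>X. u p \<noteq> 0)}"

text \<open>Non-negative square roots of spectral values.\<close>

definition sqrt_spec :: "'x set \<Rightarrow> 'x chart set \<Rightarrow> real set" where
  "sqrt_spec X A = {s. s \<ge> 0 \<and> s\<^sup>2 \<in> laplace_spec X A}"

section \<open>The tangent bundle of a surface\<close>

text \<open>A tangent vector at \<open>p\<close> is the family \<open>w\<close> of its coordinate vectors in all charts at \<open>p\<close>,
  related by the differentials of the transition maps (and \<open>0\<close> at all other arguments, so that
  equal tangent vectors are equal functions).\<close>

definition tangent_bundle :: "'x set \<Rightarrow> 'x chart set \<Rightarrow> ('x \<times> ('x chart \<Rightarrow> complex)) set" where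
  "tangent_bundle X A = {(p, w). p \<in> X \<and>
     (\<forall>c. \<not> (c \<in> A \<and> p \<in> fst c) \<longrightarrow> w c = 0) \<and>
     (\<forall>c\<in>A. \<forall>d\<in>A. p \<in> fst c \<and> p \<in> fst d \<longrightarrow>
        w d = frechet_derivative (snd d \<circ> chart_inv c) (at (snd c p)) (w c))}"

text \<open>The Borel structure of the usual topology of the tangent bundle, in which the bundle charts
  \<open>(p, w) \<mapsto> (\<phi> p, w (U, \<phi>))\<close> are homeomorphisms onto \<open>\<phi> ` U \<times> UNIV\<close>.\<close>

definition tangent_bundle_borel :: "'x set \<Rightarrow> 'x chart set \<Rightarrow> ('x \<times> ('x chart \<Rightarrow> complex)) measure" where
  "tangent_bundle_borel X A = sigma (tangent_bundle X A)
     {E. E \<subseteq> tangent_bundle X A \<and>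
         (\<forall>c\<in>A. open ((\<lambda>(p, w). (snd c p, w c)) ` {(p, w). (p, w) \<in> E \<and> p \<in> fst c}))}"

section \<open>Coverings by the hyperbolic plane\<close>

definition hyperbolic_covering :: "'x::t2_space set \<Rightarrow> 'x chart set \<Rightarrow> (complex \<Rightarrow> 'x) \<Rightarrow> bool" where
  "hyperbolic_covering X A \<pi> \<longleftrightarrow> covering_space UHP \<pi> X \<and>
     (\<forall>(U, \<phi>)\<in>A. local_isometry_plus {z \<in> UHP. \<pi> z \<in> U} (\<phi> \<circ> \<pi>))"

text \<open>Deck transformations are only relevant on \<open>UHP\<close>, so each is represented by all of its
  extensions to \<open>complex\<close>. For a hyperbolic covering they are automatically
  orientation-preserving isometries.\<close>

definition deck_group :: "(complex \<Rightarrow> 'x) \<Rightarrow> (complex \<Rightarrow> complex) set" where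
  "deck_group \<pi> = {\<gamma>. (\<exists>\<delta>. homeomorphism UHP UHP \<gamma> \<delta>) \<and> (\<forall>z\<in>UHP. \<pi> (\<gamma> z) = \<pi> z)}"

definition covering_differential ::
    "'x chart set \<Rightarrow> (complex \<Rightarrow> 'x) \<Rightarrow> complex \<times> complex \<Rightarrow> 'x \<times> ('x chart \<Rightarrow> complex)" where
  "covering_differential A \<pi> = (\<lambda>(z, v). (\<pi> z, \<lambda>c.
     if c \<in> A \<and> \<pi> z \<in> fst c then frechet_derivative (snd c \<circ> \<pi>) (at z) v else 0))"

text \<open>How a measure \<open>\<mu>\<close> on the tangent bundle of the half plane is regarded as a measure \<open>\<nu>\<close> on
  that of the surface: the two agree locally, i.e. on sets on which the differential of the
  covering is injective. (The push-forward of \<open>\<mu>\<close> would count each fibre once per sheet.)\<close>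

definition descends_to ::
    "'x set \<Rightarrow> 'x chart set \<Rightarrow> (complex \<Rightarrow> 'x) \<Rightarrow> (complex \<times> complex) measure
      \<Rightarrow> ('x \<times> ('x chart \<Rightarrow> complex)) measure \<Rightarrow> bool" where
  "descends_to X A \<pi> \<mu> \<nu> \<longleftrightarrow> sets \<nu> = sets (tangent_bundle_borel X A) \<and>
     (\<forall>E\<in>sets bundle_borel. inj_on (covering_differential A \<pi>) E \<longrightarrow>
        emeasure \<nu> (covering_differential A \<pi> ` E) = emeasure \<mu> E)"

section \<open>Ascension\<close>

definition d_dz :: "(complex \<Rightarrow> complex) \<Rightarrow> complex \<Rightarrow> complex" where
  "d_dz u z = (frechet_derivative u (at z) 1 - \<i> * frechet_derivative u (at z) \<i>) / 2"

definition raise_op :: "int \<Rightarrow> (complex \<Rightarrow> complex) \<Rightarrow> complex \<Rightarrow> complex" where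
  "raise_op \<tau> u z = 2 * \<i> * of_real (Im z) * d_dz u z + of_int \<tau> * u z"

primrec ascend :: "real \<Rightarrow> nat \<Rightarrow> (complex \<Rightarrow> complex) \<Rightarrow> complex \<Rightarrow> complex" where
  "ascend s 0 u = u"
| "ascend s (Suc n) u =
     (\<lambda>z. raise_op (int n) (ascend s n u) z / of_real (sqrt (s\<^sup>2 + real n * real (n + 1))))"

definition Asc :: "real \<Rightarrow> real \<Rightarrow> (complex \<Rightarrow> complex) \<Rightarrow> complex \<Rightarrow> complex" where
  "Asc B s u = ascend s (nat \<lfloor>B * s\<rfloor>) u"

section \<open>Semiclassical measures on the half plane\<close>

text \<open>The functions \<open>\<psi>\<^sub>j\<close>, extended by zero outside the half plane; a finite family is continued
  by zero functions.\<close>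

definition quadratic_partition :: "(nat \<Rightarrow> complex \<Rightarrow> real) \<Rightarrow> bool" where
  "quadratic_partition \<psi> \<longleftrightarrow>
     (\<forall>j. test_function UHP (\<psi> j) \<and> (\<forall>z. \<psi> j z \<ge> 0)) \<and>
     (\<forall>z\<in>UHP. \<exists>U. open U \<and> z \<in> U \<and> finite {j. U \<inter> supp (\<psi> j) \<noteq> {}}) \<and>
     (\<forall>z\<in>UHP. (\<Sum>j. (\<psi> j z)\<^sup>2) = 1)"

definition Op_plane ::
    "real \<Rightarrow> (complex \<times> complex \<Rightarrow> complex) \<Rightarrow> (complex \<Rightarrow> complex) \<Rightarrow> complex \<Rightarrow> complex" where
  "Op_plane h a u q = 1 / of_real ((2 * pi * h)\<^sup>2) *
     (\<integral>(q', \<xi>). exp (\<i> * of_real (((q - q') \<bullet> \<xi>) / h)) * a (q, \<xi>) * u q'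
        \<partial>(lborel :: (complex \<times> complex) measure))"

text \<open>At each point of the half plane only finitely many summands are non-zero.\<close>

definition Op_hyp ::
    "(nat \<Rightarrow> complex \<Rightarrow> real) \<Rightarrow> real \<Rightarrow> (complex \<times> complex \<Rightarrow> complex)
      \<Rightarrow> (complex \<Rightarrow> complex) \<Rightarrow> complex \<Rightarrow> complex" where
  "Op_hyp \<psi> h a u q =
     (\<Sum>j. of_real (\<psi> j q) * Op_plane h a (\<lambda>q'. of_real (\<psi> j q') * u q') q)"

definition inner_L2 :: "(complex \<Rightarrow> complex) \<Rightarrow> (complex \<Rightarrow> complex) \<Rightarrow> complex" where
  "inner_L2 f g = (\<integral>z. f z * cnj (g z) \<partial>hyp_area)"

definition locally_L2_bounded :: "(nat \<Rightarrow> complex \<Rightarrow> complex) \<Rightarrow> bool" where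
  "locally_L2_bounded v \<longleftrightarrow> (\<forall>k. v k \<in> borel_measurable (restrict_space borel UHP)) \<and>
     (\<forall>K. compact K \<and> K \<subseteq> UHP \<longrightarrow>
        (\<exists>C::real. \<forall>k. (\<integral>\<^sup>+z\<in>K. ennreal ((cmod (v k z))\<^sup>2) \<partial>hyp_area) \<le> ennreal C))"

definition semiclassical_measure ::
    "(nat \<Rightarrow> complex \<Rightarrow> real) \<Rightarrow> (nat \<Rightarrow> real) \<Rightarrow> (nat \<Rightarrow> complex \<Rightarrow> complex)
      \<Rightarrow> (complex \<times> complex) measure \<Rightarrow> bool" where
  "semiclassical_measure \<psi> h v \<mu> \<longleftrightarrow>
     filterlim h (at_right 0) sequentially \<and> locally_L2_bounded v \<and>
     sets \<mu> = sets bundle_borel \<and>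
     (\<forall>a. test_function (UHP \<times> UNIV) a \<longrightarrow>
        integrable \<mu> a \<and>
        (\<lambda>k. inner_L2 (Op_hyp \<psi> (h k) a (v k)) (v k)) \<longlonglongrightarrow> (\<integral>p. a p \<partial>\<mu>))"

text \<open>The semiclassical measure of \<open>{(v s, 1/s)}\<close> for \<open>s \<in> J\<close>, the index set being listed as a
  sequence. The order is irrelevant, as rearranging a sequence does not affect its limit.\<close>

definition semiclassical_measure_along ::
    "(nat \<Rightarrow> complex \<Rightarrow> real) \<Rightarrow> real set \<Rightarrow> (real \<Rightarrow> complex \<Rightarrow> complex)
      \<Rightarrow> (complex \<times> complex) measure \<Rightarrow> bool" where
  "semiclassical_measure_along \<psi> J v \<mu> \<longleftrightarrow>
     (\<exists>\<sigma>. bij_betw \<sigma> (UNIV::nat set) J \<and>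
        semiclassical_measure \<psi> (\<lambda>k. 1 / \<sigma> k) (\<lambda>k. v (\<sigma> k)) \<mu>)"

definition phi_B :: "real \<Rightarrow> complex \<times> complex \<Rightarrow> complex \<times> complex" where
  "phi_B B = (\<lambda>(z, \<xi>). (z, Complex ((Im z)\<^sup>2 * Re \<xi> - B * Im z) ((Im z)\<^sup>2 * Im \<xi>)))"

definition mu_low :: "real \<Rightarrow> (complex \<times> complex) measure \<Rightarrow> (complex \<times> complex) measure" where
  "mu_low B \<mu> = distr \<mu> bundle_borel (phi_B B)"

definition u_B :: "(real \<Rightarrow> 'x \<Rightarrow> real) \<Rightarrow> real \<Rightarrow> (complex \<Rightarrow> 'x) \<Rightarrow> real \<Rightarrow> complex \<Rightarrow> complex" where
  "u_B u0 B \<pi> s = Asc B s (\<lambda>z. of_real (u0 s (\<pi> z)))"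

end

theory Submission
  imports Defs "HOL-Complex_Analysis.Complex_Analysis"
begin

text \<open>
  Two coverings of \<open>X\<close> differ by an orientation-preserving isometry \<open>f\<close> of the half plane, and the
  operators \<open>K_\<tau>\<close> intertwine composition with \<open>f\<close> up to a unimodular factor: if \<open>j = f' / |f'|\<close>, then
  ascending \<open>n = [B s]\<close> times turns \<open>u \<circ> f\<close> into \<open>j\<^sup>n\<close> times the ascended \<open>u\<close> composed with \<open>f\<close>. Written as
  a quadratic form, \<open>\<langle>Op a v, v\<rangle>\<close> has the kernel \<open>h\<^sup>-\<^sup>2 A(q, (q - q') / h)\<close> with \<open>A\<close> a Fourier transform
  of \<open>a\<close> in the fibre variable. Changing variables by \<open>f\<close>, Taylor expansion at the diagonal replaces
  the pullback of \<open>q - q'\<close> by its linearization and \<open>j\<^sup>n\<close> by the exponential of \<open>B / h\<close> times the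
  differential of \<open>arg f'\<close>; Schur's test makes the error vanish in the limit. Hence the semiclassical
  measure is transported by the cotangent map of \<open>f\<close> followed by the covector shift \<open>B d(arg f')\<close>, and
  \<open>\<phi>_B\<close> conjugates this map to the differential of \<open>f\<close>.

  The isometry \<open>f\<close> comes from rigidity (first-order agreement at one point propagates), since the
  library's lifting theorem for coverings requires a base in a normed space. The measure on \<open>TX\<close> is
  the image of the restriction to a Borel fundamental domain.
\<close>

text \<open>Both claims rest on one comparison: invariance under the deck group is the case of a
  covering compared with itself. The functions are controlled only in L^2 on compact sets, so the
  difference of the kernels must be small as an operator, not just pointwise. Taylor expansion gives
  an error of order \<open>h (1 + |w|^2)\<close> with \<open>w = (p - q) / h\<close>, which grows in
  \<open>w\<close> and is useless for Schur's test by itself. Decay of the Fourier transform bounds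
  the same difference by a multiple of \<open>(1 + |w|^2)^-5\<close>; the geometric mean of the two
  bounds is \<open>sqrt h (1 + |w|^2)^-2\<close>, small and integrable. The weight satisfies
  \<open>|n h - B| \<le> h\<close>, so \<open>j^n\<close> oscillates at the semiclassical scale: it
  cannot be treated as an amplitude and moves the covector instead. The partition
  \<open>\<psi>\<close> is not invariant under \<open>f\<close>, but its cutoff equals 1 on the
  diagonal, so the same expansion disposes of it. A measure on \<open>TX\<close> is pinned down by
  sets on which the differential of the covering is injective; the part of a preimage over a
  fundamental domain is such a set, which yields uniqueness along with existence.\<close>

section \<open>Calculus of C^k functions\<close>

lemma Ck_on_cong:
  assumes "open S" "\<And>x. x \<in> S \<Longrightarrow> f x = g x" "Ck_on k S f"
  shows "Ck_on k S g"
  using assms(2,3)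
proof (induction k arbitrary: f g)
  case 0
  then show ?case using continuous_on_cong[of S S f g] by simp
next
  case (Suc k)
  have d: "(g has_derivative frechet_derivative f (at x)) (at x)" if "x \<in> S" for x
    using Suc.prems that \<open>open S\<close>
    by (auto simp: frechet_derivative_works intro: has_derivative_transform_within_open)
  have eq: "frechet_derivative g (at x) = frechet_derivative f (at x)" if "x \<in> S" for x
    using frechet_derivative_at[OF d[OF that]] by simp
  show ?case
    using Suc.prems Suc.IH[of "\<lambda>x. frechet_derivative f (at x) v" "\<lambda>x. frechet_derivative g (at x) v" for v]
    by (auto simp: eq intro: differentiableI[OF d])
qed

lemma Ck_on_Suc_imp_continuous: "Ck_on (Suc k) S f \<Longrightarrow> continuous_on S f"
  by (simp add: continuous_at_imp_continuous_on differentiable_imp_continuous_within)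

lemma Ck_on_Suc_imp: "Ck_on (Suc k) S f \<Longrightarrow> Ck_on k S f"
proof (induction k arbitrary: f)
  case 0
  then show ?case using Ck_on_Suc_imp_continuous by (metis Ck_on.simps(1))
next
  case (Suc k)
  then show ?case by (metis Ck_on.simps(2))
qed

lemma Ck_on_SucI:
  assumes "open S" "\<And>x. x \<in> S \<Longrightarrow> (f has_derivative D x) (at x)" "\<And>v. Ck_on k S (\<lambda>x. D x v)"
  shows "Ck_on (Suc k) S f"
proof -
  have "frechet_derivative f (at x) = D x" if "x \<in> S" for x
    using frechet_derivative_at[OF assms(2)[OF that]] by simp
  then show ?thesis
    using assms Ck_on_cong[OF \<open>open S\<close> _ assms(3)] by (auto intro: differentiableI)
qed

lemma Ck_on_SucD:
  assumes "Ck_on (Suc k) S f"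
  shows "x \<in> S \<Longrightarrow> (f has_derivative frechet_derivative f (at x)) (at x)"
    and "Ck_on k S (\<lambda>x. frechet_derivative f (at x) v)"
  using assms by (auto simp: frechet_derivative_works)

lemma Ck_on_const: "open S \<Longrightarrow> Ck_on k S (\<lambda>x. c)"
proof (induction k arbitrary: c)
  case (Suc k)
  then show ?case by (intro Ck_on_SucI[where D = "\<lambda>x v. 0"]) auto
qed simp

lemma Ck_on_add:
  assumes "open S" "Ck_on k S f" "Ck_on k S g"
  shows "Ck_on k S (\<lambda>x. f x + g x)"
  using assms(2,3)
proof (induction k arbitrary: f g)
  case (Suc k)
  show ?case
    by (rule Ck_on_SucI[OF \<open>open S\<close> has_derivative_add[OF Ck_on_SucD(1)[OF Suc.prems(1)]
            Ck_on_SucD(1)[OF Suc.prems(2)]]])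
      (auto intro!: Suc.IH Ck_on_SucD(2) Suc.prems simp del: Ck_on.simps(2))
qed (auto intro: continuous_intros)

lemma Ck_on_bounded_linear:
  assumes "open S" "bounded_linear L" "Ck_on k S f"
  shows "Ck_on k S (\<lambda>x. L (f x))"
  using assms(3)
proof (induction k arbitrary: f)
  case 0
  then show ?case using assms(2) by (auto intro: bounded_linear.continuous_on)
next
  case (Suc k)
  show ?case
    by (rule Ck_on_SucI[OF \<open>open S\<close> bounded_linear.has_derivative[OF assms(2) Ck_on_SucD(1)[OF Suc.prems]]])
      (auto intro!: Suc.IH Ck_on_SucD(2) Suc.prems simp del: Ck_on.simps(2))
qed

lemma Ck_on_bounded_linear_id:
  assumes "open S" "bounded_linear L"
  shows "Ck_on k S L"
proof (cases k)
  case 0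
  then show ?thesis using assms by (auto intro: linear_continuous_on)
next
  case (Suc n)
  then show ?thesis
    using assms Ck_on_const
    by (auto intro!: Ck_on_SucI[where D = "\<lambda>x. L"] bounded_linear_imp_has_derivative
        simp del: Ck_on.simps)
qed

lemma Ck_on_bilinear:
  assumes "open S" "bounded_bilinear P" "Ck_on k S f" "Ck_on k S g"
  shows "Ck_on k S (\<lambda>x. P (f x) (g x))"
  using assms(3,4)
proof (induction k arbitrary: f g)
  case 0
  then show ?case using assms(2) by (auto intro: bounded_bilinear.continuous_on)
next
  case (Suc k)
  show ?case
    by (rule Ck_on_SucI[OF \<open>open S\<close> bounded_bilinear.FDERIV[OF assms(2) Ck_on_SucD(1)[OF Suc.prems(1)]
            Ck_on_SucD(1)[OF Suc.prems(2)]]])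
      (auto intro!: Ck_on_add[OF \<open>open S\<close>] Suc.IH Ck_on_SucD(2) Suc.prems
        Ck_on_Suc_imp[OF Suc.prems(1)] Ck_on_Suc_imp[OF Suc.prems(2)] simp del: Ck_on.simps(2))
qed

lemmas Ck_on_mult = Ck_on_bilinear[OF _ bounded_bilinear_mult]
lemmas Ck_on_scaleR = Ck_on_bilinear[OF _ bounded_bilinear_scaleR]

lemma Ck_on_minus: "open S \<Longrightarrow> Ck_on k S f \<Longrightarrow> Ck_on k S (\<lambda>x. - f x)"
  by (rule Ck_on_bounded_linear[OF _ bounded_linear_minus[OF bounded_linear_ident]])

lemma Ck_on_diff: "open S \<Longrightarrow> Ck_on k S f \<Longrightarrow> Ck_on k S g \<Longrightarrow> Ck_on k S (\<lambda>x. f x - g x)"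
  using Ck_on_add[of S k f "\<lambda>x. - g x"] Ck_on_minus[of S k g] by simp

lemma Ck_on_sum:
  assumes "open S" "\<And>i. i \<in> I \<Longrightarrow> Ck_on k S (f i)"
  shows "Ck_on k S (\<lambda>x. \<Sum>i\<in>I. f i x)"
  using assms(2)
  by (induction I rule: infinite_finite_induct)
    (auto intro: Ck_on_const[OF \<open>open S\<close>] Ck_on_add[OF \<open>open S\<close>])

lemma Ck_on_prod:
  fixes f :: "'i \<Rightarrow> 'a::real_normed_vector \<Rightarrow> 'b::real_normed_field"
  assumes "open S" "\<And>i. i \<in> I \<Longrightarrow> Ck_on k S (f i)"
  shows "Ck_on k S (\<lambda>x. \<Prod>i\<in>I. f i x)"
  using assms(2)
  by (induction I rule: infinite_finite_induct)
    (auto intro: Ck_on_const[OF \<open>open S\<close>] Ck_on_mult[OF \<open>open S\<close>])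

text \<open>\<open>Ck_on\<close> differentiates in fixed directions, but the chain rule evaluates
  the derivative of \<open>f\<close> in the moving direction \<open>Dg(x) v\<close>. Expanding that
  direction in \<open>Basis\<close> restores fixed directions, hence the Euclidean middle
  space.\<close>

lemma Ck_on_compose:
  fixes f :: "'b::euclidean_space \<Rightarrow> 'c::real_normed_vector"
    and g :: "'a::real_normed_vector \<Rightarrow> 'b"
  assumes "open S" "open T" "g ` S \<subseteq> T" "Ck_on k T f" "Ck_on k S g"
  shows "Ck_on k S (\<lambda>x. f (g x))"
  using assms(4,5)
proof (induction k arbitrary: f)
  case 0
  then show ?case using assms(3) by (auto intro: continuous_on_compose2)
next
  case (Suc k)
  note g = Suc.prems(2) and f = Suc.prems(1)
  have der: "((\<lambda>x. f (g x)) has_derivative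
      (\<lambda>v. \<Sum>b\<in>Basis. (frechet_derivative g (at x) v \<bullet> b) *\<^sub>R frechet_derivative f (at (g x)) b)) (at x)"
    if "x \<in> S" for x
  proof -
    have *: "(f has_derivative frechet_derivative f (at (g x))) (at (g x))"
      using Ck_on_SucD(1)[OF f] assms(3) that by blast
    then have lin: "linear (frechet_derivative f (at (g x)))"
      by (simp add: has_derivative_linear)
    have rep: "frechet_derivative f (at (g x)) v = (\<Sum>b\<in>Basis. (v \<bullet> b) *\<^sub>R frechet_derivative f (at (g x)) b)" for v
      by (subst euclidean_representation[symmetric])
        (simp add: linear_sum[OF lin] linear_scale[OF lin])
    show ?thesis
      by (rule has_derivative_eq_rhs[OF has_derivative_compose[OF Ck_on_SucD(1)[OF g that] *] ext[OF rep]])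
  qed
  show ?case
  proof (rule Ck_on_SucI[OF \<open>open S\<close> der], assumption)
    fix v
    show "Ck_on k S (\<lambda>x. \<Sum>b\<in>Basis. (frechet_derivative g (at x) v \<bullet> b) *\<^sub>R frechet_derivative f (at (g x)) b)"
      by (intro Ck_on_sum Ck_on_scaleR \<open>open S\<close> Ck_on_bounded_linear[OF _ bounded_linear_inner_left]
          Ck_on_SucD(2)[OF g] Suc.IH[of "\<lambda>y. frechet_derivative f (at y) b" for b] Ck_on_SucD(2)[OF f]
          Ck_on_Suc_imp[OF g])
  qed
qed

lemma Ck_on_holomorphic:
  assumes "open S" "f holomorphic_on S"
  shows "Ck_on k S f"
  using assms(2)
proof (induction k arbitrary: f)
  case 0
  then show ?case by (auto intro: holomorphic_on_imp_continuous_on)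
next
  case (Suc k)
  have "(f has_derivative (*) (deriv f x)) (at x)" if "x \<in> S" for x
    using holomorphic_derivI[OF Suc.prems \<open>open S\<close> that] by (simp add: has_field_derivative_def)
  then show ?case
    using Suc.IH[OF holomorphic_deriv[OF Suc.prems \<open>open S\<close>]]
    by (intro Ck_on_SucI[where D="\<lambda>x. (*) (deriv f x)"] Ck_on_mult Ck_on_const \<open>open S\<close>) auto
qed

lemma Ck_on_Un:
  assumes "open S" "open T" "Ck_on k S f" "Ck_on k T f"
  shows "Ck_on k (S \<union> T) f"
  using assms(3,4) by (induction k arbitrary: f) (auto intro: continuous_on_open_Un[OF assms(1,2)])

lemma Ck_on_inverse:
  fixes f :: "'a::real_normed_vector \<Rightarrow> 'b::real_normed_field"
  assumes "open S" "Ck_on k S f" "\<And>x. x \<in> S \<Longrightarrow> f x \<noteq> 0"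
  shows "Ck_on k S (\<lambda>x. inverse (f x))"
  using assms(2)
proof (induction k)
  case 0
  then show ?case using assms(3) by (auto intro: continuous_intros)
next
  case (Suc k)
  show ?case
    by (rule Ck_on_SucI[OF \<open>open S\<close> Deriv.has_derivative_inverse[OF assms(3) Ck_on_SucD(1)[OF Suc.prems]]])
      (auto intro!: Ck_on_minus Ck_on_mult Suc.IH Ck_on_SucD(2) Suc.prems Ck_on_Suc_imp[OF Suc.prems]
        \<open>open S\<close> simp del: Ck_on.simps(2))
qed

text \<open>The family is closed under differentiation: the n-th function has derivative
  \<open>P (n + 2) - n P (n + 1)\<close>. One induction over \<open>k\<close> with \<open>n\<close>
  arbitrary therefore covers all derivatives.\<close>

lemma Ck_on_exp_neg_inverse:
  "Ck_on k (UNIV :: real set) (\<lambda>x. if x > 0 then exp (- 1 / x) / x ^ n else 0)"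
proof (induction k arbitrary: n)
  let ?P = "\<lambda>n (x::real). if x > 0 then exp (- 1 / x) / x ^ n else (0::real)"
  have der: "(?P n has_derivative (\<lambda>v. v * (?P (n+2) x - real n * ?P (n+1) x))) (at x)" for n x
  proof -
    have "(?P n has_real_derivative (?P (n+2) x - real n * ?P (n+1) x)) (at x)"
    proof (cases "x > 0")
      case True
      have "((\<lambda>x. exp (- 1 / x) / x ^ n) has_real_derivative
         (?P (n+2) x - real n * ?P (n+1) x)) (at x)"
      proof (rule DERIV_cong)
        show "((\<lambda>x. exp (- 1 / x) / x ^ n) has_real_derivative
          (exp (- 1 / x) * (1 / x ^ 2) * x ^ n - exp (- 1 / x) * (real n * x ^ (n - 1))) / (x ^ n * x ^ n)) (at x)"
          using True by (auto intro!: derivative_eq_intros simp: power2_eq_square)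
      qed (use True in \<open>cases n; simp add: field_simps power2_eq_square\<close>)
      then show ?thesis
        by (rule has_field_derivative_transform_within_open[where S="{0<..}"]) (use True in auto)
    next
      case False
      show ?thesis
      proof (cases "x < 0")
        case True
        have "((\<lambda>x. 0) has_real_derivative 0) (at x)" by simp
        then have "(?P n has_real_derivative 0) (at x)"
          by (rule has_field_derivative_transform_within_open[where S="{..<0}"]) (use True in auto)
        then show ?thesis using True by simp
      next
        case False
        with \<open>\<not> x > 0\<close> have x: "x = 0" by simp
        \<comment> \<open>At 0 the difference quotient vanishes identically from the left, so only
          the right-hand limit has content.\<close>
        have "((\<lambda>h::real. exp (- 1 / h) / h ^ n / h) \<longlongrightarrow> 0) (at_right 0)"
          by real_asymp
        then have "((\<lambda>h. (?P n (0 + h) - ?P n 0) / h) \<longlongrightarrow> 0) (at_right 0)"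
          by (rule Lim_transform_eventually) (auto simp: eventually_at_right_field intro!: exI[of _ 1])
        moreover have "((\<lambda>h. (?P n (0 + h) - ?P n 0) / h) \<longlongrightarrow> 0) (at_left 0)"
          by (rule Lim_transform_eventually[OF tendsto_const]) (auto simp: eventually_at_left_field intro!: exI[of _ "-1"])
        ultimately have "((\<lambda>h. (?P n (0 + h) - ?P n 0) / h) \<longlongrightarrow> 0) (at 0)"
          using filterlim_split_at by blast
        then show ?thesis using x by (simp add: DERIV_def)
      qed
    qed
    then show ?thesis
      unfolding has_field_derivative_def by (rule has_derivative_eq_rhs) (rule ext, rule mult.commute)
  qed
  {
    case 0
    show ?case
      using der by (auto simp: continuous_on_eq_continuous_at intro!: has_derivative_continuous)
  next
    case (Suc k)
    show ?case
      by (rule Ck_on_SucI[OF open_UNIV der])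
        (intro Ck_on_mult Ck_on_const Ck_on_diff Suc.IH open_UNIV)
  }
qed

lemma smooth_onD: "smooth_on S f \<Longrightarrow> Ck_on k S f" by (simp add: smooth_on_def)

lemma smooth_on_frechet: "smooth_on S f \<Longrightarrow> smooth_on S (\<lambda>x. frechet_derivative f (at x) v)"
  unfolding smooth_on_def using Ck_on_SucD(2) by blast

section \<open>Measures determined by their integrals of test functions\<close>

lemma ex_box_around:
  fixes x :: "'a::euclidean_space"
  assumes "open U" "x \<in> U"
  shows "\<exists>a b. x \<in> box a b \<and> cbox a b \<subseteq> U"
proof -
  obtain e where e: "e > 0" "cball x e \<subseteq> U"
    using assms open_contains_cball by blast
  obtain a b where ab: "x \<in> box a b" "box a b \<subseteq> ball x e"
    using rational_boxes[OF e(1)] by metis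
  have "box a b \<noteq> {}" using ab by blast
  then have "cbox a b = closure (box a b)" by (simp add: closure_box)
  also have "\<dots> \<subseteq> cball x e"
    using ab e by (intro closure_minimal) (auto simp: subset_iff)
  finally show ?thesis using ab e by blast
qed

text \<open>The generators are boxes whose closure stays in \<open>V\<close>, because only these
  carry bump functions with compact support in \<open>V\<close>. By Lindeloef every open subset of
  \<open>V\<close> is a countable union of them.\<close>

lemma sets_restrict_space_open_boxes:
  fixes V :: "'a::euclidean_space set"
  assumes "open V"
  shows "sets (restrict_space borel V) = sigma_sets V {box a b | a b. cbox a b \<subseteq> V}"
proof -
  let ?E = "{box a b | a b. cbox a b \<subseteq> V}"
  have "sets (restrict_space borel V) = (\<inter>) V ` sigma_sets UNIV {S. open S}"
    by (simp add: sets_restrict_space borel_def)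
  also have "\<dots> = sigma_sets V ((\<inter>) V ` {S. open S})"
  proof (rule sigma_sets_Int)
    show "V \<in> sigma_sets UNIV {S. open S}" using assms by (intro sigma_sets.Basic) simp
  qed simp
  also have "\<dots> = sigma_sets V ?E"
  proof (rule sigma_sets_eqI)
    fix S assume "S \<in> (\<inter>) V ` {S. open S}"
    then have S: "open S" "S \<subseteq> V" using assms by auto
    let ?F = "{box a b | a b. cbox a b \<subseteq> S}"
    have F: "\<Union>?F = S"
    proof
      show "\<Union>?F \<subseteq> S" using box_subset_cbox by blast
      show "S \<subseteq> \<Union>?F" using ex_box_around[OF S(1)] by blast
    qed
    have "open X" if "X \<in> ?F" for X using that open_box by blast
    then obtain D where D1: "D \<subseteq> ?F" "countable D" "\<Union>D = \<Union>?F"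
      by (rule Lindelof)
    have "?F \<subseteq> ?E" using S(2) by blast
    then have D: "countable D" "D \<subseteq> ?E" "S = \<Union>D" using D1 F by auto
    show "S \<in> sigma_sets V ?E"
      unfolding D(3) using D(1,2) by (intro sigma_sets_UNION) (auto intro: sigma_sets.Basic)
  next
    fix S assume "S \<in> ?E"
    then obtain a b where "S = box a b" "cbox a b \<subseteq> V" by blast
    then have "open S" "S = V \<inter> S" using box_subset_cbox[of a b] by auto
    then show "S \<in> sigma_sets V ((\<inter>) V ` {S. open S})" by blast
  qed
  finally show ?thesis .
qed

text \<open>Finiteness is asked only for boxes nested twice, since it will come from a bump function
  on the larger box that is bounded below on the smaller one. Such boxes still cover
  \<open>V\<close>, and countably many suffice.\<close>

lemma measure_eqI_boxes:
  fixes V :: "'a::euclidean_space set"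
  assumes V: "open V"
    and M: "sets M = sets (restrict_space borel V)"
    and N: "sets N = sets (restrict_space borel V)"
    and eq: "\<And>a b. cbox a b \<subseteq> V \<Longrightarrow> emeasure M (box a b) = emeasure N (box a b)"
    and fin: "\<And>a b c d. cbox c d \<subseteq> box a b \<Longrightarrow> cbox a b \<subseteq> V \<Longrightarrow> emeasure M (box c d) \<noteq> \<infinity>"
  shows "M = N"
proof -
  let ?E = "{box a b | a b. cbox a b \<subseteq> V}"
  let ?A = "{box c d | a b c d. cbox c d \<subseteq> box a b \<and> cbox a b \<subseteq> V}"
  have "\<Union>?A = V"
  proof
    show "V \<subseteq> \<Union>?A"
    proof
      fix x assume "x \<in> V"
      then obtain a b where ab: "x \<in> box a b" "cbox a b \<subseteq> V" using ex_box_around[OF V] by blast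
      moreover obtain c d where "x \<in> box c d" "cbox c d \<subseteq> box a b"
        using ex_box_around[OF open_box ab(1)] by blast
      ultimately show "x \<in> \<Union>?A" by blast
    qed
    show "\<Union>?A \<subseteq> V"
      using box_subset_cbox by blast
  qed
  moreover have "open X" if "X \<in> ?A" for X using that open_box by blast
  then obtain D where "D \<subseteq> ?A" "countable D" "\<Union>D = \<Union>?A"
    by (rule Lindelof)
  ultimately have D: "D \<subseteq> ?A" "countable D" "\<Union>D = V" by simp_all
  show ?thesis
  proof (rule measure_eqI_generator_eq_countable)
    show "Int_stable ?E"
    proof (rule Int_stableI)
      fix X Y assume "X \<in> ?E" "Y \<in> ?E"
      then obtain a b c d where *: "X = box a b" "Y = box c d" "cbox a b \<subseteq> V" "cbox c d \<subseteq> V" by blast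
      then have "X \<inter> Y = box (\<Sum>i\<in>Basis. max (a\<bullet>i) (c\<bullet>i) *\<^sub>R i) (\<Sum>i\<in>Basis. min (b\<bullet>i) (d\<bullet>i) *\<^sub>R i)"
        by (simp add: Int_interval box_Int_box)
      moreover have "cbox (\<Sum>i\<in>Basis. max (a\<bullet>i) (c\<bullet>i) *\<^sub>R i) (\<Sum>i\<in>Basis. min (b\<bullet>i) (d\<bullet>i) *\<^sub>R i)
          = cbox a b \<inter> cbox c d"
        by (simp add: Int_interval)
      ultimately show "X \<inter> Y \<in> ?E" using *(3) by blast
    qed
    show "?E \<subseteq> Pow V" using box_subset_cbox by blast
    show "sets M = sigma_sets V ?E" "sets N = sigma_sets V ?E"
      using M N sets_restrict_space_open_boxes[OF V] by simp_all
    show "D \<subseteq> ?E"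
    proof
      fix X assume "X \<in> D"
      then obtain a b c d where "X = box c d" "cbox c d \<subseteq> box a b" "cbox a b \<subseteq> V" using D(1) by blast
      then show "X \<in> ?E" using box_subset_cbox[of a b] by blast
    qed
    show "emeasure M X = emeasure N X" if "X \<in> ?E" for X using that eq by blast
    show "emeasure M X \<noteq> \<infinity>" if "X \<in> D" for X using that D(1) fin by blast
  qed (use D in auto)
qed

text \<open>The exact positivity set matters: \<open>1 - exp (- n \<beta>)\<close> then increases to
  the indicator of the open box.\<close>

lemma smooth_box_bump:
  fixes a b :: "'a::euclidean_space"
  obtains \<beta> :: "'a \<Rightarrow> real" where "smooth_on UNIV \<beta>" "\<And>p. 0 \<le> \<beta> p" "\<And>p. \<beta> p > 0 \<longleftrightarrow> p \<in> box a b"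
proof
  define s where "s = (\<lambda>x::real. if x > 0 then exp (- 1 / x) else 0)"
  let ?\<beta> = "\<lambda>p. \<Prod>i\<in>Basis. s (p \<bullet> i - a \<bullet> i) * s (b \<bullet> i - p \<bullet> i)"
  have s: "Ck_on k UNIV s" for k
    using Ck_on_exp_neg_inverse[of k 0] by (simp add: s_def cong: if_cong)
  have lin: "Ck_on k UNIV (\<lambda>p::'a. p \<bullet> i)" for k i
    by (intro Ck_on_bounded_linear_id bounded_linear_inner_left open_UNIV)
  have comp: "Ck_on k UNIV (\<lambda>p. s (h p))" if "Ck_on k UNIV h" for h :: "'a \<Rightarrow> real" and k
    by (rule Ck_on_compose[OF open_UNIV open_UNIV _ s that]) simp
  show "smooth_on UNIV ?\<beta>"
    unfolding smooth_on_def
    by (intro allI Ck_on_prod Ck_on_mult open_UNIV comp Ck_on_diff lin Ck_on_const)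
  have pos: "s x \<ge> 0" "s x > 0 \<longleftrightarrow> x > 0" for x by (auto simp: s_def)
  show "0 \<le> ?\<beta> p" for p by (intro prod_nonneg) (simp add: pos)
  show "?\<beta> p > 0 \<longleftrightarrow> p \<in> box a b" for p
  proof
    assume "p \<in> box a b"
    then show "?\<beta> p > 0" by (intro prod_pos) (simp add: pos mem_box)
  next
    assume *: "?\<beta> p > 0"
    then have "?\<beta> p \<noteq> 0" by linarith
    then have "s (p \<bullet> i - a \<bullet> i) * s (b \<bullet> i - p \<bullet> i) \<noteq> 0" if "i \<in> Basis" for i
      using prod_zero[OF finite_Basis, of "\<lambda>i. s (p \<bullet> i - a \<bullet> i) * s (b \<bullet> i - p \<bullet> i)"] that
      by blast
    then have "s (p \<bullet> i - a \<bullet> i) > 0 \<and> s (b \<bullet> i - p \<bullet> i) > 0" if "i \<in> Basis" for i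
      using that pos(1)[of "p \<bullet> i - a \<bullet> i"] pos(1)[of "b \<bullet> i - p \<bullet> i"] by fastforce
    then show "p \<in> box a b" by (simp add: pos mem_box)
  qed
qed

lemma supp_subset_cbox:
  fixes a b :: "'a::euclidean_space"
  assumes "\<And>p. f p \<noteq> 0 \<Longrightarrow> p \<in> box a b"
  shows "compact (supp f)" "supp f \<subseteq> cbox a b"
proof -
  show *: "supp f \<subseteq> cbox a b"
    unfolding supp_def using assms box_subset_cbox by (intro closure_minimal) auto
  have "compact (cbox a b \<inter> supp f)"
    by (rule compact_Int_closed) (simp_all add: supp_def)
  then show "compact (supp f)" using * by (simp add: Int_absorb1)
qed

lemma Ck_on_exp:
  fixes f :: "'a::real_normed_vector \<Rightarrow> real"
  assumes "open S" "Ck_on k S f"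
  shows "Ck_on k S (\<lambda>x. exp (f x))"
proof -
  have "Ck_on k UNIV (exp :: real \<Rightarrow> real)"
  proof (induction k)
    case (Suc k)
    show ?case
      by (rule Ck_on_SucI[where D = "\<lambda>x v. exp x * v"])
        (auto intro!: Ck_on_mult Suc Ck_on_const DERIV_exp simp flip: has_field_derivative_def
          simp del: Ck_on.simps(2))
  qed (auto intro: continuous_intros)
  from Ck_on_compose[OF assms(1) open_UNIV _ this assms(2)] show ?thesis by simp
qed

text \<open>The functions \<open>1 - exp (- n \<beta>)\<close> are smooth, supported in the closed
  box and increase to the indicator of the open one, so monotone convergence recovers the measure of
  boxes. Integrability of \<open>\<beta>\<close> and its positive minimum on an inner box yield
  finiteness.\<close>

theorem measure_eqI_test_functions:
  fixes V :: "'a::euclidean_space set"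
  assumes V: "open V"
    and M: "sets M = sets (restrict_space borel V)"
    and N: "sets N = sets (restrict_space borel V)"
    and int: "\<And>f :: 'a \<Rightarrow> complex. test_function V f \<Longrightarrow>
      integrable M f \<and> integrable N f \<and> (\<integral>p. f p \<partial>M) = (\<integral>p. f p \<partial>N)"
  shows "M = N"
proof (rule measure_eqI_boxes[OF V M N])
  have real: "integrable M f \<and> integrable N f \<and> (\<integral>p. f p \<partial>M) = (\<integral>p. f p \<partial>N)"
    if "\<And>k. Ck_on k UNIV f" "\<And>p. f p \<noteq> 0 \<Longrightarrow> p \<in> box a b" "cbox a b \<subseteq> V" for f :: "'a \<Rightarrow> real" and a b
  proof -
    have "test_function V (\<lambda>p. complex_of_real (f p))"
      unfolding test_function_def smooth_on_def
      using that supp_subset_cbox[of "\<lambda>p. complex_of_real (f p)" a b]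
        Ck_on_bounded_linear[OF open_UNIV bounded_linear_of_real that(1)]
      by fastforce
    from int[OF this] show ?thesis
      by (simp add: complex_of_real_integrable_eq)
  qed
  fix a b :: 'a assume ab: "cbox a b \<subseteq> V"
  obtain \<beta> :: "'a \<Rightarrow> real" where \<beta>: "smooth_on UNIV \<beta>" "\<And>p. 0 \<le> \<beta> p" "\<And>p. \<beta> p > 0 \<longleftrightarrow> p \<in> box a b"
    using smooth_box_bump[of a b] by blast
  define F where "F = (\<lambda>(n::nat) p. 1 - exp (- real n * \<beta> p))"
  have z: "\<beta> p = 0 \<longleftrightarrow> p \<notin> box a b" for p using \<beta>(2,3)[of p] by auto
  have F: "integrable M (F n) \<and> integrable N (F n) \<and> (\<integral>p. F n p \<partial>M) = (\<integral>p. F n p \<partial>N)" for n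
  proof (rule real[OF _ _ ab])
    show "Ck_on k UNIV (F n)" for k
      unfolding F_def by (intro Ck_on_diff Ck_on_const Ck_on_exp Ck_on_mult open_UNIV smooth_onD \<beta>)
    show "p \<in> box a b" if "F n p \<noteq> 0" for p
      using that z[of p] by (auto simp: F_def)
  qed
  have F01: "0 \<le> F n p" for n p using \<beta>(2)[of p] by (simp add: F_def)
  have lim: "(\<lambda>n. \<integral>\<^sup>+p. ennreal (F n p) \<partial>L) \<longlonglongrightarrow> emeasure L (box a b)"
    if L: "sets L = sets (restrict_space borel V)" "\<And>n. integrable L (F n)" for L
  proof -
    have "box a b \<in> sets L"
      unfolding L using V ab box_subset_cbox[of a b]
      by (subst sets_restrict_space_iff) auto
    then have "emeasure L (box a b) = (\<integral>\<^sup>+p. indicator (box a b) p \<partial>L)" by simp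
    moreover have "(\<lambda>n. \<integral>\<^sup>+p. ennreal (F n p) \<partial>L) \<longlonglongrightarrow> (\<integral>\<^sup>+p. indicator (box a b) p \<partial>L)"
    proof (rule nn_integral_LIMSEQ)
      show "incseq (\<lambda>n p. ennreal (F n p))"
        using \<beta>(2) by (intro incseq_SucI le_funI ennreal_leI) (simp add: F_def mult_right_mono)
      show "(\<lambda>p. ennreal (F n p)) \<in> borel_measurable L" for n using L(2)[of n] by auto
      show "(\<lambda>n. ennreal (F n p)) \<longlonglongrightarrow> indicator (box a b) p" for p
      proof (cases "p \<in> box a b")
        case True
        then have pos: "\<beta> p > 0" using \<beta>(3) by simp
        have "((\<lambda>n. 1 - exp (- real n * \<beta> p)) \<longlongrightarrow> 1) sequentially"
          using pos by real_asymp
        then have "(\<lambda>n. ennreal (F n p)) \<longlonglongrightarrow> ennreal 1"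
          unfolding F_def by (rule tendsto_ennrealI)
        then show ?thesis using True by simp
      next
        case False
        then have "\<beta> p = 0" using z by simp
        then show ?thesis using False by (simp add: F_def)
      qed
    qed
    ultimately show ?thesis by simp
  qed
  have "(\<integral>\<^sup>+p. ennreal (F n p) \<partial>M) = (\<integral>\<^sup>+p. ennreal (F n p) \<partial>N)" for n
    using F[of n] F01 by (simp add: nn_integral_eq_integral)
  moreover have "(\<lambda>n. \<integral>\<^sup>+p. ennreal (F n p) \<partial>M) \<longlonglongrightarrow> emeasure M (box a b)"
    "(\<lambda>n. \<integral>\<^sup>+p. ennreal (F n p) \<partial>N) \<longlonglongrightarrow> emeasure N (box a b)"
    using lim[OF M] lim[OF N] F by blast+
  ultimately show "emeasure M (box a b) = emeasure N (box a b)"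
    using LIMSEQ_unique by simp
  fix c d assume cd: "cbox c d \<subseteq> box a b"
  show "emeasure M (box c d) \<noteq> \<infinity>"
  proof (cases "cbox c d = {}")
    case True
    then show ?thesis using box_subset_cbox[of c d] by simp
  next
    case False
    have "continuous_on (cbox c d) \<beta>"
      using smooth_onD[OF \<beta>(1), of 0] by (auto intro: continuous_on_subset)
    from continuous_attains_inf[OF compact_cbox False this]
    obtain x where x: "x \<in> cbox c d" "\<And>y. y \<in> cbox c d \<Longrightarrow> \<beta> x \<le> \<beta> y" by blast
    have m: "\<beta> x > 0" using x(1) cd \<beta>(3) by blast
    have I: "integrable M \<beta>"
      using real[of \<beta>, OF smooth_onD[OF \<beta>(1)] _ ab] z by blast
    have "box c d \<in> sets M"
      unfolding M using V ab cd box_subset_cbox[of c d] box_subset_cbox[of a b]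
      by (subst sets_restrict_space_iff) auto
    then have "emeasure M (box c d) = (\<integral>\<^sup>+p. indicator (box c d) p \<partial>M)" by simp
    also have "\<dots> \<le> (\<integral>\<^sup>+p. ennreal (\<beta> p / \<beta> x) \<partial>M)"
    proof (rule nn_integral_mono)
      fix p show "indicator (box c d) p \<le> ennreal (\<beta> p / \<beta> x)"
        using x(2)[of p] m box_subset_cbox[of c d] by (auto simp: indicator_def ennreal_leI subset_iff)
    qed
    also have "\<dots> = ennreal (\<integral>p. \<beta> p / \<beta> x \<partial>M)"
      using I \<beta>(2) m by (intro nn_integral_eq_integral) auto
    also have "\<dots> < \<infinity>" by simp
    finally show ?thesis by simp
  qed
qed

lemma open_UHP: "open UHP"
  unfolding UHP_def by (rule open_halfspace_Im_gt)

lemma convex_UHP: "convex UHP"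
  unfolding UHP_def by (rule convex_halfspace_Im_gt)

section \<open>Holomorphic local isometries\<close>

text \<open>Complex form of an orientation-preserving local isometry: the differential is
  multiplication by \<open>h'\<close>, and its scaling factor must equal the ratio of the heights.
  Later arguments use holomorphy in place of the real metric condition.\<close>

definition hyp_local_isometry :: "complex set \<Rightarrow> (complex \<Rightarrow> complex) \<Rightarrow> bool" where
  "hyp_local_isometry S h \<longleftrightarrow> S \<subseteq> UHP \<and> h holomorphic_on S \<and> h ` S \<subseteq> UHP \<and>
     (\<forall>z\<in>S. cmod (deriv h z) * Im z = Im (h z))"

text \<open>The Gram determinant gives \<open>(p s - r q)^2 = L^2\<close>; positivity selects
  \<open>p s - r q = L\<close>. Then \<open>(p - s)^2 + (q + r)^2 = 2 L - 2 L = 0\<close>, which is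
  the Cauchy-Riemann system.\<close>

lemma complex_linear_if_conformal:
  assumes D: "linear D" and inner: "\<And>v w. D v \<bullet> D w = L * (v \<bullet> w)"
    and det: "Re (D 1) * Im (D \<i>) - Re (D \<i>) * Im (D 1) > 0"
  shows "D w = D 1 * w" and "(cmod (D 1))\<^sup>2 = L"
proof -
  obtain p q r s where pq: "D 1 = Complex p q" "D \<i> = Complex r s"
    using complex.exhaust by metis
  have 1: "p\<^sup>2 + q\<^sup>2 = L" "r\<^sup>2 + s\<^sup>2 = L" "p * r + q * s = 0"
    using inner[of 1 1] inner[of \<i> \<i>] inner[of 1 \<i>] pq
    by (simp_all add: inner_complex_def power2_eq_square)
  have d: "p * s - r * q > 0" using det pq by simp
  have "(p * s - r * q)\<^sup>2 = (p\<^sup>2 + q\<^sup>2) * (r\<^sup>2 + s\<^sup>2) - (p * r + q * s)\<^sup>2"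
    by (simp add: algebra_simps power2_eq_square)
  then have "(p * s - r * q)\<^sup>2 = L\<^sup>2" using 1 by (simp add: power2_eq_square)
  moreover have "L \<ge> 0" using 1(1) by (metis sum_power2_ge_zero)
  ultimately have "p * s - r * q = L" using d by (simp add: power2_eq_iff_nonneg)
  then have "(p - s)\<^sup>2 + (q + r)\<^sup>2 = 0" using 1 by (simp add: power2_eq_square algebra_simps)
  then have rs: "s = p" "r = - q" by (simp_all add: sum_power2_eq_zero_iff)
  have "D w = D (Re w *\<^sub>R 1 + Im w *\<^sub>R \<i>)"
    by (rule arg_cong[of _ _ D]) (simp add: complex_eq_iff)
  also have "\<dots> = Re w *\<^sub>R D 1 + Im w *\<^sub>R D \<i>"
    by (simp add: linear_add[OF D] linear_scale[OF D])
  also have "\<dots> = D 1 * w" by (simp add: pq rs complex_eq_iff algebra_simps)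
  finally show "D w = D 1 * w" .
  show "(cmod (D 1))\<^sup>2 = L" using 1 pq by (simp add: cmod_power2)
qed

lemma local_isometry_plus_imp_hyp:
  assumes "local_isometry_plus S h" "open S" "S \<subseteq> UHP"
  shows "hyp_local_isometry S h"
proof -
  have *: "(h has_field_derivative frechet_derivative h (at z) 1) (at z) \<and> h z \<in> UHP \<and>
     cmod (frechet_derivative h (at z) 1) * Im z = Im (h z)" if z: "z \<in> S" for z
  proof -
    let ?D = "frechet_derivative h (at z)"
    have h: "h z \<in> UHP" "(h has_derivative ?D) (at z)"
      and inner: "\<And>v w. (?D v \<bullet> ?D w) / (Im (h z))\<^sup>2 = (v \<bullet> w) / (Im z)\<^sup>2"
      and det: "Re (?D 1) * Im (?D \<i>) - Re (?D \<i>) * Im (?D 1) > 0"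
      using assms(1) z by (auto simp: local_isometry_plus_def Let_def frechet_derivative_works)
    have pos: "Im z > 0" "Im (h z) > 0" using h z assms(3) by (auto simp: UHP_def)
    have inner': "?D v \<bullet> ?D w = (Im (h z) / Im z)\<^sup>2 * (v \<bullet> w)" for v w
      using inner[of v w] pos by (simp add: field_simps)
    note c = complex_linear_if_conformal[OF has_derivative_linear[OF h(2)] inner' det]
    have "?D = (*) (?D 1)" using c(1) by blast
    then have "(h has_field_derivative ?D 1) (at z)" using h(2) by (simp add: has_field_derivative_def)
    moreover have "cmod (?D 1) = Im (h z) / Im z"
      using c(2) pos by (simp add: power2_eq_iff_nonneg)
    ultimately show ?thesis using h(1) pos by simp
  qed
  have "h holomorphic_on S"
    using * by (auto simp: holomorphic_on_open[OF \<open>open S\<close>])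
  then show ?thesis
    using * assms(3) DERIV_imp_deriv unfolding hyp_local_isometry_def
    by (metis image_subsetI)
qed

text \<open>For a local isometry this is \<open>h' / |h'|\<close>. Replacing the modulus by a ratio
  of heights gives an expression that the product rule differentiates directly.\<close>

definition rotation_factor :: "(complex \<Rightarrow> complex) \<Rightarrow> complex \<Rightarrow> complex" where
  "rotation_factor h z = deriv h z * of_real (Im z) / of_real (Im (h z))"

context
  fixes S h
  assumes h: "hyp_local_isometry S h" and S: "open S"
begin

lemma hyp_local_isometryD:
  assumes "z \<in> S"
  shows "Im z > 0" "Im (h z) > 0" "(h has_field_derivative deriv h z) (at z)"
    "cmod (deriv h z) * Im z = Im (h z)" "deriv h z \<noteq> 0"
    "(deriv h has_field_derivative deriv (deriv h) z) (at z)"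
proof -
  show *: "Im z > 0" "Im (h z) > 0" "cmod (deriv h z) * Im z = Im (h z)"
    using h assms by (auto simp: hyp_local_isometry_def UHP_def)
  then show "deriv h z \<noteq> 0" by auto
  show "(h has_field_derivative deriv h z) (at z)"
    using h assms S by (auto simp: hyp_local_isometry_def intro: holomorphic_derivI)
  show "(deriv h has_field_derivative deriv (deriv h) z) (at z)"
    using h assms S by (auto simp: hyp_local_isometry_def intro!: holomorphic_derivI[of "deriv h" S] holomorphic_deriv)
qed

lemma norm_rotation_factor: "z \<in> S \<Longrightarrow> cmod (rotation_factor h z) = 1"
  using hyp_local_isometryD[of z] by (simp add: rotation_factor_def norm_mult norm_divide)

lemma deriv_eq_rotation_factor:
  "z \<in> S \<Longrightarrow> deriv h z * of_real (Im z) = rotation_factor h z * of_real (Im (h z))"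
  using hyp_local_isometryD[of z] by (simp add: rotation_factor_def)

text \<open>Differentiate \<open>|h'|\<^sup>2 y\<^sup>2 = (Im h)\<^sup>2\<close> with respect to \<open>z\<close>.\<close>

lemma deriv2_isometry:
  assumes z: "z \<in> S"
  shows "\<i> * of_real (Im z) * deriv (deriv h) z = deriv h z * (rotation_factor h z - 1)"
proof -
  note d = hyp_local_isometryD[OF z]
  let ?p = "deriv h z" and ?q = "deriv (deriv h) z" and ?y = "complex_of_real (Im z)" and ?Y = "complex_of_real (Im (h z))"
  have h1: "(h has_derivative (\<lambda>v. ?p * v)) (at z)" and h2: "(deriv h has_derivative (\<lambda>v. ?q * v)) (at z)"
    using d(3,6) by (simp_all add: has_field_derivative_def)
  have 1: "((\<lambda>w. deriv h w * cnj (deriv h w) * (of_real (Im w))\<^sup>2) has_derivative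
     (\<lambda>v. ?p * cnj ?p * (2 * ?y * of_real (Im v)) + (?p * cnj (?q * v) + ?q * v * cnj ?p) * ?y\<^sup>2)) (at z)"
    by (rule derivative_eq_intros h2 refl | simp)+ (auto simp: fun_eq_iff algebra_simps)
  have 2: "((\<lambda>w. (complex_of_real (Im (h w)))\<^sup>2) has_derivative (\<lambda>v. 2 * ?Y * of_real (Im (?p * v)))) (at z)"
    by (rule derivative_eq_intros h1 refl | simp)+ (auto simp: fun_eq_iff algebra_simps)
  have eq: "deriv h w * cnj (deriv h w) * (of_real (Im w))\<^sup>2 = (complex_of_real (Im (h w)))\<^sup>2" if "w \<in> S" for w
    using hyp_local_isometryD(4)[OF that, symmetric]
    by (simp add: complex_norm_square[symmetric] power_mult_distrib)
  have "((\<lambda>w. (complex_of_real (Im (h w)))\<^sup>2) has_derivative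
     (\<lambda>v. ?p * cnj ?p * (2 * ?y * of_real (Im v)) + (?p * cnj (?q * v) + ?q * v * cnj ?p) * ?y\<^sup>2)) (at z)"
    by (rule has_derivative_transform_within_open[OF 1 S z eq])
  from has_derivative_unique[OF 2 this]
  have e: "2 * ?Y * of_real (Im (?p * v)) = ?p * cnj ?p * (2 * ?y * of_real (Im v)) + (?p * cnj (?q * v) + ?q * v * cnj ?p) * ?y\<^sup>2" for v
    by meson
  \<comment> \<open>The combination \<open>D 1 - i D i\<close> of a real derivative \<open>D\<close>
    is twice its \<open>d/dz\<close> part; here it is formed for \<open>Im h\<close>.\<close>
  have i1: "complex_of_real (Im (?p * 1)) - \<i> * of_real (Im (?p * \<i>)) = - \<i> * ?p"
    by (simp add: complex_eq_iff)
  have "2 * ?Y * (complex_of_real (Im (?p * 1)) - \<i> * of_real (Im (?p * \<i>)))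
      = 2 * ?Y * of_real (Im (?p * 1)) - \<i> * (2 * ?Y * of_real (Im (?p * \<i>)))"
    by (simp only: right_diff_distrib mult.left_commute)
  also have "\<dots> = - \<i> * 2 * ?p * cnj ?p * ?y + 2 * ?q * cnj ?p * ?y\<^sup>2"
    unfolding e by (simp add: algebra_simps)
  finally have "2 * ?Y * (complex_of_real (Im (?p * 1)) - \<i> * of_real (Im (?p * \<i>)))
      = - \<i> * 2 * ?p * cnj ?p * ?y + 2 * ?q * cnj ?p * ?y\<^sup>2" .
  then have "2 * (- \<i> * ?Y * ?p) = 2 * (- \<i> * ?p * cnj ?p * ?y + ?q * cnj ?p * ?y\<^sup>2)"
    unfolding i1 by (simp add: algebra_simps)
  then have k: "- \<i> * ?Y * ?p = - \<i> * ?p * cnj ?p * ?y + ?q * cnj ?p * ?y\<^sup>2"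
    using mult_left_cancel[of "2::complex"] by fastforce
  have Y: "?Y\<^sup>2 = ?p * cnj ?p * ?y\<^sup>2" using eq[OF z] by simp
  have nz: "?Y \<noteq> 0" "?y \<noteq> 0" "cnj ?p \<noteq> 0" using d by auto
  have "?p * rotation_factor h z * (cnj ?p * ?y) = ?p * (?p * cnj ?p * ?y\<^sup>2) / ?Y"
    by (simp add: rotation_factor_def power2_eq_square)
  also have "\<dots> = ?p * ?Y" unfolding Y[symmetric] using nz by (simp add: power2_eq_square)
  finally have r: "?p * rotation_factor h z * (cnj ?p * ?y) = ?p * ?Y" .
  have "(\<i> * ?y * ?q) * (cnj ?p * ?y) = \<i> * (?q * cnj ?p * ?y\<^sup>2)" by (simp add: power2_eq_square)
  also have "?q * cnj ?p * ?y\<^sup>2 = \<i> * ?p * cnj ?p * ?y - \<i> * ?Y * ?p" using k by (simp add: algebra_simps)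
  also have "\<i> * (\<i> * ?p * cnj ?p * ?y - \<i> * ?Y * ?p) = ?p * ?Y - ?p * (cnj ?p * ?y)"
    by (simp add: algebra_simps)
  also have "\<dots> = ?p * (rotation_factor h z - 1) * (cnj ?p * ?y)"
    unfolding r[symmetric] by (simp add: algebra_simps)
  finally show ?thesis using nz by simp
qed

end

lemma d_dz_eq: "(u has_derivative D) (at z) \<Longrightarrow> d_dz u z = (D 1 - \<i> * D \<i>) / 2"
  unfolding d_dz_def by (simp add: frechet_derivative_at[symmetric])

text \<open>The equation reads \<open>2 i y dj/dz = j (j - 1)\<close>. Its part \<open>- j\<close>
  will cancel the weight term of \<open>K_n\<close> and leave the weight with one more power of
  \<open>j\<close>. The factor \<open>j\<close> is not holomorphic, hence a real derivative
  \<open>D\<close>.\<close>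

lemma rotation_factor_has_derivative:
  assumes h: "hyp_local_isometry S h" and S: "open S" and z: "z \<in> S"
  obtains D where "(rotation_factor h has_derivative D) (at z)"
    "2 * \<i> * of_real (Im z) * ((D 1 - \<i> * D \<i>) / 2) = rotation_factor h z * (rotation_factor h z - 1)"
proof -
  note d = hyp_local_isometryD[OF h S z]
  let ?p = "deriv h z" and ?q = "deriv (deriv h) z" and ?y = "complex_of_real (Im z)" and ?Y = "complex_of_real (Im (h z))"
  have h1: "(h has_derivative (\<lambda>v. ?p * v)) (at z)" and h2: "(deriv h has_derivative (\<lambda>v. ?q * v)) (at z)"
    using d(3,6) by (simp_all add: has_field_derivative_def)
  have nz: "?Y \<noteq> 0" "?y \<noteq> 0" using d by auto
  define D where "D = (\<lambda>v. (?p * of_real (Im v) + ?q * v * ?y) / ?Y - ?p * ?y * of_real (Im (?p * v)) / ?Y\<^sup>2)"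
  show ?thesis
  proof
    show "(rotation_factor h has_derivative D) (at z)"
      unfolding rotation_factor_def D_def
      by (rule derivative_eq_intros h1 h2 refl nz | simp)+
        (use nz in \<open>auto simp: fun_eq_iff field_simps power2_eq_square\<close>)
    have i1: "complex_of_real (Im (?p * 1)) - \<i> * of_real (Im (?p * \<i>)) = - \<i> * ?p"
      by (simp add: complex_eq_iff)
    have "D 1 - \<i> * D \<i> = (- \<i> * ?p + 2 * ?q * ?y) / ?Y
       - ?p * ?y * (complex_of_real (Im (?p * 1)) - \<i> * of_real (Im (?p * \<i>))) / ?Y\<^sup>2"
      using nz by (simp add: D_def field_simps power2_eq_square)
    then have D1: "D 1 - \<i> * D \<i> = (- \<i> * ?p + 2 * ?q * ?y) / ?Y + \<i> * ?p * ?y * ?p / ?Y\<^sup>2"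
      unfolding i1 by (simp add: field_simps)
    have "2 * \<i> * ?y * ((D 1 - \<i> * D \<i>) / 2) = (?p * ?y + 2 * (\<i> * ?y * ?q) * ?y) / ?Y - (?p * ?y) * (?p * ?y) / ?Y\<^sup>2"
      unfolding D1 using nz by (simp add: field_simps power2_eq_square)
    also have "\<dots> = rotation_factor h z * (rotation_factor h z - 1)"
      unfolding deriv2_isometry[OF h S z] rotation_factor_def using nz
      by (simp add: field_simps power2_eq_square)
    finally show "2 * \<i> * ?y * ((D 1 - \<i> * D \<i>) / 2) = rotation_factor h z * (rotation_factor h z - 1)" .
  qed
qed

section \<open>Ascension and isometries\<close>

lemma smooth_on_d_dz:
  assumes "open S" "smooth_on S u" shows "smooth_on S (d_dz u)"
proof -
  have "Ck_on k S (\<lambda>z. (frechet_derivative u (at z) 1 - \<i> * frechet_derivative u (at z) \<i>) * (1/2))" for k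
    by (intro Ck_on_mult Ck_on_diff Ck_on_const assms(1) smooth_onD[OF smooth_on_frechet[OF assms(2)]])
  then show ?thesis
    unfolding smooth_on_def d_dz_def[abs_def] by simp
qed

lemma smooth_on_raise_op:
  assumes "open S" "smooth_on S u" shows "smooth_on S (raise_op \<tau> u)"
  unfolding smooth_on_def raise_op_def[abs_def]
  by (intro allI Ck_on_mult Ck_on_add Ck_on_const assms(1) smooth_onD[OF smooth_on_d_dz]
      smooth_onD assms Ck_on_bounded_linear_id[of _ "\<lambda>z. complex_of_real (Im z)"]
      bounded_linear_compose[OF bounded_linear_of_real bounded_linear_Im])

lemma smooth_on_ascend:
  assumes "open S" "smooth_on S u" shows "smooth_on S (ascend s n u)"
proof (induction n)
  case (Suc n)
  have "Ck_on k S (\<lambda>z. raise_op (int n) (ascend s n u) z * (1 / of_real (sqrt (s\<^sup>2 + real n * real (n + 1)))))" for k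
    by (intro Ck_on_mult Ck_on_const assms(1) smooth_onD[OF smooth_on_raise_op] Suc)
  then show ?case unfolding smooth_on_def by simp
qed (use assms in simp)

text \<open>One operator at a time, \<open>K_n (j^n (w o h)) = j^(n+1) (K_n w) o h\<close>. As
  \<open>h\<close> is holomorphic, \<open>d/dz\<close> of \<open>w o h\<close> is \<open>h'\<close>
  times \<open>dw/dz\<close>, and \<open>h' y = j Im h\<close> supplies a factor \<open>j\<close>.
  The derivative of \<open>j^n\<close> contributes \<open>n j^n (j - 1)\<close>, which with the
  weight term \<open>n j^n\<close> adds up to \<open>n j^(n+1)\<close>.\<close>

lemma ascend_isometry:
  assumes h: "hyp_local_isometry S h" and S: "open S" and T: "open T" "h ` S \<subseteq> T"
    and u: "smooth_on T u" and eq: "\<And>w. w \<in> S \<Longrightarrow> v w = u (h w)" and z: "z \<in> S"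
  shows "ascend s n v z = rotation_factor h z ^ n * ascend s n u (h z)"
  using z
proof (induction n arbitrary: z)
  case (Suc n)
  let ?w = "ascend s n u" and ?j = "rotation_factor h"
  have "Ck_on 1 T ?w" by (intro smooth_onD smooth_on_ascend T u)
  then have w: "(?w has_derivative frechet_derivative ?w (at (h z))) (at (h z))"
    using T(2) Suc.prems by (auto simp: frechet_derivative_works)
  let ?W = "frechet_derivative ?w (at (h z))"
  have W: "?W x = Re x *\<^sub>R ?W 1 + Im x *\<^sub>R ?W \<i>" for x
  proof -
    have l: "linear ?W" using has_derivative_linear[OF w] .
    have "?W x = ?W (Re x *\<^sub>R 1 + Im x *\<^sub>R \<i>)" by (rule arg_cong[of _ _ ?W]) (simp add: complex_eq_iff)
    then show ?thesis by (simp add: linear_add[OF l] linear_scale[OF l])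
  qed
  have h1: "(h has_derivative (\<lambda>v. deriv h z * v)) (at z)"
    using hyp_local_isometryD(3)[OF h S Suc.prems] by (simp add: has_field_derivative_def)
  obtain D where D: "(?j has_derivative D) (at z)"
    "2 * \<i> * of_real (Im z) * ((D 1 - \<i> * D \<i>) / 2) = ?j z * (?j z - 1)"
    using rotation_factor_has_derivative[OF h S Suc.prems] .
  have "((\<lambda>z. ?j z ^ n * ?w (h z)) has_derivative
     (\<lambda>v. ?j z ^ n * ?W (deriv h z * v) + (of_nat n * D v * ?j z ^ (n - 1)) * ?w (h z))) (at z)"
    by (rule has_derivative_mult has_derivative_power D has_derivative_compose[OF h1 w])+
  then have "(ascend s n v has_derivative
     (\<lambda>v. ?j z ^ n * ?W (deriv h z * v) + (of_nat n * D v * ?j z ^ (n - 1)) * ?w (h z))) (at z)"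
    by (rule has_derivative_transform_within_open[OF _ S Suc.prems]) (simp add: Suc.IH)
  note dz = d_dz_eq[OF this]
  \<comment> \<open>Multiplication by \<open>h'\<close> is complex linear, so the antiholomorphic
    part of the derivative of \<open>w\<close> drops out.\<close>
  have W2: "?W (deriv h z * 1) - \<i> * ?W (deriv h z * \<i>) = deriv h z * (?W 1 - \<i> * ?W \<i>)"
    unfolding W[of "deriv h z * 1"] W[of "deriv h z * \<i>"]
    by (simp add: complex_eq_iff algebra_simps)
  have "d_dz (ascend s n v) z = ?j z ^ n * ((?W (deriv h z * 1) - \<i> * ?W (deriv h z * \<i>)) / 2)
     + of_nat n * ?j z ^ (n - 1) * ?w (h z) * ((D 1 - \<i> * D \<i>) / 2)"
    unfolding dz by (simp add: field_simps)
  also have "\<dots> = ?j z ^ n * (deriv h z * d_dz ?w (h z))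
     + of_nat n * ?j z ^ (n - 1) * ?w (h z) * ((D 1 - \<i> * D \<i>) / 2)"
    unfolding W2 d_dz_def by simp
  finally have "2 * \<i> * of_real (Im z) * d_dz (ascend s n v) z =
      2 * \<i> * ?j z ^ n * ((deriv h z * of_real (Im z)) * d_dz ?w (h z))
     + of_nat n * ?j z ^ (n - 1) * ?w (h z) * (2 * \<i> * of_real (Im z) * ((D 1 - \<i> * D \<i>) / 2))"
    by (simp add: algebra_simps)
  also have "\<dots> = 2 * \<i> * ?j z ^ n * ((?j z * of_real (Im (h z))) * d_dz ?w (h z))
     + of_nat n * ?j z ^ (n - 1) * ?w (h z) * (?j z * (?j z - 1))"
    unfolding D(2) deriv_eq_rotation_factor[OF h S Suc.prems] ..
  \<comment> \<open>For \<open>n = 0\<close> the exponent \<open>n - 1\<close> is truncated to 0,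
    but the factor \<open>n\<close> removes the term.\<close>
  also have "\<dots> = ?j z ^ Suc n * (2 * \<i> * of_real (Im (h z)) * d_dz ?w (h z))
     + of_nat n * ?j z ^ n * ?w (h z) * (?j z - 1)"
    by (cases n) (simp_all add: algebra_simps)
  finally have "raise_op (int n) (ascend s n v) z = ?j z ^ Suc n * raise_op (int n) ?w (h z)"
    unfolding raise_op_def Suc.IH[OF Suc.prems] by (simp add: algebra_simps)
  then show ?case by simp
qed (simp add: eq)

section \<open>The phase\<close>

text \<open>\<open>UHP\<close> is contractible, so the zero-free \<open>h'\<close> has a holomorphic
  logarithm \<open>G\<close>. Its imaginary part is a single-valued argument, which turns powers of
  the rotation factor into \<open>exp (i n Im G)\<close>; the last formula is
  \<open>deriv2_isometry\<close> divided by \<open>h'\<close>.\<close>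

lemma hyp_isometry_log_deriv:
  assumes h: "hyp_local_isometry UHP h"
  obtains G where "G holomorphic_on UHP" "\<And>z. z \<in> UHP \<Longrightarrow> rotation_factor h z = exp (\<i> * of_real (Im (G z)))"
    "\<And>z. z \<in> UHP \<Longrightarrow> \<i> * of_real (Im z) * deriv G z = rotation_factor h z - 1"
proof -
  note d = hyp_local_isometryD[OF h open_UHP]
  have hol: "deriv h holomorphic_on UHP"
    using h open_UHP by (auto simp: hyp_local_isometry_def intro: holomorphic_deriv)
  obtain G where G: "G holomorphic_on UHP" "\<And>z. z \<in> UHP \<Longrightarrow> deriv h z = exp (G z)"
    using contractible_imp_holomorphic_log[OF hol convex_imp_contractible[OF convex_UHP]] d(5) by metis
  show ?thesis
  proof
    fix z assume z: "z \<in> UHP"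
    have "cmod (exp (G z)) * Im z = Im (h z)" using d(4)[OF z] G(2)[OF z] by simp
    then have e: "Im (h z) = exp (Re (G z)) * Im z" by simp
    have "exp (G z) = of_real (exp (Re (G z))) * exp (\<i> * of_real (Im (G z)))"
      by (subst exp_of_real[symmetric], subst mult_exp_exp) (simp flip: complex_eq)
    then show "rotation_factor h z = exp (\<i> * of_real (Im (G z)))"
      using d(1)[OF z] by (simp add: rotation_factor_def e G(2)[OF z])
    have "(G has_field_derivative deriv G z) (at z)" by (rule holomorphic_derivI[OF G(1) open_UHP z])
    then have "((\<lambda>w. exp (G w)) has_field_derivative exp (G z) * deriv G z) (at z)"
      by (auto intro!: derivative_eq_intros)
    then have "(deriv h has_field_derivative exp (G z) * deriv G z) (at z)"
      by (rule has_field_derivative_transform_within_open[OF _ open_UHP z]) (simp add: G(2))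
    then have "deriv (deriv h) z = deriv h z * deriv G z"
      using DERIV_imp_deriv G(2)[OF z] by auto
    then have "deriv h z * (\<i> * of_real (Im z) * deriv G z) = deriv h z * (rotation_factor h z - 1)"
      using deriv2_isometry[OF h open_UHP z] by (simp add: ac_simps)
    then show "\<i> * of_real (Im z) * deriv G z = rotation_factor h z - 1"
      using d(5)[OF z] mult_left_cancel by blast
  qed (rule G(1))
qed

section \<open>Holomorphic change of variables\<close>

text \<open>The library's change-of-variables theorem is for \<open>real ^ 'n\<close>; the maps below transfer it to
  \<open>complex\<close>.\<close>

definition vec_to_complex :: "real ^ 2 \<Rightarrow> complex" where
  "vec_to_complex v = Complex (v $ 1) (v $ 2)"

definition complex_to_vec :: "complex \<Rightarrow> real ^ 2" where
  "complex_to_vec z = (\<chi> i. if i = 1 then Re z else Im z)"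

lemma vec_complex_inverse [simp]:
  "vec_to_complex (complex_to_vec z) = z" "complex_to_vec (vec_to_complex v) = v"
  by (simp_all add: vec_to_complex_def complex_to_vec_def vec_eq_iff forall_2)

lemma linear_vec_to_complex: "linear vec_to_complex"
  by (rule linearI) (simp_all add: vec_to_complex_def complex_eq_iff)

lemma linear_complex_to_vec: "linear complex_to_vec"
  by (rule linearI) (simp_all add: complex_to_vec_def vec_eq_iff)

lemmas bounded_linear_vec_to_complex = linear_linear[THEN iffD2, OF linear_vec_to_complex]
lemmas bounded_linear_complex_to_vec = linear_linear[THEN iffD2, OF linear_complex_to_vec]

lemma Basis_vec_2: "(Basis :: (real ^ 2) set) = {axis 1 1, axis 2 1}"
  unfolding Basis_vec_def UNIV_2 by auto

lemma vimage_vec_to_complex_box: "vec_to_complex -` box a b = box (complex_to_vec a) (complex_to_vec b)"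
  by (auto simp: mem_box Basis_vec_2 Basis_complex_def inner_axis vec_to_complex_def complex_to_vec_def)

lemma vimage_vec_to_complex_cbox: "vec_to_complex -` cbox a b = cbox (complex_to_vec a) (complex_to_vec b)"
  by (auto simp: mem_box Basis_vec_2 Basis_complex_def inner_axis vec_to_complex_def complex_to_vec_def)

lemma vec_to_complex_measurable [measurable]: "vec_to_complex \<in> borel \<rightarrow>\<^sub>M borel"
  by (intro borel_measurable_continuous_onI linear_continuous_on bounded_linear_vec_to_complex)

lemma distr_vec_to_complex: "distr lborel borel vec_to_complex = (lborel :: complex measure)"
proof (rule lborel_eqI[symmetric])
  fix l u :: complex assume le: "\<And>b. b \<in> Basis \<Longrightarrow> l \<bullet> b \<le> u \<bullet> b"
  have "axis 1 1 \<noteq> (axis 2 1 :: real ^ 2)" by (simp add: axis_eq_axis)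
  moreover have "emeasure (distr lborel borel vec_to_complex) (box l u) = emeasure lborel (box (complex_to_vec l) (complex_to_vec u))"
    by (subst emeasure_distr) (simp_all add: vimage_vec_to_complex_box)
  moreover have "\<dots> = (\<Prod>b\<in>Basis. (complex_to_vec u - complex_to_vec l) \<bullet> b)"
    using le[of 1] le[of \<i>]
    by (intro emeasure_lborel_box) (auto simp: Basis_vec_2 Basis_complex_def inner_axis complex_to_vec_def)
  ultimately show "emeasure (distr lborel borel vec_to_complex) (box l u) = (\<Prod>b\<in>Basis. (u - l) \<bullet> b)"
    by (simp add: Basis_vec_2 Basis_complex_def inner_axis complex_to_vec_def)
qed simp

lemma det_complex_mult:
  "det (matrix (\<lambda>v. complex_to_vec (c * vec_to_complex v))) = (cmod c)\<^sup>2"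
  by (simp add: det_2 matrix_def complex_to_vec_def vec_to_complex_def axis_def cmod_power2 power2_eq_square[of "Re c"] power2_eq_square[of "Im c"])

text \<open>On a box with closure in \<open>S\<close> the function \<open>|f'|^2\<close> is
  continuous up to the boundary, hence integrable, and it is the Jacobian determinant of
  multiplication by \<open>f'\<close>. Boxes suffice because they determine measures.\<close>

lemma emeasure_holomorphic_image_box:
  assumes S: "open S" and f: "f holomorphic_on S" "inj_on f S" and ab: "cbox a b \<subseteq> S"
  shows "emeasure lborel (f ` box a b) = (\<integral>\<^sup>+z\<in>box a b. ennreal ((cmod (deriv f z))\<^sup>2) \<partial>lborel)"
proof -
  let ?B = "box (complex_to_vec a) (complex_to_vec b)"
  let ?g = "\<lambda>x. complex_to_vec (f (vec_to_complex x))"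
  let ?\<phi> = "\<lambda>x. (cmod (deriv f (vec_to_complex x)))\<^sup>2"
  let ?g' = "\<lambda>x v. complex_to_vec (deriv f (vec_to_complex x) * vec_to_complex v)"
  have box: "box a b \<subseteq> S" using ab box_subset_cbox by blast
  have B: "vec_to_complex x \<in> box a b \<longleftrightarrow> x \<in> ?B" for x
    using vimage_vec_to_complex_box by blast
  have img: "vec_to_complex -` (f ` box a b) = ?g ` ?B"
  proof safe
    fix x z assume *: "vec_to_complex x = f z" "z \<in> box a b"
    then have "x = ?g (complex_to_vec z)" by (metis vec_complex_inverse)
    moreover have "complex_to_vec z \<in> ?B" using *(2) B[of "complex_to_vec z"] by simp
    ultimately show "x \<in> ?g ` ?B" by blast
  qed (use B in auto)
  have opn: "open (f ` box a b)"
    by (rule open_mapping_thm3) (use f box in \<open>auto intro: holomorphic_on_subset inj_on_subset\<close>)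
  have der: "(?g has_derivative ?g' x) (at x within ?B)" if "x \<in> ?B" for x
  proof -
    have "vec_to_complex x \<in> S" using B that box by blast
    then have "(f has_derivative (*) (deriv f (vec_to_complex x))) (at (vec_to_complex x))"
      using holomorphic_derivI[OF f(1) S] by (simp add: has_field_derivative_def)
    then have "((\<lambda>x. f (vec_to_complex x)) has_derivative (\<lambda>v. deriv f (vec_to_complex x) * vec_to_complex v)) (at x within ?B)"
      by (rule has_derivative_compose[rotated])
        (rule bounded_linear_imp_has_derivative[OF bounded_linear_vec_to_complex])
    then show ?thesis by (rule bounded_linear.has_derivative[OF bounded_linear_complex_to_vec])
  qed
  have inj: "inj_on ?g ?B"
  proof (rule inj_onI)
    fix x y assume *: "x \<in> ?B" "y \<in> ?B" "?g x = ?g y"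
    then have "f (vec_to_complex x) = f (vec_to_complex y)" by (metis vec_complex_inverse(1))
    then have "vec_to_complex x = vec_to_complex y"
      using * f(2) box B by (meson inj_onD subsetD)
    then show "x = y" by (metis vec_complex_inverse(2))
  qed
  have "?\<phi> integrable_on cbox (complex_to_vec a) (complex_to_vec b)"
  proof (rule integrable_continuous)
    have "continuous_on S (deriv f)"
      using f(1) S by (intro holomorphic_on_imp_continuous_on holomorphic_deriv)
    moreover have "vec_to_complex ` cbox (complex_to_vec a) (complex_to_vec b) \<subseteq> S"
      using ab vimage_vec_to_complex_cbox[of a b] by blast
    ultimately have "continuous_on (cbox (complex_to_vec a) (complex_to_vec b)) (\<lambda>x. deriv f (vec_to_complex x))"
      by (rule continuous_on_compose2[OF _ linear_continuous_on[OF bounded_linear_vec_to_complex]])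
    then show "continuous_on (cbox (complex_to_vec a) (complex_to_vec b)) ?\<phi>"
      by (intro continuous_on_power continuous_on_norm)
  qed
  then have int: "?\<phi> integrable_on ?B"
    by (simp add: integrable_on_open_interval)
  then have hi: "(?\<phi> has_integral integral ?B ?\<phi>) ?B" by (rule integrable_integral)
  have "(\<lambda>x. \<bar>det (matrix (?g' x))\<bar>) = ?\<phi>"
    by (simp add: det_complex_mult)
  then have m: "?g ` ?B \<in> lmeasurable" "measure lebesgue (?g ` ?B) = integral ?B ?\<phi>"
    using has_measure_differentiable_image[OF _ der inj, of "integral ?B ?\<phi>"] hi by simp_all
  have "emeasure lborel (f ` box a b) = emeasure (distr lborel borel vec_to_complex) (f ` box a b)"
    by (simp add: distr_vec_to_complex)
  also have "\<dots> = emeasure lborel (?g ` ?B)"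
    using opn by (subst emeasure_distr) (auto simp: img)
  also have "\<dots> = emeasure lebesgue (?g ` ?B)"
  proof -
    have "open (?g ` ?B)"
      unfolding img[symmetric] using opn
      by (intro open_vimage linear_continuous_on bounded_linear_vec_to_complex)
    then show ?thesis by simp
  qed
  also have "\<dots> = ennreal (integral ?B ?\<phi>)"
    using m by (simp add: emeasure_eq_measure2 fmeasurableD2)
  also have "\<dots> = (\<integral>\<^sup>+x. ennreal (indicator ?B x * ?\<phi> x) \<partial>lborel)"
    using nn_integral_has_integral_lebesgue[OF _ hi] by simp
  also have "\<dots> = (\<integral>\<^sup>+z\<in>box a b. ennreal ((cmod (deriv f z))\<^sup>2) \<partial>distr lborel borel vec_to_complex)"
  proof -
    have m: "(\<lambda>z. ennreal ((cmod (deriv f z))\<^sup>2) * indicator (box a b) z) \<in> borel_measurable borel"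
    proof -
      have "continuous_on (box a b) (deriv f)"
        using f(1) S box by (meson holomorphic_on_imp_continuous_on holomorphic_deriv continuous_on_subset)
      then have "(\<lambda>z. indicator (box a b) z *\<^sub>R (cmod (deriv f z))\<^sup>2) \<in> borel_measurable borel"
        by (intro borel_measurable_continuous_on_indicator continuous_intros) auto
      then have "(\<lambda>z. ennreal (indicator (box a b) z *\<^sub>R (cmod (deriv f z))\<^sup>2)) \<in> borel_measurable borel"
        by measurable
      also have "(\<lambda>z. ennreal (indicator (box a b) z *\<^sub>R (cmod (deriv f z))\<^sup>2)) = (\<lambda>z. ennreal ((cmod (deriv f z))\<^sup>2) * indicator (box a b) z)"
        by (auto simp: indicator_def fun_eq_iff)
      finally show ?thesis .
    qed
    have "(\<integral>\<^sup>+x. ennreal (indicator ?B x * ?\<phi> x) \<partial>lborel) = (\<integral>\<^sup>+x. ennreal (?\<phi> x) * indicator (box a b) (vec_to_complex x) \<partial>lborel)"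
      by (intro nn_integral_cong) (auto simp: indicator_def B)
    also have "\<dots> = (\<integral>\<^sup>+z\<in>box a b. ennreal ((cmod (deriv f z))\<^sup>2) \<partial>distr lborel borel vec_to_complex)"
      by (subst nn_integral_distr) (use m in simp_all)
    finally show ?thesis .
  qed
  finally show ?thesis by (simp add: distr_vec_to_complex)
qed

text \<open>Lebesgue measure on the image, pushed forward by the inverse \<open>g\<close>, and the
  measure on \<open>S\<close> with density \<open>|f'|^2\<close> agree on boxes and therefore
  coincide. Integrating \<open>F o f\<close> against both gives the formula.\<close>

lemma nn_integral_holomorphic_substitution:
  assumes S: "open S" and f: "f holomorphic_on S" "inj_on f S" and F: "F \<in> borel_measurable borel"
  shows "(\<integral>\<^sup>+w\<in>f ` S. F w \<partial>lborel) = (\<integral>\<^sup>+z\<in>S. F (f z) * ennreal ((cmod (deriv f z))\<^sup>2) \<partial>lborel)"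
proof -
  obtain g where g: "g holomorphic_on (f ` S)" "\<And>z. z \<in> S \<Longrightarrow> g (f z) = z"
    using holomorphic_has_inverse[OF f(1) S f(2)] by metis
  have fS: "open (f ` S)" by (rule open_mapping_thm3[OF f(1) S f(2)])
  have S_borel: "S \<in> sets borel" "f ` S \<in> sets borel" using S fS by auto
  have cont: "continuous_on S f" "continuous_on S (deriv f)" "continuous_on (f ` S) g"
    using f g(1) S by (auto intro: holomorphic_on_imp_continuous_on holomorphic_deriv)
  let ?L = "restrict_space lborel S" and ?R = "restrict_space lborel (f ` S)"
  let ?d = "\<lambda>z. ennreal ((cmod (deriv f z))\<^sup>2)"
  have sets_L: "sets ?L = sets (restrict_space borel S)" and sets_R: "sets ?R = sets (restrict_space borel (f ` S))"
    by (simp_all add: sets_restrict_space)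
  have "(\<lambda>z. (cmod (deriv f z))\<^sup>2) \<in> borel_measurable (restrict_space borel S)"
    using cont(2) by (intro borel_measurable_continuous_on_restrict continuous_on_power continuous_on_norm)
  then have d: "?d \<in> borel_measurable ?L"
    unfolding measurable_cong_sets[OF sets_L refl] by measurable
  have fm: "f \<in> ?L \<rightarrow>\<^sub>M borel"
    unfolding measurable_cong_sets[OF sets_L refl] by (rule borel_measurable_continuous_on_restrict[OF cont(1)])
  have gm: "g \<in> ?R \<rightarrow>\<^sub>M restrict_space borel S"
  proof (rule measurable_restrict_space2)
    show "g \<in> ?R \<rightarrow>\<^sub>M borel"
      unfolding measurable_cong_sets[OF sets_R refl] by (rule borel_measurable_continuous_on_restrict[OF cont(3)])
  qed (use g in \<open>auto simp: space_restrict_space\<close>)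
  have eq: "distr ?R (restrict_space borel S) g = density ?L ?d"
  proof (rule measure_eqI_boxes[OF S])
    show "sets (density ?L ?d) = sets (restrict_space borel S)"
      by (simp add: sets_restrict_space)
    have e: "emeasure (distr ?R (restrict_space borel S) g) (box a b) = emeasure lborel (f ` box a b)" if ab: "cbox a b \<subseteq> S" for a b
    proof -
      have box: "box a b \<subseteq> S" using ab box_subset_cbox by blast
      have "g -` box a b \<inter> space ?R = f ` box a b"
        using box g(2) by (auto simp: space_restrict_space)
      moreover have "box a b \<in> sets (restrict_space borel S)"
        using box S_borel by (subst sets_restrict_space_iff) auto
      ultimately show ?thesis
        using S_borel image_mono[OF box, of f]
        by (subst emeasure_distr[OF gm]) (simp_all add: emeasure_restrict_space)
    qed
    fix a b assume ab: "cbox a b \<subseteq> S"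
    then have box: "box a b \<subseteq> S" using box_subset_cbox by blast
    have "emeasure (density ?L ?d) (box a b) = (\<integral>\<^sup>+z. ?d z * indicator (box a b) z \<partial>?L)"
      using box S_borel by (subst emeasure_density[OF d]) (auto simp: sets_restrict_space_iff)
    also have "\<dots> = (\<integral>\<^sup>+z. ?d z * indicator (box a b) z \<partial>lborel)"
      using box S_borel by (subst nn_integral_restrict_space) (auto intro!: nn_integral_cong simp: indicator_def)
    also have "\<dots> = emeasure lborel (f ` box a b)"
      by (rule emeasure_holomorphic_image_box[OF S f ab, symmetric])
    finally show "emeasure (distr ?R (restrict_space borel S) g) (box a b) = emeasure (density ?L ?d) (box a b)"
      using e[OF ab] by simp
    fix c e' assume "cbox c e' \<subseteq> box a b"
    then have ce: "cbox c e' \<subseteq> S" using box by blast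
    have "compact (f ` cbox c e')"
      using cont(1) ce by (intro compact_continuous_image compact_cbox) (auto intro: continuous_on_subset)
    then have "emeasure lborel (f ` cbox c e') < \<infinity>"
      by (intro emeasure_bounded_finite compact_imp_bounded)
    moreover have "emeasure lborel (f ` box c e') \<le> emeasure lborel (f ` cbox c e')"
      using \<open>compact (f ` cbox c e')\<close> box_subset_cbox
      by (intro emeasure_mono image_mono) (auto simp: compact_imp_closed)
    ultimately have "emeasure lborel (f ` box c e') < \<infinity>" by (rule le_less_trans[rotated])
    then show "emeasure (distr ?R (restrict_space borel S) g) (box c e') \<noteq> \<infinity>"
      using e[OF ce] by simp
  qed simp
  have F1: "(\<lambda>z. F (f z)) \<in> borel_measurable ?L" by (rule measurable_compose[OF fm F])
  then have F2: "(\<lambda>z. F (f z)) \<in> borel_measurable (restrict_space borel S)"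
    unfolding measurable_cong_sets[OF sets_L refl] .
  have "(\<integral>\<^sup>+w\<in>f ` S. F w \<partial>lborel) = (\<integral>\<^sup>+w. F w \<partial>?R)"
    using S_borel by (subst nn_integral_restrict_space) auto
  also have "\<dots> = (\<integral>\<^sup>+w. F (f (g w)) \<partial>?R)"
    using g(2) by (intro nn_integral_cong) (auto simp: space_restrict_space)
  also have "\<dots> = (\<integral>\<^sup>+z. F (f z) \<partial>distr ?R (restrict_space borel S) g)"
    by (subst nn_integral_distr[OF gm]) (use F2 in simp_all)
  also have "\<dots> = (\<integral>\<^sup>+z. ?d z * F (f z) \<partial>?L)"
    unfolding eq by (rule nn_integral_density[OF d F1])
  also have "\<dots> = (\<integral>\<^sup>+z\<in>S. F (f z) * ?d z \<partial>lborel)"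
    using S_borel by (subst nn_integral_restrict_space) (auto simp: mult.commute)
  finally show ?thesis .
qed

section \<open>The hyperbolic area\<close>

lemma UHP_borel [measurable]: "UHP \<in> sets borel"
  using open_UHP by simp

lemma hyp_density_measurable: "(\<lambda>z. ennreal (indicator UHP z / (Im z)\<^sup>2)) \<in> borel_measurable borel"
  by measurable

lemma sets_hyp_area [simp, measurable_cong]: "sets hyp_area = sets borel"
  by (simp add: hyp_area_def)

lemma space_hyp_area [simp]: "space hyp_area = UNIV"
  by (simp add: hyp_area_def)

lemma nn_integral_hyp_area:
  "F \<in> borel_measurable borel \<Longrightarrow>
    (\<integral>\<^sup>+z. F z \<partial>hyp_area) = (\<integral>\<^sup>+z. ennreal (indicator UHP z / (Im z)\<^sup>2) * F z \<partial>lborel)"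
  unfolding hyp_area_def by (rule nn_integral_density) (use hyp_density_measurable in auto)

lemma sigma_finite_hyp_area: "sigma_finite_measure hyp_area"
  unfolding hyp_area_def
  by (subst sigma_finite_measure.sigma_finite_iff_density_finite[OF sigma_finite_lborel]) (use hyp_density_measurable in auto)

interpretation hyp_pair: pair_sigma_finite hyp_area hyp_area
  by (rule pair_sigma_finite.intro; rule sigma_finite_hyp_area)

text \<open>The two functions are inverse to each other on \<open>UHP\<close> only. Carrying the
  inverse explicitly makes the exchange of \<open>f\<close> and \<open>g\<close> immediate.\<close>

definition isometry_pair :: "(complex \<Rightarrow> complex) \<Rightarrow> (complex \<Rightarrow> complex) \<Rightarrow> bool" where
  "isometry_pair f g \<longleftrightarrow> hyp_local_isometry UHP f \<and> hyp_local_isometry UHP g \<and>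
     (\<forall>z\<in>UHP. f (g z) = z) \<and> (\<forall>z\<in>UHP. g (f z) = z)"

lemma isometry_pair_sym: "isometry_pair f g \<Longrightarrow> isometry_pair g f"
  by (simp add: isometry_pair_def)

lemma isometry_pairD:
  assumes "isometry_pair f g"
  shows "hyp_local_isometry UHP f" "hyp_local_isometry UHP g"
    "z \<in> UHP \<Longrightarrow> f (g z) = z" "z \<in> UHP \<Longrightarrow> g (f z) = z" "z \<in> UHP \<Longrightarrow> f z \<in> UHP" "z \<in> UHP \<Longrightarrow> g z \<in> UHP"
    "f holomorphic_on UHP" "g holomorphic_on UHP" "f ` UHP = UHP" "g ` UHP = UHP"
    "continuous_on UHP f" "continuous_on UHP g" "inj_on f UHP" "inj_on g UHP"
proof -
  show *: "hyp_local_isometry UHP f" "hyp_local_isometry UHP g"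
    "\<And>z. z \<in> UHP \<Longrightarrow> f (g z) = z" "\<And>z. z \<in> UHP \<Longrightarrow> g (f z) = z"
    using assms by (auto simp: isometry_pair_def)
  then show **: "\<And>z. z \<in> UHP \<Longrightarrow> f z \<in> UHP" "\<And>z. z \<in> UHP \<Longrightarrow> g z \<in> UHP"
    "f holomorphic_on UHP" "g holomorphic_on UHP"
    by (auto simp: hyp_local_isometry_def)
  then show "continuous_on UHP f" "continuous_on UHP g"
    by (auto intro: holomorphic_on_imp_continuous_on)
  show "f ` UHP = UHP"
    using *(3) **(1,2) by (metis image_subsetI image_eqI subsetI subset_antisym)
  show "g ` UHP = UHP"
    using *(4) **(1,2) by (metis image_subsetI image_eqI subsetI subset_antisym)
  show "inj_on f UHP" "inj_on g UHP"
    using *(3,4) by (auto intro: inj_on_inverseI)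
qed

lemma isometry_measurable:
  assumes "isometry_pair f g"
  shows "(\<lambda>z. if z \<in> UHP then g z else 0) \<in> borel_measurable borel"
  using borel_measurable_continuous_on_if[of UHP g "\<lambda>_. 0"] isometry_pairD(12)[OF assms] by simp

text \<open>By \<open>|f'| y = Im f\<close> the Jacobian turns \<open>1 / (Im f)^2\<close> into
  \<open>1 / y^2\<close>. The default value 0 makes the map total; it is taken only where the
  density of \<open>hyp_area\<close> vanishes.\<close>

lemma distr_hyp_area_isometry:
  assumes fg: "isometry_pair f g"
  shows "distr hyp_area borel (\<lambda>z. if z \<in> UHP then g z else 0) = hyp_area"
proof (rule measure_eqI)
  note d = isometry_pairD[OF fg]
  let ?g = "\<lambda>z. if z \<in> UHP then g z else (0::complex)"
  note gm [measurable] = isometry_measurable[OF fg]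
  fix A assume "A \<in> sets (distr hyp_area borel ?g)"
  then have A [measurable]: "A \<in> sets borel" by simp
  define F where "F = (\<lambda>w. ennreal (indicator UHP w / (Im w)\<^sup>2) * indicator A (?g w))"
  have F [measurable]: "F \<in> borel_measurable borel"
    unfolding F_def by measurable
  have "emeasure (distr hyp_area borel ?g) A = (\<integral>\<^sup>+w. indicator A (?g w) \<partial>hyp_area)"
    by (subst nn_integral_distr[of ?g hyp_area borel "indicator A", symmetric])
      (auto simp: nn_integral_indicator)
  also have "\<dots> = (\<integral>\<^sup>+w. F w \<partial>lborel)"
    unfolding F_def by (rule nn_integral_hyp_area) measurable
  also have "\<dots> = (\<integral>\<^sup>+w\<in>f ` UHP. F w \<partial>lborel)"
    unfolding d(9) by (intro nn_integral_cong) (auto simp: F_def indicator_def)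
  also have "\<dots> = (\<integral>\<^sup>+z\<in>UHP. F (f z) * ennreal ((cmod (deriv f z))\<^sup>2) \<partial>lborel)"
    by (rule nn_integral_holomorphic_substitution[OF open_UHP d(7,13) F])
  also have "\<dots> = (\<integral>\<^sup>+z. ennreal (indicator UHP z / (Im z)\<^sup>2) * indicator A z \<partial>lborel)"
  proof (rule nn_integral_cong)
    fix z :: complex
    show "F (f z) * ennreal ((cmod (deriv f z))\<^sup>2) * indicator UHP z
        = ennreal (indicator UHP z / (Im z)\<^sup>2) * indicator A z"
    proof (cases "z \<in> UHP")
      case True
      note e = hyp_local_isometryD[OF d(1) open_UHP True]
      have "(1 / (Im (f z))\<^sup>2) * (cmod (deriv f z))\<^sup>2 = 1 / (Im z)\<^sup>2"
        using e(1,2,5) by (simp add: e(4)[symmetric] field_simps)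
      then have "ennreal (1 / (Im (f z))\<^sup>2) * ennreal ((cmod (deriv f z))\<^sup>2) = ennreal (1 / (Im z)\<^sup>2)"
        by (subst ennreal_mult[symmetric]) auto
      then show ?thesis
        using True d(4,5)[OF True] by (auto simp: F_def indicator_def ac_simps)
    qed simp
  qed
  also have "\<dots> = (\<integral>\<^sup>+w. indicator A w \<partial>hyp_area)"
    by (rule nn_integral_hyp_area[symmetric]) measurable
  finally show "emeasure (distr hyp_area borel ?g) A = emeasure hyp_area A"
    by (simp add: nn_integral_indicator)
qed simp

section \<open>Schur's test\<close>

lemma borel_measurable_cnj [measurable]: "cnj \<in> borel_measurable borel"
  by (intro borel_measurable_continuous_onI continuous_intros)

text \<open>Chosen to be integrable over the plane: it falls off like \<open>|w|^-4\<close> in two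
  real dimensions.\<close>

definition decay :: "complex \<Rightarrow> real" where
  "decay w = 1 / (1 + (cmod w)\<^sup>2)\<^sup>2"

lemma decay_nonneg: "0 \<le> decay w" and decay_minus: "decay (- w) = decay w"
  by (simp_all add: decay_def)

lemma decay_measurable [measurable]: "decay \<in> borel_measurable borel"
  unfolding decay_def[abs_def] by measurable

text \<open>Dyadic balls: the ball of radius \<open>2^k\<close> has area proportional to
  \<open>4^k\<close>, while outside the ball of half that radius the weight is at most
  \<open>16^-(k-1)\<close>. The factor 16 is this shift by one, and the sum is geometric with ratio
  1/4.\<close>

lemma nn_integral_decay_finite: "(\<integral>\<^sup>+w. ennreal (decay w) \<partial>lborel) < \<infinity>"
proof -
  have pt: "ennreal (decay w) \<le> (\<Sum>k. ennreal (16 * (1/16) ^ k) * indicator (cball 0 (2 ^ k)) w)" for w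
  proof -
    obtain k where k: "cmod w \<le> 2 ^ k" "k = 0 \<or> 2 ^ (k - 1) < cmod w"
    proof -
      have "\<exists>k. cmod w \<le> 2 ^ k" using real_arch_pow[of 2 "cmod w"] less_imp_le by fastforce
      then have "cmod w \<le> 2 ^ (LEAST k. cmod w \<le> 2 ^ k)" by (rule LeastI_ex)
      moreover have "(LEAST k. cmod w \<le> 2 ^ k) = 0 \<or> 2 ^ ((LEAST k. cmod w \<le> 2 ^ k) - 1) < cmod w"
        using not_less_Least[of "(LEAST k. cmod w \<le> 2 ^ k) - 1" "\<lambda>k. cmod w \<le> 2 ^ k"] by fastforce
      ultimately show ?thesis using that by blast
    qed
    have "decay w \<le> 16 * (1/16) ^ k"
    proof (cases k)
      case 0
      have "1 \<le> (1 + (cmod w)\<^sup>2)\<^sup>2" by (rule one_le_power) simp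
      then have "decay w \<le> 1" using frac_le[of 1 1 1 "(1 + (cmod w)\<^sup>2)\<^sup>2"] by (simp add: decay_def)
      then show ?thesis using 0 by simp
    next
      case (Suc m)
      then have m: "2 ^ m < cmod w" using k(2) by simp
      then have "(2 ^ m) ^ 4 \<le> (cmod w) ^ 4" by (intro power_mono) auto
      also have "(cmod w) ^ 4 = ((cmod w)\<^sup>2)\<^sup>2" by simp
      also have "\<dots> \<le> (1 + (cmod w)\<^sup>2)\<^sup>2" by (intro power_mono) auto
      finally have "((2::real) ^ m) ^ 4 \<le> (1 + (cmod w)\<^sup>2)\<^sup>2" .
      moreover have "((2::real) ^ m) ^ 4 = 16 ^ m" by (simp flip: power_mult add: mult.commute[of m] power_mult)
      ultimately have "decay w \<le> 1 / 16 ^ m" unfolding decay_def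
        by (intro divide_left_mono) (auto intro!: mult_pos_pos zero_less_power add_pos_nonneg)
      then show ?thesis using Suc by (simp add: power_divide)
    qed
    then have "ennreal (decay w) \<le> ennreal (16 * (1/16) ^ k)" by (rule ennreal_leI)
    moreover have "w \<in> cball 0 (2 ^ k)" using k(1) by simp
    ultimately have "ennreal (decay w) \<le> ennreal (16 * (1/16) ^ k) * indicator (cball 0 (2 ^ k)) w"
      by (simp only: indicator_simps mult_1_right)
    also have "\<dots> \<le> (\<Sum>k. ennreal (16 * (1/16) ^ k) * indicator (cball 0 (2 ^ k)) w)"
    proof -
      have "F k \<le> suminf F" for F :: "nat \<Rightarrow> ennreal" using sum_le_suminf[of F "{k}"] by simp
      then show ?thesis .
    qed
    finally show ?thesis .
  qed
  have "(\<integral>\<^sup>+w. ennreal (decay w) \<partial>lborel) \<le> (\<integral>\<^sup>+w. (\<Sum>k. ennreal (16 * (1/16) ^ k) * indicator (cball (0::complex) (2 ^ k)) w) \<partial>lborel)"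
    by (intro nn_integral_mono pt)
  also have "\<dots> = (\<Sum>k. \<integral>\<^sup>+w. ennreal (16 * (1/16) ^ k) * indicator (cball (0::complex) (2 ^ k)) w \<partial>lborel)"
    by (rule nn_integral_suminf) (intro borel_measurable_times_ennreal borel_measurable_const borel_measurable_indicator; simp)
  also have "\<dots> = (\<Sum>k. ennreal (16 * unit_ball_vol 2 * (1/4) ^ k))"
  proof (rule suminf_cong)
    fix k :: nat
    have "(\<integral>\<^sup>+w. ennreal (16 * (1/16) ^ k) * indicator (cball (0::complex) (2 ^ k)) w \<partial>lborel)
        = ennreal (16 * (1/16) ^ k) * emeasure lborel (cball (0::complex) (2 ^ k))"
      by (subst nn_integral_cmult_indicator) auto
    also have "\<dots> = ennreal (16 * (1/16) ^ k) * ennreal (unit_ball_vol 2 * (2 ^ k)\<^sup>2)"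
      by (subst emeasure_cball) auto
    also have "\<dots> = ennreal (16 * (1/16) ^ k * (unit_ball_vol 2 * (2 ^ k)\<^sup>2))"
      by (rule ennreal_mult[symmetric]) auto
    also have "((2::real) ^ k)\<^sup>2 = (2\<^sup>2) ^ k"
      by (simp only: power_mult[symmetric] mult.commute)
    also have "16 * (1/16) ^ k * (unit_ball_vol 2 * (2\<^sup>2) ^ k) = 16 * unit_ball_vol 2 * ((1/16 * 2\<^sup>2) ^ k :: real)"
      by (simp only: power_mult_distrib ac_simps)
    also have "(1/16 * 2\<^sup>2 :: real) = 1/4" by simp
    finally show "(\<integral>\<^sup>+w. ennreal (16 * (1/16) ^ k) * indicator (cball (0::complex) (2 ^ k)) w \<partial>lborel)
      = ennreal (16 * unit_ball_vol 2 * (1/4) ^ k)" .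
  qed
  also have "\<dots> = ennreal (\<Sum>k. 16 * unit_ball_vol 2 * (1/4) ^ k)"
    by (intro suminf_ennreal2 summable_mult summable_geometric) auto
  also have "\<dots> < \<infinity>" by simp
  finally show ?thesis .
qed

lemma nn_integral_decay_scaled:
  assumes "h > 0"
  shows "(\<integral>\<^sup>+q. ennreal (decay ((p - q) / of_real h)) \<partial>lborel) = ennreal (h\<^sup>2) * (\<integral>\<^sup>+w. ennreal (decay w) \<partial>lborel)"
proof -
  let ?f = "\<lambda>q. (p - q) / complex_of_real h"
  have surj: "?f ` UNIV = UNIV"
  proof -
    have "w = ?f (p - w * of_real h)" for w using assms by simp
    then show ?thesis by blast
  qed
  have inj: "inj ?f" using assms by (auto intro!: injI)
  have der: "deriv ?f = (\<lambda>_. - 1 / of_real h)"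
    by (rule ext, rule DERIV_imp_deriv) (use assms in \<open>auto intro!: derivative_eq_intros\<close>)
  have "(\<integral>\<^sup>+w\<in>?f ` UNIV. ennreal (decay w) \<partial>lborel)
      = (\<integral>\<^sup>+q\<in>UNIV. ennreal (decay (?f q)) * ennreal ((cmod (deriv ?f q))\<^sup>2) \<partial>lborel)"
    by (rule nn_integral_holomorphic_substitution)
      (use assms inj in \<open>auto intro!: holomorphic_intros\<close>)
  then have "(\<integral>\<^sup>+w. ennreal (decay w) \<partial>lborel) = (\<integral>\<^sup>+q. ennreal (decay (?f q)) * ennreal (1 / h\<^sup>2) \<partial>lborel)"
    unfolding surj der using assms by (simp add: norm_divide power_divide)
  also have "\<dots> = (\<integral>\<^sup>+q. ennreal (decay (?f q)) \<partial>lborel) * ennreal (1 / h\<^sup>2)"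
    by (rule nn_integral_multc) measurable
  finally have "ennreal (h\<^sup>2) * (\<integral>\<^sup>+w. ennreal (decay w) \<partial>lborel)
      = (\<integral>\<^sup>+q. ennreal (decay (?f q)) \<partial>lborel) * (ennreal (1 / h\<^sup>2) * ennreal (h\<^sup>2))"
    by (simp add: ac_simps)
  also have "ennreal (1 / h\<^sup>2) * ennreal (h\<^sup>2) = 1"
    using assms by (simp flip: ennreal_mult)
  finally show ?thesis by simp
qed

lemma compact_UHP_bounded_density:
  assumes "compact K" "K \<subseteq> UHP"
  obtains c where "c \<ge> 0" "\<And>z. z \<in> K \<Longrightarrow> 1 / (Im z)\<^sup>2 \<le> c"
proof -
  have "bounded ((\<lambda>z. 1 / (Im z)\<^sup>2) ` K)"
    using assms by (intro compact_imp_bounded compact_continuous_image continuous_intros) (auto simp: UHP_def)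
  then obtain c where "\<And>z. z \<in> K \<Longrightarrow> \<bar>1 / (Im z)\<^sup>2\<bar> \<le> c"
    unfolding bounded_iff by force
  then show ?thesis using that[of "\<bar>c\<bar>"] by force
qed

text \<open>The scaling Jacobian \<open>h^2\<close> cancels the prefactor \<open>h^-2\<close>, so
  the bound is uniform in \<open>h\<close> and in the centre \<open>p\<close>; \<open>c\<close>
  compares hyperbolic with Euclidean area on \<open>K\<close>.\<close>

lemma nn_integral_hyp_area_decay:
  assumes K: "K \<in> sets borel" "c \<ge> 0" "\<And>z. z \<in> K \<Longrightarrow> 1 / (Im z)\<^sup>2 \<le> c" and h: "h > 0" and e: "e \<ge> 0"
  shows "(\<integral>\<^sup>+q. ennreal (e / h\<^sup>2 * decay ((p - q) / of_real h)) * indicator K q \<partial>hyp_area)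
     \<le> ennreal (c * e) * (\<integral>\<^sup>+w. ennreal (decay w) \<partial>lborel)"
proof -
  note K(1) [measurable]
  have "(\<integral>\<^sup>+q. ennreal (e / h\<^sup>2 * decay ((p - q) / of_real h)) * indicator K q \<partial>hyp_area)
    = (\<integral>\<^sup>+q. ennreal (indicator UHP q / (Im q)\<^sup>2) * (ennreal (e / h\<^sup>2 * decay ((p - q) / of_real h)) * indicator K q) \<partial>lborel)"
    by (rule nn_integral_hyp_area) measurable
  also have "\<dots> \<le> (\<integral>\<^sup>+q. ennreal (c * (e / h\<^sup>2)) * ennreal (decay ((p - q) / of_real h)) \<partial>lborel)"
  proof (rule nn_integral_mono)
    fix q :: complex
    let ?d = "decay ((p - q) / of_real h)"
    show "ennreal (indicator UHP q / (Im q)\<^sup>2) * (ennreal (e / h\<^sup>2 * ?d) * indicator K q) \<le> ennreal (c * (e / h\<^sup>2)) * ennreal ?d"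
    proof (cases "q \<in> K")
      case True
      have "indicator UHP q / (Im q)\<^sup>2 \<le> c" using K(2) K(3)[OF True] by (auto simp: indicator_def)
      then have "ennreal (indicator UHP q / (Im q)\<^sup>2) * ennreal (e / h\<^sup>2 * ?d) \<le> ennreal c * ennreal (e / h\<^sup>2 * ?d)"
        by (intro mult_right_mono ennreal_leI) auto
      also have "\<dots> = ennreal (c * (e / h\<^sup>2)) * ennreal ?d"
        using K(2) e decay_nonneg[of "(p - q) / of_real h"] by (simp flip: ennreal_mult add: ac_simps)
      finally show ?thesis using True by simp
    qed simp
  qed
  also have "\<dots> = ennreal (c * (e / h\<^sup>2)) * (ennreal (h\<^sup>2) * (\<integral>\<^sup>+w. ennreal (decay w) \<partial>lborel))"
    by (subst nn_integral_cmult) (simp_all add: nn_integral_decay_scaled[OF h])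
  also have "\<dots> = ennreal (c * (e / h\<^sup>2) * h\<^sup>2) * (\<integral>\<^sup>+w. ennreal (decay w) \<partial>lborel)"
    using K(2) e by (subst ennreal_mult[of "c * (e / h\<^sup>2)" "h\<^sup>2"]) (auto simp: mult.assoc)
  also have "c * (e / h\<^sup>2) * h\<^sup>2 = c * e" using h by simp
  finally show ?thesis .
qed

definition quad_form :: "(complex \<Rightarrow> complex \<Rightarrow> complex) \<Rightarrow> (complex \<Rightarrow> complex) \<Rightarrow> complex" where
  "quad_form D v = (\<integral>z. D (fst z) (snd z) * v (snd z) * cnj (v (fst z)) \<partial>(hyp_area \<Otimes>\<^sub>M hyp_area))"

text \<open>The constant in Schur's test for kernels dominated by a multiple of
  \<open>h\<^sup>-\<^sup>2 decay ((p - q) / h)\<close> depends neither on \<open>h\<close> nor on the function tested.\<close>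

definition schur_bound :: "complex set \<Rightarrow> real \<Rightarrow> bool" where
  "schur_bound K M \<longleftrightarrow> M \<ge> 0 \<and> (\<forall>D h e v C. h > 0 \<longrightarrow> e \<ge> 0 \<longrightarrow> C \<ge> 0 \<longrightarrow>
    (\<lambda>z. D (fst z) (snd z)) \<in> borel_measurable (borel \<Otimes>\<^sub>M borel) \<longrightarrow>
    (\<forall>p q. D p q \<noteq> 0 \<longrightarrow> p \<in> K \<and> q \<in> K) \<longrightarrow>
    (\<forall>p\<in>K. \<forall>q\<in>K. cmod (D p q) \<le> e / h\<^sup>2 * decay ((p - q) / of_real h)) \<longrightarrow>
    v \<in> borel_measurable borel \<longrightarrow> (\<integral>\<^sup>+z\<in>K. ennreal ((cmod (v z))\<^sup>2) \<partial>hyp_area) \<le> ennreal C \<longrightarrow>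
    integrable (hyp_area \<Otimes>\<^sub>M hyp_area) (\<lambda>z. D (fst z) (snd z) * v (snd z) * cnj (v (fst z))) \<and>
    cmod (quad_form D v) \<le> M * e * C)"

text \<open>From \<open>|v(p) v(q)| \<le> |v(p)|^2 + |v(q)|^2\<close> two terms arise, and in each
  the kernel integrated over the free variable is at most \<open>c e I\<close>. This gives the
  constant \<open>2 c I\<close>.\<close>

lemma schur_test:
  assumes K: "compact K" "K \<subseteq> UHP"
  shows "\<exists>M. schur_bound K M"
proof -
  obtain c where c: "c \<ge> 0" "\<And>z. z \<in> K \<Longrightarrow> 1 / (Im z)\<^sup>2 \<le> c"
    using compact_UHP_bounded_density[OF K] by blast
  have K_borel [measurable]: "K \<in> sets borel" using K(1) by (simp add: borel_compact)
  obtain I where I: "I \<ge> 0" "(\<integral>\<^sup>+w. ennreal (decay w) \<partial>lborel) = ennreal I"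
    using nn_integral_decay_finite by (metis ennreal_cases less_irrefl top_neq_ennreal infinity_ennreal_def)
  {
    fix D :: "complex \<Rightarrow> complex \<Rightarrow> complex" and h e C :: real and v :: "complex \<Rightarrow> complex"
    assume h: "h > 0" and e: "e \<ge> 0" and C: "C \<ge> 0"
      and D [measurable]: "(\<lambda>z. D (fst z) (snd z)) \<in> borel_measurable (borel \<Otimes>\<^sub>M borel)"
      and D0: "\<forall>p q. D p q \<noteq> 0 \<longrightarrow> p \<in> K \<and> q \<in> K"
      and De': "\<forall>p\<in>K. \<forall>q\<in>K. cmod (D p q) \<le> e / h\<^sup>2 * decay ((p - q) / of_real h)"
      and v [measurable]: "v \<in> borel_measurable borel"
      and vC: "(\<integral>\<^sup>+z\<in>K. ennreal ((cmod (v z))\<^sup>2) \<partial>hyp_area) \<le> ennreal C"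
    note De = De'[rule_format]
    let ?m = "hyp_area \<Otimes>\<^sub>M hyp_area"
    let ?f = "\<lambda>z. D (fst z) (snd z) * v (snd z) * cnj (v (fst z))"
    define V where "V = (\<lambda>z. ennreal ((cmod (v z))\<^sup>2) * indicator K z)"
    define k where "k = (\<lambda>p q. ennreal (e / h\<^sup>2 * decay ((p - q) / of_real h)) * indicator K q)"
    have V [measurable]: "V \<in> borel_measurable borel" unfolding V_def by measurable
    have kV: "(\<integral>\<^sup>+p. \<integral>\<^sup>+q. k p q * V p \<partial>hyp_area \<partial>hyp_area) \<le> ennreal (c * e * I * C)"
    proof -
      have "(\<integral>\<^sup>+p. \<integral>\<^sup>+q. k p q * V p \<partial>hyp_area \<partial>hyp_area) = (\<integral>\<^sup>+p. (\<integral>\<^sup>+q. k p q \<partial>hyp_area) * V p \<partial>hyp_area)"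
        unfolding k_def by (intro nn_integral_cong nn_integral_multc) measurable
      also have "\<dots> \<le> (\<integral>\<^sup>+p. ennreal (c * e) * ennreal I * V p \<partial>hyp_area)"
        unfolding k_def I(2)[symmetric]
        by (intro nn_integral_mono mult_right_mono nn_integral_hyp_area_decay c h e K_borel) auto
      also have "\<dots> = ennreal (c * e) * ennreal I * (\<integral>\<^sup>+p. V p \<partial>hyp_area)"
        by (rule nn_integral_cmult) measurable
      also have "\<dots> \<le> ennreal (c * e) * ennreal I * ennreal C"
        using vC unfolding V_def by (intro mult_left_mono) auto
      also have "\<dots> = ennreal (c * e * I * C)"
        using c e I C by (simp add: ennreal_mult)
      finally show ?thesis .
    qed
    have dist_ennreal: "ennreal (d * (x + y)) = ennreal d * ennreal x + ennreal d * ennreal y"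
      if "d \<ge> 0" "x \<ge> 0" "y \<ge> 0" for d x y
      using that by (simp only: ennreal_plus[symmetric] ennreal_mult[symmetric] mult_nonneg_nonneg distrib_left)
    have bound: "ennreal (cmod (?f z)) \<le> k (fst z) (snd z) * V (fst z) + k (snd z) (fst z) * V (snd z)" for z
    proof (cases "D (fst z) (snd z) = 0")
      case False
      then have z: "fst z \<in> K" "snd z \<in> K" using D0 by auto
      let ?d = "e / h\<^sup>2 * decay ((fst z - snd z) / of_real h)"
      have sym: "decay ((snd z - fst z) / of_real h) = decay ((fst z - snd z) / of_real h)"
        using decay_minus[of "(fst z - snd z) / of_real h"] by (simp add: minus_divide_left)
      have d0: "?d \<ge> 0" using e decay_nonneg by simp
      have vv: "cmod (v (snd z)) * cmod (v (fst z)) \<le> (cmod (v (fst z)))\<^sup>2 + (cmod (v (snd z)))\<^sup>2"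
        using sum_squares_bound[of "cmod (v (fst z))" "cmod (v (snd z))"] mult_nonneg_nonneg[OF norm_ge_zero[of "v (fst z)"] norm_ge_zero[of "v (snd z)"]]
        by (simp only: mult.commute[of "cmod (v (snd z))"])
      have "cmod (D (fst z) (snd z)) * (cmod (v (snd z)) * cmod (v (fst z)))
          \<le> ?d * ((cmod (v (fst z)))\<^sup>2 + (cmod (v (snd z)))\<^sup>2)"
        by (rule mult_mono[OF De[OF z] vv d0]) simp
      then have "ennreal (cmod (?f z)) \<le> ennreal (?d * ((cmod (v (fst z)))\<^sup>2 + (cmod (v (snd z)))\<^sup>2))"
        by (intro ennreal_leI) (simp only: norm_mult complex_mod_cnj mult.assoc)
      also have "\<dots> = ennreal ?d * ennreal ((cmod (v (fst z)))\<^sup>2) + ennreal ?d * ennreal ((cmod (v (snd z)))\<^sup>2)"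
        using d0 by (intro dist_ennreal) simp_all
      finally show ?thesis using z by (simp add: k_def V_def sym)
    qed simp
    have km [measurable]: "(\<lambda>z. k (fst z) (snd z)) \<in> borel_measurable (borel \<Otimes>\<^sub>M borel)"
      "(\<lambda>z. k (snd z) (fst z)) \<in> borel_measurable (borel \<Otimes>\<^sub>M borel)"
      unfolding k_def by measurable
    have "(\<integral>\<^sup>+z. ennreal (cmod (?f z)) \<partial>?m) \<le> (\<integral>\<^sup>+z. k (fst z) (snd z) * V (fst z) + k (snd z) (fst z) * V (snd z) \<partial>?m)"
      by (intro nn_integral_mono bound)
    also have "\<dots> = (\<integral>\<^sup>+z. k (fst z) (snd z) * V (fst z) \<partial>?m) + (\<integral>\<^sup>+z. k (snd z) (fst z) * V (snd z) \<partial>?m)"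
      by (rule nn_integral_add) measurable
    also have "(\<integral>\<^sup>+z. k (fst z) (snd z) * V (fst z) \<partial>?m) = (\<integral>\<^sup>+p. \<integral>\<^sup>+q. k p q * V p \<partial>hyp_area \<partial>hyp_area)"
      by (subst sigma_finite_measure.nn_integral_fst[OF sigma_finite_hyp_area, symmetric]) simp_all
    also have "(\<integral>\<^sup>+z. k (snd z) (fst z) * V (snd z) \<partial>?m) = (\<integral>\<^sup>+q. \<integral>\<^sup>+p. k q p * V q \<partial>hyp_area \<partial>hyp_area)"
      by (subst hyp_pair.nn_integral_snd[symmetric]) (simp_all add: split_beta')
    finally have tot: "(\<integral>\<^sup>+z. ennreal (cmod (?f z)) \<partial>?m) \<le> ennreal (c * e * I * C) + ennreal (c * e * I * C)"
      using kV by (meson add_mono order_trans)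
    also have "\<dots> = ennreal (2 * c * I * e * C)"
      using c e I C by (simp flip: ennreal_plus)
    finally have tot: "(\<integral>\<^sup>+z. ennreal (cmod (?f z)) \<partial>?m) \<le> ennreal (2 * c * I * e * C)" .
    have int: "integrable ?m ?f"
    proof (rule integrableI_bounded)
      show "?f \<in> borel_measurable ?m" by measurable
      show "(\<integral>\<^sup>+z. ennreal (cmod (?f z)) \<partial>?m) < \<infinity>"
        using tot by (rule le_less_trans) simp
    qed
    have "cmod (quad_form D v) \<le> (\<integral>z. cmod (?f z) \<partial>?m)"
      unfolding quad_form_def by (rule integral_norm_bound)
    also have "\<dots> \<le> 2 * c * I * e * C"
    proof -
      have "ennreal (\<integral>z. cmod (?f z) \<partial>?m) = (\<integral>\<^sup>+z. ennreal (cmod (?f z)) \<partial>?m)"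
        by (rule nn_integral_eq_integral[symmetric]) (use int in auto)
      also note tot
      finally have *: "ennreal (\<integral>z. cmod (?f z) \<partial>?m) \<le> ennreal (2 * c * I * e * C)" .
      have "0 \<le> 2 * c * I * e * C" using c(1) e I(1) C by (intro mult_nonneg_nonneg) simp_all
      then show ?thesis using * by (simp only: ennreal_le_iff)
    qed
    finally have "integrable ?m ?f \<and> cmod (quad_form D v) \<le> 2 * c * I * e * C" using int by blast
  }
  note main = this
  have "0 \<le> 2 * c * I" using c I by simp
  then show ?thesis
    unfolding schur_bound_def
    by - (rule exI[of _ "2 * c * I"], rule conjI, assumption, intro allI impI, (rule main; assumption))
qed

lemma schur_boundD:
  assumes "schur_bound K M" "h > 0" "e \<ge> 0" "C \<ge> 0"
    and "(\<lambda>z. D (fst z) (snd z)) \<in> borel_measurable (borel \<Otimes>\<^sub>M borel)"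
    and "\<And>p q. D p q \<noteq> 0 \<Longrightarrow> p \<in> K \<and> q \<in> K"
    and "\<And>p q. p \<in> K \<Longrightarrow> q \<in> K \<Longrightarrow> cmod (D p q) \<le> e / h\<^sup>2 * decay ((p - q) / of_real h)"
    and "v \<in> borel_measurable borel" "(\<integral>\<^sup>+z\<in>K. ennreal ((cmod (v z))\<^sup>2) \<partial>hyp_area) \<le> ennreal C"
  shows "integrable (hyp_area \<Otimes>\<^sub>M hyp_area) (\<lambda>z. D (fst z) (snd z) * v (snd z) * cnj (v (fst z)))"
    and "cmod (quad_form D v) \<le> M * e * C"
proof -
  have "\<forall>p q. D p q \<noteq> 0 \<longrightarrow> p \<in> K \<and> q \<in> K"
    "\<forall>p\<in>K. \<forall>q\<in>K. cmod (D p q) \<le> e / h\<^sup>2 * decay ((p - q) / of_real h)"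
    using assms(6,7) by blast+
  then show "integrable (hyp_area \<Otimes>\<^sub>M hyp_area) (\<lambda>z. D (fst z) (snd z) * v (snd z) * cnj (v (fst z)))"
    "cmod (quad_form D v) \<le> M * e * C"
    using assms unfolding schur_bound_def by blast+
qed

section \<open>Test functions\<close>

lemma test_function_continuous: "test_function V a \<Longrightarrow> continuous_on UNIV a"
  unfolding test_function_def smooth_on_def by (metis Ck_on.simps(1))

lemma test_function_measurable: "test_function V a \<Longrightarrow> a \<in> borel_measurable borel"
  by (intro borel_measurable_continuous_onI test_function_continuous)

lemma supp_memI: "f x \<noteq> 0 \<Longrightarrow> x \<in> supp f"
  unfolding supp_def by (rule subsetD[OF closure_subset]) simp

lemma test_function_bounded:
  fixes a :: "'a::real_normed_vector \<Rightarrow> 'b::real_normed_vector"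
  assumes "test_function V a"
  obtains M where "M \<ge> 0" "\<And>p. norm (a p) \<le> M"
proof -
  have "bounded (a ` supp a)"
    using assms test_function_continuous[OF assms]
    by (intro compact_imp_bounded compact_continuous_image)
      (auto simp: test_function_def intro: continuous_on_subset)
  then obtain M where M: "\<And>p. p \<in> supp a \<Longrightarrow> norm (a p) \<le> M"
    unfolding bounded_iff by blast
  have "norm (a p) \<le> max M 0" for p
    using M[of p] supp_memI[of a p] by (cases "a p = 0") auto
  then show ?thesis using that[of "max M 0"] by simp
qed

lemma test_function_frechet:
  assumes "test_function V a"
  shows "test_function V (\<lambda>p. frechet_derivative a (at p) v)"
proof -
  let ?D = "\<lambda>p. frechet_derivative a (at p) v"
  have "?D p = 0" if "p \<notin> supp a" for p
  proof -
    have "(a has_derivative (\<lambda>_. 0)) (at p)"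
    proof (rule has_derivative_transform_within_open[OF has_derivative_const])
      show "open (- supp a)" unfolding supp_def by (rule open_Compl[OF closed_closure])
      show "p \<in> - supp a" using that by simp
      show "0 = a x" if "x \<in> - supp a" for x using that supp_memI[of a x] by auto
    qed
    then show ?thesis by (simp add: frechet_derivative_at[symmetric])
  qed
  then have sub: "supp ?D \<subseteq> supp a"
    unfolding supp_def[of ?D] by (intro closure_minimal) (auto simp: supp_def)
  have "compact (supp a \<inter> supp ?D)"
    using assms by (intro compact_Int_closed) (auto simp: test_function_def supp_def)
  then have "compact (supp ?D)" using sub by (simp add: Int_absorb1)
  then show ?thesis
    using assms sub smooth_on_frechet unfolding test_function_def by blast
qed

lemma test_function_diff:
  fixes a b :: "'a::real_normed_vector \<Rightarrow> 'b::real_normed_vector"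
  assumes "test_function V a" "test_function V b"
  shows "test_function V (\<lambda>p. a p - b p)"
proof -
  let ?d = "\<lambda>p. a p - b p"
  have sub: "supp ?d \<subseteq> supp a \<union> supp b"
    unfolding supp_def[of ?d]
    by (intro closure_minimal closed_Un) (use supp_memI[of a] supp_memI[of b] in \<open>force simp: supp_def\<close>)+
  have "compact (supp a \<union> supp b)" using assms by (auto simp: test_function_def)
  then have "compact ((supp a \<union> supp b) \<inter> supp ?d)"
    by (intro compact_Int_closed) (auto simp: supp_def)
  then have "compact (supp ?d)" using sub by (simp add: Int_absorb1)
  moreover have "smooth_on UNIV ?d"
    using assms unfolding test_function_def smooth_on_def by (auto intro: Ck_on_diff)
  ultimately show ?thesis
    using assms sub unfolding test_function_def by blast
qed

lemma smooth_on_has_derivative: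
  "smooth_on UNIV a \<Longrightarrow> (a has_derivative frechet_derivative a (at p)) (at p)"
  using Ck_on_SucD(1)[of 0 UNIV a p] smooth_onD by blast

text \<open>A mean value bound, uniform in \<open>p\<close>; it dominates the difference quotients
  in \<open>FT_frechet\<close>.\<close>

lemma test_function_line_bound:
  fixes a :: "'a::real_normed_vector \<Rightarrow> 'b::real_normed_vector"
  assumes a: "test_function V a" and M: "\<And>p. norm (frechet_derivative a (at p) e) \<le> M" and t: "t \<ge> 0"
  shows "norm (a (p + t *\<^sub>R e) - a p) \<le> M * t"
proof -
  have s: "smooth_on UNIV a" using a by (simp add: test_function_def)
  let ?f = "\<lambda>s::real. a (p + s *\<^sub>R e)"
  let ?D = "\<lambda>s. frechet_derivative a (at (p + s *\<^sub>R e))"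
  have "(?f has_derivative (\<lambda>r. r *\<^sub>R ?D s e)) (at s within {0..t})" for s
  proof -
    have "((\<lambda>s. p + s *\<^sub>R e) has_derivative (\<lambda>r. r *\<^sub>R e)) (at s within {0..t})"
      by (auto intro!: derivative_eq_intros)
    from has_derivative_compose[OF this smooth_on_has_derivative[OF s]]
    have "(?f has_derivative (\<lambda>r. ?D s (r *\<^sub>R e))) (at s within {0..t})" .
    moreover have "?D s (r *\<^sub>R e) = r *\<^sub>R ?D s e" for r
      using has_derivative_linear[OF smooth_on_has_derivative[OF s]] by (simp add: linear_scale)
    ultimately show ?thesis by simp
  qed
  then have der: "(?f has_derivative (\<lambda>r. r *\<^sub>R ?D s e)) (at s within {0..t})" if "s \<in> {0..t}" for s
    by blast
  have "norm (?f t - ?f 0) \<le> M * norm (t - 0)"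
  proof (rule differentiable_bound[OF _ der])
    fix s assume "s \<in> {0..t}"
    have "norm (r *\<^sub>R ?D s e) \<le> M * norm r" for r
      using mult_right_mono[OF M[of "p + s *\<^sub>R e"], of "\<bar>r\<bar>"] by (simp add: mult.commute)
    then show "onorm (\<lambda>r. r *\<^sub>R ?D s e) \<le> M" by (intro onorm_le)
  qed (use t in auto)
  then show ?thesis using t by simp
qed

section \<open>The Fourier transform in the fibre variable\<close>

text \<open>Normalised by \<open>(2 pi)^-2\<close> so that \<open>Op_plane h a\<close> has the
  kernel \<open>h^-2 FT a q ((q - q') / h)\<close>.\<close>

definition FT :: "(complex \<times> complex \<Rightarrow> complex) \<Rightarrow> complex \<Rightarrow> complex \<Rightarrow> complex" where
  "FT a q w = (\<integral>\<xi>. exp (\<i> * of_real (w \<bullet> \<xi>)) * a (q, \<xi>) \<partial>lborel) / of_real ((2 * pi)\<^sup>2)"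

text \<open>Factor out one exponential; what remains is
  \<open>|exp (i t) - 1| = 2 |sin (t / 2)|\<close>.\<close>

lemma norm_exp_i_diff_le: "cmod (exp (\<i> * of_real x) - exp (\<i> * of_real y)) \<le> \<bar>x - y\<bar>"
proof -
  have "exp (\<i> * of_real x) - exp (\<i> * of_real y) = exp (\<i> * of_real y) * (exp (\<i> * of_real (x - y)) - 1)"
    by (simp add: right_diff_distrib algebra_simps flip: exp_add)
  then have "cmod (exp (\<i> * of_real x) - exp (\<i> * of_real y)) = cmod (exp (\<i> * of_real (x - y)) - 1)"
    by (simp add: norm_mult)
  also have "\<dots> \<le> \<bar>x - y\<bar>"
  proof (rule power2_le_imp_le)
    let ?t = "x - y"
    have "(cmod (exp (\<i> * of_real ?t) - 1))\<^sup>2 = (cos ?t - 1)\<^sup>2 + (sin ?t)\<^sup>2"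
      by (simp add: cmod_power2 Re_exp Im_exp)
    also have "\<dots> = 2 - 2 * cos ?t" using sin_cos_squared_add[of ?t] by (simp add: power2_eq_square algebra_simps)
    also have "\<dots> = (2 * sin (?t / 2))\<^sup>2"
    proof -
      have "2 * (?t / 2) = ?t" by simp
      then have "cos ?t = 1 - 2 * (sin (?t / 2))\<^sup>2" using cos_double_sin[of "?t / 2"] by metis
      then show ?thesis by (simp only: power_mult_distrib) simp
    qed
    also have "\<dots> \<le> \<bar>?t\<bar>\<^sup>2"
    proof -
      have "\<bar>2 * sin (?t / 2)\<bar> \<le> \<bar>?t\<bar>" using abs_sin_x_le_abs_x[of "?t / 2"] by simp
      then show ?thesis by (metis abs_le_square_iff abs_abs power2_abs)
    qed
    finally show "(cmod (exp (\<i> * of_real ?t) - 1))\<^sup>2 \<le> \<bar>?t\<bar>\<^sup>2" .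
  qed simp
  finally show ?thesis .
qed

locale symbol =
  fixes a :: "complex \<times> complex \<Rightarrow> complex"
  assumes test: "test_function (UHP \<times> UNIV) a"
begin

definition base where "base = fst ` supp a"

lemma compact_base: "compact base" and base_UHP: "base \<subseteq> UHP"
  and base_memI: "a (q, \<xi>) \<noteq> 0 \<Longrightarrow> q \<in> base"
proof -
  show "compact base"
    unfolding base_def using test by (intro compact_continuous_image continuous_on_fst) (auto simp: test_function_def)
  show "base \<subseteq> UHP"
    using test by (auto simp: base_def test_function_def)
  show "q \<in> base" if "a (q, \<xi>) \<noteq> 0"
    unfolding base_def using supp_memI[of a, OF that] by force
qed

lemma FT_zero: "q \<notin> base \<Longrightarrow> FT a q w = 0"
proof -
  assume "q \<notin> base"
  then have "a (q, \<xi>) = 0" for \<xi> using base_memI by blast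
  then show ?thesis by (simp add: FT_def)
qed

lemma fibre_bounds:
  obtains R M where "R > 0" "M \<ge> 0" "\<And>p. cmod (a p) \<le> M" "\<And>q \<xi>. a (q, \<xi>) \<noteq> 0 \<Longrightarrow> cmod \<xi> \<le> R"
proof -
  obtain M where M: "M \<ge> 0" "\<And>p. norm (a p) \<le> M" using test_function_bounded[OF test] by blast
  have "bounded (snd ` supp a)"
    using test by (intro compact_imp_bounded compact_continuous_image continuous_on_snd) (auto simp: test_function_def)
  then obtain R where R: "R > 0" "\<And>p. p \<in> supp a \<Longrightarrow> norm (snd p) \<le> R"
    unfolding bounded_pos by auto
  have "cmod \<xi> \<le> R" if "a (q, \<xi>) \<noteq> 0" for q \<xi>
    using R(2)[OF supp_memI[of a, OF that]] by simp
  then show ?thesis using that M R(1) by blast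
qed

lemma measurable_a [measurable]: "a \<in> borel_measurable (borel \<Otimes>\<^sub>M borel)"
  using test_function_measurable[OF test] by (simp add: borel_prod)

lemma integrable_fibre: "integrable lborel (\<lambda>\<xi>. exp (\<i> * of_real (w \<bullet> \<xi>)) * a (q, \<xi>))"
proof -
  obtain R M where RM: "R > 0" "M \<ge> 0" "\<And>p. cmod (a p) \<le> M" "\<And>q \<xi>. a (q, \<xi>) \<noteq> 0 \<Longrightarrow> cmod \<xi> \<le> R"
    using fibre_bounds by blast
  show ?thesis
  proof (rule integrableI_bounded_set[where A = "cball 0 R" and B = M])
    show "(\<lambda>\<xi>. exp (\<i> * of_real (w \<bullet> \<xi>)) * a (q, \<xi>)) \<in> borel_measurable lborel"
      by measurable
    show "emeasure lborel (cball (0::complex) R) < \<infinity>"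
      by (rule emeasure_bounded_finite) simp
    show "AE \<xi> in lborel. \<xi> \<in> cball 0 R \<longrightarrow> norm (exp (\<i> * of_real (w \<bullet> \<xi>)) * a (q, \<xi>)) \<le> M"
      using RM(3) by (auto simp: norm_mult)
    show "AE \<xi> in lborel. \<xi> \<notin> cball 0 R \<longrightarrow> exp (\<i> * of_real (w \<bullet> \<xi>)) * a (q, \<xi>) = 0"
      using RM(4) by (intro AE_I2 impI) (simp, metis)
  qed simp
qed

lemma integrable_fibre_norm: "integrable lborel (\<lambda>\<xi>. a (q, \<xi>))"
  using integrable_fibre[of 0 q] by simp

lemma integral_norm_fibre_bound: obtains C where "C \<ge> 0" "\<And>q. (\<integral>\<xi>. cmod (a (q, \<xi>)) \<partial>lborel) \<le> C"
proof -
  obtain R M where RM: "R > 0" "M \<ge> 0" "\<And>p. cmod (a p) \<le> M" "\<And>q \<xi>. a (q, \<xi>) \<noteq> 0 \<Longrightarrow> cmod \<xi> \<le> R"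
    using fibre_bounds by blast
  have int: "integrable lborel (\<lambda>\<xi>. M * indicator (cball (0::complex) R) \<xi>)"
    by (intro integrable_mult_right integrable_real_indicator emeasure_bounded_finite) auto
  have "(\<integral>\<xi>. cmod (a (q, \<xi>)) \<partial>lborel) \<le> (\<integral>\<xi>. M * indicator (cball (0::complex) R) \<xi> \<partial>lborel)" for q
  proof (rule Bochner_Integration.integral_mono[OF integrable_norm[OF integrable_fibre_norm] int])
    show "cmod (a (q, \<xi>)) \<le> M * indicator (cball 0 R) \<xi>" for \<xi>
      using RM(3)[of "(q, \<xi>)"] RM(4)[of q \<xi>] by (cases "a (q, \<xi>) = 0") (auto simp: indicator_def RM(2))
  qed
  moreover have "(\<integral>\<xi>. M * indicator (cball (0::complex) R) \<xi> \<partial>lborel) \<ge> 0"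
    using RM(2) by (intro integral_nonneg_AE) auto
  ultimately show ?thesis using that by blast
qed

lemma FT_bounded: obtains C where "C \<ge> 0" "\<And>q w. cmod (FT a q w) \<le> C"
proof -
  obtain C where C: "C \<ge> 0" "\<And>q. (\<integral>\<xi>. cmod (a (q, \<xi>)) \<partial>lborel) \<le> C" using integral_norm_fibre_bound by blast
  have "cmod (FT a q w) \<le> C / (2 * pi)\<^sup>2" for q w
  proof -
    have "cmod (\<integral>\<xi>. exp (\<i> * of_real (w \<bullet> \<xi>)) * a (q, \<xi>) \<partial>lborel) \<le> (\<integral>\<xi>. cmod (exp (\<i> * of_real (w \<bullet> \<xi>)) * a (q, \<xi>)) \<partial>lborel)"
      by (rule integral_norm_bound)
    also have "\<dots> = (\<integral>\<xi>. cmod (a (q, \<xi>)) \<partial>lborel)" by (simp add: norm_mult)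
    also have "\<dots> \<le> C" by (rule C(2))
    finally show ?thesis by (simp add: FT_def norm_divide norm_power norm_mult divide_right_mono)
  qed
  then show ?thesis using that[of "C / (2 * pi)\<^sup>2"] C(1) by simp
qed

text \<open>The fibre variable stays in a ball of radius \<open>R\<close>, on which the exponential
  is \<open>R\<close>-Lipschitz in \<open>w\<close>.\<close>

lemma FT_Lipschitz: obtains C where "C \<ge> 0" "\<And>q w w'. cmod (FT a q w - FT a q w') \<le> C * cmod (w - w')"
proof -
  obtain R M where RM: "R > 0" "M \<ge> 0" "\<And>p. cmod (a p) \<le> M" "\<And>q \<xi>. a (q, \<xi>) \<noteq> 0 \<Longrightarrow> cmod \<xi> \<le> R"
    using fibre_bounds by blast
  obtain C where C: "C \<ge> 0" "\<And>q. (\<integral>\<xi>. cmod (a (q, \<xi>)) \<partial>lborel) \<le> C" using integral_norm_fibre_bound by blast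
  have "cmod (FT a q w - FT a q w') \<le> R * C / (2 * pi)\<^sup>2 * cmod (w - w')" for q w w'
  proof -
    let ?e = "\<lambda>w \<xi>. exp (\<i> * complex_of_real (w \<bullet> \<xi>))"
    let ?I = "\<integral>\<xi>. (?e w \<xi> - ?e w' \<xi>) * a (q, \<xi>) \<partial>lborel"
    have eq: "FT a q w - FT a q w' = ?I / of_real ((2 * pi)\<^sup>2)"
      using integrable_fibre[of w q] integrable_fibre[of w' q]
      by (simp add: FT_def diff_divide_distrib[symmetric] left_diff_distrib)
    have int: "integrable lborel (\<lambda>\<xi>. (?e w \<xi> - ?e w' \<xi>) * a (q, \<xi>))"
      unfolding left_diff_distrib by (intro Bochner_Integration.integrable_diff integrable_fibre)
    have "cmod ?I \<le> (\<integral>\<xi>. cmod ((?e w \<xi> - ?e w' \<xi>) * a (q, \<xi>)) \<partial>lborel)"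
      by (rule integral_norm_bound)
    also have "\<dots> \<le> (\<integral>\<xi>. cmod (w - w') * R * cmod (a (q, \<xi>)) \<partial>lborel)"
    proof (rule Bochner_Integration.integral_mono)
      show "integrable lborel (\<lambda>\<xi>. cmod ((?e w \<xi> - ?e w' \<xi>) * a (q, \<xi>)))"
        by (rule integrable_norm[OF int])
      show "integrable lborel (\<lambda>\<xi>. cmod (w - w') * R * cmod (a (q, \<xi>)))"
        by (intro integrable_mult_right integrable_norm integrable_fibre_norm)
      fix \<xi>
      show "cmod ((?e w \<xi> - ?e w' \<xi>) * a (q, \<xi>)) \<le> cmod (w - w') * R * cmod (a (q, \<xi>))"
      proof (cases "a (q, \<xi>) = 0")
        case False
        have "cmod (?e w \<xi> - ?e w' \<xi>) \<le> \<bar>w \<bullet> \<xi> - w' \<bullet> \<xi>\<bar>" by (rule norm_exp_i_diff_le)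
        also have "\<dots> = \<bar>(w - w') \<bullet> \<xi>\<bar>" by (simp add: inner_diff_left)
        also have "\<dots> \<le> cmod (w - w') * cmod \<xi>" by (rule Cauchy_Schwarz_ineq2)
        also have "\<dots> \<le> cmod (w - w') * R" using RM(4)[OF False] by (rule mult_left_mono) simp
        finally show ?thesis unfolding norm_mult by (rule mult_right_mono) simp
      qed simp
    qed
    also have "\<dots> = cmod (w - w') * R * (\<integral>\<xi>. cmod (a (q, \<xi>)) \<partial>lborel)" by simp
    also have "\<dots> \<le> cmod (w - w') * R * C" using C(2)[of q] RM(1) by (intro mult_left_mono) auto
    finally have "cmod ?I \<le> cmod (w - w') * R * C" .
    then show ?thesis unfolding eq
      by (simp add: norm_divide norm_power norm_mult divide_right_mono ac_simps)
  qed
  then show ?thesis using that[of "R * C / (2 * pi)\<^sup>2"] C(1) RM(1) by simp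
qed

lemma FT_measurable [measurable]: "(\<lambda>z. FT a (fst z) (snd z)) \<in> borel_measurable (borel \<Otimes>\<^sub>M borel)"
proof -
  have "(\<lambda>z. \<integral>\<xi>. exp (\<i> * of_real (snd z \<bullet> \<xi>)) * a (fst z, \<xi>) \<partial>lborel) \<in> borel_measurable (borel \<Otimes>\<^sub>M borel)"
    by (rule lborel.borel_measurable_lebesgue_integral) measurable
  then show ?thesis unfolding FT_def by measurable
qed

lemma symbol_frechet: "symbol (\<lambda>p. frechet_derivative a (at p) v)"
  using test_function_frechet[OF test] by (rule symbol.intro)

text \<open>Integration by parts through difference quotients: translation invariance of Lebesgue
  measure evaluates their integrals exactly, and dominated convergence identifies the limit with the
  transform of the derivative.\<close>

lemma FT_frechet:
  "FT (\<lambda>p. frechet_derivative a (at p) (0, e)) q w = - \<i> * of_real (w \<bullet> e) * FT a q w"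
proof -
  let ?D = "\<lambda>p. frechet_derivative a (at p) (0, e)"
  interpret D: symbol ?D by (rule symbol_frechet)
  obtain R M where RM: "R > 0" "M \<ge> 0" "\<And>p. cmod (a p) \<le> M" "\<And>q \<xi>. a (q, \<xi>) \<noteq> 0 \<Longrightarrow> cmod \<xi> \<le> R"
    using fibre_bounds by blast
  obtain B where B: "B \<ge> 0" "\<And>p. cmod (?D p) \<le> B" using test_function_bounded[OF D.test] by blast
  let ?E = "\<lambda>\<xi>. exp (\<i> * complex_of_real (w \<bullet> \<xi>))"
  \<comment> \<open>Steps of length at most 1 keep every translated support in the ball of radius
    \<open>R + |e|\<close> used by the dominating function.\<close>
  let ?t = "\<lambda>n. 1 / real (Suc n)"
  let ?s = "\<lambda>n \<xi>. of_real (real (Suc n)) * (?E \<xi> * (a (q, \<xi> + ?t n *\<^sub>R e) - a (q, \<xi>)))"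
  let ?I = "\<integral>\<xi>. ?E \<xi> * a (q, \<xi>) \<partial>lborel"
  have shift: "integrable lborel (\<lambda>\<xi>. ?E \<xi> * a (q, \<xi> + u)) \<and>
     (\<integral>\<xi>. ?E \<xi> * a (q, \<xi> + u) \<partial>lborel) = exp (- \<i> * of_real (w \<bullet> u)) * ?I" for u
  proof -
    have eq: "?E \<xi> * a (q, \<xi> + u) = exp (- \<i> * of_real (w \<bullet> u)) * (?E (u + \<xi>) * a (q, u + \<xi>))" for \<xi>
      by (simp add: inner_add_right algebra_simps exp_add[symmetric] add.commute)
    have int: "integrable (distr lborel borel ((+) u)) (\<lambda>\<xi>. ?E \<xi> * a (q, \<xi>))"
      unfolding lborel_distr_plus by (rule integrable_fibre)
    have m: "(\<lambda>\<xi>. ?E \<xi> * a (q, \<xi>)) \<in> borel_measurable borel" by measurable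
    have 1: "integrable lborel (\<lambda>\<xi>. ?E (u + \<xi>) * a (q, u + \<xi>))"
      using int by (subst (asm) integrable_distr_eq) (use m in auto)
    have "?I = (\<integral>\<xi>. ?E \<xi> * a (q, \<xi>) \<partial>distr lborel borel ((+) u))"
      by (simp add: lborel_distr_plus)
    also have "\<dots> = (\<integral>\<xi>. ?E (u + \<xi>) * a (q, u + \<xi>) \<partial>lborel)"
      by (rule integral_distr) (use m in auto)
    finally show ?thesis unfolding eq using 1 by simp
  qed
  have lim: "(\<lambda>n. \<integral>\<xi>. ?s n \<xi> \<partial>lborel) \<longlonglongrightarrow> (\<integral>\<xi>. ?E \<xi> * ?D (q, \<xi>) \<partial>lborel)"
  proof (rule integral_dominated_convergence[where w = "\<lambda>\<xi>. B * indicator (cball 0 (R + cmod e)) \<xi>"])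
    show "(\<lambda>\<xi>. ?E \<xi> * ?D (q, \<xi>)) \<in> borel_measurable lborel"
      using D.integrable_fibre[of w q] by (rule borel_measurable_integrable)
    show "?s n \<in> borel_measurable lborel" for n
      by measurable
    show "integrable lborel (\<lambda>\<xi>. B * indicator (cball (0::complex) (R + cmod e)) \<xi>)"
      by (intro integrable_mult_right integrable_real_indicator emeasure_bounded_finite) auto
    show "AE \<xi> in lborel. (\<lambda>n. ?s n \<xi>) \<longlonglongrightarrow> ?E \<xi> * ?D (q, \<xi>)"
    proof (rule AE_I2)
      fix \<xi>
      have sm: "smooth_on UNIV a" using test by (simp add: test_function_def)
      have "((\<lambda>s::real. (q, \<xi> + s *\<^sub>R e)) has_derivative (\<lambda>r. (0, r *\<^sub>R e))) (at 0)"
        by (auto intro!: derivative_eq_intros)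
      from has_derivative_compose[OF this smooth_on_has_derivative[OF sm]]
      have "((\<lambda>s. a (q, \<xi> + s *\<^sub>R e)) has_derivative (\<lambda>r. frechet_derivative a (at (q, \<xi>)) (0, r *\<^sub>R e))) (at 0)"
        by simp
      moreover have "frechet_derivative a (at (q, \<xi>)) (0, r *\<^sub>R e) = r *\<^sub>R ?D (q, \<xi>)" for r
      proof -
        have "linear (frechet_derivative a (at (q, \<xi>)))"
          by (rule has_derivative_linear[OF smooth_on_has_derivative[OF sm]])
        from linear_scale[OF this] have "frechet_derivative a (at (q, \<xi>)) (r *\<^sub>R (0, e)) = r *\<^sub>R ?D (q, \<xi>)" .
        then show ?thesis by simp
      qed
      ultimately have "((\<lambda>s. a (q, \<xi> + s *\<^sub>R e)) has_derivative (\<lambda>r. r *\<^sub>R ?D (q, \<xi>))) (at 0)"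
        by simp
      then have "((\<lambda>s. norm (a (q, \<xi> + s *\<^sub>R e) - a (q, \<xi>) - s *\<^sub>R ?D (q, \<xi>)) / norm s) \<longlongrightarrow> 0) (at 0)"
        by (simp add: has_derivative_iff_norm)
      moreover have "filterlim ?t (at 0) sequentially"
        by (rule filterlim_atI[OF LIMSEQ_Suc[OF lim_1_over_n]]) simp
      ultimately have "(\<lambda>n. norm (a (q, \<xi> + ?t n *\<^sub>R e) - a (q, \<xi>) - ?t n *\<^sub>R ?D (q, \<xi>)) / norm (?t n)) \<longlonglongrightarrow> 0"
        by (rule filterlim_compose)
      moreover have "norm (a (q, \<xi> + ?t n *\<^sub>R e) - a (q, \<xi>) - ?t n *\<^sub>R ?D (q, \<xi>)) / norm (?t n)
          = norm ((a (q, \<xi> + ?t n *\<^sub>R e) - a (q, \<xi>)) /\<^sub>R ?t n - ?D (q, \<xi>))" for n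
      proof -
        have *: "norm (X - t *\<^sub>R Y) / norm t = norm (X /\<^sub>R t - Y)" if "t \<noteq> 0" for X Y :: complex and t :: real
        proof -
          have "X /\<^sub>R t - Y = (X - t *\<^sub>R Y) /\<^sub>R t" using that by (simp add: scaleR_diff_right)
          then show ?thesis by (simp add: divide_inverse mult.commute)
        qed
        show ?thesis by (rule *) simp
      qed
      ultimately have "(\<lambda>n. (a (q, \<xi> + ?t n *\<^sub>R e) - a (q, \<xi>)) /\<^sub>R ?t n) \<longlonglongrightarrow> ?D (q, \<xi>)"
        by (simp only: LIM_zero_iff tendsto_norm_zero_iff)
      then have "(\<lambda>n. ?E \<xi> * ((a (q, \<xi> + ?t n *\<^sub>R e) - a (q, \<xi>)) /\<^sub>R ?t n)) \<longlonglongrightarrow> ?E \<xi> * ?D (q, \<xi>)"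
        by (intro tendsto_intros)
      then show "(\<lambda>n. ?s n \<xi>) \<longlonglongrightarrow> ?E \<xi> * ?D (q, \<xi>)"
        by (simp add: scaleR_conv_of_real ac_simps)
    qed
    show "AE \<xi> in lborel. norm (?s n \<xi>) \<le> B * indicator (cball 0 (R + cmod e)) \<xi>" for n
    proof (rule AE_I2)
      fix \<xi>
      have t: "0 \<le> ?t n" "?t n \<le> 1" by (auto simp: field_simps)
      show "norm (?s n \<xi>) \<le> B * indicator (cball 0 (R + cmod e)) \<xi>"
      proof (cases "cmod \<xi> \<le> R + cmod e")
        case True
        have "cmod (a ((q, \<xi>) + ?t n *\<^sub>R (0, e)) - a (q, \<xi>)) \<le> B * ?t n"
          by (rule test_function_line_bound[OF test B(2) t(1)])
        then have "cmod (a (q, \<xi> + ?t n *\<^sub>R e) - a (q, \<xi>)) \<le> B * ?t n" by simp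
        then have "real (Suc n) * cmod (a (q, \<xi> + ?t n *\<^sub>R e) - a (q, \<xi>)) \<le> real (Suc n) * (B * ?t n)"
          by (rule mult_left_mono) simp
        also have "\<dots> = B" by simp
        finally show ?thesis using True by (simp only: norm_mult norm_exp_i_times norm_of_real) simp
      next
        case False
        have "cmod (?t n *\<^sub>R e) \<le> cmod e"
          unfolding norm_scaleR using t by (intro mult_left_le_one_le) auto
        then have "cmod (\<xi> + ?t n *\<^sub>R e) > R" "cmod \<xi> > R"
          using False norm_diff_ineq[of \<xi> "?t n *\<^sub>R e"] norm_ge_zero[of e] by linarith+
        then have "a (q, \<xi> + ?t n *\<^sub>R e) = 0" "a (q, \<xi>) = 0" using RM(4) by (metis not_le)+
        then show ?thesis using B(1) by simp
      qed
    qed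
  qed
  have "(\<integral>\<xi>. ?s n \<xi> \<partial>lborel) = (exp (- \<i> * of_real (?t n * (w \<bullet> e))) - 1) / of_real (?t n) * ?I" for n
  proof -
    have "(\<integral>\<xi>. ?s n \<xi> \<partial>lborel) = of_real (real (Suc n)) * (\<integral>\<xi>. ?E \<xi> * a (q, \<xi> + ?t n *\<^sub>R e) - ?E \<xi> * a (q, \<xi>) \<partial>lborel)"
      by (simp only: integral_mult_right_zero right_diff_distrib[of "exp _"])
    also have "(\<integral>\<xi>. ?E \<xi> * a (q, \<xi> + ?t n *\<^sub>R e) - ?E \<xi> * a (q, \<xi>) \<partial>lborel)
       = exp (- \<i> * of_real (w \<bullet> (?t n *\<^sub>R e))) * ?I - ?I"
      using shift[of "?t n *\<^sub>R e"] integrable_fibre[of w q] by (subst Bochner_Integration.integral_diff) auto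
    finally show ?thesis by (simp add: algebra_simps)
  qed
  moreover have "(\<lambda>n. (exp (- \<i> * of_real (?t n * (w \<bullet> e))) - 1) / of_real (?t n) * ?I) \<longlonglongrightarrow> (- \<i> * of_real (w \<bullet> e)) * ?I"
  proof (rule tendsto_mult_right)
    have "((\<lambda>z. exp (- \<i> * of_real (w \<bullet> e) * z)) has_field_derivative (- \<i> * of_real (w \<bullet> e))) (at 0)"
      by (auto intro!: derivative_eq_intros)
    then have "((\<lambda>z. (exp (- \<i> * of_real (w \<bullet> e) * z) - 1) / z) \<longlongrightarrow> - \<i> * of_real (w \<bullet> e)) (at 0)"
      by (simp add: DERIV_def)
    moreover have "filterlim (\<lambda>n. complex_of_real (?t n)) (at 0) sequentially"
      using tendsto_of_real[OF LIMSEQ_Suc[OF lim_1_over_n], where ?'a = complex]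
      by (intro filterlim_atI) (simp_all del: of_real_divide)
    ultimately have "(\<lambda>n. (exp (- \<i> * of_real (w \<bullet> e) * of_real (?t n)) - 1) / of_real (?t n)) \<longlonglongrightarrow> - \<i> * of_real (w \<bullet> e)"
      by (rule filterlim_compose)
    then show "(\<lambda>n. (exp (- \<i> * of_real (?t n * (w \<bullet> e))) - 1) / of_real (?t n)) \<longlonglongrightarrow> - \<i> * of_real (w \<bullet> e)"
      by (simp add: ac_simps)
  qed
  ultimately have "(\<lambda>n. \<integral>\<xi>. ?s n \<xi> \<partial>lborel) \<longlonglongrightarrow> (- \<i> * of_real (w \<bullet> e)) * ?I"
    by (simp only:)
  from LIMSEQ_unique[OF lim this] show ?thesis
    unfolding FT_def by (simp only: times_divide_eq_right)
qed

lemma FT_diff: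
  assumes "symbol b" shows "FT (\<lambda>p. a p - b p) q w = FT a q w - FT b q w"
  using integrable_fibre[of w q] symbol.integrable_fibre[OF assms, of w q]
  by (simp add: FT_def right_diff_distrib diff_divide_distrib)

end

text \<open>Subtracting from \<open>a\<close> its two pure second fibre derivatives multiplies the
  transform by \<open>1 + |w|^2\<close> and yields a symbol again, so each induction step gains one
  power.\<close>

lemma FT_decay:
  assumes "symbol a"
  shows "\<exists>C\<ge>0. \<forall>q w. (1 + (cmod w)\<^sup>2) ^ N * cmod (FT a q w) \<le> C"
  using assms
proof (induction N arbitrary: a)
  case 0
  obtain C where "C \<ge> 0" "\<And>q w. cmod (FT a q w) \<le> C" using symbol.FT_bounded[OF 0] by blast
  then show ?case by auto
next
  case (Suc N)
  interpret symbol a by fact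
  let ?d = "\<lambda>e b p. frechet_derivative b (at p) (0::complex, e::complex)"
  interpret d1: symbol "?d 1 a" by (rule symbol_frechet)
  interpret d2: symbol "?d \<i> a" by (rule symbol_frechet)
  interpret d11: symbol "?d 1 (?d 1 a)" by (rule d1.symbol_frechet)
  interpret d22: symbol "?d \<i> (?d \<i> a)" by (rule d2.symbol_frechet)
  interpret b1: symbol "\<lambda>p. a p - ?d 1 (?d 1 a) p"
    by (rule symbol.intro) (intro test_function_diff test d11.test)
  interpret b: symbol "\<lambda>p. (a p - ?d 1 (?d 1 a) p) - ?d \<i> (?d \<i> a) p"
    by (rule symbol.intro) (intro test_function_diff b1.test d22.test)
  have cm: "(cmod w)\<^sup>2 = Re w * Re w + Im w * Im w" for w
    unfolding cmod_power2 by (simp add: power2_eq_square)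
  have E1: "FT (\<lambda>p. (a p - ?d 1 (?d 1 a) p) - ?d \<i> (?d \<i> a) p) q w = of_real (1 + (cmod w)\<^sup>2) * FT a q w" for q w
    unfolding b1.FT_diff[OF d22.symbol_axioms] FT_diff[OF d11.symbol_axioms]
      d1.FT_frechet d2.FT_frechet FT_frechet cm
    by (simp add: inner_complex_def algebra_simps)
  obtain C where C: "C \<ge> 0" "\<And>q w. (1 + (cmod w)\<^sup>2) ^ N * cmod (FT (\<lambda>p. (a p - ?d 1 (?d 1 a) p) - ?d \<i> (?d \<i> a) p) q w) \<le> C"
    using Suc.IH[OF b.symbol_axioms] by blast
  have nm: "cmod (of_real (1 + (cmod w)\<^sup>2)) = 1 + (cmod w)\<^sup>2" for w
    by (simp only: norm_of_real) simp
  have "(1 + (cmod w)\<^sup>2) ^ N * ((1 + (cmod w)\<^sup>2) * cmod (FT a q w)) \<le> C" for q w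
    using C(2) unfolding E1 norm_mult nm by blast
  then show ?case using C(1) by (intro exI[of _ C]) (simp add: ac_simps)
qed

section \<open>Affine substitutions\<close>

lemma lborel_integral_affine:
  fixes F :: "complex \<Rightarrow> complex"
  assumes c: "c \<noteq> 0" and F: "F \<in> borel_measurable borel"
  shows "(\<integral>\<eta>. F \<eta> \<partial>lborel) = of_real ((cmod c)\<^sup>2) * (\<integral>\<xi>. F (c * \<xi> + t) \<partial>lborel)"
proof -
  let ?T = "\<lambda>\<xi>. c * \<xi> + t"
  have surj: "?T ` UNIV = UNIV"
  proof -
    have "w = ?T ((w - t) / c)" for w using c by simp
    then show ?thesis by blast
  qed
  have der: "deriv ?T = (\<lambda>_. c)"
    by (rule ext, rule DERIV_imp_deriv) (auto intro!: derivative_eq_intros)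
  have eq: "lborel = density (distr lborel borel ?T) (\<lambda>_. ennreal ((cmod c)\<^sup>2))"
  proof (rule measure_eqI)
    fix A assume "A \<in> sets (lborel :: complex measure)"
    then have A [measurable]: "A \<in> sets borel" by simp
    have "emeasure lborel A = (\<integral>\<^sup>+w\<in>?T ` UNIV. indicator A w \<partial>lborel)" by (simp add: surj)
    also have "\<dots> = (\<integral>\<^sup>+z\<in>UNIV. indicator A (?T z) * ennreal ((cmod (deriv ?T z))\<^sup>2) \<partial>lborel)"
      by (rule nn_integral_holomorphic_substitution) (use c in \<open>auto intro!: holomorphic_intros injI\<close>)
    also have "\<dots> = (\<integral>\<^sup>+z. ennreal ((cmod c)\<^sup>2) * indicator A z \<partial>distr lborel borel ?T)"
      unfolding der by (subst nn_integral_distr) (simp_all add: mult.commute)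
    also have "\<dots> = emeasure (density (distr lborel borel ?T) (\<lambda>_. ennreal ((cmod c)\<^sup>2))) A"
      by (subst emeasure_density) simp_all
    finally show "emeasure lborel A = emeasure (density (distr lborel borel ?T) (\<lambda>_. ennreal ((cmod c)\<^sup>2))) A" .
  qed simp
  have "(\<integral>\<eta>. F \<eta> \<partial>lborel) = (\<integral>\<eta>. F \<eta> \<partial>density (distr lborel borel ?T) (\<lambda>_. ennreal ((cmod c)\<^sup>2)))"
    using eq by simp
  also have "\<dots> = (\<integral>\<eta>. (cmod c)\<^sup>2 *\<^sub>R F \<eta> \<partial>distr lborel borel ?T)"
    by (rule integral_density) (use F in auto)
  also have "\<dots> = (\<integral>\<xi>. (cmod c)\<^sup>2 *\<^sub>R F (?T \<xi>) \<partial>lborel)"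
    by (rule integral_distr) (use F in auto)
  finally show ?thesis by (simp add: scaleR_conv_of_real)
qed

section \<open>Quantization as a quadratic form\<close>

lemma ennreal_finiteE:
  assumes "x < (\<infinity> :: ennreal)"
  obtains L where "L \<ge> 0" "x = ennreal L"
  using assms by (cases x rule: ennreal_cases) auto

lemma inner_divide_of_real: "(z / complex_of_real h) \<bullet> \<xi> = (z \<bullet> \<xi>) / h"
  by (simp add: inner_complex_def field_simps add_divide_distrib)

context symbol
begin

text \<open>Fubini applies because \<open>a\<close> is bounded with bounded support in the fibre and
  \<open>u\<close> is integrable; the inner integral over the fibre is \<open>FT\<close> at the
  scaled displacement.\<close>

lemma Op_plane_eq:
  assumes h: "h > 0" and u: "u \<in> borel_measurable borel" "integrable lborel u"
  shows "Op_plane h a u q = (\<integral>q'. of_real (1 / h\<^sup>2) * FT a q ((q - q') / of_real h) * u q' \<partial>lborel)"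
proof -
  note u(1) [measurable]
  define f where "f = (\<lambda>(q', \<xi>). exp (\<i> * of_real (((q - q') \<bullet> \<xi>) / h)) * a (q, \<xi>) * u q')"
  have f_eq: "f (q', \<xi>) = exp (\<i> * of_real (((q - q') / of_real h) \<bullet> \<xi>)) * a (q, \<xi>) * u q'" for q' \<xi>
    by (simp add: f_def inner_divide_of_real)
  have int: "integrable (lborel \<Otimes>\<^sub>M lborel) f"
  proof (rule lborel_pair.Fubini_integrable)
    show "f \<in> borel_measurable (lborel \<Otimes>\<^sub>M lborel)"
      unfolding f_def by measurable
    have "(\<integral>\<xi>. norm (f (q', \<xi>)) \<partial>lborel) = (\<integral>\<xi>. cmod (a (q, \<xi>)) \<partial>lborel) * cmod (u q')" for q'
      by (simp add: f_eq norm_mult)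
    then show "integrable lborel (\<lambda>q'. \<integral>\<xi>. norm (f (q', \<xi>)) \<partial>lborel)"
      using u(2) by simp
    show "AE q' in lborel. integrable lborel (\<lambda>\<xi>. f (q', \<xi>))"
      unfolding f_eq by (intro AE_I2 integrable_mult_left integrable_fibre)
  qed
  have inner: "(\<integral>\<xi>. f (q', \<xi>) \<partial>lborel) = of_real ((2 * pi)\<^sup>2) * FT a q ((q - q') / of_real h) * u q'" for q'
    by (simp add: f_eq FT_def)
  have "(\<integral>z. f z \<partial>lborel) = (\<integral>q'. \<integral>\<xi>. f (q', \<xi>) \<partial>lborel \<partial>lborel)"
    using lborel_pair.integral_fst'[OF int] by (simp add: lborel_prod)
  also have "\<dots> = (\<integral>q'. of_real ((2 * pi)\<^sup>2) * (FT a q ((q - q') / of_real h) * u q') \<partial>lborel)"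
    unfolding inner by (simp add: mult.assoc)
  also have "\<dots> = of_real ((2 * pi)\<^sup>2) * (\<integral>q'. FT a q ((q - q') / of_real h) * u q' \<partial>lborel)"
    by (rule integral_mult_right_zero)
  finally have 1: "(\<integral>z. f z \<partial>lborel) = of_real ((2 * pi)\<^sup>2) * (\<integral>q'. FT a q ((q - q') / of_real h) * u q' \<partial>lborel)" .
  have "Op_plane h a u q = 1 / of_real ((2 * pi * h)\<^sup>2) * (\<integral>z. f z \<partial>lborel)"
    by (simp add: Op_plane_def f_def)
  also have "\<dots> = of_real (1 / h\<^sup>2) * (\<integral>q'. FT a q ((q - q') / of_real h) * u q' \<partial>lborel)"
    unfolding 1 by (simp add: power_mult_distrib)
  finally show ?thesis by (simp add: mult.assoc)
qed

end

lemma integral_lborel_hyp_area: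
  fixes f :: "complex \<Rightarrow> complex"
  assumes f [measurable]: "f \<in> borel_measurable borel" and z: "\<And>z. z \<notin> UHP \<Longrightarrow> f z = 0"
  shows "(\<integral>z. f z \<partial>lborel) = (\<integral>z. f z * of_real ((Im z)\<^sup>2) \<partial>hyp_area)"
proof -
  have "(\<integral>z. f z * of_real ((Im z)\<^sup>2) \<partial>hyp_area)
      = (\<integral>z. (indicator UHP z / (Im z)\<^sup>2) *\<^sub>R (f z * of_real ((Im z)\<^sup>2)) \<partial>lborel)"
    unfolding hyp_area_def by (rule integral_density) auto
  also have "\<dots> = (\<integral>z. f z \<partial>lborel)"
  proof (rule Bochner_Integration.integral_cong[OF refl])
    fix z :: complex
    show "(indicator UHP z / (Im z)\<^sup>2) *\<^sub>R (f z * of_real ((Im z)\<^sup>2)) = f z"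
      using z[of z] by (cases "z \<in> UHP") (auto simp: UHP_def scaleR_conv_of_real)
  qed
  finally show ?thesis ..
qed

definition locally_L2 :: "(complex \<Rightarrow> complex) \<Rightarrow> bool" where
  "locally_L2 v \<longleftrightarrow> v \<in> borel_measurable borel \<and>
     (\<forall>K. compact K \<and> K \<subseteq> UHP \<longrightarrow> (\<integral>\<^sup>+z\<in>K. ennreal ((cmod (v z))\<^sup>2) \<partial>hyp_area) < \<infinity>)"

text \<open>Local square integrability gives local integrability through
  \<open>|v| \<le> 1 + |v|^2\<close>; passing from hyperbolic to Lebesgue area costs the bound
  \<open>Y^2\<close> for \<open>y^2\<close> on the support.\<close>

lemma locally_L2_integrable:
  fixes g :: "complex \<Rightarrow> real"
  assumes v: "locally_L2 v" and g: "test_function UHP g"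
  shows "integrable lborel (\<lambda>z. of_real (g z) * v z)"
proof (rule integrableI_bounded)
  have vm [measurable]: "v \<in> borel_measurable borel" using v by (simp add: locally_L2_def)
  have cm [measurable]: "g \<in> borel_measurable borel" by (rule test_function_measurable[OF g])
  show "(\<lambda>z. of_real (g z) * v z) \<in> borel_measurable lborel" by measurable
  let ?K = "supp g"
  have K: "compact ?K" "?K \<subseteq> UHP" using g by (auto simp: test_function_def)
  have Km [measurable]: "?K \<in> sets borel" using K(1) by (simp add: borel_compact)
  obtain M where M: "M \<ge> 0" "\<And>z. \<bar>g z\<bar> \<le> M" using test_function_bounded[OF g] by auto
  have "bounded (Im ` ?K)"
    using K(1) by (intro compact_imp_bounded compact_continuous_image continuous_intros)
  then obtain Y where Y: "\<And>z. z \<in> ?K \<Longrightarrow> \<bar>Im z\<bar> \<le> Y" unfolding bounded_iff by auto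
  let ?W = "\<lambda>z. ennreal ((cmod (v z))\<^sup>2) * indicator ?K z"
  have "(\<integral>\<^sup>+z. ennreal (norm (of_real (g z) * v z)) \<partial>lborel)
      \<le> (\<integral>\<^sup>+z. ennreal M * indicator ?K z + ennreal (M * Y\<^sup>2) * (ennreal (indicator UHP z / (Im z)\<^sup>2) * ?W z) \<partial>lborel)"
  proof (rule nn_integral_mono)
    fix z
    show "ennreal (norm (of_real (g z) * v z))
        \<le> ennreal M * indicator ?K z + ennreal (M * Y\<^sup>2) * (ennreal (indicator UHP z / (Im z)\<^sup>2) * ?W z)"
    proof (cases "g z = 0")
      case False
      then have z: "z \<in> ?K" by (rule supp_memI)
      then have zU: "z \<in> UHP" using K by blast
      then have y: "Im z > 0" by (simp add: UHP_def)
      have "Im z \<le> Y" using Y[OF z] y by simp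
      then have "(Im z)\<^sup>2 \<le> Y\<^sup>2" using y by (intro power_mono) auto
      then have "1 \<le> Y\<^sup>2 * (1 / (Im z)\<^sup>2)" using y by simp
      then have "1 * (cmod (v z))\<^sup>2 \<le> Y\<^sup>2 * (1 / (Im z)\<^sup>2) * (cmod (v z))\<^sup>2" by (rule mult_right_mono) simp
      moreover have "cmod (v z) \<le> 1 + (cmod (v z))\<^sup>2"
      proof -
        have "0 \<le> (cmod (v z) - 1)\<^sup>2" by simp
        then show ?thesis by (simp add: power2_eq_square algebra_simps) (use norm_ge_zero[of "v z"] in linarith)
      qed
      ultimately have "cmod (v z) \<le> 1 + Y\<^sup>2 * (1 / (Im z)\<^sup>2) * (cmod (v z))\<^sup>2" by linarith
      then have "M * cmod (v z) \<le> M * (1 + Y\<^sup>2 * (1 / (Im z)\<^sup>2) * (cmod (v z))\<^sup>2)" using M(1) by (rule mult_left_mono)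
      moreover have "\<bar>g z\<bar> * cmod (v z) \<le> M * cmod (v z)" using M(2)[of z] by (rule mult_right_mono) simp
      ultimately have "\<bar>g z\<bar> * cmod (v z) \<le> M + (M * Y\<^sup>2) * ((1 / (Im z)\<^sup>2) * (cmod (v z))\<^sup>2)"
        by (simp only: distrib_left mult_1_right mult.assoc) 
      then have "ennreal (\<bar>g z\<bar> * cmod (v z)) \<le> ennreal (M + (M * Y\<^sup>2) * ((1 / (Im z)\<^sup>2) * (cmod (v z))\<^sup>2))"
        by (rule ennreal_leI)
      also have "\<dots> = ennreal M + ennreal (M * Y\<^sup>2) * (ennreal (1 / (Im z)\<^sup>2) * ennreal ((cmod (v z))\<^sup>2))"
        using M(1) by (subst ennreal_plus; simp add: ennreal_mult[symmetric])
      finally show ?thesis using z zU by (simp add: norm_mult)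
    qed simp
  qed
  also have "\<dots> = (\<integral>\<^sup>+z. ennreal M * indicator ?K z \<partial>lborel)
      + ennreal (M * Y\<^sup>2) * (\<integral>\<^sup>+z. ennreal (indicator UHP z / (Im z)\<^sup>2) * ?W z \<partial>lborel)"
    by (subst nn_integral_add, measurable, subst nn_integral_cmult[of _ _ "ennreal (M * Y\<^sup>2)"], measurable)
  also have "(\<integral>\<^sup>+z. ennreal (indicator UHP z / (Im z)\<^sup>2) * ?W z \<partial>lborel) = (\<integral>\<^sup>+z. ?W z \<partial>hyp_area)"
    by (rule nn_integral_hyp_area[symmetric]) measurable
  also have "(\<integral>\<^sup>+z. ennreal M * indicator ?K z \<partial>lborel) = ennreal M * emeasure lborel ?K"
    by (rule nn_integral_cmult_indicator) simp
  also have "ennreal M * emeasure lborel ?K + ennreal (M * Y\<^sup>2) * (\<integral>\<^sup>+z. ?W z \<partial>hyp_area) < \<infinity>"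
  proof -
    have "emeasure lborel ?K < \<infinity>" using K(1) by (intro emeasure_bounded_finite compact_imp_bounded)
    moreover have "(\<integral>\<^sup>+z. ?W z \<partial>hyp_area) < \<infinity>" using v K by (auto simp: locally_L2_def)
    ultimately show ?thesis by (simp add: ennreal_mult_less_top)
  qed
  finally show "(\<integral>\<^sup>+z. ennreal (norm (of_real (g z) * v z)) \<partial>lborel) < \<infinity>" .
qed

definition cutoff :: "(nat \<Rightarrow> complex \<Rightarrow> real) \<Rightarrow> nat set \<Rightarrow> complex \<Rightarrow> complex \<Rightarrow> real" where
  "cutoff \<psi> F q q' = (\<Sum>j\<in>F. \<psi> j q * \<psi> j q')"

text \<open>The kernel with respect to \<open>hyp_area\<close> in the second variable:
  \<open>(Im q')^2\<close> undoes its density. The finite set \<open>F\<close> stands in for the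
  series over the partition.\<close>

definition op_kernel ::
    "(nat \<Rightarrow> complex \<Rightarrow> real) \<Rightarrow> nat set \<Rightarrow> real \<Rightarrow> (complex \<times> complex \<Rightarrow> complex) \<Rightarrow> complex \<Rightarrow> complex \<Rightarrow> complex" where
  "op_kernel \<psi> F h a q q' =
     of_real (1 / h\<^sup>2) * FT a q ((q - q') / of_real h) * of_real (cutoff \<psi> F q q' * (Im q')\<^sup>2)"

locale partition =
  fixes \<psi> :: "nat \<Rightarrow> complex \<Rightarrow> real"
  assumes partition: "quadratic_partition \<psi>"
begin

lemma psi_test: "test_function UHP (\<psi> j)"
  using partition by (simp add: quadratic_partition_def)

lemma psi_zero: "z \<notin> UHP \<Longrightarrow> \<psi> j z = 0"
  using psi_test[of j] supp_memI[of "\<psi> j" z] by (auto simp: test_function_def)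

lemma psi_measurable [measurable]: "\<psi> j \<in> borel_measurable borel"
  by (rule test_function_measurable[OF psi_test])

text \<open>Local finiteness and compactness leave finitely many indices, so the series in
  \<open>Op_hyp\<close> becomes a sum over one finite set, the same for all points of
  \<open>K\<close>.\<close>

lemma finite_cover:
  assumes "compact K" "K \<subseteq> UHP"
  obtains F where "finite F" "\<And>j q. j \<notin> F \<Longrightarrow> q \<in> K \<Longrightarrow> \<psi> j q = 0"
proof -
  let ?C = "{U. open U \<and> finite {j. U \<inter> supp (\<psi> j) \<noteq> {}}}"
  have "K \<subseteq> \<Union>?C"
    using assms(2) partition unfolding quadratic_partition_def by blast
  then obtain D where D: "D \<subseteq> ?C" "finite D" "K \<subseteq> \<Union>D"
    using compactE[OF assms(1), of ?C] by blast
  show ?thesis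
  proof
    show "finite (\<Union>U\<in>D. {j. U \<inter> supp (\<psi> j) \<noteq> {}})" using D by blast
    fix j q assume *: "j \<notin> (\<Union>U\<in>D. {j. U \<inter> supp (\<psi> j) \<noteq> {}})" "q \<in> K"
    then obtain U where "U \<in> D" "q \<in> U" using D(3) by blast
    then have "q \<notin> supp (\<psi> j)" using *(1) by blast
    then show "\<psi> j q = 0" using supp_memI[of "\<psi> j" q] by blast
  qed
qed

lemma cutoff_diag:
  assumes "finite F" "\<And>j. j \<notin> F \<Longrightarrow> \<psi> j q = 0" "q \<in> UHP"
  shows "cutoff \<psi> F q q = 1"
proof -
  have "(\<Sum>j. (\<psi> j q)\<^sup>2) = (\<Sum>j\<in>F. (\<psi> j q)\<^sup>2)"
    by (rule suminf_finite) (use assms in auto)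
  then show ?thesis
    using partition assms(3) by (simp add: quadratic_partition_def cutoff_def power2_eq_square)
qed

lemma cutoff_measurable [measurable]: "(\<lambda>z. cutoff \<psi> F (fst z) (snd z)) \<in> borel_measurable (borel \<Otimes>\<^sub>M borel)"
  unfolding cutoff_def by measurable

lemma cutoff_bounded: obtains C where "C \<ge> 0" "\<And>q q'. \<bar>cutoff \<psi> F q q'\<bar> \<le> C"
proof -
  have "\<exists>M. M \<ge> 0 \<and> (\<forall>q. \<bar>\<psi> j q\<bar> \<le> M)" for j
    using test_function_bounded[OF psi_test[of j]] by (metis real_norm_def)
  then obtain M where M: "\<And>j. M j \<ge> 0" "\<And>j q. \<bar>\<psi> j q\<bar> \<le> M j" by metis
  have "\<bar>cutoff \<psi> F q q'\<bar> \<le> (\<Sum>j\<in>F. M j * M j)" for q q'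
  proof -
    have "\<bar>cutoff \<psi> F q q'\<bar> \<le> (\<Sum>j\<in>F. \<bar>\<psi> j q * \<psi> j q'\<bar>)" unfolding cutoff_def by (rule sum_abs)
    also have "\<dots> \<le> (\<Sum>j\<in>F. M j * M j)"
      unfolding abs_mult by (intro sum_mono mult_mono M) auto
    finally show ?thesis .
  qed
  moreover have "(\<Sum>j\<in>F. M j * M j) \<ge> 0" by (intro sum_nonneg) simp
  ultimately show ?thesis using that by blast
qed

definition cover_supp :: "nat set \<Rightarrow> complex set" where
  "cover_supp F = (\<Union>j\<in>F. supp (\<psi> j))"

lemma compact_cover_supp: "finite F \<Longrightarrow> compact (cover_supp F)" and cover_supp_UHP: "cover_supp F \<subseteq> UHP"
  and cutoff_nonzero: "cutoff \<psi> F q q' \<noteq> 0 \<Longrightarrow> q' \<in> cover_supp F"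
proof -
  show "compact (cover_supp F)" if "finite F"
    unfolding cover_supp_def using that psi_test by (intro compact_UN) (auto simp: test_function_def)
  show "cover_supp F \<subseteq> UHP" unfolding cover_supp_def using psi_test by (auto simp: test_function_def)
  assume "cutoff \<psi> F q q' \<noteq> 0"
  then obtain j where "j \<in> F" "\<psi> j q * \<psi> j q' \<noteq> 0"
    unfolding cutoff_def by (meson sum.neutral)
  then show "q' \<in> cover_supp F" unfolding cover_supp_def using supp_memI[of "\<psi> j" q'] by auto
qed

lemma op_kernel_measurable [measurable]:
  assumes "symbol a"
  shows "(\<lambda>z. op_kernel \<psi> F h a (fst z) (snd z)) \<in> borel_measurable (borel \<Otimes>\<^sub>M borel)"
proof -
  have "(\<lambda>z. (\<lambda>y. FT a (fst y) (snd y)) (fst z, (fst z - snd z) / of_real h)) \<in> borel_measurable (borel \<Otimes>\<^sub>M borel)"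
    by (rule measurable_compose[OF _ symbol.FT_measurable[OF assms]]) measurable
  then have [measurable]: "(\<lambda>z. FT a (fst z) ((fst z - snd z) / of_real h)) \<in> borel_measurable (borel \<Otimes>\<^sub>M borel)"
    by simp
  show ?thesis unfolding op_kernel_def by measurable
qed

text \<open>The cutoffs vanish outside \<open>UHP\<close>, on the input as well as on the output of
  the operator. Extension by zero allows working with functions that are Borel on the whole
  plane.\<close>

lemma inner_L2_extend:
  "inner_L2 (Op_hyp \<psi> h a v) v
    = inner_L2 (Op_hyp \<psi> h a (\<lambda>z. if z \<in> UHP then v z else 0)) (\<lambda>z. if z \<in> UHP then v z else 0)"
proof -
  have 1: "(\<lambda>q'. of_real (\<psi> j q') * v q') = (\<lambda>q'. of_real (\<psi> j q') * (if q' \<in> UHP then v q' else 0))" for j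
    by (auto simp: psi_zero)
  have "Op_hyp \<psi> h a v q * cnj (v q)
      = Op_hyp \<psi> h a (\<lambda>z. if z \<in> UHP then v z else 0) q * cnj (if q \<in> UHP then v q else 0)" for q
    unfolding Op_hyp_def 1 by (cases "q \<in> UHP") (auto simp: psi_zero)
  then show ?thesis unfolding inner_L2_def by simp
qed

text \<open>Two powers of decay of the transform are exactly \<open>decay\<close>, so Schur's test
  applies; here it serves to justify Fubini.\<close>

lemma op_kernel_integrable:
  assumes a: "symbol a" and h: "h > 0" and F: "finite F" and v: "locally_L2 v"
  shows "integrable (hyp_area \<Otimes>\<^sub>M hyp_area) (\<lambda>z. op_kernel \<psi> F h a (fst z) (snd z) * v (snd z) * cnj (v (fst z)))"
proof -
  interpret symbol a by fact
  obtain C where C: "C \<ge> 0" "\<And>q w. (1 + (cmod w)\<^sup>2) ^ 2 * cmod (FT a q w) \<le> C"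
    using FT_decay[OF a, of 2] by blast
  obtain C' where C': "C' \<ge> 0" "\<And>q q'. \<bar>cutoff \<psi> F q q'\<bar> \<le> C'" using cutoff_bounded by blast
  define K where "K = base \<union> cover_supp F"
  have K: "compact K" "K \<subseteq> UHP"
    unfolding K_def using compact_base base_UHP compact_cover_supp[OF F] cover_supp_UHP by auto
  have "bounded (Im ` K)"
    using K(1) by (intro compact_imp_bounded compact_continuous_image continuous_intros)
  then obtain Y where Y: "\<And>z. z \<in> K \<Longrightarrow> \<bar>Im z\<bar> \<le> Y" unfolding bounded_iff by auto
  have "(\<integral>\<^sup>+z\<in>K. ennreal ((cmod (v z))\<^sup>2) \<partial>hyp_area) < \<infinity>"
    using v K by (auto simp: locally_L2_def)
  then obtain L where L: "L \<ge> 0" "(\<integral>\<^sup>+z\<in>K. ennreal ((cmod (v z))\<^sup>2) \<partial>hyp_area) = ennreal L"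
    by (rule ennreal_finiteE)
  have nz: "p \<in> K \<and> q \<in> K" if "op_kernel \<psi> F h a p q \<noteq> 0" for p q
  proof -
    have "FT a p ((p - q) / of_real h) \<noteq> 0" "cutoff \<psi> F p q \<noteq> 0" using that by (auto simp: op_kernel_def)
    then show ?thesis unfolding K_def using FT_zero cutoff_nonzero by blast
  qed
  have bound: "cmod (op_kernel \<psi> F h a p q) \<le> (C * C' * Y\<^sup>2) / h\<^sup>2 * decay ((p - q) / of_real h)"
    if "p \<in> K" "q \<in> K" for p q
  proof -
    let ?w = "(p - q) / of_real h"
    have pos: "(1 + (cmod ?w)\<^sup>2) ^ 2 > 0" by (intro zero_less_power add_pos_nonneg) auto
    have 1: "cmod (FT a p ?w) \<le> C * decay ?w"
      using C(2)[of ?w p] pos by (simp add: decay_def field_simps)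
    have "(Im q)\<^sup>2 \<le> Y\<^sup>2" using Y[OF that(2)] by (metis abs_ge_zero power2_abs power_mono)
    then have 2: "\<bar>cutoff \<psi> F p q\<bar> * (Im q)\<^sup>2 \<le> C' * Y\<^sup>2"
      using C' by (intro mult_mono) auto
    have "cmod (op_kernel \<psi> F h a p q) = (1 / h\<^sup>2) * (cmod (FT a p ?w) * (\<bar>cutoff \<psi> F p q\<bar> * (Im q)\<^sup>2))"
      unfolding op_kernel_def norm_mult norm_of_real by (simp add: abs_mult)
    also have "\<dots> \<le> (1 / h\<^sup>2) * ((C * decay ?w) * (C' * Y\<^sup>2))"
      by (rule mult_left_mono[OF mult_mono[OF 1 2]]) (use C(1) decay_nonneg[of ?w] in auto)
    finally show ?thesis by (simp add: ac_simps)
  qed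
  obtain M where "schur_bound K M" using schur_test[OF K] by blast
  then show ?thesis
    by (rule schur_boundD(1)[where h = h and e = "C * C' * Y\<^sup>2" and C = L])
      (use h C(1) C'(1) L nz bound op_kernel_measurable[OF a] v in \<open>auto simp: locally_L2_def\<close>)
qed

text \<open>It is enough that \<open>F\<close> exhausts the partition over the base of
  \<open>a\<close>, since the transform vanishes at all other \<open>q\<close>. The operator is
  evaluated pointwise, and \<open>op_kernel_integrable\<close> merges the iterated integral into one
  over the product.\<close>

theorem inner_L2_eq_quad_form:
  assumes a: "symbol a" and h: "h > 0" and F: "finite F"
    and cover: "\<And>j q. j \<notin> F \<Longrightarrow> q \<in> symbol.base a \<Longrightarrow> \<psi> j q = 0"
    and v: "locally_L2 v"
  shows "inner_L2 (Op_hyp \<psi> h a v) v = quad_form (op_kernel \<psi> F h a) v"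
proof -
  interpret symbol a by fact
  have vm [measurable]: "v \<in> borel_measurable borel" using v by (simp add: locally_L2_def)
  have FTm [measurable]: "(\<lambda>q'. FT a q ((q - q') / of_real h)) \<in> borel_measurable borel" for q
    by (rule measurable_compose[of "\<lambda>q'. (q, (q - q') / of_real h)" _ "borel \<Otimes>\<^sub>M borel" "\<lambda>z. FT a (fst z) (snd z)", simplified])
      (simp_all add: FT_measurable)
  obtain C where "C \<ge> 0" and C: "\<And>q w. cmod (FT a q w) \<le> C" using FT_bounded by blast
  have op: "Op_hyp \<psi> h a v q = (\<integral>q'. op_kernel \<psi> F h a q q' * v q' \<partial>hyp_area)" for q
  proof (cases "q \<in> base")
    case False
    have "Op_plane h a (\<lambda>q'. of_real (\<psi> j q') * v q') q = 0" for j
      using Op_plane_eq[OF h _ locally_L2_integrable[OF v psi_test[of j]], of q] False by (simp add: FT_zero)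
    then show ?thesis using False by (simp add: Op_hyp_def op_kernel_def FT_zero)
  next
    case True
    let ?f = "\<lambda>j q'. of_real (\<psi> j q) * (of_real (1 / h\<^sup>2) * FT a q ((q - q') / of_real h) * (of_real (\<psi> j q') * v q'))"
    have int: "integrable lborel (?f j)" for j
    proof (rule integrable_mult_right)
      show "integrable lborel (\<lambda>q'. of_real (1 / h\<^sup>2) * FT a q ((q - q') / of_real h) * (of_real (\<psi> j q') * v q'))"
      proof (rule Bochner_Integration.integrable_bound)
        show "integrable lborel (\<lambda>q'. of_real (1 / h\<^sup>2 * C) * (complex_of_real (\<psi> j q') * v q'))"
          by (intro integrable_mult_right locally_L2_integrable[OF v psi_test])
        show "AE q' in lborel. norm (of_real (1 / h\<^sup>2) * FT a q ((q - q') / of_real h) * (of_real (\<psi> j q') * v q'))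
          \<le> norm (of_real (1 / h\<^sup>2 * C) * (complex_of_real (\<psi> j q') * v q'))"
        proof (rule AE_I2)
          fix q'
          have "cmod (FT a q ((q - q') / of_real h)) \<le> \<bar>C\<bar>" using C by (metis abs_ge_self order_trans)
          then show "norm (of_real (1 / h\<^sup>2) * FT a q ((q - q') / of_real h) * (of_real (\<psi> j q') * v q'))
            \<le> norm (of_real (1 / h\<^sup>2 * C) * (complex_of_real (\<psi> j q') * v q'))"
            unfolding norm_mult norm_of_real abs_mult by (intro mult_right_mono mult_left_mono) auto
        qed
      qed measurable
    qed
    have "Op_hyp \<psi> h a v q = (\<Sum>j\<in>F. of_real (\<psi> j q) * Op_plane h a (\<lambda>q'. of_real (\<psi> j q') * v q') q)"
      unfolding Op_hyp_def by (rule suminf_finite[OF F]) (simp add: cover[OF _ True])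
    also have "\<dots> = (\<Sum>j\<in>F. \<integral>q'. ?f j q' \<partial>lborel)"
      by (intro sum.cong refl, subst Op_plane_eq[OF h _ locally_L2_integrable[OF v psi_test]]) simp_all
    also have "\<dots> = (\<integral>q'. (\<Sum>j\<in>F. ?f j q') \<partial>lborel)"
      by (rule Bochner_Integration.integral_sum[symmetric]) (rule int)
    also have "\<dots> = (\<integral>q'. (\<Sum>j\<in>F. ?f j q') * of_real ((Im q')\<^sup>2) \<partial>hyp_area)"
      by (rule integral_lborel_hyp_area) (simp_all add: psi_zero)
    also have "\<dots> = (\<integral>q'. op_kernel \<psi> F h a q q' * v q' \<partial>hyp_area)"
      by (simp add: op_kernel_def cutoff_def sum_distrib_left sum_distrib_right ac_simps)
    finally show ?thesis .
  qed
  have "inner_L2 (Op_hyp \<psi> h a v) v = (\<integral>q. \<integral>q'. op_kernel \<psi> F h a q q' * v q' * cnj (v q) \<partial>hyp_area \<partial>hyp_area)"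
    unfolding inner_L2_def op by simp
  also have "\<dots> = quad_form (op_kernel \<psi> F h a) v"
    unfolding quad_form_def using hyp_pair.integral_fst'[OF op_kernel_integrable[OF a h F v]] by simp
  finally show ?thesis .
qed

end

section \<open>Estimates for the transformed kernel\<close>

text \<open>Taylor's formula needs the segment from \<open>p\<close> to \<open>q\<close>. The convex
  hull of \<open>K\<close> supplies it and remains a compact subset of the convex set
  \<open>UHP\<close>.\<close>

lemma holomorphic_compact_bounds:
  assumes g: "g holomorphic_on UHP" and K: "compact K" "K \<subseteq> UHP"
  obtains M where "M \<ge> 1"
    "\<And>p. p \<in> K \<Longrightarrow> cmod (g p) \<le> M"
    "\<And>p. p \<in> K \<Longrightarrow> cmod (deriv g p) \<le> M"
    "\<And>p q. p \<in> K \<Longrightarrow> q \<in> K \<Longrightarrow> cmod (g q - g p) \<le> M * cmod (q - p)"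
    "\<And>p q. p \<in> K \<Longrightarrow> q \<in> K \<Longrightarrow> cmod (g q - g p - deriv g p * (q - p)) \<le> M * (cmod (q - p))\<^sup>2"
proof -
  let ?H = "convex hull K"
  have H: "compact ?H" "?H \<subseteq> UHP" "K \<subseteq> ?H"
    using hull_minimal[of K UHP convex, OF K(2) convex_UHP] by (simp_all add: K(1) compact_convex_hull hull_subset)
  have g1: "deriv g holomorphic_on UHP" and g2: "deriv (deriv g) holomorphic_on UHP"
    using g open_UHP by (auto intro: holomorphic_deriv)
  have bd: "\<exists>B. \<forall>p\<in>?H. cmod (u p) \<le> B" if "u holomorphic_on UHP" for u
  proof -
    have "continuous_on ?H u" using that H(2) holomorphic_on_imp_continuous_on holomorphic_on_subset by blast
    then have "bounded (u ` ?H)" using H(1) by (intro compact_imp_bounded compact_continuous_image)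
    then show ?thesis unfolding bounded_iff by blast
  qed
  obtain B0 where B0: "\<And>p. p \<in> ?H \<Longrightarrow> cmod (g p) \<le> B0" using bd[OF g] by blast
  obtain B1 where B1: "\<And>p. p \<in> ?H \<Longrightarrow> cmod (deriv g p) \<le> B1" using bd[OF g1] by blast
  obtain B2 where B2: "\<And>p. p \<in> ?H \<Longrightarrow> cmod (deriv (deriv g) p) \<le> B2" using bd[OF g2] by blast
  define M where "M = max 1 (max B0 (max B1 B2))"
  have M: "1 \<le> M" "B0 \<le> M" "B1 \<le> M" "B2 \<le> M" by (auto simp: M_def)
  have d0: "(g has_field_derivative deriv g p) (at p within ?H)"
    and d1: "(deriv g has_field_derivative deriv (deriv g) p) (at p within ?H)" if "p \<in> ?H" for p
    using that H(2) holomorphic_derivI[OF g open_UHP] holomorphic_derivI[OF g1 open_UHP]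
    by (auto intro: has_field_derivative_at_within)
  show ?thesis
  proof (rule that[OF M(1)])
    show "cmod (g p) \<le> M" "cmod (deriv g p) \<le> M" if "p \<in> K" for p
      using B0[of p] B1[of p] M H(3) that by auto
    fix p q assume "p \<in> K" "q \<in> K"
    then have pq: "p \<in> ?H" "q \<in> ?H" using H(3) by auto
    let ?f = "\<lambda>i. if i = 0 then g else if i = Suc 0 then deriv g else deriv (deriv g)"
    have "cmod (?f 0 q - (\<Sum>i\<le>0. ?f i p * (q - p) ^ i / fact i)) \<le> M * cmod (q - p) ^ Suc 0 / fact 0"
      by (rule complex_Taylor[OF convex_convex_hull]) (use d0 B1 M pq in \<open>auto intro: order_trans\<close>)
    then show "cmod (g q - g p) \<le> M * cmod (q - p)" by simp
    have "cmod (?f 0 q - (\<Sum>i\<le>Suc 0. ?f i p * (q - p) ^ i / fact i)) \<le> M * cmod (q - p) ^ Suc (Suc 0) / fact (Suc 0)"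
    proof (rule complex_Taylor[OF convex_convex_hull[of K]])
      show "(?f i has_field_derivative ?f (Suc i) x) (at x within ?H)" if "x \<in> ?H" "i \<le> Suc 0" for i x
        using that d0 d1 by (cases i) auto
      show "cmod (?f (Suc (Suc 0)) x) \<le> M" if "x \<in> ?H" for x
        using B2[OF that] M by simp
    qed (use pq in auto)
    then show "cmod (g q - g p - deriv g p * (q - p)) \<le> M * (cmod (q - p))\<^sup>2"
      by (simp add: power2_eq_square diff_diff_eq)
  qed
qed

context partition
begin

lemma cutoff_Lipschitz: obtains C where "C \<ge> 0" "\<And>q q' q''. \<bar>cutoff \<psi> F q q' - cutoff \<psi> F q q''\<bar> \<le> C * cmod (q' - q'')"
proof -
  have "\<exists>M. M \<ge> 0 \<and> (\<forall>q. \<bar>\<psi> j q\<bar> \<le> M)" for j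
    using test_function_bounded[OF psi_test[of j]] by (metis real_norm_def)
  then obtain M where M: "\<And>j. M j \<ge> 0" "\<And>j q. \<bar>\<psi> j q\<bar> \<le> M j" by metis
  have "\<exists>L. L \<ge> 0 \<and> (\<forall>q q'. \<bar>\<psi> j q - \<psi> j q'\<bar> \<le> L * cmod (q - q'))" for j
  proof -
    let ?D = "\<lambda>p. frechet_derivative (\<psi> j) (at p)"
    obtain L1 where L1: "L1 \<ge> 0" "\<And>p. norm (?D p 1) \<le> L1"
      using test_function_bounded[OF test_function_frechet[OF psi_test[of j], of 1]] by blast
    obtain L2 where L2: "L2 \<ge> 0" "\<And>p. norm (?D p \<i>) \<le> L2"
      using test_function_bounded[OF test_function_frechet[OF psi_test[of j], of \<i>]] by blast
    have der: "(\<psi> j has_derivative ?D p) (at p)" for p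
      using psi_test[of j] by (intro smooth_on_has_derivative) (simp add: test_function_def)
    have "norm (?D p v) \<le> (L1 + L2) * norm v" for p v
    proof -
      have l: "linear (?D p)" by (rule has_derivative_linear[OF der])
      have "?D p v = ?D p (Re v *\<^sub>R 1 + Im v *\<^sub>R \<i>)" by (rule arg_cong[of _ _ "?D p"]) (simp add: complex_eq_iff)
      also have "\<dots> = Re v * ?D p 1 + Im v * ?D p \<i>" by (simp add: linear_add[OF l] linear_scale[OF l])
      finally have "norm (?D p v) \<le> \<bar>Re v\<bar> * norm (?D p 1) + \<bar>Im v\<bar> * norm (?D p \<i>)"
        by (metis abs_mult abs_triangle_ineq real_norm_def)
      also have "\<dots> \<le> cmod v * L1 + cmod v * L2"
        by (intro add_mono mult_mono abs_Re_le_cmod abs_Im_le_cmod L1 L2) auto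
      finally show ?thesis by (simp add: algebra_simps)
    qed
    then have "onorm (?D p) \<le> L1 + L2" for p by (intro onorm_le)
    then have "norm (\<psi> j q - \<psi> j q') \<le> (L1 + L2) * norm (q - q')" for q q'
      by (intro differentiable_bound[of UNIV "\<psi> j" ?D]) (auto intro: has_derivative_at_withinI der)
    then show ?thesis using L1(1) L2(1) by (intro exI[of _ "L1 + L2"]) auto
  qed
  then obtain L where L: "\<And>j. L j \<ge> 0" "\<And>j q q'. \<bar>\<psi> j q - \<psi> j q'\<bar> \<le> L j * cmod (q - q')" by metis
  have "\<bar>cutoff \<psi> F q q' - cutoff \<psi> F q q''\<bar> \<le> (\<Sum>j\<in>F. M j * L j) * cmod (q' - q'')" for q q' q''
  proof -
    have "\<bar>cutoff \<psi> F q q' - cutoff \<psi> F q q''\<bar> = \<bar>\<Sum>j\<in>F. \<psi> j q * (\<psi> j q' - \<psi> j q'')\<bar>"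
      by (simp add: cutoff_def sum_subtractf right_diff_distrib)
    also have "\<dots> \<le> (\<Sum>j\<in>F. \<bar>\<psi> j q * (\<psi> j q' - \<psi> j q'')\<bar>)" by (rule sum_abs)
    also have "\<dots> \<le> (\<Sum>j\<in>F. M j * (L j * cmod (q' - q'')))"
      unfolding abs_mult by (intro sum_mono mult_mono M L) auto
    finally show ?thesis by (simp add: sum_distrib_right mult.assoc)
  qed
  moreover have "(\<Sum>j\<in>F. M j * L j) \<ge> 0" by (intro sum_nonneg mult_nonneg_nonneg M L)
  ultimately show ?thesis using that by blast
qed

end

text \<open>Minus the Euclidean gradient of \<open>arg g'\<close>, written without the logarithm
  \<open>G\<close>. For the inverse \<open>f\<close> of \<open>g\<close> this is the gradient of
  \<open>arg f'(g p)\<close> as a function of \<open>p\<close>.\<close>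

definition phase_gradient :: "(complex \<Rightarrow> complex) \<Rightarrow> complex \<Rightarrow> complex" where
  "phase_gradient g p = (cnj (rotation_factor g p) - 1) / of_real (Im p)"

text \<open>The kernel frozen at \<open>p\<close>, as a function of \<open>w = (p - q) / h\<close>:
  the displacement \<open>g p - g q\<close> is linearised, the cutoff has its diagonal value 1, the
  height is taken at \<open>p\<close>, and the phase is its linear part with \<open>n h\<close>
  replaced by \<open>B\<close>.\<close>

definition limit_kernel ::
    "(complex \<times> complex \<Rightarrow> complex) \<Rightarrow> (complex \<Rightarrow> complex) \<Rightarrow> real \<Rightarrow> complex \<Rightarrow> complex \<Rightarrow> complex" where
  "limit_kernel a g B p w = FT a (g p) (deriv g p * w) * of_real ((Im (g p))\<^sup>2)
     * exp (\<i> * of_real (- B * (w \<bullet> phase_gradient g p)))"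

lemma Im_mult_phase_gradient:
  assumes "\<i> * of_real (Im p) * d = rotation_factor g p - 1" "Im p > 0"
  shows "Im (d * w) = - (w \<bullet> phase_gradient g p)"
proof -
  have "cnj d * (- \<i> * of_real (Im p)) = cnj (rotation_factor g p) - 1"
    using arg_cong[OF assms(1), of cnj] by (simp add: mult.commute)
  then have "phase_gradient g p = - \<i> * cnj d"
    unfolding phase_gradient_def using assms(2) by (simp add: field_simps)
  then show ?thesis by (simp add: inner_complex_def algebra_simps)
qed

lemma norm_mult_diff_le:
  fixes x1 x2 y1 y2 :: complex
  assumes "cmod x1 \<le> A" "cmod (x2 - y2) \<le> d2" "cmod (x1 - y1) \<le> d1" "cmod y2 \<le> E"
  shows "cmod (x1 * x2 - y1 * y2) \<le> A * d2 + d1 * E"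
proof -
  have "x1 * x2 - y1 * y2 = x1 * (x2 - y2) + (x1 - y1) * y2" by (simp add: algebra_simps)
  then have "cmod (x1 * x2 - y1 * y2) \<le> cmod x1 * cmod (x2 - y2) + cmod (x1 - y1) * cmod y2"
    by (metis norm_mult norm_triangle_ineq)
  also have "\<dots> \<le> A * d2 + d1 * E"
  proof (intro add_mono mult_mono assms)
    show "0 \<le> A" using assms(1) norm_ge_zero order_trans by blast
    show "0 \<le> d1" using assms(3) norm_ge_zero order_trans by blast
  qed auto
  finally show ?thesis .
qed

locale kernel_data = partition \<psi> + symbol a for \<psi> a +
  fixes f g G :: "complex \<Rightarrow> complex" and F :: "nat set" and B :: real and K :: "complex set"
  assumes fg: "isometry_pair f g"
    and G: "G holomorphic_on UHP" "\<And>z. z \<in> UHP \<Longrightarrow> \<i> * of_real (Im z) * deriv G z = rotation_factor g z - 1"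
    and F: "finite F" "\<And>j q. j \<notin> F \<Longrightarrow> q \<in> base \<Longrightarrow> \<psi> j q = 0"
    and B: "B \<ge> 0"
    and K: "compact K" "K \<subseteq> UHP"
begin

text \<open>This is \<open>h^2\<close> times the kernel of \<open>Op_hyp\<close> pulled back by
  \<open>g\<close>. The exponential is \<open>c q * cnj (c p)\<close> with
  \<open>c = exp (- i n Im G)\<close>, the factor relating the two functions tested.\<close>

definition scaled_kernel :: "real \<Rightarrow> nat \<Rightarrow> complex \<Rightarrow> complex \<Rightarrow> complex" where
  "scaled_kernel h n p q = FT a (g p) ((g p - g q) / of_real h) * of_real (cutoff \<psi> F (g p) (g q))
     * of_real ((Im (g q))\<^sup>2) * exp (\<i> * of_real (n * (Im (G p) - Im (G q))))"

text \<open>Each of the four factors differs from its frozen value by at most a constant times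
  \<open>h (1 + |w|^2)\<close>, and the products telescope. In the phase, the size
  \<open>B / h\<close> of \<open>n\<close> costs one power of \<open>h\<close>, but the Taylor
  remainder has two.\<close>

lemma scaled_kernel_limit:
  obtains C where "C \<ge> 0" "\<And>h n p q. 0 < h \<Longrightarrow> h \<le> 1 \<Longrightarrow> \<bar>n * h - B\<bar> \<le> h \<Longrightarrow> p \<in> K \<Longrightarrow> q \<in> K \<Longrightarrow>
     cmod (scaled_kernel h n p q - limit_kernel a g B p ((p - q) / of_real h)) \<le> C * h * (1 + (cmod ((p - q) / of_real h))\<^sup>2)"
proof -
  note gd = isometry_pairD[OF fg]
  obtain M where M: "M \<ge> 1" "\<And>p. p \<in> K \<Longrightarrow> cmod (g p) \<le> M" "\<And>p. p \<in> K \<Longrightarrow> cmod (deriv g p) \<le> M"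
    "\<And>p q. p \<in> K \<Longrightarrow> q \<in> K \<Longrightarrow> cmod (g q - g p) \<le> M * cmod (q - p)"
    "\<And>p q. p \<in> K \<Longrightarrow> q \<in> K \<Longrightarrow> cmod (g q - g p - deriv g p * (q - p)) \<le> M * (cmod (q - p))\<^sup>2"
    using holomorphic_compact_bounds[OF gd(8) K] by blast
  obtain N where N: "N \<ge> 1" "\<And>p. p \<in> K \<Longrightarrow> cmod (G p) \<le> N" "\<And>p. p \<in> K \<Longrightarrow> cmod (deriv G p) \<le> N"
    "\<And>p q. p \<in> K \<Longrightarrow> q \<in> K \<Longrightarrow> cmod (G q - G p) \<le> N * cmod (q - p)"
    "\<And>p q. p \<in> K \<Longrightarrow> q \<in> K \<Longrightarrow> cmod (G q - G p - deriv G p * (q - p)) \<le> N * (cmod (q - p))\<^sup>2"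
    using holomorphic_compact_bounds[OF G(1) K] by blast
  obtain CA where CA: "CA \<ge> 0" "\<And>q w. cmod (FT a q w) \<le> CA" using FT_bounded by blast
  obtain CL where CL: "CL \<ge> 0" "\<And>q w w'. cmod (FT a q w - FT a q w') \<le> CL * cmod (w - w')" using FT_Lipschitz by blast
  obtain CC where CC: "CC \<ge> 0" "\<And>q q'. \<bar>cutoff \<psi> F q q'\<bar> \<le> CC" using cutoff_bounded by blast
  obtain CP where CP: "CP \<ge> 0" "\<And>q q' q''. \<bar>cutoff \<psi> F q q' - cutoff \<psi> F q q''\<bar> \<le> CP * cmod (q' - q'')"
    using cutoff_Lipschitz by blast
  \<comment> \<open>One constant per factor: transform, cutoff, height, phase. In \<open>C4\<close>,
    one \<open>N\<close> is the error of \<open>n h\<close> against \<open>B\<close>, and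
    \<open>(B + 1) N\<close> is the Taylor remainder with \<open>n h \<le> B + 1\<close>.\<close>
  define C1 C2 C3 C4 where "C1 = CL * M" and "C2 = CP * M" and "C3 = 2 * M * M" and "C4 = (B + 2) * N"
  have C: "C1 \<ge> 0" "C2 \<ge> 0" "C3 \<ge> 0" "C4 \<ge> 0"
    using CL CP M(1) N(1) B by (auto simp: C1_def C2_def C3_def C4_def)
  define CT where "CT = CA * CC * M\<^sup>2 * C4 + (CA * CC * C3 + (CA * C2 + C1) * M\<^sup>2)"
  show ?thesis
  proof (rule that[of CT])
    show "CT \<ge> 0" unfolding CT_def using CA CC C by (intro add_nonneg_nonneg mult_nonneg_nonneg) auto
    fix h :: real and p q :: complex and n :: nat
    assume h: "0 < h" "h \<le> 1" and n: "\<bar>n * h - B\<bar> \<le> h" and pq: "p \<in> K" "q \<in> K"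
    define w where "w = (p - q) / complex_of_real h"
    define u where "u = 1 + (cmod w)\<^sup>2"
    have u: "1 \<le> u" "cmod w \<le> u" "(cmod w)\<^sup>2 \<le> u"
    proof -
      show "cmod w \<le> u"
        unfolding u_def using sum_squares_bound[of 1 "cmod w"] norm_ge_zero[of w]
        by (simp only: power_one mult_1_right)
    qed (auto simp: u_def)
    have hw: "q - p = - of_real h * w" "cmod (q - p) = h * cmod w"
      using h by (simp_all add: w_def norm_divide norm_minus_commute)
    have hu: "h * cmod w \<le> h * u" "h * (cmod w)\<^sup>2 \<le> h * u" using u h by (auto intro: mult_left_mono)
    have pU: "p \<in> UHP" "Im p > 0" using pq K by (auto simp: UHP_def)
    let ?A1 = "FT a (g p) ((g p - g q) / of_real h)" and ?A2 = "FT a (g p) (deriv g p * w)"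
    let ?c1 = "complex_of_real (cutoff \<psi> F (g p) (g q))"
    let ?m1 = "complex_of_real ((Im (g q))\<^sup>2)" and ?m2 = "complex_of_real ((Im (g p))\<^sup>2)"
    let ?x = "real n * (Im (G p) - Im (G q))" and ?y = "- B * (w \<bullet> phase_gradient g p)"
    let ?e1 = "exp (\<i> * of_real ?x)" and ?e2 = "exp (\<i> * of_real ?y)"
    show "cmod (scaled_kernel h n p q - limit_kernel a g B p ((p - q) / of_real h)) \<le> CT * h * (1 + (cmod ((p - q) / of_real h))\<^sup>2)"
    proof (cases "g p \<in> base")
      \<comment> \<open>Off the base both kernels vanish. On it, \<open>F\<close> contains every
        index active at \<open>g p\<close>, so the cutoff is 1 on the diagonal.\<close>
      case False
      then show ?thesis
        using \<open>CT \<ge> 0\<close> h by (simp add: scaled_kernel_def limit_kernel_def FT_zero)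
    next
      case True
      have dA: "cmod (?A1 - ?A2) \<le> C1 * (h * u)"
      proof -
        have "(g p - g q) / of_real h - deriv g p * w = - (g q - g p - deriv g p * (q - p)) / of_real h"
          using h unfolding hw(1) by (simp add: field_simps)
        then have "cmod ((g p - g q) / of_real h - deriv g p * w) = cmod (g q - g p - deriv g p * (q - p)) / h"
          using h by (simp only: norm_divide norm_minus_cancel norm_of_real)
        also have "\<dots> \<le> M * (cmod (q - p))\<^sup>2 / h"
          using M(5)[OF pq] h by (intro divide_right_mono) auto
        also have "\<dots> = M * (h * (cmod w)\<^sup>2)" unfolding hw(2) using h by (simp add: power2_eq_square)
        also have "\<dots> \<le> M * (h * u)" using mult_left_mono[OF hu(2), of M] M(1) by simp
        finally have "CL * cmod ((g p - g q) / of_real h - deriv g p * w) \<le> CL * (M * (h * u))"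
          using CL(1) by (rule mult_left_mono)
        then show ?thesis using CL(2)[of "g p" "(g p - g q) / of_real h" "deriv g p * w"]
          unfolding C1_def by (simp add: mult.assoc)
      qed
      have lin: "cmod (g q - g p) \<le> M * (h * u)"
        using M(4)[OF pq] mult_left_mono[OF hu(1), of M] M(1) unfolding hw(2) by linarith
      have dc: "cmod (?c1 - 1) \<le> C2 * (h * u)"
      proof -
        have "cutoff \<psi> F (g p) (g p) = 1"
          by (rule cutoff_diag[OF F(1)]) (use F(2) True pU gd(6) in auto)
        then have "cmod (?c1 - 1) = \<bar>cutoff \<psi> F (g p) (g q) - cutoff \<psi> F (g p) (g p)\<bar>"
          by (metis norm_of_real of_real_1 of_real_diff)
        also have "\<dots> \<le> CP * cmod (g q - g p)" by (rule CP(2))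
        also have "\<dots> \<le> CP * (M * (h * u))" using lin CP(1) by (rule mult_left_mono)
        finally show ?thesis by (simp add: C2_def mult.assoc)
      qed
      have Imb: "\<bar>Im (g p)\<bar> \<le> M" "\<bar>Im (g q)\<bar> \<le> M"
        using M(2)[OF pq(1)] M(2)[OF pq(2)] abs_Im_le_cmod order_trans by blast+
      have m2: "cmod ?m1 \<le> M\<^sup>2" "cmod ?m2 \<le> M\<^sup>2"
        using power_mono[OF Imb(2) abs_ge_zero, of 2] power_mono[OF Imb(1) abs_ge_zero, of 2]
        by (simp_all only: norm_of_real abs_of_nonneg zero_le_power2 power2_abs)
      have dm: "cmod (?m1 - ?m2) \<le> C3 * (h * u)"
      proof -
        have "cmod (?m1 - ?m2) = \<bar>(Im (g q))\<^sup>2 - (Im (g p))\<^sup>2\<bar>" by (metis norm_of_real of_real_diff)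
        also have "\<dots> = \<bar>Im (g q) + Im (g p)\<bar> * \<bar>Im (g q - g p)\<bar>"
          by (simp add: abs_mult[symmetric] power2_eq_square algebra_simps)
        also have "\<dots> \<le> (2 * M) * (M * (h * u))"
          using Imb lin abs_Im_le_cmod[of "g q - g p"] M(1) by (intro mult_mono) auto
        finally show ?thesis by (simp add: C3_def mult.assoc)
      qed
      have de: "cmod (?e1 - ?e2) \<le> C4 * (h * u)"
      proof -
        define r where "r = Im (G q - G p - deriv G p * (q - p))"
        have "\<bar>r\<bar> \<le> N * (cmod (q - p))\<^sup>2"
          using N(5)[OF pq] abs_Im_le_cmod[of "G q - G p - deriv G p * (q - p)"] unfolding r_def by linarith
        then have r: "\<bar>r\<bar> \<le> N * (h * (h * (cmod w)\<^sup>2))" unfolding hw(2) by (simp add: power2_eq_square ac_simps)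
        have ip: "Im (deriv G p * w) = - (w \<bullet> phase_gradient g p)"
          by (rule Im_mult_phase_gradient[OF G(2)[OF pU(1)] pU(2)])
        have "deriv G p * (q - p) = - of_real h * (deriv G p * w)" unfolding hw(1) by simp
        then have "Im (deriv G p * (q - p)) = - h * Im (deriv G p * w)" by simp
        then have "Im (G q) - Im (G p) = h * (w \<bullet> phase_gradient g p) + r"
          unfolding r_def ip by simp
        then have GG: "Im (G p) - Im (G q) = - (h * (w \<bullet> phase_gradient g p) + r)" by linarith
        \<comment> \<open>The linear part of the phase leaves the mismatch \<open>n h - B\<close>;
          the rest is \<open>n\<close> times the second-order remainder.\<close>
        have xy: "?x - ?y = - ((n * h - B) * (w \<bullet> phase_gradient g p)) - n * r"
          unfolding GG by (simp add: algebra_simps)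
        have ab: "\<bar>w \<bullet> phase_gradient g p\<bar> \<le> N * cmod w"
        proof -
          have "\<bar>w \<bullet> phase_gradient g p\<bar> \<le> cmod (deriv G p * w)" using abs_Im_le_cmod[of "deriv G p * w"] ip by simp
          also have "\<dots> \<le> N * cmod w" unfolding norm_mult using N(3)[OF pq(1)] by (rule mult_right_mono) simp
          finally show ?thesis .
        qed
        have 1: "\<bar>(n * h - B) * (w \<bullet> phase_gradient g p)\<bar> \<le> h * (N * cmod w)"
          unfolding abs_mult by (rule mult_mono[OF n ab]) (use h in auto)
        have nh: "n * h \<le> B + 1" using n h by linarith
        have "\<bar>n * r\<bar> \<le> n * (N * (h * (h * (cmod w)\<^sup>2)))"
          using mult_left_mono[OF r, of "real n"] by (simp add: abs_mult)
        also have "\<dots> = (n * h) * (N * (h * (cmod w)\<^sup>2))" by (simp add: ac_simps)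
        also have "\<dots> \<le> (B + 1) * (N * (h * (cmod w)\<^sup>2))" using nh N(1) h by (intro mult_right_mono) auto
        also have "\<dots> \<le> (B + 1) * (N * (h * u))" using mult_left_mono[OF mult_left_mono[OF hu(2), of N], of "B + 1"] N(1) B by simp
        finally have 2: "\<bar>n * r\<bar> \<le> (B + 1) * (N * (h * u))" .
        have "h * (N * cmod w) \<le> N * (h * u)" using mult_left_mono[OF hu(1), of N] N(1) by (simp add: ac_simps)
        then have "\<bar>?x - ?y\<bar> \<le> N * (h * u) + (B + 1) * (N * (h * u))"
          unfolding xy using 1 2 by linarith
        also have "\<dots> = C4 * (h * u)" by (simp add: C4_def algebra_simps)
        finally show ?thesis using norm_exp_i_diff_le[of ?x ?y] by linarith
      qed
      have 1: "cmod (?A1 * ?c1 - ?A2 * 1) \<le> CA * (C2 * (h * u)) + (C1 * (h * u)) * 1"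
        by (rule norm_mult_diff_le[OF CA(2) dc dA]) simp
      have Ac: "cmod (?A1 * ?c1) \<le> CA * CC"
        unfolding norm_mult norm_of_real by (intro mult_mono CA CC) auto
      have 2: "cmod (?A1 * ?c1 * ?m1 - ?A2 * 1 * ?m2)
          \<le> CA * CC * (C3 * (h * u)) + (CA * (C2 * (h * u)) + (C1 * (h * u)) * 1) * M\<^sup>2"
        by (rule norm_mult_diff_le[OF Ac dm 1 m2(2)])
      have Acm: "cmod (?A1 * ?c1 * ?m1) \<le> CA * CC * M\<^sup>2"
        unfolding norm_mult[of "?A1 * ?c1"] by (rule mult_mono[OF Ac m2(1)]) (use CA CC in auto)
      have "cmod (?A1 * ?c1 * ?m1 * ?e1 - ?A2 * 1 * ?m2 * ?e2)
          \<le> CA * CC * M\<^sup>2 * (C4 * (h * u)) + (CA * CC * (C3 * (h * u)) + (CA * (C2 * (h * u)) + (C1 * (h * u)) * 1) * M\<^sup>2) * 1"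
        by (rule norm_mult_diff_le[OF Acm de 2]) simp
      also have "\<dots> = CT * h * u" by (simp add: CT_def algebra_simps)
      finally show ?thesis unfolding scaled_kernel_def limit_kernel_def w_def u_def by simp
    qed
  qed
qed

text \<open>Decay holds in \<open>(g p - g q) / h\<close>; the Lipschitz bound for \<open>f\<close>
  on the image of \<open>K\<close> converts it to \<open>(p - q) / h\<close>. The exponent 5 makes
  the geometric mean with the growth \<open>(1 + |w|^2)^1\<close> of the limit estimate equal to
  \<open>(1 + |w|^2)^-2\<close>, that is, \<open>decay\<close>.\<close>

lemma scaled_kernel_decay:
  obtains C where "C \<ge> 0" "\<And>h n p q. 0 < h \<Longrightarrow> p \<in> K \<Longrightarrow> q \<in> K \<Longrightarrow>
     cmod (scaled_kernel h n p q) \<le> C / (1 + (cmod ((p - q) / of_real h))\<^sup>2) ^ 5"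
proof -
  note gd = isometry_pairD[OF fg]
  have gK: "compact (g ` K)" "g ` K \<subseteq> UHP"
    using K gd(6,12) by (auto intro!: compact_continuous_image intro: continuous_on_subset)
  obtain M where M: "M \<ge> 1" "\<And>p. p \<in> K \<Longrightarrow> cmod (g p) \<le> M" "\<And>p. p \<in> K \<Longrightarrow> cmod (deriv g p) \<le> M"
    "\<And>p q. p \<in> K \<Longrightarrow> q \<in> K \<Longrightarrow> cmod (g q - g p) \<le> M * cmod (q - p)"
    "\<And>p q. p \<in> K \<Longrightarrow> q \<in> K \<Longrightarrow> cmod (g q - g p - deriv g p * (q - p)) \<le> M * (cmod (q - p))\<^sup>2"
    using holomorphic_compact_bounds[OF gd(8) K] by blast
  obtain N where N: "N \<ge> 1" "\<And>p. p \<in> g ` K \<Longrightarrow> cmod (f p) \<le> N" "\<And>p. p \<in> g ` K \<Longrightarrow> cmod (deriv f p) \<le> N"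
    "\<And>p q. p \<in> g ` K \<Longrightarrow> q \<in> g ` K \<Longrightarrow> cmod (f q - f p) \<le> N * cmod (q - p)"
    "\<And>p q. p \<in> g ` K \<Longrightarrow> q \<in> g ` K \<Longrightarrow> cmod (f q - f p - deriv f p * (q - p)) \<le> N * (cmod (q - p))\<^sup>2"
    using holomorphic_compact_bounds[OF gd(7) gK] by blast
  obtain C5 where C5: "C5 \<ge> 0" "\<And>q w. (1 + (cmod w)\<^sup>2) ^ 5 * cmod (FT a q w) \<le> C5"
    using FT_decay[OF symbol_axioms, of 5] by blast
  obtain CC where CC: "CC \<ge> 0" "\<And>q q'. \<bar>cutoff \<psi> F q q'\<bar> \<le> CC" using cutoff_bounded by blast
  show ?thesis
  proof (rule that[of "(N\<^sup>2) ^ 5 * C5 * CC * M\<^sup>2"])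
    show "0 \<le> (N\<^sup>2) ^ 5 * C5 * CC * M\<^sup>2" using C5 CC by (intro mult_nonneg_nonneg) auto
    fix h :: real and p q :: complex and n :: nat assume h: "0 < h" and pq: "p \<in> K" "q \<in> K"
    let ?w = "(p - q) / complex_of_real h" and ?W = "(g p - g q) / complex_of_real h"
    have "cmod (f (g p) - f (g q)) \<le> N * cmod (g p - g q)" using N(4) pq by blast
    then have "cmod (p - q) \<le> N * cmod (g p - g q)" using gd(3) pq K by (simp add: subset_iff)
    then have "cmod (p - q) / h \<le> N * cmod (g p - g q) / h" using h by (intro divide_right_mono) auto
    then have "cmod ?w \<le> N * cmod ?W" using h by (simp add: norm_divide)
    then have "(cmod ?w)\<^sup>2 \<le> (N * cmod ?W)\<^sup>2" by (intro power_mono) auto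
    moreover have "1 \<le> N\<^sup>2" using N(1) by simp
    ultimately have "1 + (cmod ?w)\<^sup>2 \<le> N\<^sup>2 * (1 + (cmod ?W)\<^sup>2)"
      by (simp add: power_mult_distrib distrib_left)
    then have "(1 + (cmod ?w)\<^sup>2) ^ 5 \<le> (N\<^sup>2 * (1 + (cmod ?W)\<^sup>2)) ^ 5" by (intro power_mono) auto
    then have "(1 + (cmod ?w)\<^sup>2) ^ 5 * cmod (FT a (g p) ?W) \<le> (N\<^sup>2 * (1 + (cmod ?W)\<^sup>2)) ^ 5 * cmod (FT a (g p) ?W)"
      by (rule mult_right_mono) simp
    also have "\<dots> = (N\<^sup>2) ^ 5 * ((1 + (cmod ?W)\<^sup>2) ^ 5 * cmod (FT a (g p) ?W))"
      by (simp only: power_mult_distrib mult.assoc)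
    also have "\<dots> \<le> (N\<^sup>2) ^ 5 * C5" using C5(2) by (intro mult_left_mono) auto
    finally have 1: "(1 + (cmod ?w)\<^sup>2) ^ 5 * cmod (FT a (g p) ?W) \<le> (N\<^sup>2) ^ 5 * C5" .
    have "\<bar>Im (g q)\<bar> \<le> M" using M(2)[OF pq(2)] abs_Im_le_cmod order_trans by blast
    then have 2: "(Im (g q))\<^sup>2 \<le> M\<^sup>2" by (metis abs_ge_zero power2_abs power_mono)
    have 3: "\<bar>cutoff \<psi> F (g p) (g q)\<bar> * (Im (g q))\<^sup>2 \<le> CC * M\<^sup>2"
      by (rule mult_mono[OF CC(2) 2]) (use CC in auto)
    have "(1 + (cmod ?w)\<^sup>2) ^ 5 * cmod (scaled_kernel h n p q)
        = ((1 + (cmod ?w)\<^sup>2) ^ 5 * cmod (FT a (g p) ?W)) * (\<bar>cutoff \<psi> F (g p) (g q)\<bar> * (Im (g q))\<^sup>2)"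
      unfolding scaled_kernel_def norm_mult norm_of_real norm_exp_i_times by simp
    also have "\<dots> \<le> ((N\<^sup>2) ^ 5 * C5) * (CC * M\<^sup>2)"
      by (rule mult_mono[OF 1 3]) (use C5 in auto)
    finally have "cmod (scaled_kernel h n p q) * (1 + (cmod ?w)\<^sup>2) ^ 5 \<le> (N\<^sup>2) ^ 5 * C5 * CC * M\<^sup>2"
      by (simp add: ac_simps)
    moreover have "(1 + (cmod ?w)\<^sup>2) ^ 5 > 0" by (intro zero_less_power add_pos_nonneg) auto
    ultimately show "cmod (scaled_kernel h n p q) \<le> (N\<^sup>2) ^ 5 * C5 * CC * M\<^sup>2 / (1 + (cmod ?w)\<^sup>2) ^ 5"
      by (simp only: pos_le_divide_eq)
  qed
qed

end

section \<open>The transformed symbol\<close>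

text \<open>The inverse transpose of \<open>g'\<close> applied after a covector shift. The real
  transpose of multiplication by \<open>d\<close> is multiplication by \<open>cnj d\<close>, hence
  the conjugate in the denominator.\<close>

definition symbol_map :: "(complex \<Rightarrow> complex) \<Rightarrow> real \<Rightarrow> complex \<times> complex \<Rightarrow> complex \<times> complex" where
  "symbol_map g B = (\<lambda>(p, \<eta>). (g p, (\<eta> + of_real B * phase_gradient g p) / cnj (deriv g p)))"

definition symbol_map_inv ::
    "(complex \<Rightarrow> complex) \<Rightarrow> (complex \<Rightarrow> complex) \<Rightarrow> real \<Rightarrow> complex \<times> complex \<Rightarrow> complex \<times> complex" where
  "symbol_map_inv f g B = (\<lambda>(q, \<xi>). (f q, cnj (deriv g (f q)) * \<xi> - of_real B * phase_gradient g (f q)))"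

definition pullback_symbol ::
    "(complex \<Rightarrow> complex) \<Rightarrow> real \<Rightarrow> (complex \<times> complex \<Rightarrow> complex) \<Rightarrow> complex \<times> complex \<Rightarrow> complex" where
  "pullback_symbol g B a = (\<lambda>z. if fst z \<in> UHP then a (symbol_map g B z) else 0)"

lemma open_UHP_times: "open (UHP \<times> (UNIV :: complex set))"
  by (intro open_Times open_UHP open_UNIV)

lemma Ck_on_Pair:
  assumes "open S" "Ck_on k S f" "Ck_on k S g"
  shows "Ck_on k S (\<lambda>x. (f x, g x))"
proof -
  have "bounded_linear (\<lambda>u. (u :: 'b, 0 :: 'c))" "bounded_linear (\<lambda>u. (0 :: 'b, u :: 'c))"
    by (auto intro!: bounded_linear_intros)
  then have "Ck_on k S (\<lambda>x. (f x, 0) + (0, g x))"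
    using assms by (intro Ck_on_add Ck_on_bounded_linear[of S "\<lambda>u. (u, 0)"] Ck_on_bounded_linear[of S "\<lambda>u. (0, u)"])
  then show ?thesis by simp
qed

lemma Ck_on_symbol_map:
  assumes g: "hyp_local_isometry UHP g"
  shows "Ck_on k (UHP \<times> UNIV) (symbol_map g B)"
proof -
  let ?S = "UHP \<times> (UNIV :: complex set)"
  note o = open_UHP_times
  note d = hyp_local_isometryD[OF g open_UHP]
  have hol: "g holomorphic_on UHP" "deriv g holomorphic_on UHP"
    using g open_UHP by (auto simp: hyp_local_isometry_def intro: holomorphic_deriv)
  have comp: "Ck_on k ?S (\<lambda>z. u (fst z))" if "u holomorphic_on UHP" for u
    by (rule Ck_on_compose[OF o open_UHP _ Ck_on_holomorphic[OF open_UHP that]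
          Ck_on_bounded_linear_id[OF o bounded_linear_fst]]) auto
  have re: "Ck_on k ?S (\<lambda>z. complex_of_real (Im (u (fst z))))" if "u holomorphic_on UHP" for u
    by (rule Ck_on_bounded_linear[OF o bounded_linear_compose[OF bounded_linear_of_real bounded_linear_Im] comp[OF that]])
  have cn: "Ck_on k ?S (\<lambda>z. cnj (deriv g (fst z)))"
    by (rule Ck_on_bounded_linear[OF o bounded_linear_cnj comp[OF hol(2)]])
  have id: "(\<lambda>z. z) holomorphic_on UHP" by (rule holomorphic_on_ident)
  have "Ck_on k ?S (\<lambda>z. (g (fst z), (snd z + of_real B *
      ((cnj (deriv g (fst z)) * of_real (Im (fst z)) * inverse (of_real (Im (g (fst z)))) - 1) * inverse (of_real (Im (fst z)))))
      * inverse (cnj (deriv g (fst z)))))"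
    using d by (intro Ck_on_Pair Ck_on_mult Ck_on_add Ck_on_diff Ck_on_inverse Ck_on_const o comp[OF hol(1)] cn
        re[OF hol(1)] re[OF id] Ck_on_bounded_linear_id bounded_linear_snd) fastforce+
  then show ?thesis
    by (rule Ck_on_cong[OF o, rotated])
      (auto simp: symbol_map_def phase_gradient_def rotation_factor_def divide_inverse)
qed

lemma continuous_on_symbol_map:
  "hyp_local_isometry UHP g \<Longrightarrow> continuous_on (UHP \<times> UNIV) (symbol_map g B)"
  using Ck_on_symbol_map[of g 0 B] by simp

lemma symbol_map_image: "hyp_local_isometry UHP g \<Longrightarrow> z \<in> UHP \<times> UNIV \<Longrightarrow> symbol_map g B z \<in> UHP \<times> UNIV"
  by (auto simp: symbol_map_def hyp_local_isometry_def)

lemma symbol_map_inverse: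
  assumes "isometry_pair f g" "z \<in> UHP \<times> UNIV"
  shows "symbol_map_inv f g B (symbol_map g B z) = z"
  using assms isometry_pairD(4)[of f g] isometry_pairD(3,4,2)[OF assms(1)] hyp_local_isometryD(5)[of UHP g]
  by (auto simp: symbol_map_def symbol_map_inv_def open_UHP)

lemma continuous_on_symbol_map_inv:
  assumes fg: "isometry_pair f g"
  shows "continuous_on (UHP \<times> UNIV) (symbol_map_inv f g B)"
proof -
  note d = isometry_pairD[OF fg]
  have dg: "continuous_on UHP (deriv g)"
    using d(8) open_UHP by (intro holomorphic_on_imp_continuous_on holomorphic_deriv)
  have c1: "continuous_on (UHP \<times> (UNIV::complex set)) (\<lambda>z. f (fst z))"
    by (rule continuous_on_compose2[OF d(11) continuous_on_fst[OF continuous_on_id]]) auto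
  have im: "(\<lambda>z. f (fst z)) ` (UHP \<times> (UNIV::complex set)) \<subseteq> UHP" using d(5) by auto
  have c2: "continuous_on (UHP \<times> (UNIV::complex set)) (\<lambda>z. deriv g (f (fst z)))"
    by (rule continuous_on_compose2[OF dg c1 im])
  have c3: "continuous_on (UHP \<times> (UNIV::complex set)) (\<lambda>z. g (f (fst z)))"
    by (rule continuous_on_compose2[OF d(12) c1 im])
  have nz: "Im z \<noteq> 0" "Im (f z) \<noteq> 0" "Im (g z) \<noteq> 0" if "z \<in> UHP" for z
    using that d(5,6)[OF that] by (auto simp: UHP_def)
  show ?thesis
    unfolding symbol_map_inv_def split_beta' phase_gradient_def rotation_factor_def
    using nz d(3-6) by (intro continuous_intros c1 c2 c3) auto
qed

context
  fixes f g :: "complex \<Rightarrow> complex" and a :: "complex \<times> complex \<Rightarrow> complex" and B :: real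
  assumes fg: "isometry_pair f g" and a: "symbol a"
begin

text \<open>Smoothness is obtained by gluing: over \<open>UHP\<close> the function is a composition
  of smooth maps, and off a compact subset of the bundle it is zero. These two open sets cover the
  whole space.\<close>

lemma pullback_symbol: "symbol (pullback_symbol g B a)"
proof
  let ?b = "pullback_symbol g B a" and ?S = "UHP \<times> (UNIV :: complex set)"
  note g = isometry_pairD(2)[OF fg]
  have at: "test_function ?S a" using a by (simp add: symbol_def)
  let ?K = "symbol_map_inv f g B ` supp a"
  have K: "compact ?K"
    using at continuous_on_symbol_map_inv[OF fg]
    by (intro compact_continuous_image) (auto simp: test_function_def intro: continuous_on_subset)
  have KS: "?K \<subseteq> ?S"
    using at isometry_pairD(5)[OF fg] by (fastforce simp: test_function_def symbol_map_inv_def)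
  have zero: "?b z = 0" if "z \<notin> ?K" for z
  proof (rule ccontr)
    assume "?b z \<noteq> 0"
    then have z: "fst z \<in> UHP" "a (symbol_map g B z) \<noteq> 0" by (auto simp: pullback_symbol_def split: if_splits)
    then have "z \<in> ?S" by (cases z) auto
    from symbol_map_inverse[OF fg this, of B] have "z = symbol_map_inv f g B (symbol_map g B z)" by simp
    then have "z \<in> ?K" using supp_memI[of a, OF z(2)] by blast
    then show False using that by blast
  qed
  have sub: "supp ?b \<subseteq> ?K"
    unfolding supp_def[of ?b] using zero compact_imp_closed[OF K] by (intro closure_minimal) auto
  have "compact (?K \<inter> supp ?b)" using K by (intro compact_Int_closed) (simp_all add: supp_def)
  then have "compact (supp ?b)" using sub by (simp add: Int_absorb1)
  moreover have "Ck_on k UNIV ?b" for k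
  proof -
    have "Ck_on k ?S (\<lambda>z. a (symbol_map g B z))"
      by (rule Ck_on_compose[OF open_UHP_times open_UNIV _ _ Ck_on_symbol_map[OF g]])
        (use at in \<open>auto simp: test_function_def smooth_on_def\<close>)
    then have 1: "Ck_on k ?S ?b"
      by (rule Ck_on_cong[OF open_UHP_times, rotated]) (auto simp: pullback_symbol_def)
    have o: "open (- ?K)" using compact_imp_closed[OF K] by (rule open_Compl)
    have 2: "Ck_on k (- ?K) ?b"
      by (rule Ck_on_cong[OF o _ Ck_on_const[OF o, of k 0]]) (use zero in auto)
    have "?S \<union> - ?K = UNIV" using KS by auto
    then show ?thesis using Ck_on_Un[OF open_UHP_times o 1 2] by simp
  qed
  ultimately show "test_function ?S ?b"
    using sub KS unfolding test_function_def smooth_on_def by blast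
qed

text \<open>Substitute \<open>\<eta> = cnj (g') \<xi> - B * phase_gradient\<close>: the area factor
  is \<open>|g'|^2\<close>, the shift becomes the exponential, and the conjugate moves over to
  \<open>w\<close> under the real inner product.\<close>

lemma FT_pullback_symbol:
  assumes p: "p \<in> UHP"
  shows "FT (pullback_symbol g B a) p w = of_real ((cmod (deriv g p))\<^sup>2) * exp (\<i> * of_real (- B * (w \<bullet> phase_gradient g p)))
    * FT a (g p) (deriv g p * w)"
proof -
  interpret symbol a by (rule a)
  let ?c = "cnj (deriv g p)" and ?\<tau> = "phase_gradient g p"
  have c: "?c \<noteq> 0" using hyp_local_isometryD(5)[OF isometry_pairD(2)[OF fg] open_UHP p] by simp
  let ?t = "- (of_real B * ?\<tau>)"
  let ?F = "\<lambda>\<eta>. exp (\<i> * of_real (w \<bullet> \<eta>)) * pullback_symbol g B a (p, \<eta>)"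
  have F: "?F \<in> borel_measurable borel"
    using borel_measurable_integrable[OF symbol.integrable_fibre[OF pullback_symbol, of w p]] by simp
  have in1: "w \<bullet> (?c * \<xi>) = (deriv g p * w) \<bullet> \<xi>" for \<xi>
    by (simp add: inner_complex_def algebra_simps)
  have in2: "w \<bullet> ?t = - B * (w \<bullet> ?\<tau>)"
    by (simp add: inner_complex_def algebra_simps)
  have "?F (?c * \<xi> + ?t) = exp (\<i> * of_real (- B * (w \<bullet> ?\<tau>))) * (exp (\<i> * of_real ((deriv g p * w) \<bullet> \<xi>)) * a (g p, \<xi>))" for \<xi>
  proof -
    have "pullback_symbol g B a (p, ?c * \<xi> + ?t) = a (g p, \<xi>)"
      using p c by (simp add: pullback_symbol_def symbol_map_def)
    moreover have "w \<bullet> (?c * \<xi> + ?t) = - B * (w \<bullet> ?\<tau>) + (deriv g p * w) \<bullet> \<xi>"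
      by (simp only: inner_add_right in1 in2 add.commute)
    ultimately show ?thesis by (simp only: of_real_add distrib_left exp_add mult.assoc)
  qed
  then have "(\<integral>\<eta>. ?F \<eta> \<partial>lborel) = of_real ((cmod ?c)\<^sup>2) *
     (\<integral>\<xi>. exp (\<i> * of_real (- B * (w \<bullet> ?\<tau>))) * (exp (\<i> * of_real ((deriv g p * w) \<bullet> \<xi>)) * a (g p, \<xi>)) \<partial>lborel)"
    using lborel_integral_affine[OF c F, of ?t] by simp
  then show ?thesis
    unfolding FT_def by (simp add: mult.assoc)
qed

end

lemma isometry_pair_id: "isometry_pair (\<lambda>z. z) (\<lambda>z. z)"
  by (auto simp: isometry_pair_def hyp_local_isometry_def UHP_def)

lemma rotation_factor_id: "z \<in> UHP \<Longrightarrow> rotation_factor (\<lambda>z. z) z = 1"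
  by (auto simp: rotation_factor_def UHP_def)

text \<open>The two quadratic forms have the same frozen kernel:
  \<open>|g'|^2 (Im p)^2 = (Im (g p))^2\<close> absorbs the area factor, and the identity map has
  zero phase gradient, so \<open>B'\<close> is arbitrary.\<close>

lemma limit_kernel_pullback:
  assumes fg: "isometry_pair f g" and a: "symbol a" and p: "p \<in> UHP"
  shows "limit_kernel (pullback_symbol g B a) (\<lambda>z. z) B' p w = limit_kernel a g B p w"
proof -
  have y: "Im p > 0" "cmod (deriv g p) * Im p = Im (g p)"
    using hyp_local_isometryD(1,4)[OF isometry_pairD(2)[OF fg] open_UHP p] by auto
  have "phase_gradient (\<lambda>z. z) p = 0" using rotation_factor_id[OF p] by (simp add: phase_gradient_def)
  moreover have "(cmod (deriv g p))\<^sup>2 * (Im p)\<^sup>2 = (Im (g p))\<^sup>2" by (simp add: y(2)[symmetric] power_mult_distrib)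
  then have "complex_of_real ((cmod (deriv g p))\<^sup>2) * of_real ((Im p)\<^sup>2) = of_real ((Im (g p))\<^sup>2)"
    by (metis of_real_mult)
  ultimately show ?thesis
    unfolding limit_kernel_def using FT_pullback_symbol[OF fg a p, of B w]
    by (simp add: ac_simps del: of_real_power)
qed

section \<open>Comparison of the quadratic forms\<close>

text \<open>Here \<open>c\<close> is the factor in \<open>v (g p) = c p * v' p\<close>; it is
  conjugated in the variable in which the quadratic form conjugates \<open>v\<close>.\<close>

definition transported_kernel ::
    "(complex \<Rightarrow> complex \<Rightarrow> complex) \<Rightarrow> (complex \<Rightarrow> complex) \<Rightarrow> (complex \<Rightarrow> complex) \<Rightarrow> complex \<Rightarrow> complex \<Rightarrow> complex" where
  "transported_kernel D g c p q = (if p \<in> UHP \<and> q \<in> UHP then D (g p) (g q) * c q * cnj (c p) else 0)"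

text \<open>\<open>hyp_area\<close> is invariant under \<open>g\<close>, hence so is its product
  with itself, and the claim is one change of variables. Points outside \<open>UHP\<close> are sent
  to 0, where \<open>v\<close> vanishes.\<close>

lemma quad_form_transport:
  assumes fg: "isometry_pair f g"
    and D: "(\<lambda>z. D (fst z) (snd z)) \<in> borel_measurable (borel \<Otimes>\<^sub>M borel)"
    and v: "v \<in> borel_measurable borel" and v0: "\<And>z. z \<notin> UHP \<Longrightarrow> v z = 0" "\<And>z. z \<notin> UHP \<Longrightarrow> v' z = 0"
    and rel: "\<And>p. p \<in> UHP \<Longrightarrow> v (g p) = c p * v' p"
    and int: "integrable (hyp_area \<Otimes>\<^sub>M hyp_area) (\<lambda>z. D (fst z) (snd z) * v (snd z) * cnj (v (fst z)))"
  shows "integrable (hyp_area \<Otimes>\<^sub>M hyp_area) (\<lambda>z. transported_kernel D g c (fst z) (snd z) * v' (snd z) * cnj (v' (fst z)))"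
    and "quad_form D v = quad_form (transported_kernel D g c) v'"
proof -
  let ?m = "hyp_area \<Otimes>\<^sub>M hyp_area"
  let ?g = "\<lambda>z. if z \<in> UHP then g z else (0::complex)"
  let ?T = "\<lambda>(x, y). (?g x, ?g y)"
  let ?k = "\<lambda>z. D (fst z) (snd z) * v (snd z) * cnj (v (fst z))"
  note gm [measurable] = isometry_measurable[OF fg]
  note D [measurable] v [measurable]
  have gm': "?g \<in> hyp_area \<rightarrow>\<^sub>M borel" by measurable
  have "distr hyp_area borel ?g \<Otimes>\<^sub>M distr hyp_area borel ?g = distr ?m (borel \<Otimes>\<^sub>M borel) ?T"
    by (rule pair_measure_distr[OF gm' gm']) (simp add: distr_hyp_area_isometry[OF fg] sigma_finite_hyp_area)
  then have eq: "?m = distr ?m (borel \<Otimes>\<^sub>M borel) ?T"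
    by (simp add: distr_hyp_area_isometry[OF fg])
  have Tm: "?T \<in> ?m \<rightarrow>\<^sub>M (borel \<Otimes>\<^sub>M borel)" by measurable
  have km: "?k \<in> borel_measurable (borel \<Otimes>\<^sub>M borel)" by measurable
  have "(0::complex) \<notin> UHP" by (simp add: UHP_def)
  then have k: "?k (?T z) = transported_kernel D g c (fst z) (snd z) * v' (snd z) * cnj (v' (fst z))" for z
    using v0(1)[of 0] by (auto simp: transported_kernel_def rel v0 split_beta' ac_simps)
  have "integrable (distr ?m (borel \<Otimes>\<^sub>M borel) ?T) ?k" using int eq by simp
  then have "integrable ?m (\<lambda>z. ?k (?T z))"
    by (subst (asm) integrable_distr_eq[OF Tm km])
  then show "integrable ?m (\<lambda>z. transported_kernel D g c (fst z) (snd z) * v' (snd z) * cnj (v' (fst z)))"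
    unfolding k .
  have "quad_form D v = (\<integral>z. ?k z \<partial>distr ?m (borel \<Otimes>\<^sub>M borel) ?T)"
    unfolding quad_form_def using eq by simp
  also have "\<dots> = (\<integral>z. ?k (?T z) \<partial>?m)" by (rule integral_distr[OF Tm km])
  finally show "quad_form D v = quad_form (transported_kernel D g c) v'"
    unfolding k quad_form_def .
qed

lemma rotation_factor_inverse:
  assumes fg: "isometry_pair f g" and z: "z \<in> UHP"
  shows "rotation_factor f (g z) * rotation_factor g z = 1"
proof -
  note d = isometry_pairD[OF fg]
  have gz: "g z \<in> UHP" by (rule d(6)[OF z])
  note h1 = hyp_local_isometryD[OF d(1) open_UHP gz] and h2 = hyp_local_isometryD[OF d(2) open_UHP z]
  have "((\<lambda>w. f (g w)) has_field_derivative deriv f (g z) * deriv g z) (at z)"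
    by (rule DERIV_chain2[OF h1(3) h2(3)])
  moreover have "((\<lambda>w. f (g w)) has_field_derivative 1) (at z)"
    by (rule has_field_derivative_transform_within_open[OF DERIV_ident open_UHP z]) (simp add: d(3))
  ultimately have "deriv f (g z) * deriv g z = 1" by (rule DERIV_unique)
  then show ?thesis
    using h1(1) h2(1) d(3)[OF z] by (simp add: rotation_factor_def field_simps)
qed

lemma locally_L2_bounded_extend:
  assumes v: "locally_L2_bounded v"
  shows "locally_L2 (\<lambda>z. if z \<in> UHP then v k z else 0)"
    and "compact K \<Longrightarrow> K \<subseteq> UHP \<Longrightarrow>
      \<exists>C\<ge>0. \<forall>k. (\<integral>\<^sup>+z\<in>K. ennreal ((cmod (if z \<in> UHP then v k z else 0))\<^sup>2) \<partial>hyp_area) \<le> ennreal C"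
proof -
  have bd: "\<exists>C\<ge>0. \<forall>k. (\<integral>\<^sup>+z\<in>K. ennreal ((cmod (if z \<in> UHP then v k z else 0))\<^sup>2) \<partial>hyp_area) \<le> ennreal C"
    if K: "compact K" "K \<subseteq> UHP" for K
  proof -
    obtain C where C: "\<And>k. (\<integral>\<^sup>+z\<in>K. ennreal ((cmod (v k z))\<^sup>2) \<partial>hyp_area) \<le> ennreal C"
      using v K unfolding locally_L2_bounded_def by blast
    have eq: "(\<integral>\<^sup>+z\<in>K. ennreal ((cmod (if z \<in> UHP then v k z else 0))\<^sup>2) \<partial>hyp_area)
        = (\<integral>\<^sup>+z\<in>K. ennreal ((cmod (v k z))\<^sup>2) \<partial>hyp_area)" for k
      using K(2) by (intro nn_integral_cong) (auto simp: indicator_def)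
    have "ennreal C \<le> ennreal (max C 0)" by (rule ennreal_leI) simp
    from order_trans[OF C this] show ?thesis
      by (intro exI[of _ "max C 0"]) (simp only: eq, simp)
  qed
  then show "compact K \<Longrightarrow> K \<subseteq> UHP \<Longrightarrow>
      \<exists>C\<ge>0. \<forall>k. (\<integral>\<^sup>+z\<in>K. ennreal ((cmod (if z \<in> UHP then v k z else 0))\<^sup>2) \<partial>hyp_area) \<le> ennreal C"
    by blast
  have "v k \<in> borel_measurable (restrict_space borel UHP)"
    using v by (simp add: locally_L2_bounded_def)
  then have "(\<lambda>z. if z \<in> UHP then v k z else 0) \<in> borel_measurable borel"
    by (subst measurable_If_restrict_space_iff) (auto simp: Collect_neg_eq)
  then show "locally_L2 (\<lambda>z. if z \<in> UHP then v k z else 0)"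
    unfolding locally_L2_def
  proof (intro conjI allI impI)
    fix K assume "compact K \<and> K \<subseteq> UHP"
    then obtain C where "\<forall>k. (\<integral>\<^sup>+z\<in>K. ennreal ((cmod (if z \<in> UHP then v k z else 0))\<^sup>2) \<partial>hyp_area) \<le> ennreal C"
      using bd by blast
    then have "(\<integral>\<^sup>+z\<in>K. ennreal ((cmod (if z \<in> UHP then v k z else 0))\<^sup>2) \<partial>hyp_area) \<le> ennreal C" by blast
    also have "\<dots> < \<infinity>" by simp
    finally show "(\<integral>\<^sup>+z\<in>K. ennreal ((cmod (if z \<in> UHP then v k z else 0))\<^sup>2) \<partial>hyp_area) < \<infinity>" .
  qed
qed

lemma transported_kernel_measurable:
  assumes fg: "isometry_pair f g"
    and D: "(\<lambda>z. D (fst z) (snd z)) \<in> borel_measurable (borel \<Otimes>\<^sub>M borel)"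
    and c: "continuous_on UHP c"
  shows "(\<lambda>z. transported_kernel D g c (fst z) (snd z)) \<in> borel_measurable (borel \<Otimes>\<^sub>M borel)"
proof -
  let ?g = "\<lambda>z. if z \<in> UHP then g z else (0::complex)" and ?c = "\<lambda>z. if z \<in> UHP then c z else (0::complex)"
  note gm [measurable] = isometry_measurable[OF fg]
  have cm [measurable]: "?c \<in> borel_measurable borel"
    using c borel_measurable_continuous_on_if[of UHP c "\<lambda>_. 0"] by simp
  have "(\<lambda>z. (?g (fst z), ?g (snd z))) \<in> borel \<Otimes>\<^sub>M borel \<rightarrow>\<^sub>M borel \<Otimes>\<^sub>M borel" by measurable
  from measurable_compose[OF this D]
  have Dg: "(\<lambda>z. D (?g (fst z)) (?g (snd z))) \<in> borel_measurable (borel \<Otimes>\<^sub>M borel)"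
    by (simp only: fst_conv snd_conv)
  have "(\<lambda>z. D (?g (fst z)) (?g (snd z)) * ?c (snd z) * cnj (?c (fst z))) \<in> borel_measurable (borel \<Otimes>\<^sub>M borel)"
    by (intro borel_measurable_times Dg measurable_compose[OF measurable_snd cm]
        measurable_compose[OF measurable_compose[OF measurable_fst cm] borel_measurable_cnj])
  also have "(\<lambda>z. D (?g (fst z)) (?g (snd z)) * ?c (snd z) * cnj (?c (fst z))) = (\<lambda>z. transported_kernel D g c (fst z) (snd z))"
    by (auto simp: transported_kernel_def fun_eq_iff)
  finally show ?thesis .
qed

text \<open>Multiply the two bounds: \<open>h (1 + |w|^2)\<close> times
  \<open>(1 + |w|^2)^-5\<close> is \<open>h (1 + |w|^2)^-4\<close>, the square of
  \<open>sqrt h * decay w\<close>.\<close>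

lemma geometric_mean_decay:
  assumes "X \<ge> 0" "X \<le> C * h * (1 + (cmod w)\<^sup>2)" "X \<le> C / (1 + (cmod w)\<^sup>2) ^ 5" "h > 0" "C \<ge> 0"
  shows "X \<le> C * sqrt h * decay w"
proof (rule power2_le_imp_le)
  let ?u = "1 + (cmod w)\<^sup>2"
  have u: "?u > 0" by (intro add_pos_nonneg) auto
  have "X\<^sup>2 \<le> (C * h * ?u) * (C / ?u ^ 5)"
    unfolding power2_eq_square[of X] by (rule mult_mono[OF assms(2,3)]) (use assms u in auto)
  also have "\<dots> = (C * sqrt h * decay w)\<^sup>2"
  proof -
    have "(C * h * u) * (C / u ^ 5) = (C * sqrt h * (1 / u\<^sup>2))\<^sup>2" if "u > 0" for u :: real
      using that assms(4) by (simp add: power_mult_distrib power_divide) (simp add: field_simps eval_nat_numeral)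
    from this[OF u] show ?thesis by (simp only: decay_def)
  qed
  finally show "X\<^sup>2 \<le> (C * sqrt h * decay w)\<^sup>2" .
qed (use assms decay_nonneg in auto)

lemma (in partition) op_kernel_nonzero:
  assumes "symbol a" "op_kernel \<psi> F h a p q \<noteq> 0"
  shows "p \<in> symbol.base a" "q \<in> cover_supp F"
proof -
  have "FT a p ((p - q) / of_real h) \<noteq> 0" "cutoff \<psi> F p q \<noteq> 0" using assms(2) by (auto simp: op_kernel_def)
  then show "p \<in> symbol.base a" "q \<in> cover_supp F"
    using symbol.FT_zero[OF assms(1)] cutoff_nonzero by blast+
qed

lemma (in partition) quantization_isometry:
  assumes fg: "isometry_pair f g" and a: "symbol a" and B: "B \<ge> 0"
    and h: "filterlim h (at_right 0) sequentially"
    and n: "eventually (\<lambda>k. \<bar>real (n k) * h k - B\<bar> \<le> h k) sequentially"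
    and v: "locally_L2_bounded v" and v': "locally_L2_bounded v'"
    and rel: "\<And>k z. z \<in> UHP \<Longrightarrow> v' k z = rotation_factor f z ^ n k * v k (f z)"
  shows "(\<lambda>k. inner_L2 (Op_hyp \<psi> (h k) a (v' k)) (v' k)
    - inner_L2 (Op_hyp \<psi> (h k) (pullback_symbol g B a) (v k)) (v k)) \<longlonglongrightarrow> 0"
proof -
  let ?b = "pullback_symbol g B a"
  have b: "symbol ?b" by (rule pullback_symbol[OF fg a])
  note d = isometry_pairD[OF fg]
  obtain G where G: "G holomorphic_on UHP" "\<And>z. z \<in> UHP \<Longrightarrow> rotation_factor g z = exp (\<i> * of_real (Im (G z)))"
    "\<And>z. z \<in> UHP \<Longrightarrow> \<i> * of_real (Im z) * deriv G z = rotation_factor g z - 1"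
    using hyp_isometry_log_deriv[OF d(2)] by blast
  let ?A = "symbol.base a" and ?A' = "symbol.base ?b"
  have A: "compact ?A" "?A \<subseteq> UHP" "compact ?A'" "?A' \<subseteq> UHP"
    using symbol.compact_base[OF a] symbol.base_UHP[OF a] symbol.compact_base[OF b] symbol.base_UHP[OF b] by auto
  obtain F where F: "finite F" "\<And>j q. j \<notin> F \<Longrightarrow> q \<in> ?A \<union> ?A' \<Longrightarrow> \<psi> j q = 0"
    using finite_cover[of "?A \<union> ?A'"] A by (metis compact_Un Un_least)
  \<comment> \<open>\<open>K\<close> has to contain the supports of both kernels: base and
    second-variable support, taken directly for the pulled-back symbol and through \<open>f\<close>
    for the transported kernel.\<close>
  define K where "K = f ` ?A \<union> f ` cover_supp F \<union> (?A' \<union> cover_supp F)"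
  have cf: "compact (f ` S) \<and> f ` S \<subseteq> UHP" if "compact S" "S \<subseteq> UHP" for S
    using that d(5,11) by (auto intro!: compact_continuous_image intro: continuous_on_subset)
  have K: "compact K" "K \<subseteq> UHP"
    unfolding K_def using cf[OF A(1,2)] cf[OF compact_cover_supp[OF F(1)] cover_supp_UHP] A compact_cover_supp[OF F(1)] cover_supp_UHP
    by auto
  interpret P: kernel_data \<psi> a f g G F B K
    by (intro kernel_data.intro partition_axioms a kernel_data_axioms.intro fg G F B K) auto
  \<comment> \<open>The kernel of \<open>?b\<close> itself is the case of the identity isometry with
    phase 0, so the same two estimates cover it.\<close>
  interpret Q: kernel_data \<psi> ?b "\<lambda>z. z" "\<lambda>z. z" "\<lambda>_. 0" F B K
    by (intro kernel_data.intro partition_axioms b kernel_data_axioms.intro isometry_pair_id F B K)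
      (auto simp: rotation_factor_id)
  obtain C1 where C1: "C1 \<ge> 0" "\<And>h n p q. 0 < h \<Longrightarrow> h \<le> 1 \<Longrightarrow> \<bar>real n * h - B\<bar> \<le> h \<Longrightarrow> p \<in> K \<Longrightarrow> q \<in> K \<Longrightarrow>
     cmod (P.scaled_kernel h n p q - limit_kernel a g B p ((p - q) / of_real h)) \<le> C1 * h * (1 + (cmod ((p - q) / of_real h))\<^sup>2)"
    using P.scaled_kernel_limit by blast
  obtain C2 where C2: "C2 \<ge> 0" "\<And>h n p q. 0 < h \<Longrightarrow> h \<le> 1 \<Longrightarrow> \<bar>real n * h - B\<bar> \<le> h \<Longrightarrow> p \<in> K \<Longrightarrow> q \<in> K \<Longrightarrow>
     cmod (Q.scaled_kernel h n p q - limit_kernel ?b (\<lambda>z. z) B p ((p - q) / of_real h)) \<le> C2 * h * (1 + (cmod ((p - q) / of_real h))\<^sup>2)"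
    using Q.scaled_kernel_limit by blast
  obtain C3 where C3: "C3 \<ge> 0" "\<And>h n p q. 0 < h \<Longrightarrow> p \<in> K \<Longrightarrow> q \<in> K \<Longrightarrow>
     cmod (P.scaled_kernel h n p q) \<le> C3 / (1 + (cmod ((p - q) / of_real h))\<^sup>2) ^ 5"
    using P.scaled_kernel_decay by blast
  obtain C4 where C4: "C4 \<ge> 0" "\<And>h n p q. 0 < h \<Longrightarrow> p \<in> K \<Longrightarrow> q \<in> K \<Longrightarrow>
     cmod (Q.scaled_kernel h n p q) \<le> C4 / (1 + (cmod ((p - q) / of_real h))\<^sup>2) ^ 5"
    using Q.scaled_kernel_decay by blast
  obtain M where M: "schur_bound K M" using schur_test[OF K] by blast
  obtain L where L: "L \<ge> 0"
    "\<And>k. (\<integral>\<^sup>+z\<in>K. ennreal ((cmod (if z \<in> UHP then v k z else 0))\<^sup>2) \<partial>hyp_area) \<le> ennreal L"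
    using locally_L2_bounded_extend(2)[OF v K] by blast
  define C where "C = C1 + C2 + C3 + C4"
  have C: "C \<ge> 0" "C1 + C2 \<le> C" "C3 + C4 \<le> C" using C1(1) C2(1) C3(1) C4(1) by (auto simp: C_def)
  have main: "cmod (inner_L2 (Op_hyp \<psi> (h k) a (v' k)) (v' k) - inner_L2 (Op_hyp \<psi> (h k) ?b (v k)) (v k))
      \<le> M * (C * sqrt (h k)) * L"
    if hk: "0 < h k" "h k \<le> 1" and nk: "\<bar>real (n k) * h k - B\<bar> \<le> h k" for k
  proof -
    let ?v = "\<lambda>z. if z \<in> UHP then v k z else 0" and ?v' = "\<lambda>z. if z \<in> UHP then v' k z else 0"
    let ?D = "op_kernel \<psi> F (h k) a" and ?D' = "op_kernel \<psi> F (h k) ?b"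
    \<comment> \<open>The minus sign arises because the rotation factor of \<open>f\<close> at
      \<open>g p\<close> is the inverse of that of \<open>g\<close> at \<open>p\<close>.\<close>
    define c where "c = (\<lambda>p. exp (\<i> * of_real (- (real (n k) * Im (G p)))))"
    let ?T = "transported_kernel ?D g c"
    have lv: "locally_L2 ?v" "locally_L2 ?v'"
      using locally_L2_bounded_extend(1)[OF v] locally_L2_bounded_extend(1)[OF v'] by auto
    then have vm: "?v \<in> borel_measurable borel" "?v' \<in> borel_measurable borel"
      by (auto simp: locally_L2_def)
    have relc: "?v' (g p) = c p * ?v p" if p: "p \<in> UHP" for p
    proof -
      have "rotation_factor f (g p) * exp (\<i> * of_real (Im (G p))) = 1"
        using rotation_factor_inverse[OF fg p] G(2)[OF p] by simp
      then have "rotation_factor f (g p) = exp (- (\<i> * of_real (Im (G p))))"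
        by (simp add: exp_minus inverse_eq_divide nonzero_eq_divide_eq)
      then have "rotation_factor f (g p) ^ n k = c p"
        by (simp add: c_def exp_of_nat_mult[symmetric] ac_simps)
      then show ?thesis using rel[of "g p" k] d(3,6)[OF p] p by simp
    qed
    have int1: "integrable (hyp_area \<Otimes>\<^sub>M hyp_area) (\<lambda>z. ?D (fst z) (snd z) * ?v' (snd z) * cnj (?v' (fst z)))"
      by (rule op_kernel_integrable[OF a hk(1) F(1) lv(2)])
    have int2: "integrable (hyp_area \<Otimes>\<^sub>M hyp_area) (\<lambda>z. ?D' (fst z) (snd z) * ?v (snd z) * cnj (?v (fst z)))"
      by (rule op_kernel_integrable[OF b hk(1) F(1) lv(1)])
    have int3: "integrable (hyp_area \<Otimes>\<^sub>M hyp_area) (\<lambda>z. ?T (fst z) (snd z) * ?v (snd z) * cnj (?v (fst z)))"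
      by (rule quad_form_transport(1)[OF fg op_kernel_measurable[OF a] vm(2) _ _ relc int1]) auto
    have eq1: "inner_L2 (Op_hyp \<psi> (h k) a (v' k)) (v' k) = quad_form ?T ?v"
    proof -
      have "inner_L2 (Op_hyp \<psi> (h k) a (v' k)) (v' k) = quad_form ?D ?v'"
        unfolding inner_L2_extend[of "h k" a "v' k"]
        by (rule inner_L2_eq_quad_form[OF a hk(1) F(1) _ lv(2)]) (use F(2) in auto)
      also have "\<dots> = quad_form ?T ?v"
        by (rule quad_form_transport(2)[OF fg op_kernel_measurable[OF a] vm(2) _ _ relc int1]) auto
      finally show ?thesis .
    qed
    have eq2: "inner_L2 (Op_hyp \<psi> (h k) ?b (v k)) (v k) = quad_form ?D' ?v"
      unfolding inner_L2_extend[of "h k" ?b "v k"]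
      by (rule inner_L2_eq_quad_form[OF b hk(1) F(1) _ lv(1)]) (use F(2) in auto)
    let ?E = "\<lambda>p q. ?T p q - ?D' p q"
    have "quad_form ?T ?v - quad_form ?D' ?v = quad_form ?E ?v"
      unfolding quad_form_def using Bochner_Integration.integral_diff[OF int3 int2] by (simp add: left_diff_distrib)
    moreover have "cmod (quad_form ?E ?v) \<le> M * (C * sqrt (h k)) * L"
    proof (rule schur_boundD(2)[OF M hk(1) _ L(1) _ _ _ vm(1) L(2)])
      show "0 \<le> C * sqrt (h k)" using C(1) hk by simp
      have "continuous_on UHP c"
        unfolding c_def using G(1) by (intro continuous_intros holomorphic_on_imp_continuous_on)
      then have "(\<lambda>z. ?T (fst z) (snd z)) \<in> borel_measurable (borel \<Otimes>\<^sub>M borel)"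
        by (rule transported_kernel_measurable[OF fg op_kernel_measurable[OF a]])
      then show "(\<lambda>z. ?E (fst z) (snd z)) \<in> borel_measurable (borel \<Otimes>\<^sub>M borel)"
        using op_kernel_measurable[OF b] by (rule borel_measurable_diff)
      show "p \<in> K \<and> q \<in> K" if "?E p q \<noteq> 0" for p q
      proof (cases "?D' p q = 0")
        case False
        then show ?thesis using op_kernel_nonzero[OF b] unfolding K_def by blast
      next
        case True
        then have "?T p q \<noteq> 0" using that by simp
        then have pq: "p \<in> UHP" "q \<in> UHP" "?D (g p) (g q) \<noteq> 0"
          by (auto simp: transported_kernel_def split: if_splits)
        then have "g p \<in> ?A" "g q \<in> cover_supp F" using op_kernel_nonzero[OF a pq(3)] by auto
        then have "f (g p) \<in> K" "f (g q) \<in> K" unfolding K_def by auto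
        then show ?thesis using d(3) pq by simp
      qed
      fix p q assume pq: "p \<in> K" "q \<in> K"
      then have pqU: "p \<in> UHP" "q \<in> UHP" using K by auto
      let ?w = "(p - q) / complex_of_real (h k)"
      have h2: "complex_of_real ((h k)\<^sup>2) \<noteq> 0" using hk by simp
      have "c q * cnj (c p) = exp (\<i> * of_real (n k * (Im (G p) - Im (G q))))"
        by (simp add: c_def exp_cnj exp_add[symmetric] algebra_simps)
      then have "?T p q = P.scaled_kernel (h k) (n k) p q / of_real ((h k)\<^sup>2)"
        using pqU h2 by (simp add: transported_kernel_def op_kernel_def P.scaled_kernel_def mult.assoc)
      moreover have "?D' p q = Q.scaled_kernel (h k) (n k) p q / of_real ((h k)\<^sup>2)"
        by (simp add: op_kernel_def Q.scaled_kernel_def mult.assoc)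
      ultimately have E: "?E p q = (P.scaled_kernel (h k) (n k) p q - Q.scaled_kernel (h k) (n k) p q) / of_real ((h k)\<^sup>2)"
        by (simp only: diff_divide_distrib)
      let ?X = "cmod (P.scaled_kernel (h k) (n k) p q - Q.scaled_kernel (h k) (n k) p q)"
      have "?X \<le> C * sqrt (h k) * decay ?w"
      proof (rule geometric_mean_decay)
        let ?l = "limit_kernel a g B p ?w"
        have "cmod (Q.scaled_kernel (h k) (n k) p q - ?l) \<le> C2 * h k * (1 + (cmod ?w)\<^sup>2)"
          using C2(2)[OF hk nk pq] by (simp only: limit_kernel_pullback[OF fg a pqU(1)])
        moreover have "cmod (P.scaled_kernel (h k) (n k) p q - ?l) \<le> C1 * h k * (1 + (cmod ?w)\<^sup>2)"
          by (rule C1(2)[OF hk nk pq])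
        ultimately have "?X \<le> C1 * h k * (1 + (cmod ?w)\<^sup>2) + C2 * h k * (1 + (cmod ?w)\<^sup>2)"
          by (metis norm_minus_commute norm_triangle_le_diff norm_diff_triangle_le)
        also have "\<dots> = (C1 + C2) * (h k * (1 + (cmod ?w)\<^sup>2))" by (simp add: algebra_simps)
        also have "\<dots> \<le> C * (h k * (1 + (cmod ?w)\<^sup>2))"
          by (rule mult_right_mono[OF C(2)]) (use hk in simp)
        finally show "?X \<le> C * h k * (1 + (cmod ?w)\<^sup>2)" by (simp add: mult.assoc)
        have "?X \<le> C3 / (1 + (cmod ?w)\<^sup>2) ^ 5 + C4 / (1 + (cmod ?w)\<^sup>2) ^ 5"
          using norm_triangle_ineq4 C3(2)[OF hk(1) pq, of "n k"] C4(2)[OF hk(1) pq, of "n k"] by (meson add_mono order_trans)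
        also have "\<dots> \<le> C / (1 + (cmod ?w)\<^sup>2) ^ 5"
          unfolding add_divide_distrib[symmetric] by (rule divide_right_mono[OF C(3)]) simp
        finally show "?X \<le> C / (1 + (cmod ?w)\<^sup>2) ^ 5" .
      qed (use hk C(1) in auto)
      then have "?X / (h k)\<^sup>2 \<le> C * sqrt (h k) * decay ?w / (h k)\<^sup>2" by (rule divide_right_mono) simp
      then show "cmod (?E p q) \<le> C * sqrt (h k) / (h k)\<^sup>2 * decay ?w"
        unfolding E by (simp add: norm_divide norm_power)
    qed
    ultimately show ?thesis unfolding eq1 eq2 by simp
  qed
  have h0: "h \<longlonglongrightarrow> 0" and hpos: "eventually (\<lambda>k. 0 < h k) sequentially"
    using h by (auto simp: filterlim_at elim: eventually_mono)
  have h1: "eventually (\<lambda>k. h k \<le> 1) sequentially"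
    using order_tendstoD(2)[OF h0, of 1] by (auto elim: eventually_mono)
  have "(\<lambda>k. M * (C * sqrt (h k)) * L) \<longlonglongrightarrow> M * (C * sqrt 0) * L"
    by (intro tendsto_intros h0)
  then have lim: "(\<lambda>k. M * (C * sqrt (h k)) * L) \<longlonglongrightarrow> 0" by simp
  show ?thesis
  proof (rule Lim_null_comparison[OF _ lim])
    show "\<forall>\<^sub>F k in sequentially. norm (inner_L2 (Op_hyp \<psi> (h k) a (v' k)) (v' k) - inner_L2 (Op_hyp \<psi> (h k) ?b (v k)) (v k))
        \<le> M * (C * sqrt (h k)) * L"
      using hpos h1 n by eventually_elim (rule main)
  qed
qed

section \<open>Transformation of semiclassical measures\<close>

text \<open>By \<open>(Im g)^2 = |g'|^2 y^2\<close> the inverse transpose cancels. By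
  \<open>g' y cnj j = Im g\<close> the covector shift contributes \<open>B Im g - B g' y\<close>,
  whose first part is removed by the term \<open>- B Im g\<close> of \<open>phi_B\<close>. What is
  left is \<open>g'\<close> times \<open>y^2 \<eta> - B y\<close>.\<close>

lemma phi_B_symbol_map:
  assumes fg: "isometry_pair f g" and z: "z \<in> UHP \<times> UNIV"
  shows "phi_B B (symbol_map g B z) = tangent_map g (phi_B B z)"
proof -
  obtain p \<eta> where pz: "z = (p, \<eta>)" "p \<in> UHP" using z by auto
  note d = hyp_local_isometryD[OF isometry_pairD(2)[OF fg] open_UHP pz(2)]
  have phi: "phi_B B (q, \<xi>) = (q, of_real ((Im q)\<^sup>2) * \<xi> - of_real (B * Im q))" for q \<xi>
    by (simp add: phi_B_def complex_eq_iff)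
  have fd: "frechet_derivative g (at p) v = deriv g p * v" for v
    using frechet_derivative_at[OF d(3)[unfolded has_field_derivative_def]] by (metis)
  let ?y = "complex_of_real (Im p)" and ?Y = "complex_of_real (Im (g p))" and ?p = "deriv g p" and ?j = "rotation_factor g p"
  have nz: "?y \<noteq> 0" "cnj ?p \<noteq> 0" using d by auto
  have jj: "?j * cnj ?j = 1"
    using norm_rotation_factor[OF isometry_pairD(2)[OF fg] open_UHP pz(2)] by (simp add: complex_norm_square[symmetric])
  have py: "?p * ?y = ?j * ?Y" by (rule deriv_eq_rotation_factor[OF isometry_pairD(2)[OF fg] open_UHP pz(2)])
  have "?Y\<^sup>2 = (?j * cnj ?j) * ?Y\<^sup>2" by (simp add: jj)
  also have "\<dots> = (?j * ?Y) * cnj (?j * ?Y)" by (simp add: power2_eq_square)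
  also have "\<dots> = ?p * cnj ?p * ?y\<^sup>2" unfolding py[symmetric] by (simp add: power2_eq_square)
  finally have Y2: "?Y\<^sup>2 = ?p * cnj ?p * ?y\<^sup>2" .
  have grad: "?y * phase_gradient g p = cnj ?j - 1" using nz by (simp add: phase_gradient_def)
  have "?Y\<^sup>2 * ((\<eta> + of_real B * phase_gradient g p) / cnj ?p) = ?p * ?y\<^sup>2 * (\<eta> + of_real B * phase_gradient g p)"
    unfolding Y2 using nz by simp
  also have "\<dots> = ?p * ?y\<^sup>2 * \<eta> + of_real B * (?p * ?y) * (?y * phase_gradient g p)"
    by (simp add: algebra_simps power2_eq_square)
  also have "of_real B * (?p * ?y) * (?y * phase_gradient g p) = of_real B * (?j * cnj ?j) * ?Y - of_real B * (?p * ?y)"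
    unfolding grad by (simp add: right_diff_distrib) (simp add: py)
  finally have "?Y\<^sup>2 * ((\<eta> + of_real B * phase_gradient g p) / cnj ?p) - of_real B * ?Y = ?p * (?y\<^sup>2 * \<eta> - of_real B * ?y)"
    unfolding jj by (simp add: algebra_simps)
  then show ?thesis
    by (simp add: pz symbol_map_def tangent_map_def phi fd)
qed

lemma continuous_bundle_measurable:
  fixes T :: "complex \<times> complex \<Rightarrow> complex \<times> complex"
  assumes "continuous_on (UHP \<times> UNIV) T" "T ` (UHP \<times> UNIV) \<subseteq> UHP \<times> UNIV"
  shows "T \<in> bundle_borel \<rightarrow>\<^sub>M bundle_borel"
  unfolding bundle_borel_def
  using assms by (intro measurable_restrict_space2 borel_measurable_continuous_on_restrict)
    (auto simp: space_restrict_space)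

lemma space_bundle_borel: "space bundle_borel = UHP \<times> UNIV"
  by (simp add: bundle_borel_def space_restrict_space)

lemma phi_B_measurable: "phi_B B \<in> bundle_borel \<rightarrow>\<^sub>M bundle_borel"
proof (rule continuous_bundle_measurable)
  have "phi_B B = (\<lambda>z. (fst z, of_real ((Im (fst z))\<^sup>2) * snd z - of_real (B * Im (fst z))))"
    by (auto simp: phi_B_def complex_eq_iff fun_eq_iff)
  then show "continuous_on (UHP \<times> UNIV) (phi_B B)" by (simp only:) (intro continuous_intros)
qed (auto simp: phi_B_def)

lemma tangent_map_measurable:
  assumes "isometry_pair f g"
  shows "tangent_map g \<in> bundle_borel \<rightarrow>\<^sub>M bundle_borel"
proof (rule continuous_bundle_measurable)
  note d = isometry_pairD[OF assms]
  have "continuous_on (UHP \<times> UNIV) (\<lambda>z. (g (fst z), deriv g (fst z) * snd z))"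
  proof -
    have "continuous_on UHP (deriv g)"
      using d(8) open_UHP by (intro holomorphic_on_imp_continuous_on holomorphic_deriv)
    then have "continuous_on (UHP \<times> (UNIV::complex set)) (\<lambda>z. deriv g (fst z))" "continuous_on (UHP \<times> (UNIV::complex set)) (\<lambda>z. g (fst z))"
      using d(12) by (auto intro!: continuous_on_compose2[of UHP _ _ fst] continuous_intros)
    then show ?thesis by (intro continuous_intros)
  qed
  moreover have "tangent_map g z = (g (fst z), deriv g (fst z) * snd z)" if "z \<in> UHP \<times> UNIV" for z
    using frechet_derivative_at[OF hyp_local_isometryD(3)[OF d(2) open_UHP, unfolded has_field_derivative_def]] that
    by (auto simp: tangent_map_def)
  ultimately show "continuous_on (UHP \<times> UNIV) (tangent_map g)"
    by (metis (no_types, lifting) continuous_on_cong)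
  show "tangent_map g ` (UHP \<times> UNIV) \<subseteq> UHP \<times> UNIV"
    using d(6) by (auto simp: tangent_map_def)
qed

text \<open>Both limits exist by assumption and the quadratic forms differ by a null sequence, so
  the integrals of \<open>a\<close> and of its pull-back agree. Test functions determine the
  measure, and \<open>phi_B\<close> conjugates the symbol map to the differential.\<close>

theorem (in partition) semiclassical_measure_isometry:
  assumes fg: "isometry_pair f g" and B: "B \<ge> 0"
    and n: "eventually (\<lambda>k. \<bar>real (n k) * h k - B\<bar> \<le> h k) sequentially"
    and v: "semiclassical_measure \<psi> h v \<mu>" and v': "semiclassical_measure \<psi> h v' \<mu>'"
    and rel: "\<And>k z. z \<in> UHP \<Longrightarrow> v' k z = rotation_factor f z ^ n k * v k (f z)"
  shows "mu_low B \<mu>' = distr (mu_low B \<mu>) bundle_borel (tangent_map g)"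
proof -
  let ?S = "symbol_map g B"
  have sets: "sets \<mu> = sets bundle_borel" "sets \<mu>' = sets bundle_borel"
    using v v' by (auto simp: semiclassical_measure_def)
  then have space: "space \<mu> = UHP \<times> UNIV" using sets_eq_imp_space_eq space_bundle_borel by metis
  note g = isometry_pairD(2)[OF fg]
  have Sm: "?S \<in> bundle_borel \<rightarrow>\<^sub>M bundle_borel"
    by (intro continuous_bundle_measurable continuous_on_symbol_map[OF g] image_subsetI symbol_map_image[OF g])
  then have Sm': "?S \<in> \<mu> \<rightarrow>\<^sub>M bundle_borel" using measurable_cong_sets[OF sets(1) refl] by blast
  have "\<mu>' = distr \<mu> bundle_borel ?S"
  proof (rule measure_eqI_test_functions[OF open_UHP_times])
    fix a :: "complex \<times> complex \<Rightarrow> complex" assume a: "test_function (UHP \<times> UNIV) a"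
    then have sa: "symbol a" by (rule symbol.intro)
    let ?b = "pullback_symbol g B a"
    have sb: "test_function (UHP \<times> UNIV) ?b" using pullback_symbol[OF fg sa] by (rule symbol.test)
    have hv: "filterlim h (at_right 0) sequentially" "locally_L2_bounded v" "locally_L2_bounded v'"
      using v v' by (auto simp: semiclassical_measure_def)
    have 1: "integrable \<mu>' a" "(\<lambda>k. inner_L2 (Op_hyp \<psi> (h k) a (v' k)) (v' k)) \<longlonglongrightarrow> (\<integral>p. a p \<partial>\<mu>')"
      using v' a by (auto simp: semiclassical_measure_def)
    have 2: "integrable \<mu> ?b" "(\<lambda>k. inner_L2 (Op_hyp \<psi> (h k) ?b (v k)) (v k)) \<longlonglongrightarrow> (\<integral>p. ?b p \<partial>\<mu>)"
      using v sb by (auto simp: semiclassical_measure_def)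
    have "(\<lambda>k. inner_L2 (Op_hyp \<psi> (h k) a (v' k)) (v' k) - inner_L2 (Op_hyp \<psi> (h k) ?b (v k)) (v k))
        \<longlonglongrightarrow> (\<integral>p. a p \<partial>\<mu>') - (\<integral>p. ?b p \<partial>\<mu>)"
      by (rule tendsto_diff[OF 1(2) 2(2)])
    from LIMSEQ_unique[OF this quantization_isometry[OF fg sa B hv(1) n hv(2,3) rel]]
    have lim: "(\<integral>p. a p \<partial>\<mu>') = (\<integral>p. ?b p \<partial>\<mu>)" by simp
    have am: "a \<in> borel_measurable bundle_borel"
      unfolding bundle_borel_def by (rule measurable_restrict_space1[OF test_function_measurable[OF a]])
    have eq: "?b z = a (?S z)" if "z \<in> space \<mu>" for z
      using that unfolding space by (auto simp: pullback_symbol_def)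
    have "integrable \<mu> (\<lambda>z. a (?S z))" using 2(1) eq Bochner_Integration.integrable_cong by metis
    then have "integrable (distr \<mu> bundle_borel ?S) a" by (simp add: integrable_distr_eq[OF Sm' am])
    moreover have "(\<integral>p. a p \<partial>distr \<mu> bundle_borel ?S) = (\<integral>p. ?b p \<partial>\<mu>)"
      unfolding integral_distr[OF Sm' am] by (rule Bochner_Integration.integral_cong) (auto simp: eq)
    ultimately show "integrable \<mu>' a \<and> integrable (distr \<mu> bundle_borel ?S) a \<and> (\<integral>p. a p \<partial>\<mu>') = (\<integral>p. a p \<partial>distr \<mu> bundle_borel ?S)"
      using 1(1) lim by simp
  qed (use sets in \<open>auto simp: bundle_borel_def\<close>)
  then have "mu_low B \<mu>' = distr \<mu> bundle_borel (phi_B B \<circ> ?S)"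
    unfolding mu_low_def by (simp add: distr_distr[OF phi_B_measurable Sm'])
  also have "\<dots> = distr \<mu> bundle_borel (tangent_map g \<circ> phi_B B)"
    by (rule distr_cong) (auto simp: space phi_B_symbol_map[OF fg])
  also have "\<dots> = distr (mu_low B \<mu>) bundle_borel (tangent_map g)"
  proof -
    have "phi_B B \<in> \<mu> \<rightarrow>\<^sub>M bundle_borel" using phi_B_measurable measurable_cong_sets[OF sets(1) refl] by blast
    then show ?thesis unfolding mu_low_def by (simp add: distr_distr[OF tangent_map_measurable[OF fg]])
  qed
  finally show ?thesis .
qed

section \<open>Rigidity of local isometries\<close>

text \<open>For \<open>d/dz\<close> the conjugated factors are constants, so applying it repeatedly
  to the zero function differentiates the \<open>a i\<close> alone. In the proof \<open>P\<close>
  and \<open>Q\<close> are the coefficients of \<open>v\<close> and \<open>cnj v\<close>, separated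
  by testing \<open>v = 1\<close> and \<open>v = i\<close>.\<close>

lemma sum_holomorphic_cnj_derivs:
  assumes S: "open S" and b: "\<And>i. i \<in> I \<Longrightarrow> b i holomorphic_on S"
    and a: "\<And>i. i \<in> I \<Longrightarrow> a i holomorphic_on S"
    and zero: "\<And>z. z \<in> S \<Longrightarrow> (\<Sum>i\<in>I. a i z * cnj (b i z)) = 0"
    and z: "z \<in> S"
  shows "(\<Sum>i\<in>I. (deriv ^^ n) (a i) z * cnj (b i z)) = 0"
  using z
proof (induction n arbitrary: z)
  case (Suc n)
  let ?a = "\<lambda>i. (deriv ^^ n) (a i)"
  have "((\<lambda>z. \<Sum>i\<in>I. ?a i z * cnj (b i z)) has_derivative
      (\<lambda>v. \<Sum>i\<in>I. ?a i z * cnj (deriv (b i) z * v) + deriv (?a i) z * v * cnj (b i z))) (at z)"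
  proof (rule has_derivative_sum)
    fix i assume i: "i \<in> I"
    have "?a i holomorphic_on S" by (rule holomorphic_higher_deriv[OF a[OF i] S])
    then have 1: "(?a i has_derivative (\<lambda>v. deriv (?a i) z * v)) (at z)"
      using holomorphic_derivI[OF _ S Suc.prems] by (simp add: has_field_derivative_def)
    have "(b i has_derivative (\<lambda>v. deriv (b i) z * v)) (at z)"
      using holomorphic_derivI[OF b[OF i] S Suc.prems] by (simp add: has_field_derivative_def)
    then have 2: "((\<lambda>z. cnj (b i z)) has_derivative (\<lambda>v. cnj (deriv (b i) z * v))) (at z)"
      by (rule bounded_linear.has_derivative[OF bounded_linear_cnj])
    show "((\<lambda>z. ?a i z * cnj (b i z)) has_derivative
      (\<lambda>v. ?a i z * cnj (deriv (b i) z * v) + deriv (?a i) z * v * cnj (b i z))) (at z)"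
      by (rule has_derivative_mult[OF 1 2])
  qed
  moreover have "((\<lambda>z. \<Sum>i\<in>I. ?a i z * cnj (b i z)) has_derivative (\<lambda>v. 0)) (at z)"
    by (rule has_derivative_transform_within_open[OF has_derivative_const S Suc.prems]) (simp add: Suc.IH)
  ultimately have "(\<lambda>v. \<Sum>i\<in>I. ?a i z * cnj (deriv (b i) z * v) + deriv (?a i) z * v * cnj (b i z)) = (\<lambda>v. 0)"
    by (rule has_derivative_unique)
  then have e: "(\<Sum>i\<in>I. ?a i z * cnj (deriv (b i) z * v) + deriv (?a i) z * v * cnj (b i z)) = 0" for v
    by meson
  define P Q where "P = (\<Sum>i\<in>I. deriv (?a i) z * cnj (b i z))" and "Q = (\<Sum>i\<in>I. ?a i z * cnj (deriv (b i) z))"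
  have "Q + P = 0" using e[of 1] by (simp add: sum.distrib P_def Q_def)
  moreover have "- \<i> * Q + \<i> * P = 0"
  proof -
    have "- \<i> * Q + \<i> * P = (\<Sum>i\<in>I. ?a i z * cnj (deriv (b i) z * \<i>) + deriv (?a i) z * \<i> * cnj (b i z))"
      unfolding P_def Q_def sum_distrib_left sum.distrib[symmetric] by (rule sum.cong) (auto simp: algebra_simps)
    then show ?thesis by (simp only: e)
  qed
  then have "\<i> * (P - Q) = 0" by (simp add: algebra_simps)
  then have "P = Q" by simp
  ultimately have "P = 0" by simp
  then show ?case by (simp add: P_def)
qed (simp add: zero)

text \<open>The identity \<open>|h'(z)|\<^sup>2 |z - cnj z|\<^sup>2 = |h z - cnj (h z)|\<^sup>2\<close>, polarized.\<close>

lemma isometry_polarized: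
  assumes h: "hyp_local_isometry S h" and S: "open S" "connected S" and zw: "z \<in> S" "w \<in> S"
  shows "deriv h z * cnj (deriv h w) * (z - cnj w)\<^sup>2 = (h z - cnj (h w))\<^sup>2"
proof -
  have hol: "h holomorphic_on S" "deriv h holomorphic_on S"
    using h S(1) by (auto simp: hyp_local_isometry_def intro: holomorphic_deriv)
  \<comment> \<open>Expanding both squares gives six terms, each a function holomorphic in
    \<open>z\<close> times the conjugate of one holomorphic in \<open>w\<close>.\<close>
  define a :: "nat \<Rightarrow> complex \<Rightarrow> complex" where
    "a = (\<lambda>i. [\<lambda>z. deriv h z * z\<^sup>2, \<lambda>z. - 2 * deriv h z * z, deriv h, \<lambda>z. - (h z)\<^sup>2, \<lambda>z. 2 * h z, \<lambda>z. - 1] ! i)"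
  define b :: "nat \<Rightarrow> complex \<Rightarrow> complex" where
    "b = (\<lambda>i. [deriv h, \<lambda>w. deriv h w * w, \<lambda>w. deriv h w * w\<^sup>2, \<lambda>w. 1, h, \<lambda>w. (h w)\<^sup>2] ! i)"
  have less6: "i < 6 \<longleftrightarrow> i = 0 \<or> i = 1 \<or> i = 2 \<or> i = 3 \<or> i = 4 \<or> i = (5::nat)" for i by auto
  have ha: "a i holomorphic_on S" if "i \<in> {..<6}" for i
    using that less6[of i] unfolding a_def by (auto intro!: holomorphic_intros hol)
  have hb: "b i holomorphic_on S" if "i \<in> {..<6}" for i
    using that less6[of i] unfolding b_def by (auto intro!: holomorphic_intros hol)
  have expand: "(\<Sum>i\<in>{..<6}. a i z * cnj (b i w)) = deriv h z * cnj (deriv h w) * (z - cnj w)\<^sup>2 - (h z - cnj (h w))\<^sup>2" for z w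
    by (simp add: a_def b_def eval_nat_numeral) (simp add: algebra_simps)
  have diag: "(\<Sum>i\<in>{..<6}. a i z * cnj (b i z)) = 0" if "z \<in> S" for z
  proof -
    have m: "cmod (deriv h z) * Im z = Im (h z)" by (rule hyp_local_isometryD(4)[OF h S(1) that])
    have i: "u - cnj u = 2 * \<i> * of_real (Im u)" for u by (simp add: complex_eq_iff)
    have "complex_of_real ((cmod (deriv h z))\<^sup>2) * (of_real (Im z))\<^sup>2 = (of_real (Im (h z)))\<^sup>2"
      by (simp add: m[symmetric] power_mult_distrib)
    then have "deriv h z * cnj (deriv h z) * (of_real (Im z))\<^sup>2 = (of_real (Im (h z)))\<^sup>2"
      unfolding complex_norm_square .
    then show ?thesis
      unfolding expand i by (simp add: power_mult_distrib mult.assoc)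
  qed
  \<comment> \<open>For fixed \<open>w\<close> the sum is holomorphic in \<open>z\<close>, and all
    its derivatives vanish at \<open>z = w\<close> because the identity holds on the
    diagonal.\<close>
  have "(\<Sum>i\<in>{..<6}. a i z * cnj (b i w)) = 0"
  proof (rule holomorphic_fun_eq_0_on_connected[of "\<lambda>z. \<Sum>i\<in>{..<6}. a i z * cnj (b i w)" S w z])
    show "(\<lambda>z. \<Sum>i\<in>{..<6}. a i z * cnj (b i w)) holomorphic_on S"
      by (intro holomorphic_intros ha)
    fix n
    have "(deriv ^^ n) (\<lambda>z. \<Sum>i\<in>{..<6}. a i z * cnj (b i w)) w' = (\<Sum>i\<in>{..<6}. (deriv ^^ n) (a i) w' * cnj (b i w))" if "w' \<in> S" for w'
      using that
    proof (induction n arbitrary: w')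
      case (Suc n)
      have hd: "((deriv ^^ n) (a i)) holomorphic_on S" if "i \<in> {..<6}" for i
        by (rule holomorphic_higher_deriv[OF ha[OF that] S(1)])
      have "((\<lambda>z. \<Sum>i\<in>{..<6}. (deriv ^^ n) (a i) z * cnj (b i w)) has_field_derivative
          (\<Sum>i\<in>{..<6}. deriv ((deriv ^^ n) (a i)) w' * cnj (b i w))) (at w')"
        by (intro DERIV_sum DERIV_cmult_right holomorphic_derivI[OF hd S(1) Suc.prems])
      then have "((deriv ^^ n) (\<lambda>z. \<Sum>i\<in>{..<6}. a i z * cnj (b i w)) has_field_derivative
          (\<Sum>i\<in>{..<6}. deriv ((deriv ^^ n) (a i)) w' * cnj (b i w))) (at w')"
        by (rule has_field_derivative_transform_within_open[OF _ S(1) Suc.prems]) (simp only: Suc.IH)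
      then show ?case using DERIV_imp_deriv by simp
    qed simp
    then show "(deriv ^^ n) (\<lambda>z. \<Sum>i\<in>{..<6}. a i z * cnj (b i w)) w = 0"
      using sum_holomorphic_cnj_derivs[OF S(1) hb ha diag zw(2)] zw(2) by simp
  qed (use S zw in auto)
  then show ?thesis unfolding expand by simp
qed

text \<open>By \<open>isometry_polarized\<close>, the derivative of
  \<open>1 / (h z - cnj (h w))\<close> is \<open>- 1 / (cnj (h' w) (z - cnj w)^2)\<close>, which
  involves \<open>h\<close> only through \<open>h' w\<close>. The reciprocals for \<open>h\<close>
  and \<open>k\<close> thus differ by a constant, and it is 0 at \<open>w\<close>.\<close>

lemma isometry_rigid:
  assumes h: "hyp_local_isometry S h" and k: "hyp_local_isometry S k" and S: "open S" "connected S"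
    and w: "w \<in> S" and eq: "h w = k w" "deriv h w = deriv k w" and z: "z \<in> S"
  shows "h z = k z"
proof -
  have ne: "u z - cnj (u w) \<noteq> 0" if u: "hyp_local_isometry S u" and z: "z \<in> S" for u z
  proof -
    have "Im (u z - cnj (u w)) > 0" using hyp_local_isometryD(2)[OF u S(1) w] hyp_local_isometryD(2)[OF u S(1) z] by simp
    then show ?thesis by auto
  qed
  have ne': "z - cnj w \<noteq> 0" if "z \<in> S" for z
  proof -
    have "Im (z - cnj w) > 0" using hyp_local_isometryD(1)[OF h S(1) w] hyp_local_isometryD(1)[OF h S(1) that] by simp
    then show ?thesis by auto
  qed
  have d: "((\<lambda>z. inverse (u z - cnj (u w))) has_field_derivative - inverse (cnj (deriv u w) * (z - cnj w)\<^sup>2)) (at z)"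
    if u: "hyp_local_isometry S u" and z: "z \<in> S" for u z
  proof -
    have "((\<lambda>z. inverse (u z - cnj (u w))) has_field_derivative - (deriv u z * inverse ((u z - cnj (u w))\<^sup>2))) (at z)"
      using hyp_local_isometryD(3)[OF u S(1) z] ne[OF u z]
      by (auto intro!: derivative_eq_intros simp: power2_eq_square)
    also have "deriv u z * inverse ((u z - cnj (u w))\<^sup>2) = inverse (cnj (deriv u w) * (z - cnj w)\<^sup>2)"
      unfolding isometry_polarized[OF u S z w, symmetric]
      using hyp_local_isometryD(5)[OF u S(1) z] by simp
    finally show ?thesis .
  qed
  let ?q = "\<lambda>z. inverse (h z - cnj (h w)) - inverse (k z - cnj (k w))"
  have q: "(?q has_field_derivative 0) (at z)" if "z \<in> S" for z
    using DERIV_diff[OF d[OF h that] d[OF k that]] eq(2) by simp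
  have "continuous_on S ?q"
    by (rule DERIV_continuous_on[of S ?q "\<lambda>_. 0"]) (rule has_field_derivative_at_within[OF q])
  then obtain c where c: "\<And>z. z \<in> S \<Longrightarrow> ?q z = c"
    by (rule DERIV_zero_connected_constant[of S "{}" ?q, OF S(2,1) finite.emptyI]) (use q in auto)
  have "c = 0" using c[OF w] eq(1) by simp
  then have "inverse (h z - cnj (h w)) = inverse (k z - cnj (k w))" using c[OF z] by simp
  then show ?thesis using eq(1) by simp
qed

section \<open>Real Moebius transformations\<close>

lemma moebius_isometry_pair:
  fixes a b c d :: real
  assumes det: "a * d - b * c = 1"
  shows "isometry_pair (\<lambda>z. (of_real a * z + of_real b) / (of_real c * z + of_real d))
     (\<lambda>z. (of_real d * z - of_real b) / (- of_real c * z + of_real a))"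
    and "z \<in> UHP \<Longrightarrow> deriv (\<lambda>z. (of_real a * z + of_real b) / (of_real c * z + of_real d)) z = 1 / (of_real c * z + of_real d)\<^sup>2"
proof -
  \<comment> \<open>This and the next facts are stated for arbitrary coefficients, so that they also
    apply to the inverse matrix.\<close>
  have ne: "of_real c * z + of_real d \<noteq> (0::complex)" if "z \<in> UHP" "a * d - b * c = 1" for a b c d :: real and z
  proof
    assume 0: "of_real c * z + of_real d = 0"
    then have "c * Im z = 0" by (simp add: complex_eq_iff)
    then have "c = 0" using that(1) by (simp add: UHP_def)
    then show False using 0 that(2) by simp
  qed
  have der: "((\<lambda>z. (of_real a * z + of_real b) / (of_real c * z + of_real d)) has_field_derivative
      1 / (of_real c * z + of_real d)\<^sup>2) (at z)" if z: "z \<in> UHP" and det: "a * d - b * c = 1" for a b c d :: real and z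
  proof -
    have "of_real a * of_real d - of_real b * of_real c = (1::complex)"
      using arg_cong[OF det, of complex_of_real] by simp
    then have e: "of_real a * (of_real c * z + of_real d) - (of_real a * z + of_real b) * of_real c = (1::complex)"
      by (simp add: algebra_simps)
    have "((\<lambda>z. (of_real a * z + of_real b) / (of_real c * z + of_real d)) has_field_derivative
      (of_real a * (of_real c * z + of_real d) - (of_real a * z + of_real b) * of_real c) / ((of_real c * z + of_real d) * (of_real c * z + of_real d))) (at z)"
      using ne[OF z det] by (auto intro!: derivative_eq_intros)
    then show ?thesis unfolding e by (simp add: power2_eq_square)
  qed
  have im: "Im ((of_real a * z + of_real b) / (of_real c * z + of_real d)) = Im z / (cmod (of_real c * z + of_real d))\<^sup>2"
    if det: "a * d - b * c = 1" for a b c d :: real and z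
  proof -
    have "Im ((of_real a * z + of_real b) * cnj (of_real c * z + of_real d)) = (a * d - b * c) * Im z"
      by (simp add: algebra_simps)
    then show ?thesis unfolding complex_div_cnj[of "of_real a * z + of_real b"] using det by (simp add: Im_divide_of_real flip: of_real_power)
  qed
  have iso: "hyp_local_isometry UHP (\<lambda>z. (of_real a * z + of_real b) / (of_real c * z + of_real d))"
    if det: "a * d - b * c = 1" for a b c d :: real
    unfolding hyp_local_isometry_def
  proof (intro conjI ballI subset_refl)
    let ?m = "\<lambda>z. (of_real a * z + of_real b) / (of_real c * z + of_real d) :: complex"
    show "?m holomorphic_on UHP"
      using der[OF _ det] open_UHP by (auto simp: holomorphic_on_open)
    show "?m ` UHP \<subseteq> UHP"
    proof
      fix w assume "w \<in> ?m ` UHP"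
      then obtain z where z: "z \<in> UHP" "w = ?m z" by blast
      then show "w \<in> UHP" using ne[OF z(1) det] by (simp add: UHP_def im[OF det])
    qed
    fix z assume z: "z \<in> UHP"
    show "cmod (deriv ?m z) * Im z = Im (?m z)"
      unfolding DERIV_imp_deriv[OF der[OF z det]] im[OF det] by (simp add: norm_divide norm_power)
  qed
  have det': "d * a - (- b) * (- c) = 1" using det by (simp add: algebra_simps)
  let ?m = "\<lambda>z. (of_real a * z + of_real b) / (of_real c * z + of_real d) :: complex"
  let ?n = "\<lambda>z. (of_real d * z - of_real b) / (- of_real c * z + of_real a) :: complex"
  have n: "?n = (\<lambda>z. (of_real d * z + of_real (- b)) / (of_real (- c) * z + of_real a))" by simp
  have detc: "of_real a * of_real d - of_real b * of_real c = (1::complex)"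
    using arg_cong[OF det, of complex_of_real] by simp
  have inv: "(d' * ((a' * z + b') / (c' * z + d')) - b') / (- c' * ((a' * z + b') / (c' * z + d')) + a') = z"
    if "c' * z + d' \<noteq> 0" "a' * d' - b' * c' = 1" for a' b' c' d' z :: complex
  proof -
    have "d' * ((a' * z + b') / (c' * z + d')) - b' = z * (a' * d' - b' * c') / (c' * z + d')"
      using that(1) by (simp add: field_simps)
    moreover have "- c' * ((a' * z + b') / (c' * z + d')) + a' = (a' * d' - b' * c') / (c' * z + d')"
      using that(1) by (simp add: field_simps)
    ultimately show ?thesis using that by simp
  qed
  show "isometry_pair ?m ?n"
    unfolding isometry_pair_def
  proof (intro conjI ballI)
    show "hyp_local_isometry UHP ?m" by (rule iso[OF det])
    show "hyp_local_isometry UHP ?n" unfolding n by (rule iso[OF det'])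
    fix z assume z: "z \<in> UHP"
    show "?n (?m z) = z" by (rule inv[OF ne[OF z det] detc])
    show "?m (?n z) = z"
      using inv[of "- of_real c" z "of_real a" "of_real d" "- of_real b"] ne[OF z det'] detc
      by (simp add: mult.commute)
  qed
  show "deriv ?m z = 1 / (of_real c * z + of_real d)\<^sup>2" if "z \<in> UHP"
    by (rule DERIV_imp_deriv[OF der[OF that det]])
qed

text \<open>Take \<open>r\<close> with \<open>r^2 = 1 / D\<close> and solve
  \<open>c z + d = r\<close>, \<open>a z + b = w r\<close> in real coefficients by comparing real
  and imaginary parts. The value is then \<open>w\<close> and the derivative
  \<open>1 / r^2 = D\<close>; the condition on \<open>|D|\<close> makes the determinant 1.\<close>

lemma ex_isometry_with_derivative:
  assumes z: "z \<in> UHP" and w: "w \<in> UHP" and D: "cmod D * Im z = Im w"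
  obtains f g where "isometry_pair f g" "f z = w" "deriv f z = D"
proof -
  have y: "Im z > 0" "Im w > 0" using z w by (auto simp: UHP_def)
  then have D0: "D \<noteq> 0" using D by auto
  define r where "r = csqrt (1 / D)"
  have r2: "r\<^sup>2 = 1 / D" by (simp add: r_def)
  have r0: "r \<noteq> 0" using r2 D0 by auto
  have "(cmod r)\<^sup>2 = 1 / cmod D" using arg_cong[OF r2, of cmod] by (simp add: norm_power norm_divide)
  then have rn: "(cmod r)\<^sup>2 * Im w = Im z" using D D0 by (simp add: D[symmetric])
  define c where "c = Im r / Im z"
  define d where "d = Re r - c * Re z"
  define a where "a = Im (w * r) / Im z"
  define b where "b = Re (w * r) - a * Re z"
  have cd: "of_real c * z + of_real d = r" using y by (simp add: complex_eq_iff c_def d_def)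
  have ab: "of_real a * z + of_real b = w * r" using y by (simp add: complex_eq_iff a_def b_def)
  have "(a * d - b * c) * Im z = Im ((of_real a * z + of_real b) * cnj (of_real c * z + of_real d))"
    by (simp add: algebra_simps)
  also have "\<dots> = Im (w * of_real ((cmod r)\<^sup>2))" unfolding cd ab complex_norm_square by (simp add: mult.assoc)
  also have "\<dots> = Im z" using rn by (simp add: mult.commute del: of_real_power)
  finally have det: "a * d - b * c = 1" using y by simp
  show ?thesis
  proof (rule that[OF moebius_isometry_pair(1)[OF det]])
    show "(of_real a * z + of_real b) / (of_real c * z + of_real d) = w" unfolding cd ab using r0 by simp
    show "deriv (\<lambda>z. (of_real a * z + of_real b) / (of_real c * z + of_real d)) z = D"
      unfolding moebius_isometry_pair(2)[OF det z] cd r2 by simp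
  qed
qed

section \<open>Coverings by the half plane\<close>

lemma connected_UHP: "connected UHP"
  using convex_UHP by (rule convex_connected)

lemma i_UHP: "\<i> \<in> UHP"
  by (simp add: UHP_def)

lemma hyp_local_isometry_subset:
  assumes "hyp_local_isometry S h" "T \<subseteq> S"
  shows "hyp_local_isometry T h"
  using assms holomorphic_on_subset unfolding hyp_local_isometry_def by blast

lemma hyp_local_isometry_compose:
  assumes h: "hyp_local_isometry S h" "open S" and k: "hyp_local_isometry T k" "open T" and sub: "k ` T \<subseteq> S"
  shows "hyp_local_isometry T (\<lambda>z. h (k z))"
    and "z \<in> T \<Longrightarrow> deriv (\<lambda>z. h (k z)) z = deriv h (k z) * deriv k z"
    and "z \<in> T \<Longrightarrow> rotation_factor (\<lambda>z. h (k z)) z = rotation_factor h (k z) * rotation_factor k z"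
proof -
  have der: "((\<lambda>z. h (k z)) has_field_derivative deriv h (k z) * deriv k z) (at z)" if z: "z \<in> T" for z
    using DERIV_chain2[OF hyp_local_isometryD(3)[OF h] hyp_local_isometryD(3)[OF k z]] sub z by blast
  then show d: "z \<in> T \<Longrightarrow> deriv (\<lambda>z. h (k z)) z = deriv h (k z) * deriv k z" for z
    by (intro DERIV_imp_deriv)
  show "hyp_local_isometry T (\<lambda>z. h (k z))"
    unfolding hyp_local_isometry_def
  proof (intro conjI ballI)
    show "(\<lambda>z. h (k z)) holomorphic_on T" using der k(2) by (auto simp: holomorphic_on_open)
    show "T \<subseteq> UHP" using k(1) by (simp add: hyp_local_isometry_def)
    show "(\<lambda>z. h (k z)) ` T \<subseteq> UHP" using h(1) sub by (auto simp: hyp_local_isometry_def)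
    fix z assume z: "z \<in> T"
    then show "cmod (deriv (\<lambda>z. h (k z)) z) * Im z = Im (h (k z))"
      using hyp_local_isometryD(4)[OF h, of "k z"] hyp_local_isometryD(4)[OF k z] sub
      by (auto simp: d norm_mult mult.assoc)
  qed
  show "rotation_factor (\<lambda>z. h (k z)) z = rotation_factor h (k z) * rotation_factor k z" if z: "z \<in> T"
    using hyp_local_isometryD(2)[OF k z] by (simp add: rotation_factor_def d[OF z])
qed

locale hyperbolic_surface =
  fixes X :: "'x::t2_space set" and A :: "'x chart set"
  assumes surface: "compact_hyperbolic_surface X A"
begin

lemma chart:
  assumes "c \<in> A"
  shows "openin (top_of_set X) (fst c)" "open (snd c ` fst c)" "snd c ` fst c \<subseteq> UHP"
    "homeomorphism (fst c) (snd c ` fst c) (snd c) (chart_inv c)" "inj_on (snd c) (fst c)" "fst c \<subseteq> X"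
    "p \<in> fst c \<Longrightarrow> chart_inv c (snd c p) = p"
proof -
  obtain U \<phi> where c: "c = (U, \<phi>)" by (cases c)
  show *: "openin (top_of_set X) (fst c)" "open (snd c ` fst c)" "snd c ` fst c \<subseteq> UHP"
    "homeomorphism (fst c) (snd c ` fst c) (snd c) (chart_inv c)"
    using bspec[OF conjunct1[OF conjunct2[OF conjunct2[OF conjunct2[OF surface[unfolded compact_hyperbolic_surface_def]]]]] assms]
    unfolding c by simp_all
  then show "inj_on (snd c) (fst c)" "p \<in> fst c \<Longrightarrow> chart_inv c (snd c p) = p"
    by (auto simp: homeomorphism_def intro: inj_on_inverseI)
  show "fst c \<subseteq> X" using openin_subset[OF *(1)] by simp
qed

lemma chart_cover: "p \<in> X \<Longrightarrow> \<exists>c\<in>A. p \<in> fst c"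
  using surface unfolding compact_hyperbolic_surface_def by blast

lemma transition:
  "c \<in> A \<Longrightarrow> d \<in> A \<Longrightarrow> local_isometry_plus (snd c ` (fst c \<inter> fst d)) (snd d \<circ> chart_inv c)"
proof -
  assume c: "c \<in> A" and d: "d \<in> A"
  have "\<forall>c\<in>A. \<forall>d\<in>A. local_isometry_plus (snd c ` (fst c \<inter> fst d)) (snd d \<circ> chart_inv c)"
    using conjunct2[OF conjunct2[OF conjunct2[OF conjunct2[OF surface[unfolded compact_hyperbolic_surface_def]]]]]
    unfolding split_beta by simp
  then show ?thesis using c d by blast
qed

end

locale covered_surface = hyperbolic_surface X A for X :: "'x::t2_space set" and A :: "'x chart set" +
  fixes \<pi> :: "complex \<Rightarrow> 'x"
  assumes covering: "hyperbolic_covering X A \<pi>"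
begin

definition dom :: "'x chart \<Rightarrow> complex set" where
  "dom c = {z \<in> UHP. \<pi> z \<in> fst c}"

lemma pi_props: "continuous_on UHP \<pi>" "\<pi> ` UHP = X" "z \<in> UHP \<Longrightarrow> \<pi> z \<in> X"
  using covering unfolding hyperbolic_covering_def covering_space_def by auto

lemma open_pi_vimage: "openin (top_of_set X) U \<Longrightarrow> open {z \<in> UHP. \<pi> z \<in> U}"
proof -
  assume "openin (top_of_set X) U"
  then obtain T where T: "open T" "U = X \<inter> T" by (auto simp: openin_open)
  have "open (UHP \<inter> \<pi> -` T)" using pi_props(1) open_UHP T(1) by (intro continuous_open_preimage)
  also have "UHP \<inter> \<pi> -` T = {z \<in> UHP. \<pi> z \<in> U}" using T(2) pi_props(3) by auto
  finally show ?thesis .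
qed

lemma open_dom: "c \<in> A \<Longrightarrow> open (dom c)"
  unfolding dom_def by (intro open_pi_vimage chart(1))

lemma dom_UHP: "dom c \<subseteq> UHP" by (auto simp: dom_def)

lemma ex_dom: "z \<in> UHP \<Longrightarrow> \<exists>c\<in>A. z \<in> dom c"
  using chart_cover[OF pi_props(3)] by (auto simp: dom_def)

lemma coordinate_isometry: "c \<in> A \<Longrightarrow> hyp_local_isometry (dom c) (snd c \<circ> \<pi>)"
  using covering local_isometry_plus_imp_hyp[OF _ open_dom dom_UHP]
  unfolding hyperbolic_covering_def dom_def split_beta by blast

lemmas coordinateD = hyp_local_isometryD[OF coordinate_isometry open_dom]

lemma locally_injective:
  assumes "z \<in> UHP"
  obtains U where "open U" "z \<in> U" "U \<subseteq> UHP" "inj_on \<pi> U"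
proof -
  obtain c where c: "c \<in> A" "z \<in> dom c" using ex_dom[OF assms] by blast
  have "(snd c \<circ> \<pi>) holomorphic_on dom c" using coordinate_isometry[OF c(1)] by (simp add: hyp_local_isometry_def)
  then obtain r where r: "r > 0" "ball z r \<subseteq> dom c" "inj_on (snd c \<circ> \<pi>) (ball z r)"
    using has_complex_derivative_locally_injective[OF _ c(2) open_dom[OF c(1)] coordinateD(5)[OF c(1) c(1) c(2)]] by blast
  show ?thesis
  proof
    show "inj_on \<pi> (ball z r)" using r(3) by (rule inj_on_imageI2)
    show "ball z r \<subseteq> UHP" using r(2) dom_UHP by blast
  qed (use r in auto)
qed

end

text \<open>\<open>f\<close> is a Moebius map chosen so that \<open>\<pi> o f\<close> and
  \<open>\<pi>'\<close> have the same value and, in a chart, the same derivative at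
  \<open>z\<close>. The required derivative has the admissible modulus because both coordinate maps
  are isometries. Agreement spreads over the connected half plane by an open-closed
  argument.\<close>

lemma two_coverings_lift:
  assumes "covered_surface X A \<pi>" "covered_surface X A \<pi>'"
    and z: "z \<in> UHP" and w: "w \<in> UHP" and zw: "\<pi> w = \<pi>' z"
  obtains f g where "isometry_pair f g" "f z = w" "\<And>x. x \<in> UHP \<Longrightarrow> \<pi> (f x) = \<pi>' x"
proof -
  interpret p: covered_surface X A \<pi> by fact
  interpret q: covered_surface X A \<pi>' by fact
  obtain c where c: "c \<in> A" "z \<in> q.dom c" using q.ex_dom[OF z] by blast
  then have wc: "w \<in> p.dom c" using zw w by (auto simp: p.dom_def q.dom_def)
  let ?h = "\<lambda>c. snd c \<circ> \<pi>" and ?h' = "\<lambda>c. snd c \<circ> \<pi>'"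
  note D = p.coordinateD[OF c(1) c(1) wc] and D' = q.coordinateD[OF c(1) c(1) c(2)]
  have "cmod (deriv (?h' c) z / deriv (?h c) w) * Im z = Im w"
    using D(4,5) D'(4) zw by (simp add: norm_divide field_simps)
  then obtain f g where fg: "isometry_pair f g" "f z = w" "deriv f z = deriv (?h' c) z / deriv (?h c) w"
    using ex_isometry_with_derivative[OF z w] by blast
  note fd = isometry_pairD[OF fg(1)]
  text \<open>On a connected open set whose images lie in the domain of one chart, rigidity propagates
    \<open>\<pi> \<circ> f = \<pi>'\<close> from first-order agreement at one point.\<close>
  have spread: "\<pi> (f x) = \<pi>' x"
    if B: "open B" "connected B" "B \<subseteq> q.dom c" "f ` B \<subseteq> p.dom c" "c \<in> A" and y: "y \<in> B" "\<pi> (f y) = \<pi>' y"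
      "deriv (?h c) (f y) * deriv f y = deriv (?h' c) y" and x: "x \<in> B" for B c x y
  proof -
    have BU: "B \<subseteq> UHP" using B(3) q.dom_UHP by blast
    have f: "hyp_local_isometry B f" by (rule hyp_local_isometry_subset[OF fd(1) BU])
    note comp = hyp_local_isometry_compose[OF p.coordinate_isometry[OF B(5)] p.open_dom[OF B(5)] f B(1,4)]
    have "(?h c) (f x) = (?h' c) x"
      by (rule isometry_rigid[OF comp(1) hyp_local_isometry_subset[OF q.coordinate_isometry[OF B(5)] B(3)] B(1,2) y(1) _ _ x])
        (use comp(2)[OF y(1)] y in auto)
    moreover have "\<pi> (f x) \<in> fst c" "\<pi>' x \<in> fst c" using x B(3,4) by (auto simp: p.dom_def q.dom_def)
    ultimately show ?thesis using p.chart(5)[OF B(5)] by (auto dest: inj_onD)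
  qed
  have fdom: "open {x \<in> q.dom c. f x \<in> p.dom c}" if "c \<in> A" for c
  proof -
    have "open (q.dom c \<inter> f -` p.dom c)"
      using fd(11) q.dom_UHP q.open_dom[OF that] p.open_dom[OF that]
      by (intro continuous_open_preimage continuous_on_subset[OF fd(11)])
    moreover have "{x \<in> q.dom c. f x \<in> p.dom c} = q.dom c \<inter> f -` p.dom c" by blast
    ultimately show ?thesis by (simp only:)
  qed
  \<comment> \<open>The interior of the set of agreement: openness is immediate, and at its points
    the derivatives agree as well.\<close>
  let ?G = "\<Union>{B. open B \<and> B \<subseteq> UHP \<and> (\<forall>x\<in>B. \<pi> (f x) = \<pi>' x)}"
  have "?G = {} \<or> ?G = UHP"
  proof (rule connected_clopen[THEN iffD1, rule_format, OF connected_UHP], intro conjI)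
    have oG: "open ?G" by blast
    show "openin (top_of_set UHP) ?G"
      unfolding openin_open_eq[OF open_UHP] using oG by blast
    have "open (UHP - ?G)"
    proof (subst open_subopen, intro ballI)
      fix x assume x: "x \<in> UHP - ?G"
      show "\<exists>T. open T \<and> x \<in> T \<and> T \<subseteq> UHP - ?G"
      proof (cases "\<pi> (f x) = \<pi>' x")
        \<comment> \<open>Disagreement is an open condition since the target is Hausdorff.\<close>
        case False
        then obtain U V where UV: "open U" "open V" "\<pi> (f x) \<in> U" "\<pi>' x \<in> V" "U \<inter> V = {}"
          using hausdorff by metis
        have "continuous_on UHP (\<lambda>x. \<pi> (f x))"
          by (rule continuous_on_compose2[OF p.pi_props(1) fd(11)]) (use fd(5) in auto)
        then have "open (UHP \<inter> (\<lambda>x. \<pi> (f x)) -` U)" "open (UHP \<inter> \<pi>' -` V)"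
          using UV(1,2) q.pi_props(1) open_UHP by (auto intro: continuous_open_preimage)
        then have "open ((UHP \<inter> (\<lambda>x. \<pi> (f x)) -` U) \<inter> (UHP \<inter> \<pi>' -` V))" by (rule open_Int)
        moreover have "x \<in> (UHP \<inter> (\<lambda>x. \<pi> (f x)) -` U) \<inter> (UHP \<inter> \<pi>' -` V)" using x UV by auto
        moreover have "(UHP \<inter> (\<lambda>x. \<pi> (f x)) -` U) \<inter> (UHP \<inter> \<pi>' -` V) \<subseteq> UHP - ?G"
        proof
          fix y assume y: "y \<in> (UHP \<inter> (\<lambda>x. \<pi> (f x)) -` U) \<inter> (UHP \<inter> \<pi>' -` V)"
          then have "\<pi> (f y) \<noteq> \<pi>' y" using UV(5) by auto
          then show "y \<in> UHP - ?G" using y by blast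
        qed
        ultimately show ?thesis by blast
      next
        case True
        obtain c where c: "c \<in> A" "x \<in> q.dom c" using q.ex_dom x by blast
        then have "f x \<in> p.dom c" using True x fd(5) by (auto simp: p.dom_def q.dom_def)
        then obtain r where r: "r > 0" "ball x r \<subseteq> {x \<in> q.dom c. f x \<in> p.dom c}"
          using fdom[OF c(1)] c(2) by (metis (mono_tags, lifting) mem_Collect_eq openE)
        \<comment> \<open>If the ball met \<open>?G\<close>, first-order agreement at a common point
          would spread over the ball and put its centre \<open>x\<close> into
          \<open>?G\<close>.\<close>
        have "ball x r \<subseteq> UHP - ?G"
        proof
          fix y assume y: "y \<in> ball x r"
          have yU: "y \<in> UHP" using y r(2) q.dom_UHP by blast
          show "y \<in> UHP - ?G"
          proof (rule ccontr)
            assume "y \<notin> UHP - ?G"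
            then obtain B where B: "open B" "B \<subseteq> UHP" "y \<in> B" "\<And>x. x \<in> B \<Longrightarrow> \<pi> (f x) = \<pi>' x"
              using yU by blast
            have yd: "y \<in> q.dom c" "f y \<in> p.dom c" using y r(2) by auto
            have "((\<lambda>x. (?h c) (f x)) has_field_derivative deriv (?h c) (f y) * deriv f y) (at y)"
              by (rule DERIV_chain2[OF p.coordinateD(3)[OF c(1) c(1) yd(2)] hyp_local_isometryD(3)[OF fd(1) open_UHP yU]])
            moreover have "((\<lambda>x. (?h c) (f x)) has_field_derivative deriv (?h' c) y) (at y)"
              by (rule has_field_derivative_transform_within_open[OF q.coordinateD(3)[OF c(1) c(1) yd(1)] B(1,3)]) (simp add: B(4))
            ultimately have dy: "deriv (?h c) (f y) * deriv f y = deriv (?h' c) y" by (rule DERIV_unique)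
            have "\<pi> (f u) = \<pi>' u" if "u \<in> ball x r" for u
              by (rule spread[of "ball x r" c y u]) (use r(2) c(1) y B(3,4) dy that in auto)
            moreover have "ball x r \<subseteq> UHP" using r(2) subsetD[OF q.dom_UHP[of c]] by blast
            ultimately have "ball x r \<in> {B. open B \<and> B \<subseteq> UHP \<and> (\<forall>x\<in>B. \<pi> (f x) = \<pi>' x)}"
              by blast
            then have "x \<in> ?G" using r(1) by (meson UnionI centre_in_ball)
            then show False using x by blast
          qed
        qed
        then show ?thesis using r(1) by (intro exI[of _ "ball x r"]) auto
      qed
    qed
    then show "closedin (top_of_set UHP) ?G"
      unfolding closedin_def topspace_euclidean_subtopology openin_open_eq[OF open_UHP] by blast
  qed
  moreover have "z \<in> ?G"
  proof -
    have "z \<in> {x \<in> q.dom c. f x \<in> p.dom c}" using c wc fg(2) by simp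
    then obtain r where r: "r > 0" "ball z r \<subseteq> {x \<in> q.dom c. f x \<in> p.dom c}"
      using fdom[OF c(1)] by (meson openE)
    have "\<pi> (f u) = \<pi>' u" if "u \<in> ball z r" for u
      by (rule spread[of "ball z r" c z u]) (use r c(1) zw fg(2,3) D(5) that in auto)
    moreover have "ball z r \<subseteq> UHP" using r(2) subsetD[OF q.dom_UHP[of c]] by blast
    ultimately have "ball z r \<in> {B. open B \<and> B \<subseteq> UHP \<and> (\<forall>x\<in>B. \<pi> (f x) = \<pi>' x)}"
      by blast
    then show ?thesis using r(1) by (meson UnionI centre_in_ball)
  qed
  ultimately have "?G = UHP" by blast
  then have "\<pi> (f x) = \<pi>' x" if "x \<in> UHP" for x using that by blast
  then show ?thesis using that fg by blast
qed

text \<open>In one chart both pulled-back functions come from the same function \<open>?U\<close>,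
  so \<open>ascend_isometry\<close> applies to each coordinate map. The chain rule splits the
  rotation factor of one into that of the other and that of \<open>f\<close>.\<close>

lemma ascend_coverings:
  assumes "covered_surface X A \<pi>" "covered_surface X A \<pi>'" and eig: "laplace_eigen_eq A ev u"
    and fg: "isometry_pair f g" and lift: "\<And>x. x \<in> UHP \<Longrightarrow> \<pi> (f x) = \<pi>' x" and z: "z \<in> UHP"
  shows "ascend s n (\<lambda>z. of_real (u (\<pi>' z))) z
    = rotation_factor f z ^ n * ascend s n (\<lambda>z. of_real (u (\<pi> z))) (f z)"
proof -
  interpret p: covered_surface X A \<pi> by fact
  interpret q: covered_surface X A \<pi>' by fact
  note fd = isometry_pairD[OF fg]
  obtain c where c: "c \<in> A" "z \<in> q.dom c" using q.ex_dom[OF z] by blast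
  have fz: "f z \<in> p.dom c" using c(2) fd(5)[OF z] lift[OF z] by (auto simp: p.dom_def q.dom_def)
  let ?T = "snd c ` fst c" and ?U = "\<lambda>y. complex_of_real (u (chart_inv c y))"
  have sm: "smooth_on ?T ?U"
    using eig c(1) Ck_on_bounded_linear[OF p.chart(2)[OF c(1)] bounded_linear_of_real]
    unfolding laplace_eigen_eq_def smooth_on_def by (fastforce simp: o_def)
  have 1: "ascend s n (\<lambda>z. of_real (u (\<pi>' z))) z = rotation_factor (snd c \<circ> \<pi>') z ^ n * ascend s n ?U ((snd c \<circ> \<pi>') z)"
    by (rule ascend_isometry[OF q.coordinate_isometry[OF c(1)] q.open_dom[OF c(1)] p.chart(2)[OF c(1)] _ sm _ c(2)])
      (auto simp: q.dom_def p.chart(7)[OF c(1)])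
  have 2: "ascend s n (\<lambda>z. of_real (u (\<pi> z))) (f z) = rotation_factor (snd c \<circ> \<pi>) (f z) ^ n * ascend s n ?U ((snd c \<circ> \<pi>) (f z))"
    by (rule ascend_isometry[OF p.coordinate_isometry[OF c(1)] p.open_dom[OF c(1)] p.chart(2)[OF c(1)] _ sm _ fz])
      (auto simp: p.dom_def p.chart(7)[OF c(1)])
  have f: "hyp_local_isometry (q.dom c) f" by (rule hyp_local_isometry_subset[OF fd(1) q.dom_UHP])
  have sub: "f ` q.dom c \<subseteq> p.dom c" using fd(5) lift by (auto simp: p.dom_def q.dom_def)
  note comp = hyp_local_isometry_compose(3)[OF p.coordinate_isometry[OF c(1)] p.open_dom[OF c(1)] f q.open_dom[OF c(1)] sub c(2)]
  have loc: "deriv (snd c \<circ> \<pi>') z = deriv (\<lambda>z. (snd c \<circ> \<pi>) (f z)) z"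
    by (rule deriv_cong_ev[OF _ refl])
      (use lift subsetD[OF q.dom_UHP[of c]] in \<open>auto simp: eventually_nhds intro!: exI[of _ "q.dom c"] q.open_dom c\<close>)
  have "rotation_factor (snd c \<circ> \<pi>') z = rotation_factor (\<lambda>z. (snd c \<circ> \<pi>) (f z)) z"
    by (simp add: rotation_factor_def loc lift[OF z])
  then show ?thesis
    unfolding 1 2 comp using lift[OF z] by (simp add: power_mult_distrib ac_simps)
qed

section \<open>The differential of a covering\<close>

lemma frechet_derivative_field:
  "(h has_field_derivative d) (at z) \<Longrightarrow> frechet_derivative h (at z) v = d * v"
  using frechet_derivative_at[of h "(*) d" z] by (simp add: has_field_derivative_def)

context hyperbolic_surface
begin

lemma tangent_bundle_eqI:
  assumes "(p, w) \<in> tangent_bundle X A" "(p, w') \<in> tangent_bundle X A" "c \<in> A" "p \<in> fst c" "w c = w' c"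
  shows "w = w'"
proof
  fix d
  show "w d = w' d"
  proof (cases "d \<in> A \<and> p \<in> fst d")
    case True
    let ?F = "frechet_derivative (snd d \<circ> chart_inv c) (at (snd c p))"
    have "w d = ?F (w c)" "w' d = ?F (w' c)"
      using assms(1-4) True unfolding tangent_bundle_def by blast+
    then show ?thesis using assms(5) by (simp only:)
  next
    case False
    then have "w d = 0" "w' d = 0" using assms(1,2) unfolding tangent_bundle_def by blast+
    then show ?thesis by simp
  qed
qed

definition bundle_chart :: "'x chart \<Rightarrow> 'x \<times> ('x chart \<Rightarrow> complex) \<Rightarrow> complex \<times> complex" where
  "bundle_chart c = (\<lambda>(p, w). (snd c p, w c))"

definition over :: "'x chart \<Rightarrow> ('x \<times> ('x chart \<Rightarrow> complex)) set \<Rightarrow> ('x \<times> ('x chart \<Rightarrow> complex)) set" where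
  "over c E = {(p, w). (p, w) \<in> E \<and> p \<in> fst c}"

lemma over_iff: "q \<in> over c E \<longleftrightarrow> q \<in> E \<and> fst q \<in> fst c"
  by (cases q) (simp add: over_def)

definition bundle_open :: "('x \<times> ('x chart \<Rightarrow> complex)) set \<Rightarrow> bool" where
  "bundle_open E \<longleftrightarrow> E \<subseteq> tangent_bundle X A \<and> (\<forall>c\<in>A. open (bundle_chart c ` over c E))"

lemma tangent_bundle_borel_eq: "tangent_bundle_borel X A = sigma (tangent_bundle X A) {E. bundle_open E}"
  by (simp add: tangent_bundle_borel_def bundle_open_def bundle_chart_def over_def)

lemma space_tangent_bundle_borel: "space (tangent_bundle_borel X A) = tangent_bundle X A"
  unfolding tangent_bundle_borel_eq by (rule space_measure_of) (auto simp: bundle_open_def)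

lemma bundle_open_sets: "bundle_open E \<Longrightarrow> E \<in> sets (tangent_bundle_borel X A)"
  unfolding tangent_bundle_borel_eq by (subst sets_measure_of) (auto simp: bundle_open_def)

end

context covered_surface
begin

abbreviation dpi where "dpi \<equiv> covering_differential A \<pi>"

lemma dpi_apply:
  assumes "c \<in> A" "z \<in> dom c"
  shows "snd (dpi (z, v)) c = deriv (snd c \<circ> \<pi>) z * v"
  using assms frechet_derivative_field[OF coordinateD(3)[OF assms(1) assms]]
  by (simp add: covering_differential_def dom_def)

lemma fst_dpi: "fst (dpi (z, v)) = \<pi> z"
  by (simp add: covering_differential_def)

lemma dpi_tangent:
  assumes z: "z \<in> UHP"
  shows "dpi (z, v) \<in> tangent_bundle X A"
proof -
  let ?w = "snd (dpi (z, v))"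
  have comp: "?w d = frechet_derivative (snd d \<circ> chart_inv c) (at (snd c (\<pi> z))) (?w c)"
    if c: "c \<in> A" "\<pi> z \<in> fst c" and d: "d \<in> A" "\<pi> z \<in> fst d" for c d
  proof -
    have zd: "z \<in> dom c" "z \<in> dom d" using z c d by (auto simp: dom_def)
    let ?t = "snd d \<circ> chart_inv c" and ?hc = "snd c \<circ> \<pi>" and ?hd = "snd d \<circ> \<pi>"
    have "?t differentiable (at (snd c (\<pi> z)))"
      using transition[OF c(1) d(1)] c d by (auto simp: local_isometry_plus_def)
    then have t: "(?t has_derivative frechet_derivative ?t (at (?hc z))) (at (?hc z))"
      by (simp add: frechet_derivative_works)
    have hc: "(?hc has_derivative (*) (deriv ?hc z)) (at z)" and hd: "(?hd has_derivative (*) (deriv ?hd z)) (at z)"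
      using coordinateD(3)[OF c(1) c(1) zd(1)] coordinateD(3)[OF d(1) d(1) zd(2)] by (simp_all add: has_field_derivative_def)
    have "((\<lambda>x. ?t (?hc x)) has_derivative (\<lambda>v. frechet_derivative ?t (at (?hc z)) (deriv ?hc z * v))) (at z)"
      by (rule has_derivative_compose[OF hc t])
    then have "(?hd has_derivative (\<lambda>v. frechet_derivative ?t (at (?hc z)) (deriv ?hc z * v))) (at z)"
      by (rule has_derivative_transform_within_open[OF _ open_dom[OF c(1)] zd(1)])
        (simp add: dom_def chart(7)[OF c(1)])
    from has_derivative_unique[OF this hd]
    have "frechet_derivative ?t (at (?hc z)) (deriv ?hc z * v) = deriv ?hd z * v" by (rule fun_cong)
    then show ?thesis unfolding dpi_apply[OF c(1) zd(1)] dpi_apply[OF d(1) zd(2)] by simp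
  qed
  have zero: "?w c = 0" if "\<not> (c \<in> A \<and> \<pi> z \<in> fst c)" for c
    using that by (auto simp: covering_differential_def)
  have "dpi (z, v) = (\<pi> z, ?w)" by (simp add: covering_differential_def)
  moreover have "(\<pi> z, ?w) \<in> tangent_bundle X A"
    unfolding tangent_bundle_def using pi_props(3)[OF z] comp zero by blast
  ultimately show ?thesis by simp
qed

lemma dpi_eqI:
  assumes "z \<in> UHP" "(p, w) \<in> tangent_bundle X A" "c \<in> A" "z \<in> dom c" "\<pi> z = p" "deriv (snd c \<circ> \<pi>) z * v = w c"
  shows "dpi (z, v) = (p, w)"
proof -
  have "(p, snd (dpi (z, v))) \<in> tangent_bundle X A"
    using dpi_tangent[OF assms(1), of v] fst_dpi[of z v] assms(5) by (metis prod.collapse)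
  then have "snd (dpi (z, v)) = w"
    by (rule tangent_bundle_eqI[OF _ assms(2,3)]) (use assms dpi_apply in \<open>auto simp: dom_def\<close>)
  then show ?thesis using fst_dpi[of z v] assms(5) by (metis prod.collapse)
qed

lemma dpi_fibre_inj:
  assumes "z \<in> UHP" "dpi (z, v) = dpi (z, v')"
  shows "v = v'"
proof -
  obtain c where c: "c \<in> A" "z \<in> dom c" using ex_dom[OF assms(1)] by blast
  have "deriv (snd c \<circ> \<pi>) z * v = deriv (snd c \<circ> \<pi>) z * v'"
    using dpi_apply[OF c] assms(2) by metis
  then show ?thesis using coordinateD(5)[OF c(1) c] by simp
qed

lemma dpi_surj:
  assumes "(p, w) \<in> tangent_bundle X A" "z \<in> UHP" "\<pi> z = p"
  obtains v where "dpi (z, v) = (p, w)"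
proof -
  obtain c where c: "c \<in> A" "z \<in> dom c" using ex_dom[OF assms(2)] by blast
  show ?thesis
    by (rule that[OF dpi_eqI[OF assms(2,1) c assms(3)], of "w c / deriv (snd c \<circ> \<pi>) z"])
      (use coordinateD(5)[OF c(1) c] in simp)
qed

lemma continuous_on_coordinate_differential:
  assumes "c \<in> A"
  shows "continuous_on (dom c \<times> UNIV) (\<lambda>(z, v). ((snd c \<circ> \<pi>) z, deriv (snd c \<circ> \<pi>) z * v))"
proof -
  have hol: "(snd c \<circ> \<pi>) holomorphic_on dom c" using coordinate_isometry[OF assms] by (simp add: hyp_local_isometry_def)
  note c = holomorphic_on_imp_continuous_on[OF hol]
    holomorphic_on_imp_continuous_on[OF holomorphic_deriv[OF hol open_dom[OF assms]]]
  have "continuous_on (dom c \<times> (UNIV::complex set)) (\<lambda>z. (snd c \<circ> \<pi>) (fst z))" "continuous_on (dom c \<times> (UNIV::complex set)) (\<lambda>z. deriv (snd c \<circ> \<pi>) (fst z))"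
    by (rule continuous_on_compose2[OF c(1) continuous_on_fst[OF continuous_on_id]],
        auto intro: continuous_on_compose2[OF c(2) continuous_on_fst[OF continuous_on_id]])
  then show ?thesis unfolding split_beta by (intro continuous_intros)
qed

text \<open>Over a chart with coordinate map \<open>h\<close>, \<open>dpi\<close> reads
  \<open>(z, v) \<mapsto> (h z, h'(z) v)\<close>, which is continuous; preimages of the generating
  sets are therefore open.\<close>

lemma dpi_measurable: "dpi \<in> bundle_borel \<rightarrow>\<^sub>M tangent_bundle_borel X A"
  unfolding tangent_bundle_borel_eq
proof (rule measurable_measure_of)
  show "{E. bundle_open E} \<subseteq> Pow (tangent_bundle X A)" by (auto simp: bundle_open_def)
  show "dpi \<in> space bundle_borel \<rightarrow> tangent_bundle X A"
    using dpi_tangent by (auto simp: space_bundle_borel)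
  fix E assume "E \<in> {E. bundle_open E}"
  then have E: "E \<subseteq> tangent_bundle X A" "\<And>c. c \<in> A \<Longrightarrow> open (bundle_chart c ` over c E)"
    by (auto simp: bundle_open_def)
  let ?h = "\<lambda>c (z, v). ((snd c \<circ> \<pi>) z, deriv (snd c \<circ> \<pi>) z * v)"
  let ?P = "\<lambda>c. (dom c \<times> UNIV) \<inter> ?h c -` (bundle_chart c ` over c E)"
  have "dpi -` E \<inter> (UHP \<times> UNIV) = (\<Union>c\<in>A. ?P c)"
  proof (intro equalityI subsetI)
    fix x assume x: "x \<in> dpi -` E \<inter> (UHP \<times> UNIV)"
    obtain z v where zv: "x = (z, v)" by (cases x)
    then have zE: "z \<in> UHP" "dpi (z, v) \<in> E" using x by auto
    obtain c where c: "c \<in> A" "z \<in> dom c" using ex_dom[OF zE(1)] by blast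
    have "dpi (z, v) \<in> over c E"
      using zE c(2) by (simp add: over_iff fst_dpi dom_def)
    moreover have "bundle_chart c (dpi (z, v)) = ?h c (z, v)"
      using dpi_apply[OF c] fst_dpi[of z v] by (simp add: bundle_chart_def split_beta)
    ultimately have "?h c (z, v) \<in> bundle_chart c ` over c E" by (metis image_eqI)
    then show "x \<in> (\<Union>c\<in>A. ?P c)" using c zv by auto
  next
    fix x assume "x \<in> (\<Union>c\<in>A. ?P c)"
    then obtain c z v where c: "c \<in> A" and zv: "x = (z, v)" "z \<in> dom c" "?h c (z, v) \<in> bundle_chart c ` over c E" by auto
    then obtain p w where pw: "(p, w) \<in> E" "p \<in> fst c" "snd c (\<pi> z) = snd c p" "deriv (snd c \<circ> \<pi>) z * v = w c"
      by (auto simp: over_def bundle_chart_def)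
    have "\<pi> z = p" using chart(5)[OF c] zv(2) pw(2,3) by (auto simp: dom_def dest: inj_onD)
    moreover have z: "z \<in> UHP" using zv(2) dom_UHP[of c] by blast
    ultimately have "dpi (z, v) = (p, w)"
      using E(1) pw by (intro dpi_eqI[OF _ _ c zv(2)]) auto
    then show "x \<in> dpi -` E \<inter> (UHP \<times> UNIV)" using zv(1) pw(1) z by auto
  qed
  moreover have "open (\<Union>c\<in>A. ?P c)"
    using continuous_on_coordinate_differential open_dom E(2)
    by (intro open_UN ballI continuous_open_preimage open_Times open_UNIV) auto
  ultimately have "open (dpi -` E \<inter> (UHP \<times> UNIV))" by simp
  then show "dpi -` E \<inter> space bundle_borel \<in> sets bundle_borel"
    unfolding space_bundle_borel unfolding bundle_borel_def
    by (subst sets_restrict_space_iff) (auto simp: open_UHP_times)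
qed

text \<open>In a chart, \<open>dpi\<close> has the local inverse
  \<open>(x, u) \<mapsto> (k x, u / h'(k x))\<close>, with \<open>k\<close> a local inverse of the
  coordinate map; its continuity makes the image open.\<close>

lemma bundle_open_image:
  assumes P: "open P" "P \<subseteq> UHP \<times> UNIV"
  shows "bundle_open (dpi ` P)"
  unfolding bundle_open_def
proof (intro conjI ballI)
  show "dpi ` P \<subseteq> tangent_bundle X A" using P(2) dpi_tangent by auto
  fix c assume c: "c \<in> A"
  let ?h = "snd c \<circ> \<pi>"
  have img: "bundle_chart c ` over c (dpi ` P) = (\<lambda>(z, v). (?h z, deriv ?h z * v)) ` (P \<inter> dom c \<times> UNIV)"
  proof (intro equalityI subsetI)
    fix y assume "y \<in> bundle_chart c ` over c (dpi ` P)"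
    then obtain q where q: "q \<in> over c (dpi ` P)" "y = bundle_chart c q" by blast
    then have "q \<in> dpi ` P" "fst q \<in> fst c" by (simp_all only: over_iff)
    then obtain z v where zv: "(z, v) \<in> P" "fst (dpi (z, v)) \<in> fst c" "y = bundle_chart c (dpi (z, v))"
      using q(2) by auto
    then have zd: "z \<in> dom c" using P(2) fst_dpi[of z v] by (auto simp: dom_def)
    have "y = (?h z, deriv ?h z * v)"
      using zv(3) dpi_apply[OF c zd] fst_dpi[of z v] by (simp add: bundle_chart_def split_beta)
    then show "y \<in> (\<lambda>(z, v). (?h z, deriv ?h z * v)) ` (P \<inter> dom c \<times> UNIV)" using zv(1) zd by force
  next
    fix y assume "y \<in> (\<lambda>(z, v). (?h z, deriv ?h z * v)) ` (P \<inter> dom c \<times> UNIV)"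
    then obtain z v where zv: "(z, v) \<in> P" "z \<in> dom c" "y = (?h z, deriv ?h z * v)" by auto
    have "dpi (z, v) \<in> over c (dpi ` P)" using zv(1,2) by (simp add: over_iff fst_dpi dom_def)
    moreover have "y = bundle_chart c (dpi (z, v))"
      using zv(3) dpi_apply[OF c zv(2)] fst_dpi[of z v] by (simp add: bundle_chart_def split_beta)
    ultimately show "y \<in> bundle_chart c ` over c (dpi ` P)" by blast
  qed
  show "open (bundle_chart c ` over c (dpi ` P))"
    unfolding img
  proof (subst open_subopen, intro ballI)
    fix y assume "y \<in> (\<lambda>(z, v). (?h z, deriv ?h z * v)) ` (P \<inter> dom c \<times> UNIV)"
    then obtain z v where zv: "(z, v) \<in> P" "z \<in> dom c" "y = (?h z, deriv ?h z * v)" by auto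
    have hol: "?h holomorphic_on dom c" using coordinate_isometry[OF c] by (simp add: hyp_local_isometry_def)
    then obtain r where r: "r > 0" "ball z r \<subseteq> dom c" "inj_on ?h (ball z r)"
      using has_complex_derivative_locally_injective[OF _ zv(2) open_dom[OF c] coordinateD(5)[OF c c zv(2)]] by blast
    have hb: "?h holomorphic_on ball z r" using hol r(2) by (rule holomorphic_on_subset)
    obtain k where k: "k holomorphic_on (?h ` ball z r)" "\<And>x. x \<in> ball z r \<Longrightarrow> k (?h x) = x"
      using holomorphic_has_inverse[OF hb open_ball r(3)] by metis
    have oV: "open (?h ` ball z r)" by (rule open_mapping_thm3[OF hb open_ball r(3)])
    let ?V = "?h ` ball z r"
    have kV: "k ` ?V \<subseteq> dom c" using k(2) r(2) by auto
    have ck: "continuous_on ?V k" using k(1) by (rule holomorphic_on_imp_continuous_on)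
    have cd: "continuous_on (dom c) (deriv ?h)"
      using hol open_dom[OF c] by (intro holomorphic_on_imp_continuous_on holomorphic_deriv)
    have c1: "continuous_on (?V \<times> (UNIV::complex set)) (\<lambda>x. k (fst x))"
      by (rule continuous_on_compose2[OF ck continuous_on_fst[OF continuous_on_id]]) auto
    have c2: "continuous_on (?V \<times> (UNIV::complex set)) (\<lambda>x. deriv ?h (k (fst x)))"
      by (rule continuous_on_compose2[OF cd c1]) (use kV in auto)
    have nz: "deriv ?h (k (fst x)) \<noteq> 0" if "x \<in> ?V \<times> (UNIV::complex set)" for x
      using coordinateD(5)[OF c c] kV that by (auto simp: mem_Times_iff)
    let ?T = "(?V \<times> UNIV) \<inter> (\<lambda>x. (k (fst x), snd x / deriv ?h (k (fst x)))) -` P"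
    have "open ?T"
      by (intro continuous_open_preimage open_Times oV open_UNIV P(1) continuous_intros c1 c2 ballI nz)
    moreover have "y \<in> ?T"
      using zv r(1) k(2)[of z] coordinateD(5)[OF c c zv(2)] by auto
    moreover have "?T \<subseteq> (\<lambda>(z, v). (?h z, deriv ?h z * v)) ` (P \<inter> dom c \<times> UNIV)"
    proof
      fix x assume x: "x \<in> ?T"
      then obtain u where u: "u \<in> ball z r" "fst x = ?h u" by auto
      have ku: "k (fst x) = u" using k(2) u by simp
      have "(u, snd x / deriv ?h u) \<in> P \<inter> dom c \<times> UNIV" using x u r(2) ku by auto
      moreover have "x = (\<lambda>(z, v). (?h z, deriv ?h z * v)) (u, snd x / deriv ?h u)"
        using u coordinateD(5)[OF c c, of u] r(2) by (cases x) (auto simp: subset_iff)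
      ultimately show "x \<in> (\<lambda>(z, v). (?h z, deriv ?h z * v)) ` (P \<inter> dom c \<times> UNIV)" by (rule rev_image_eqI)
    qed
    ultimately show "\<exists>T. open T \<and> y \<in> T \<and> T \<subseteq> (\<lambda>(z, v). (?h z, deriv ?h z * v)) ` (P \<inter> dom c \<times> UNIV)" by blast
  qed
qed

lemma dpi_inj_on: "inj_on \<pi> U \<Longrightarrow> U \<subseteq> UHP \<Longrightarrow> inj_on dpi (U \<times> UNIV)"
proof (rule inj_onI)
  fix x y assume U: "inj_on \<pi> U" "U \<subseteq> UHP" and xy: "x \<in> U \<times> UNIV" "y \<in> U \<times> UNIV" "dpi x = dpi y"
  obtain z v z' v' where x: "x = (z, v)" and y: "y = (z', v')" by (cases x, cases y)
  have "\<pi> z = \<pi> z'" using xy(3) fst_dpi[of z v] fst_dpi[of z' v'] x y by simp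
  then have "z = z'" using U(1) xy x y by (auto dest: inj_onD)
  then show "x = y" using dpi_fibre_inj[of z v v'] U(2) xy x y by auto
qed

lemma injective_cover:
  obtains U :: "nat \<Rightarrow> complex set" where "\<And>n. open (U n)" "\<And>n. U n \<subseteq> UHP" "\<And>n. inj_on \<pi> (U n)" "(\<Union>n. U n) = UHP"
proof -
  let ?F = "{U. open U \<and> U \<subseteq> UHP \<and> inj_on \<pi> U}"
  have "\<Union>?F = UHP"
  proof
    show "UHP \<subseteq> \<Union>?F" using locally_injective by (metis (mono_tags, lifting) UnionI mem_Collect_eq subsetI)
  qed blast
  moreover have "open S" if "S \<in> ?F" for S using that by blast
  then obtain F where F: "F \<subseteq> ?F" "countable F" "\<Union>F = \<Union>?F" by (rule Lindelof)
  ultimately have FU: "\<Union>F = UHP" by simp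
  have ne: "F \<noteq> {}" using FU i_UHP by blast
  have r: "range (from_nat_into F) = F" by (rule range_from_nat_into[OF ne F(2)])
  then have mem: "from_nat_into F n \<in> ?F" for n using F(1) by blast
  show ?thesis
    by (rule that[of "from_nat_into F"]) (use mem r FU in auto)
qed

text \<open>Images commute with complements only for injective maps, so the induction over Borel
  sets runs on each injective sheet \<open>U n \<times> UNIV\<close>; countably many sheets
  cover.\<close>

lemma dpi_image_measurable:
  assumes E: "E \<in> sets bundle_borel"
  shows "dpi ` E \<in> sets (tangent_bundle_borel X A)"
proof -
  obtain U where U: "\<And>n. open (U n)" "\<And>n. U n \<subseteq> UHP" "\<And>n. inj_on \<pi> (U n)" "(\<Union>n::nat. U n) = UHP"
    using injective_cover by blast
  have E': "E \<in> sets borel" "E \<subseteq> UHP \<times> UNIV"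
    using E unfolding bundle_borel_def by (subst (asm) sets_restrict_space_iff; simp add: open_UHP_times)+
  have loc: "dpi ` ((U n \<times> UNIV) \<inter> B) \<in> sets (tangent_bundle_borel X A)" if "B \<in> sets borel" for B n
  proof -
    have inj: "inj_on dpi (U n \<times> UNIV)" by (rule dpi_inj_on[OF U(3,2)])
    have op: "dpi ` ((U n \<times> UNIV) \<inter> S) \<in> sets (tangent_bundle_borel X A)" if "open S" for S
      using U(1,2)[of n] that by (intro bundle_open_sets bundle_open_image open_Int open_Times open_UNIV) auto
    have "B \<in> sigma_sets UNIV {S. open S}" using that by (simp add: borel_def)
    then show ?thesis
    proof (induction rule: sigma_sets.induct)
      case (Basic S)
      then show ?case using op by simp
    next
      case (Compl S)
      have "(U n \<times> UNIV) \<inter> (UNIV - S) = (U n \<times> UNIV) \<inter> UNIV - (U n \<times> UNIV) \<inter> S" by blast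
      then have "dpi ` ((U n \<times> UNIV) \<inter> (UNIV - S)) = dpi ` ((U n \<times> UNIV) \<inter> UNIV) - dpi ` ((U n \<times> UNIV) \<inter> S)"
        using inj by (simp add: inj_on_image_set_diff[of dpi "U n \<times> UNIV"])
      then show ?case using op[OF open_UNIV] Compl.IH by simp
    next
      case (Union S)
      have "dpi ` ((U n \<times> UNIV) \<inter> (\<Union>i. S i)) = (\<Union>i. dpi ` ((U n \<times> UNIV) \<inter> S i))" by blast
      then show ?case using Union.IH by simp
    qed simp
  qed
  have "dpi ` E = (\<Union>n. dpi ` ((U n \<times> UNIV) \<inter> E))"
    using E'(2) U(4) by auto blast
  then show ?thesis using loc[OF E'(1)] by simp
qed

section \<open>A Borel fundamental domain\<close>

text \<open>From the n-th sheet keep the points whose image no earlier sheet has met. Each point of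
  \<open>X\<close> then retains exactly its preimage in the first sheet that reaches it.\<close>

lemma fundamental_domain:
  obtains D where "D \<in> sets borel" "D \<subseteq> UHP" "\<And>p. p \<in> X \<Longrightarrow> \<exists>!z. z \<in> D \<and> \<pi> z = p"
proof -
  obtain U where U: "\<And>n. open (U n)" "\<And>n. U n \<subseteq> UHP" "\<And>n. inj_on \<pi> (U n)" "(\<Union>n::nat. U n) = UHP"
    using injective_cover by blast
  define V where "V n = {z \<in> UHP. \<pi> z \<in> \<pi> ` U n}" for n
  define D where "D = (\<Union>n. U n - (\<Union>m\<in>{..<n}. V m))"
  have V: "V n \<in> sets borel" for n
  proof -
    \<comment> \<open>The zero section carries the question into the bundle, where measurability of
      \<open>dpi\<close> and of its open images is already available.\<close>
    have "V n = UHP \<inter> (\<lambda>z. (z, 0::complex)) -` (dpi -` (dpi ` (U n \<times> UNIV)) \<inter> (UHP \<times> UNIV))"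
    proof (intro equalityI subsetI)
      fix z assume "z \<in> V n"
      then obtain u where u: "z \<in> UHP" "u \<in> U n" "\<pi> z = \<pi> u" by (auto simp: V_def)
      have t: "(\<pi> z, snd (dpi (z, 0))) \<in> tangent_bundle X A"
        using dpi_tangent[OF u(1), of 0] fst_dpi[of z 0] by (metis prod.collapse)
      obtain v where "dpi (u, v) = (\<pi> z, snd (dpi (z, 0)))"
        using dpi_surj[OF t, of u] u U(2)[of n] by auto
      then have "dpi (z, 0) = dpi (u, v)" using fst_dpi[of z 0] by (metis prod.collapse)
      then show "z \<in> UHP \<inter> (\<lambda>z. (z, 0::complex)) -` (dpi -` (dpi ` (U n \<times> UNIV)) \<inter> (UHP \<times> UNIV))"
        using u by auto
    next
      fix z assume "z \<in> UHP \<inter> (\<lambda>z. (z, 0::complex)) -` (dpi -` (dpi ` (U n \<times> UNIV)) \<inter> (UHP \<times> UNIV))"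
      then obtain u v where "z \<in> UHP" "u \<in> U n" "dpi (z, 0) = dpi (u, v)" by auto
      moreover from this have "\<pi> z = \<pi> u" using fst_dpi[of z 0] fst_dpi[of u v] by simp
      ultimately show "z \<in> V n" by (simp add: V_def)
    qed
    moreover have "dpi ` (U n \<times> UNIV) \<in> sets (tangent_bundle_borel X A)"
      using U(1,2)[of n] by (intro bundle_open_sets bundle_open_image open_Times open_UNIV) auto
    then have "dpi -` (dpi ` (U n \<times> UNIV)) \<inter> (UHP \<times> UNIV) \<in> sets bundle_borel"
      using measurable_sets[OF dpi_measurable] by (simp add: space_bundle_borel)
    then have "dpi -` (dpi ` (U n \<times> UNIV)) \<inter> (UHP \<times> UNIV) \<in> sets borel"
      unfolding bundle_borel_def by (subst (asm) sets_restrict_space_iff) (simp_all add: open_UHP_times)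
    then have "(\<lambda>z. (z, 0::complex)) -` (dpi -` (dpi ` (U n \<times> UNIV)) \<inter> (UHP \<times> UNIV)) \<inter> space borel \<in> sets borel"
      by (intro measurable_sets[of _ borel borel]) (auto intro!: borel_measurable_continuous_onI continuous_intros)
    ultimately show ?thesis using UHP_borel by auto
  qed
  have "D \<in> sets borel"
    unfolding D_def using U(1) V by (intro sets.countable_UN) auto
  moreover have "D \<subseteq> UHP" unfolding D_def using U(2) by blast
  moreover have "\<exists>!z. z \<in> D \<and> \<pi> z = p" if p: "p \<in> X" for p
  proof -
    obtain x where x: "x \<in> UHP" "\<pi> x = p" using pi_props(2) p by blast
    then have "\<exists>n. p \<in> \<pi> ` U n" using U(4) by blast
    define n where "n = (LEAST n. p \<in> \<pi> ` U n)"
    have n: "p \<in> \<pi> ` U n" "\<And>m. m < n \<Longrightarrow> p \<notin> \<pi> ` U m"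
      using LeastI_ex[OF \<open>\<exists>n. p \<in> \<pi> ` U n\<close>] not_less_Least unfolding n_def by auto
    obtain z where z: "z \<in> U n" "\<pi> z = p" using n(1) by blast
    have "z \<in> D" unfolding D_def using z n(2) by (auto simp: V_def)
    moreover have "y = z" if y: "y \<in> D" "\<pi> y = p" for y
    proof -
      obtain m where m: "y \<in> U m" "\<And>k. k < m \<Longrightarrow> y \<notin> V k" using y(1) unfolding D_def by blast
      have "y \<in> UHP" using m(1) U(2) by blast
      then have "\<not> n < m" using m(2)[of n] y(2) n(1) by (auto simp: V_def)
      moreover have "\<not> m < n" using n(2)[of m] m(1) y(2) by blast
      ultimately have "m = n" by simp
      then show ?thesis using U(3)[of n] m(1) z y(2) by (auto dest: inj_onD)
    qed
    ultimately show ?thesis using z(2) by blast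
  qed
  ultimately show ?thesis using that by blast
qed

lemma countable_fibre: "countable {z \<in> UHP. \<pi> z = p}"
proof -
  obtain U where U: "\<And>n. open (U n)" "\<And>n. U n \<subseteq> UHP" "\<And>n. inj_on \<pi> (U n)" "(\<Union>n::nat. U n) = UHP"
    using injective_cover by blast
  have "countable {z \<in> U n. \<pi> z = p}" for n
  proof (cases "\<exists>z\<in>U n. \<pi> z = p")
    case True
    then obtain z where z: "z \<in> U n" "\<pi> z = p" by blast
    then have "{z \<in> U n. \<pi> z = p} \<subseteq> {z}" using U(3)[of n] by (auto dest: inj_onD)
    then show ?thesis by (rule countable_subset) simp
  next
    case False
    then have "{z \<in> U n. \<pi> z = p} = {}" by blast
    then show ?thesis by (simp only: countable_empty)
  qed
  then have "countable (\<Union>n. {z \<in> U n. \<pi> z = p})" by simp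
  also have "(\<Union>n. {z \<in> U n. \<pi> z = p}) = {z \<in> UHP. \<pi> z = p}" using U(4) by blast
  finally show ?thesis .
qed

end

section \<open>Descent to the surface\<close>

lemma bundle_borel_iff: "E \<in> sets bundle_borel \<longleftrightarrow> E \<in> sets borel \<and> E \<subseteq> UHP \<times> UNIV"
  unfolding bundle_borel_def by (subst sets_restrict_space_iff) (auto simp: open_UHP_times)

lemma tangent_map_isometry:
  "isometry_pair f g \<Longrightarrow> z \<in> UHP \<Longrightarrow> tangent_map f (z, v) = (f z, deriv f z * v)"
  using frechet_derivative_field[OF hyp_local_isometryD(3)[OF isometry_pairD(1) open_UHP]]
  by (simp add: tangent_map_def)

lemma tangent_map_inverse:
  assumes fg: "isometry_pair f g" and x: "x \<in> UHP \<times> UNIV"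
  shows "tangent_map f x \<in> UHP \<times> UNIV" "tangent_map g (tangent_map f x) = x"
proof -
  note d = isometry_pairD[OF fg]
  obtain z v where zv: "x = (z, v)" "z \<in> UHP" using x by auto
  have "((\<lambda>w. g (f w)) has_field_derivative deriv g (f z) * deriv f z) (at z)"
    by (rule DERIV_chain2[OF hyp_local_isometryD(3)[OF d(2) open_UHP d(5)[OF zv(2)]] hyp_local_isometryD(3)[OF d(1) open_UHP zv(2)]])
  moreover have "((\<lambda>w. g (f w)) has_field_derivative 1) (at z)"
    by (rule has_field_derivative_transform_within_open[OF DERIV_ident open_UHP zv(2)]) (simp add: d(4))
  ultimately have "deriv g (f z) * deriv f z = 1" by (rule DERIV_unique)
  then show "tangent_map f x \<in> UHP \<times> UNIV" "tangent_map g (tangent_map f x) = x"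
    using d(4,5)[OF zv(2)]
    by (simp_all add: zv tangent_map_isometry[OF fg] tangent_map_isometry[OF isometry_pair_sym[OF fg]] mult.assoc[symmetric])
qed

lemma tangent_map_image:
  assumes fg: "isometry_pair f g" and E: "E \<subseteq> UHP \<times> UNIV"
  shows "tangent_map f ` E = tangent_map g -` E \<inter> (UHP \<times> UNIV)"
proof (intro equalityI subsetI)
  fix y assume "y \<in> tangent_map f ` E"
  then obtain x where "x \<in> E" "y = tangent_map f x" by blast
  then show "y \<in> tangent_map g -` E \<inter> (UHP \<times> UNIV)"
    using tangent_map_inverse[OF fg, of x] E by auto
next
  fix y assume "y \<in> tangent_map g -` E \<inter> (UHP \<times> UNIV)"
  then have "tangent_map g y \<in> E" "y = tangent_map f (tangent_map g y)"
    using tangent_map_inverse(2)[OF isometry_pair_sym[OF fg], of y] by auto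
  then show "y \<in> tangent_map f ` E" by blast
qed

lemma tangent_map_image_measurable:
  assumes fg: "isometry_pair f g" and E: "E \<in> sets bundle_borel"
  shows "tangent_map f ` E \<in> sets bundle_borel"
  using measurable_sets[OF tangent_map_measurable[OF fg] E] E
  by (simp add: tangent_map_image[OF fg] bundle_borel_iff space_bundle_borel)

lemma emeasure_tangent_map_image:
  assumes fg: "isometry_pair f g" and M: "sets M = sets bundle_borel"
    and N: "N = distr M bundle_borel (tangent_map g)" and E: "E \<in> sets bundle_borel"
  shows "emeasure M (tangent_map f ` E) = emeasure N E"
proof -
  have "tangent_map g \<in> M \<rightarrow>\<^sub>M bundle_borel"
    using tangent_map_measurable[OF fg] measurable_cong_sets[OF M refl] by blast
  moreover have "space M = UHP \<times> UNIV" using sets_eq_imp_space_eq[OF M] space_bundle_borel by simp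
  ultimately show ?thesis
    using E tangent_map_image[OF fg, of E] by (simp add: N emeasure_distr bundle_borel_iff)
qed

text \<open>A tangent vector is determined by its coordinate in a single chart, and there the claim
  is the chain rule.\<close>

lemma covering_differential_lift:
  assumes "covered_surface X A \<pi>" "covered_surface X A \<pi>'"
    and fg: "isometry_pair f g" and lift: "\<And>x. x \<in> UHP \<Longrightarrow> \<pi> (f x) = \<pi>' x" and x: "x \<in> UHP \<times> UNIV"
  shows "covering_differential A \<pi>' x = covering_differential A \<pi> (tangent_map f x)"
proof -
  interpret p: covered_surface X A \<pi> by fact
  interpret q: covered_surface X A \<pi>' by fact
  note fd = isometry_pairD[OF fg]
  obtain z v where zv: "x = (z, v)" "z \<in> UHP" using x by auto
  obtain c where c: "c \<in> A" "z \<in> q.dom c" using q.ex_dom[OF zv(2)] by blast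
  have fz: "f z \<in> p.dom c" using c(2) fd(5)[OF zv(2)] lift[OF zv(2)] by (auto simp: p.dom_def q.dom_def)
  have "((\<lambda>x. (snd c \<circ> \<pi>) (f x)) has_field_derivative deriv (snd c \<circ> \<pi>) (f z) * deriv f z) (at z)"
    by (rule DERIV_chain2[OF p.coordinateD(3)[OF c(1) c(1) fz] hyp_local_isometryD(3)[OF fd(1) open_UHP zv(2)]])
  then have "((snd c \<circ> \<pi>') has_field_derivative deriv (snd c \<circ> \<pi>) (f z) * deriv f z) (at z)"
    by (rule has_field_derivative_transform_within_open[OF _ open_UHP zv(2)]) (simp add: lift)
  then have d: "deriv (snd c \<circ> \<pi>') z = deriv (snd c \<circ> \<pi>) (f z) * deriv f z" by (rule DERIV_imp_deriv)
  let ?y = "covering_differential A \<pi> (tangent_map f x)"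
  have y: "?y = (\<pi>' z, snd ?y)"
    using p.fst_dpi[of "f z" "deriv f z * v"] lift[OF zv(2)] tangent_map_isometry[OF fg zv(2)]
    by (metis prod.collapse zv(1))
  have t: "?y \<in> tangent_bundle X A"
    using p.dpi_tangent[OF fd(5)[OF zv(2)]] by (simp add: zv tangent_map_isometry[OF fg])
  have "snd ?y c = deriv (snd c \<circ> \<pi>) (f z) * (deriv f z * v)"
    using p.dpi_apply[OF c(1) fz] by (simp add: zv tangent_map_isometry[OF fg])
  then have "covering_differential A \<pi>' (z, v) = (\<pi>' z, snd ?y)"
    using t y d by (intro q.dpi_eqI[OF zv(2) _ c refl]) (auto simp: mult.assoc)
  then show ?thesis using y zv(1) by simp
qed

context covered_surface
begin

lemma lift_unique:
  assumes "continuous_on UHP f1" "f1 \<in> UHP \<rightarrow> UHP" "continuous_on UHP f2" "f2 \<in> UHP \<rightarrow> UHP"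
    and "\<And>x. x \<in> UHP \<Longrightarrow> \<pi> (f1 x) = \<pi> (f2 x)" "z \<in> UHP" "f1 z = f2 z" "x \<in> UHP"
  shows "f1 x = f2 x"
proof (rule covering_space_lift_unique[where c = UHP and p = \<pi> and S = X and f = "\<lambda>x. \<pi> (f1 x)" and T = UHP and a = z and ?g1.0 = f1 and ?g2.0 = f2])
  show "covering_space UHP \<pi> X" using covering by (simp add: hyperbolic_covering_def)
  show "continuous_on UHP (\<lambda>x. \<pi> (f1 x))"
    by (rule continuous_on_compose2[OF pi_props(1) assms(1)]) (use assms(2) in auto)
  show "(\<lambda>x. \<pi> (f1 x)) \<in> UHP \<rightarrow> X" using pi_props(3) assms(2) by auto
qed (use assms connected_UHP in auto)

text \<open>A deck transformation is by definition only a homeomorphism. There is an isometric lift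
  sending \<open>\<i>\<close> to the same point, and uniqueness of lifts identifies the two on
  \<open>UHP\<close>.\<close>

lemma deck_group_isometry:
  assumes "\<gamma> \<in> deck_group \<pi>"
  obtains f g where "isometry_pair f g" "\<And>x. x \<in> UHP \<Longrightarrow> \<pi> (f x) = \<pi> x" "\<And>x. x \<in> UHP \<Longrightarrow> \<gamma> x = f x"
proof -
  obtain \<delta> where h: "homeomorphism UHP UHP \<gamma> \<delta>" and p: "\<And>z. z \<in> UHP \<Longrightarrow> \<pi> (\<gamma> z) = \<pi> z"
    using assms by (auto simp: deck_group_def)
  then have c: "continuous_on UHP \<gamma>" "\<gamma> ` UHP = UHP" by (auto simp: homeomorphism_def)
  then have gi: "\<gamma> \<i> \<in> UHP" using i_UHP by blast
  obtain f g where fg: "isometry_pair f g" "f \<i> = \<gamma> \<i>" "\<And>x. x \<in> UHP \<Longrightarrow> \<pi> (f x) = \<pi> x"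
    using two_coverings_lift[OF covered_surface_axioms covered_surface_axioms i_UHP gi p[OF i_UHP]] by blast
  have "\<gamma> x = f x" if "x \<in> UHP" for x
    by (rule lift_unique[OF c(1) _ isometry_pairD(11)[OF fg(1)] _ _ i_UHP _ that])
      (use c(2) isometry_pairD(5)[OF fg(1)] p fg in auto)
  then show ?thesis using that fg by blast
qed

text \<open>Deck transformations are indexed by where they send \<open>\<i>\<close>, so by the fibre
  over \<open>\<pi> \<i>\<close>, which is countable. Uniqueness of lifts makes them act simply
  transitively on every fibre.\<close>

lemma deck_representatives:
  obtains \<gamma> \<delta> :: "complex \<Rightarrow> complex \<Rightarrow> complex"
  where "\<And>w. w \<in> {w \<in> UHP. \<pi> w = \<pi> \<i>} \<Longrightarrow> isometry_pair (\<gamma> w) (\<delta> w)"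
    and "\<And>w x. w \<in> {w \<in> UHP. \<pi> w = \<pi> \<i>} \<Longrightarrow> x \<in> UHP \<Longrightarrow> \<pi> (\<gamma> w x) = \<pi> x"
    and "\<And>z z'. z \<in> UHP \<Longrightarrow> z' \<in> UHP \<Longrightarrow> \<pi> z = \<pi> z' \<Longrightarrow> \<exists>w\<in>{w \<in> UHP. \<pi> w = \<pi> \<i>}. \<gamma> w z = z'"
    and "\<And>w w' z. w \<in> {w \<in> UHP. \<pi> w = \<pi> \<i>} \<Longrightarrow> w' \<in> {w \<in> UHP. \<pi> w = \<pi> \<i>} \<Longrightarrow> z \<in> UHP \<Longrightarrow> \<gamma> w z = \<gamma> w' z \<Longrightarrow> w = w'"
proof -
  let ?F = "{w \<in> UHP. \<pi> w = \<pi> \<i>}"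
  have "\<exists>p. isometry_pair (fst p) (snd p) \<and> fst p \<i> = w \<and> (\<forall>x\<in>UHP. \<pi> (fst p x) = \<pi> x)" if w: "w \<in> ?F" for w
  proof -
    have "w \<in> UHP" "\<pi> w = \<pi> \<i>" using w by auto
    then obtain f g where "isometry_pair f g" "f \<i> = w" "\<And>x. x \<in> UHP \<Longrightarrow> \<pi> (f x) = \<pi> x"
      using two_coverings_lift[OF covered_surface_axioms covered_surface_axioms i_UHP] by blast
    then show ?thesis by (intro exI[of _ "(f, g)"]) auto
  qed
  then have "\<exists>P. \<forall>w\<in>?F. isometry_pair (fst (P w)) (snd (P w)) \<and> fst (P w) \<i> = w \<and> (\<forall>x\<in>UHP. \<pi> (fst (P w) x) = \<pi> x)"
    by (intro bchoice ballI)
  then obtain P where "\<forall>w\<in>?F. isometry_pair (fst (P w)) (snd (P w)) \<and> fst (P w) \<i> = w \<and> (\<forall>x\<in>UHP. \<pi> (fst (P w) x) = \<pi> x)"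
    by (elim exE)
  then have P: "\<And>w. w \<in> ?F \<Longrightarrow> isometry_pair (fst (P w)) (snd (P w))" "\<And>w. w \<in> ?F \<Longrightarrow> fst (P w) \<i> = w"
    "\<And>w x. w \<in> ?F \<Longrightarrow> x \<in> UHP \<Longrightarrow> \<pi> (fst (P w) x) = \<pi> x"
    by (simp_all only: Ball_def)
  have same: "f x = f' x"
    if "isometry_pair f g" "isometry_pair f' g'" "\<And>x. x \<in> UHP \<Longrightarrow> \<pi> (f x) = \<pi> x" "\<And>x. x \<in> UHP \<Longrightarrow> \<pi> (f' x) = \<pi> x"
      "z \<in> UHP" "f z = f' z" "x \<in> UHP" for f g f' g' z x
    by (rule lift_unique[OF isometry_pairD(11)[OF that(1)] _ isometry_pairD(11)[OF that(2)] _ _ that(5-7)])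
      (use that isometry_pairD(5)[OF that(1)] isometry_pairD(5)[OF that(2)] in auto)
  show ?thesis
  proof (rule that[of "\<lambda>w. fst (P w)" "\<lambda>w. snd (P w)"])
    fix z z' assume z: "z \<in> UHP" "z' \<in> UHP" "\<pi> z = \<pi> z'"
    obtain f g where fg: "isometry_pair f g" "f z = z'" "\<And>x. x \<in> UHP \<Longrightarrow> \<pi> (f x) = \<pi> x"
      using two_coverings_lift[OF covered_surface_axioms covered_surface_axioms z(1,2)] z(3) by metis
    have F: "f \<i> \<in> ?F" using fg(3)[OF i_UHP] isometry_pairD(5)[OF fg(1) i_UHP] by simp
    have "fst (P (f \<i>)) z = f z"
      by (rule same[OF P(1)[OF F] fg(1) P(3)[OF F] fg(3) i_UHP P(2)[OF F] z(1)])
    then show "\<exists>w\<in>?F. fst (P w) z = z'" using F fg(2) by blast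
  next
    fix w w' z assume w: "w \<in> ?F" "w' \<in> ?F" and z: "z \<in> UHP" "fst (P w) z = fst (P w') z"
    have "fst (P w) \<i> = fst (P w') \<i>"
      by (rule same[OF P(1)[OF w(1)] P(1)[OF w(2)] P(3)[OF w(1)] P(3)[OF w(2)] z i_UHP])
    then show "w = w'" using P(2)[OF w(1)] P(2)[OF w(2)] by simp
  qed (use P in blast)+
qed

lemma dpi_eq_iff_tangent_map:
  assumes fg: "isometry_pair f g" "\<And>x. x \<in> UHP \<Longrightarrow> \<pi> (f x) = \<pi> x" and x: "x \<in> UHP \<times> UNIV"
  shows "dpi (tangent_map f x) = dpi x"
  using covering_differential_lift[OF covered_surface_axioms covered_surface_axioms fg x] by simp

lemma fst_tangent_map: "fst (tangent_map f x) = f (fst x)"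
  by (simp add: tangent_map_def split_beta)

context
  fixes D assumes D: "D \<in> sets borel" "D \<subseteq> UHP" "\<forall>p\<in>X. \<exists>!z. z \<in> D \<and> \<pi> z = p"
begin

lemma domain_times: "D \<times> UNIV \<in> sets bundle_borel"
proof -
  have "fst -` D \<inter> space borel \<in> sets (borel :: (complex \<times> complex) measure)"
    by (rule measurable_sets[OF _ D(1)]) (intro borel_measurable_continuous_onI continuous_intros)
  moreover have "fst -` D \<inter> space borel = D \<times> (UNIV :: complex set)" by auto
  ultimately show ?thesis using D(2) by (auto simp: bundle_borel_iff)
qed

lemma domain_trace_measurable:
  assumes "F \<in> sets (tangent_bundle_borel X A)"
  shows "dpi -` F \<inter> (D \<times> UNIV) \<in> sets bundle_borel"
proof -
  have "(dpi -` F \<inter> space bundle_borel) \<inter> (D \<times> UNIV) \<in> sets bundle_borel"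
    by (intro sets.Int measurable_sets[OF dpi_measurable assms] domain_times)
  also have "(dpi -` F \<inter> space bundle_borel) \<inter> (D \<times> UNIV) = dpi -` F \<inter> (D \<times> UNIV)"
    using D(2) by (auto simp: space_bundle_borel)
  finally show ?thesis .
qed

text \<open>The part over \<open>D\<close> of the preimage of \<open>F\<close> maps bijectively onto
  \<open>F\<close>, so the defining property fixes the measure of every \<open>F\<close>. Uniqueness
  rests on this formula.\<close>

lemma descends_to_emeasure:
  assumes \<nu>: "descends_to X A \<pi> \<mu> \<nu>" and F: "F \<in> sets \<nu>"
  shows "emeasure \<nu> F = emeasure \<mu> (dpi -` F \<inter> (D \<times> UNIV))"
proof -
  have F': "F \<in> sets (tangent_bundle_borel X A)" using \<nu> F by (simp add: descends_to_def)
  have sub: "F \<subseteq> tangent_bundle X A" using sets.sets_into_space[OF F'] by (simp add: space_tangent_bundle_borel)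
  have "inj_on \<pi> D" using D(3) pi_props(3) D(2) by (intro inj_onI) (metis subsetD)
  then have inj: "inj_on dpi (D \<times> UNIV)" by (rule dpi_inj_on[OF _ D(2)])
  have "dpi ` (dpi -` F \<inter> (D \<times> UNIV)) = F"
  proof (intro equalityI subsetI)
    fix q assume q: "q \<in> F"
    obtain p w where pw: "q = (p, w)" by (cases q)
    then have t: "(p, w) \<in> tangent_bundle X A" using q sub by blast
    then have "p \<in> X" by (simp add: tangent_bundle_def)
    then obtain z where z: "z \<in> D" "\<pi> z = p" using D(3) by blast
    then obtain v where "dpi (z, v) = (p, w)" using dpi_surj[OF t, of z] D(2) by blast
    then show "q \<in> dpi ` (dpi -` F \<inter> (D \<times> UNIV))" using z(1) q pw by (intro image_eqI[of _ _ "(z, v)"]) auto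
  qed blast
  moreover have "inj_on dpi (dpi -` F \<inter> (D \<times> UNIV))" using inj by (rule inj_on_subset) blast
  ultimately show ?thesis
    using \<nu> domain_trace_measurable[OF F'] unfolding descends_to_def by metis
qed

text \<open>Cut \<open>E\<close> into pieces according to the deck transformation that moves a point
  into \<open>D\<close>. Each move preserves \<open>\<mu>\<close>, and the moved pieces fill the
  part over \<open>D\<close> of the preimage of the image of \<open>E\<close>. They are disjoint
  because \<open>dpi\<close> is injective on \<open>E\<close>.\<close>

lemma descends_to_distr:
  assumes \<mu>: "sets \<mu> = sets bundle_borel"
    and inv: "\<And>f g. isometry_pair f g \<Longrightarrow> (\<And>x. x \<in> UHP \<Longrightarrow> \<pi> (f x) = \<pi> x) \<Longrightarrow> distr \<mu> bundle_borel (tangent_map f) = \<mu>"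
  shows "descends_to X A \<pi> \<mu> (distr (restrict_space \<mu> (D \<times> UNIV)) (tangent_bundle_borel X A) dpi)"
  unfolding descends_to_def
proof (intro conjI ballI impI)
  let ?\<nu> = "distr (restrict_space \<mu> (D \<times> UNIV)) (tangent_bundle_borel X A) dpi"
  let ?D = "D \<times> (UNIV :: complex set)" and ?S = "{w \<in> UHP. \<pi> w = \<pi> \<i>}"
  show "sets ?\<nu> = sets (tangent_bundle_borel X A)" by simp
  fix E assume E: "E \<in> sets bundle_borel" "inj_on dpi E"
  have EU: "E \<subseteq> UHP \<times> UNIV" using E(1) by (simp add: bundle_borel_iff)
  have sp: "space \<mu> = UHP \<times> UNIV" using sets_eq_imp_space_eq[OF \<mu>] space_bundle_borel by simp
  have DU: "?D \<subseteq> UHP \<times> UNIV" using D(2) by blast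
  have Dm: "?D \<in> sets \<mu>" using domain_times \<mu> by simp
  have dm: "dpi \<in> \<mu> \<rightarrow>\<^sub>M tangent_bundle_borel X A" using dpi_measurable measurable_cong_sets[OF \<mu> refl] by blast
  have img: "dpi ` E \<in> sets (tangent_bundle_borel X A)" by (rule dpi_image_measurable[OF E(1)])
  obtain \<gamma> \<delta> :: "complex \<Rightarrow> complex \<Rightarrow> complex" where
    iso: "\<And>w. w \<in> ?S \<Longrightarrow> isometry_pair (\<gamma> w) (\<delta> w)"
    and lift: "\<And>w x. w \<in> ?S \<Longrightarrow> x \<in> UHP \<Longrightarrow> \<pi> (\<gamma> w x) = \<pi> x"
    and trans: "\<And>z z'. z \<in> UHP \<Longrightarrow> z' \<in> UHP \<Longrightarrow> \<pi> z = \<pi> z' \<Longrightarrow> \<exists>w\<in>?S. \<gamma> w z = z'"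
    and free: "\<And>w w' z. w \<in> ?S \<Longrightarrow> w' \<in> ?S \<Longrightarrow> z \<in> UHP \<Longrightarrow> \<gamma> w z = \<gamma> w' z \<Longrightarrow> w = w'"
    by (rule deck_representatives, rule that) blast+
  let ?T = "\<lambda>w. tangent_map (\<gamma> w)"
  define P where "P = (\<lambda>w. E \<inter> (?T w -` ?D \<inter> (UHP \<times> UNIV)))"
  have P_iff: "e \<in> P w \<longleftrightarrow> e \<in> E \<and> ?T w e \<in> ?D \<and> e \<in> UHP \<times> UNIV" for e w
    unfolding P_def by (simp only: Int_iff vimage_eq)
  have Pm: "P w \<in> sets bundle_borel" if "w \<in> ?S" for w
    unfolding P_def
    using measurable_sets[OF tangent_map_measurable[OF isometry_pair_sym[OF iso[OF that]]] domain_times] E(1)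
    by (intro sets.Int[OF E(1)]) (simp add: space_bundle_borel)
  have TPm: "?T w ` P w \<in> sets bundle_borel" if "w \<in> ?S" for w
    by (rule tangent_map_image_measurable[OF iso[OF that] Pm[OF that]])
  have TP: "emeasure \<mu> (?T w ` P w) = emeasure \<mu> (P w)" if w: "w \<in> ?S" for w
  proof (rule emeasure_tangent_map_image[OF iso[OF w] \<mu> _ Pm[OF w]])
    show "\<mu> = distr \<mu> bundle_borel (tangent_map (\<delta> w))"
    proof (rule inv[symmetric, OF isometry_pair_sym[OF iso[OF w]]])
      fix x assume x: "x \<in> UHP"
      show "\<pi> (\<delta> w x) = \<pi> x"
        using lift[OF w isometry_pairD(6)[OF iso[OF w] x]] isometry_pairD(3)[rule_format, OF iso[OF w] x] by simp
    qed
  qed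
  have dT: "dpi (?T w x) = dpi x" if "w \<in> ?S" "x \<in> UHP \<times> UNIV" for w x
    by (rule dpi_eq_iff_tangent_map[OF iso[OF that(1)] lift[OF that(1)] that(2)])
  have Y: "dpi -` (dpi ` E) \<inter> ?D = (\<Union>w\<in>?S. ?T w ` P w)"
  proof (intro equalityI subsetI)
    fix y assume y: "y \<in> dpi -` (dpi ` E) \<inter> ?D"
    then obtain e where e: "e \<in> E" "dpi y = dpi e" by auto
    have yU: "fst y \<in> UHP" and eU: "fst e \<in> UHP" using y DU e(1) EU by auto
    have "\<pi> (fst e) = \<pi> (fst y)" using e(2) fst_dpi by (metis prod.collapse)
    then obtain w where w: "w \<in> ?S" "\<gamma> w (fst e) = fst y" using trans[OF eU yU] by blast
    have eU': "e \<in> UHP \<times> UNIV" using e(1) EU by blast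
    have "dpi (?T w e) = dpi y" using dT[OF w(1) eU'] e(2) by simp
    moreover have "?T w e = (fst y, snd (?T w e))" using fst_tangent_map[of "\<gamma> w" e] w(2) by (metis prod.collapse)
    ultimately have "dpi (fst y, snd (?T w e)) = dpi (fst y, snd y)" by simp
    then have "snd (?T w e) = snd y" by (rule dpi_fibre_inj[OF yU])
    then have Te: "?T w e = y" using \<open>?T w e = (fst y, snd (?T w e))\<close> by simp
    have "?T w e \<in> ?D" using Te y by (simp only: Int_iff)
    then have "e \<in> P w" using e(1) eU' by (simp only: P_iff)
    then show "y \<in> (\<Union>w\<in>?S. ?T w ` P w)" using w(1) Te by blast
  next
    fix y assume "y \<in> (\<Union>w\<in>?S. ?T w ` P w)"
    then obtain w e where "w \<in> ?S" "e \<in> P w" "y = ?T w e" by (elim UN_E imageE)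
    then have we: "w \<in> ?S" "e \<in> E" "?T w e \<in> ?D" "e \<in> UHP \<times> UNIV" "y = ?T w e"
      by (simp_all only: P_iff)
    have "dpi y \<in> dpi ` E" using dT[OF we(1,4)] we(2,5) by (simp only: imageI)
    then show "y \<in> dpi -` (dpi ` E) \<inter> ?D" using we(3,5) by (simp only: Int_iff vimage_eq)
  qed
  have cover: "E = (\<Union>w\<in>?S. P w)"
  proof (intro equalityI subsetI)
    fix e assume e: "e \<in> E"
    then have eU: "e \<in> UHP \<times> UNIV" "fst e \<in> UHP" using EU by auto
    obtain z where z: "z \<in> D" "\<pi> z = \<pi> (fst e)" using D(3)[rule_format, OF pi_props(3)[OF eU(2)]] by blast
    then obtain w where w: "w \<in> ?S" "\<gamma> w (fst e) = z" using trans[OF eU(2), of z] D(2) by auto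
    have "fst (?T w e) \<in> D" using fst_tangent_map[of "\<gamma> w" e] w(2) z(1) by simp
    then have "e \<in> P w" using e eU by (simp add: P_iff mem_Times_iff)
    then show "e \<in> (\<Union>w\<in>?S. P w)" using w(1) by blast
  qed (simp only: UN_iff P_iff, blast)
  have disjP: "disjoint_family_on P ?S"
    unfolding disjoint_family_on_def
  proof (intro ballI impI)
    fix w w' assume w: "w \<in> ?S" "w' \<in> ?S" "w \<noteq> w'"
    show "P w \<inter> P w' = {}"
    proof (rule ccontr)
      assume "P w \<inter> P w' \<noteq> {}"
      then obtain e where "e \<in> P w" "e \<in> P w'" by blast
      then have e: "e \<in> UHP \<times> UNIV" "?T w e \<in> ?D" "?T w' e \<in> ?D" by (simp_all only: P_iff)
      then have eU: "fst e \<in> UHP" and in_D: "\<gamma> w (fst e) \<in> D" "\<gamma> w' (fst e) \<in> D"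
        using fst_tangent_map[of "\<gamma> w" e] fst_tangent_map[of "\<gamma> w'" e] by (auto simp: mem_Times_iff)
      have "\<pi> (\<gamma> w (fst e)) = \<pi> (fst e)" "\<pi> (\<gamma> w' (fst e)) = \<pi> (fst e)" using lift w eU by blast+
      then have "\<gamma> w (fst e) = \<gamma> w' (fst e)" using D(3)[rule_format, OF pi_props(3)[OF eU]] in_D by blast
      then show False using free[OF w(1,2) eU] w(3) by blast
    qed
  qed
  have disjT: "disjoint_family_on (\<lambda>w. ?T w ` P w) ?S"
    unfolding disjoint_family_on_def
  proof (intro ballI impI)
    fix w w' assume w: "w \<in> ?S" "w' \<in> ?S" "w \<noteq> w'"
    show "?T w ` P w \<inter> ?T w' ` P w' = {}"
    proof (rule ccontr)
      assume "?T w ` P w \<inter> ?T w' ` P w' \<noteq> {}"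
      then obtain e e' where e: "e \<in> P w" "e' \<in> P w'" "?T w e = ?T w' e'" by blast
      then have eE: "e \<in> E" "e' \<in> E" and eU: "e \<in> UHP \<times> UNIV" "e' \<in> UHP \<times> UNIV"
        by (simp_all only: P_iff)
      have "dpi e = dpi e'" using dT[OF w(1) eU(1)] dT[OF w(2) eU(2)] e(3) by simp
      then have "e = e'" using E(2) eE by (auto dest: inj_onD)
      then show False using disjP e(1,2) w unfolding disjoint_family_on_def by blast
    qed
  qed
  \<comment> \<open>Countability of the fibre permits summing the measures of the pieces.\<close>
  have S: "countable ?S" by (rule countable_fibre)
  have "emeasure ?\<nu> (dpi ` E) = emeasure \<mu> (dpi -` (dpi ` E) \<inter> ?D)"
  proof -
    have "emeasure ?\<nu> (dpi ` E) = emeasure (restrict_space \<mu> ?D) (dpi -` (dpi ` E) \<inter> space (restrict_space \<mu> ?D))"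
      by (rule emeasure_distr[OF measurable_restrict_space1[OF dm] img])
    also have "space (restrict_space \<mu> ?D) = ?D" using DU by (auto simp: space_restrict_space sp)
    finally show ?thesis using Dm by (simp add: emeasure_restrict_space)
  qed
  also have "\<dots> = (\<integral>\<^sup>+w. emeasure \<mu> (?T w ` P w) \<partial>count_space ?S)"
    unfolding Y by (rule emeasure_UN_countable[OF _ S disjT]) (use TPm \<mu> in blast)
  also have "\<dots> = (\<integral>\<^sup>+w. emeasure \<mu> (P w) \<partial>count_space ?S)"
    by (rule nn_integral_cong) (simp add: TP)
  also have "\<dots> = emeasure \<mu> (\<Union>w\<in>?S. P w)"
    by (rule emeasure_UN_countable[OF _ S disjP, symmetric]) (use Pm \<mu> in blast)
  also have "(\<Union>w\<in>?S. P w) = E" using cover by simp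
  finally show "emeasure ?\<nu> (dpi ` E) = emeasure \<mu> E" .
qed

end

theorem ex1_descends_to:
  assumes \<mu>: "sets \<mu> = sets bundle_borel"
    and inv: "\<And>f g. isometry_pair f g \<Longrightarrow> (\<And>x. x \<in> UHP \<Longrightarrow> \<pi> (f x) = \<pi> x) \<Longrightarrow> distr \<mu> bundle_borel (tangent_map f) = \<mu>"
  shows "\<exists>!\<nu>. descends_to X A \<pi> \<mu> \<nu>"
proof (rule fundamental_domain)
  fix D assume "D \<in> sets borel" "D \<subseteq> UHP" "\<And>p. p \<in> X \<Longrightarrow> \<exists>!z. z \<in> D \<and> \<pi> z = p"
  then have D: "D \<in> sets borel" "D \<subseteq> UHP" "\<forall>p\<in>X. \<exists>!z. z \<in> D \<and> \<pi> z = p" by simp_all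
  show ?thesis
  proof (rule ex1I)
    show "descends_to X A \<pi> \<mu> (distr (restrict_space \<mu> (D \<times> UNIV)) (tangent_bundle_borel X A) dpi)" (is "descends_to _ _ _ _ ?\<nu>")
      by (rule descends_to_distr[OF D \<mu> inv])
    then have 1: "sets ?\<nu> = sets (tangent_bundle_borel X A)"
      "\<And>F. F \<in> sets ?\<nu> \<Longrightarrow> emeasure ?\<nu> F = emeasure \<mu> (dpi -` F \<inter> (D \<times> UNIV))"
      using descends_to_emeasure[OF D] unfolding descends_to_def by blast+
    fix \<nu>' assume \<nu>': "descends_to X A \<pi> \<mu> \<nu>'"
    then have 2: "sets \<nu>' = sets (tangent_bundle_borel X A)" by (simp add: descends_to_def)
    show "\<nu>' = ?\<nu>"
    proof (rule measure_eqI)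
      show "sets \<nu>' = sets ?\<nu>" using 1(1) 2 by simp
      fix F assume F: "F \<in> sets \<nu>'"
      have F': "F \<in> sets ?\<nu>" using F by (simp only: 1(1) 2)
      show "emeasure \<nu>' F = emeasure ?\<nu> F" unfolding descends_to_emeasure[OF D \<nu>' F] 1(2)[OF F'] by (rule refl)
    qed
  qed
qed

end

section \<open>Invariance and independence of the covering\<close>

text \<open>Two measures along the same \<open>J\<close> may come with different enumerations of
  \<open>J\<close>, related by an injection of the indices; limits must survive this
  reindexing.\<close>

lemma filterlim_inj_sequentially:
  fixes \<tau> :: "nat \<Rightarrow> nat"
  assumes "inj \<tau>" shows "filterlim \<tau> sequentially sequentially"
  unfolding filterlim_iff cofinite_eq_sequentially[symmetric] eventually_cofinite
proof (intro allI impI)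
  fix P :: "nat \<Rightarrow> bool" assume "finite {x. \<not> P x}"
  then have "finite (\<tau> -` {x. \<not> P x})" using assms by (rule finite_vimageI)
  then show "finite {x. \<not> P (\<tau> x)}" by (simp add: vimage_def)
qed

lemma semiclassical_measure_reorder:
  assumes "semiclassical_measure \<psi> h v \<mu>" "inj \<tau>"
  shows "semiclassical_measure \<psi> (\<lambda>k. h (\<tau> k)) (\<lambda>k. v (\<tau> k)) \<mu>"
proof -
  note t = filterlim_inj_sequentially[OF assms(2)]
  have v: "filterlim h (at_right 0) sequentially" "locally_L2_bounded v" "sets \<mu> = sets bundle_borel"
    and lim: "\<And>a. test_function (UHP \<times> UNIV) a \<Longrightarrow> integrable \<mu> (a :: complex \<times> complex \<Rightarrow> complex)"
      "\<And>a. test_function (UHP \<times> UNIV) a \<Longrightarrow> (\<lambda>k. inner_L2 (Op_hyp \<psi> (h k) a (v k)) (v k)) \<longlonglongrightarrow> (\<integral>p. a p \<partial>\<mu>)"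
    using assms(1) by (simp_all add: semiclassical_measure_def)
  have "locally_L2_bounded (\<lambda>k. v (\<tau> k))"
    unfolding locally_L2_bounded_def
  proof (intro conjI allI impI)
    show "v (\<tau> k) \<in> borel_measurable (restrict_space borel UHP)" for k
      using v(2) by (simp add: locally_L2_bounded_def)
    fix K assume "compact K \<and> K \<subseteq> UHP"
    then have "\<exists>C::real. \<forall>k. (\<integral>\<^sup>+z\<in>K. ennreal ((cmod (v k z))\<^sup>2) \<partial>hyp_area) \<le> ennreal C"
      using v(2) by (simp only: locally_L2_bounded_def)
    then obtain C :: real where "\<forall>k. (\<integral>\<^sup>+z\<in>K. ennreal ((cmod (v k z))\<^sup>2) \<partial>hyp_area) \<le> ennreal C"
      by (elim exE)
    then show "\<exists>C::real. \<forall>k. (\<integral>\<^sup>+z\<in>K. ennreal ((cmod (v (\<tau> k) z))\<^sup>2) \<partial>hyp_area) \<le> ennreal C"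
      by (intro exI[of _ C] allI) (elim allE)
  qed
  then show ?thesis
    unfolding semiclassical_measure_def
    using filterlim_compose[OF v(1) t] v(3) lim(1) filterlim_compose[OF lim(2) t] by simp
qed

text \<open>With \<open>n = [B s]\<close> and \<open>h = 1 / s\<close>, the rounding error of the
  integer part is at most 1, which is the rate \<open>|n h - B| \<le> h\<close> demanded by
  \<open>semiclassical_measure_isometry\<close>.\<close>

lemma mu_low_coverings:
  assumes c: "covered_surface X A \<pi>" "covered_surface X A \<pi>'" and \<psi>: "quadratic_partition \<psi>"
    and B: "B > 0" and J: "J \<subseteq> sqrt_spec X A - {0}"
    and eig: "\<And>s. s \<in> J \<Longrightarrow> laplace_eigen_eq A (s\<^sup>2) (u0 s)"
    and fg: "isometry_pair f g" and lift: "\<And>x. x \<in> UHP \<Longrightarrow> \<pi> (f x) = \<pi>' x"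
    and \<mu>: "semiclassical_measure_along \<psi> J (u_B u0 B \<pi>) \<mu>"
    and \<mu>': "semiclassical_measure_along \<psi> J (u_B u0 B \<pi>') \<mu>'"
  shows "mu_low B \<mu>' = distr (mu_low B \<mu>) bundle_borel (tangent_map g)"
proof -
  interpret partition \<psi> using \<psi> by (rule partition.intro)
  obtain \<sigma> where \<sigma>: "bij_betw \<sigma> (UNIV :: nat set) J" "semiclassical_measure \<psi> (\<lambda>k. 1 / \<sigma> k) (\<lambda>k. u_B u0 B \<pi> (\<sigma> k)) \<mu>"
    using \<mu> by (auto simp: semiclassical_measure_along_def)
  obtain \<rho> where \<rho>: "bij_betw \<rho> (UNIV :: nat set) J" "semiclassical_measure \<psi> (\<lambda>k. 1 / \<rho> k) (\<lambda>k. u_B u0 B \<pi>' (\<rho> k)) \<mu>'"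
    using \<mu>' by (auto simp: semiclassical_measure_along_def)
  \<comment> \<open>Re-enumerates \<open>J\<close> in the first family so that both families run
    through it in the same order.\<close>
  define \<tau> where "\<tau> k = inv_into UNIV \<sigma> (\<rho> k)" for k
  have mem: "\<rho> k \<in> J" for k using \<rho>(1) by (auto simp: bij_betw_def)
  then have \<tau>: "\<sigma> (\<tau> k) = \<rho> k" for k
    unfolding \<tau>_def using \<sigma>(1) by (intro f_inv_into_f) (auto simp: bij_betw_def)
  have inj: "inj \<tau>"
    using \<rho>(1) \<tau> by (intro injI) (metis bij_betw_def injD)
  have m: "semiclassical_measure \<psi> (\<lambda>k. 1 / \<rho> k) (\<lambda>k. u_B u0 B \<pi> (\<rho> k)) \<mu>"
    using semiclassical_measure_reorder[OF \<sigma>(2) inj] by (simp add: \<tau>)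
  have pos: "\<rho> k > 0" for k
    using mem[of k] J by (auto simp: sqrt_spec_def subset_iff)
  show ?thesis
  proof (rule semiclassical_measure_isometry[OF fg _ _ m \<rho>(2), where n = "\<lambda>k. nat \<lfloor>B * \<rho> k\<rfloor>"])
    have "\<bar>real (nat \<lfloor>B * \<rho> k\<rfloor>) * (1 / \<rho> k) - B\<bar> \<le> 1 / \<rho> k" for k
    proof -
      have "0 \<le> B * \<rho> k" using B pos[of k] by simp
      then have "real (nat \<lfloor>B * \<rho> k\<rfloor>) = of_int \<lfloor>B * \<rho> k\<rfloor>" by simp
      then have "\<bar>real (nat \<lfloor>B * \<rho> k\<rfloor>) - B * \<rho> k\<bar> \<le> 1" by linarith
      then have "\<bar>real (nat \<lfloor>B * \<rho> k\<rfloor>) - B * \<rho> k\<bar> / \<rho> k \<le> 1 / \<rho> k"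
        using pos[of k] by (intro divide_right_mono) auto
      also have "\<bar>real (nat \<lfloor>B * \<rho> k\<rfloor>) - B * \<rho> k\<bar> / \<rho> k = \<bar>(real (nat \<lfloor>B * \<rho> k\<rfloor>) - B * \<rho> k) / \<rho> k\<bar>"
        using pos[of k] by simp
      also have "(real (nat \<lfloor>B * \<rho> k\<rfloor>) - B * \<rho> k) / \<rho> k = real (nat \<lfloor>B * \<rho> k\<rfloor>) * (1 / \<rho> k) - B"
        using pos[of k] by (simp add: diff_divide_distrib)
      finally show ?thesis .
    qed
    then show "\<forall>\<^sub>F k in sequentially. \<bar>real (nat \<lfloor>B * \<rho> k\<rfloor>) * (1 / \<rho> k) - B\<bar> \<le> 1 / \<rho> k" by simp
    show "u_B u0 B \<pi>' (\<rho> k) z = rotation_factor f z ^ nat \<lfloor>B * \<rho> k\<rfloor> * u_B u0 B \<pi> (\<rho> k) (f z)" if "z \<in> UHP" for k z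
      unfolding u_B_def Asc_def by (rule ascend_coverings[OF c eig[OF mem] fg lift that])
  qed (use B in simp)
qed

theorem proposition1p4:
  fixes X :: "'x::t2_space set" and A :: "'x chart set"
    and u0 :: "real \<Rightarrow> 'x \<Rightarrow> real"
    and \<psi> :: "nat \<Rightarrow> complex \<Rightarrow> real"
    and B :: real and J :: "real set"
  assumes "compact_hyperbolic_surface X A"
    and "\<And>s. s \<in> sqrt_spec X A \<Longrightarrow> laplace_eigen_eq A (s\<^sup>2) (u0 s) \<and> L2_norm_surface X A (u0 s) = 1"
    and "quadratic_partition \<psi>"
    and "B > 0"
    and "J \<subseteq> sqrt_spec X A - {0}" and "infinite J"
  shows
    "(\<forall>\<pi> \<mu>. hyperbolic_covering X A \<pi> \<and> semiclassical_measure_along \<psi> J (u_B u0 B \<pi>) \<mu> \<longrightarrow>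
        (\<forall>\<gamma>\<in>deck_group \<pi>. distr (mu_low B \<mu>) bundle_borel (tangent_map \<gamma>) = mu_low B \<mu>) \<and>
        (\<exists>!\<nu>. descends_to X A \<pi> (mu_low B \<mu>) \<nu>)) \<and>
     (\<forall>\<pi>\<^sub>I \<pi>\<^sub>I\<^sub>I \<mu>\<^sub>I \<mu>\<^sub>I\<^sub>I \<nu>\<^sub>I \<nu>\<^sub>I\<^sub>I.
        hyperbolic_covering X A \<pi>\<^sub>I \<and> semiclassical_measure_along \<psi> J (u_B u0 B \<pi>\<^sub>I) \<mu>\<^sub>I \<and>
        hyperbolic_covering X A \<pi>\<^sub>I\<^sub>I \<and> semiclassical_measure_along \<psi> J (u_B u0 B \<pi>\<^sub>I\<^sub>I) \<mu>\<^sub>I\<^sub>I \<and>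
        descends_to X A \<pi>\<^sub>I (mu_low B \<mu>\<^sub>I) \<nu>\<^sub>I \<and> descends_to X A \<pi>\<^sub>I\<^sub>I (mu_low B \<mu>\<^sub>I\<^sub>I) \<nu>\<^sub>I\<^sub>I \<longrightarrow>
        \<nu>\<^sub>I = \<nu>\<^sub>I\<^sub>I)"
proof -
  have cs: "covered_surface X A \<pi>" if "hyperbolic_covering X A \<pi>" for \<pi>
    using assms(1) that by (intro covered_surface.intro hyperbolic_surface.intro covered_surface_axioms.intro)
  have eig: "laplace_eigen_eq A (s\<^sup>2) (u0 s)" if "s \<in> J" for s using assms(2,5) that by blast
  have sets: "sets (mu_low B \<mu>) = sets bundle_borel" for \<mu> by (simp add: mu_low_def)
  have space: "space (mu_low B \<mu>) = UHP \<times> UNIV" for \<mu> by (simp add: mu_low_def space_bundle_borel)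
  \<comment> \<open>A covering compared with itself. The pair is swapped because
    \<open>mu_low_coverings\<close> transports by the second component.\<close>
  have inv: "distr (mu_low B \<mu>) bundle_borel (tangent_map f) = mu_low B \<mu>"
    if \<pi>: "hyperbolic_covering X A \<pi>" and \<mu>: "semiclassical_measure_along \<psi> J (u_B u0 B \<pi>) \<mu>"
      and fg: "isometry_pair f g" and lift: "\<And>x. x \<in> UHP \<Longrightarrow> \<pi> (f x) = \<pi> x" for \<pi> \<mu> f g
  proof (rule mu_low_coverings[OF cs[OF \<pi>] cs[OF \<pi>] assms(3,4,5) eig isometry_pair_sym[OF fg] _ \<mu> \<mu>, symmetric])
    show "\<pi> (g x) = \<pi> x" if "x \<in> UHP" for x
      using lift[OF isometry_pairD(6)[OF fg that]] isometry_pairD(3)[OF fg that] by simp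
  qed
  have ex1: "\<exists>!\<nu>. descends_to X A \<pi> (mu_low B \<mu>) \<nu>"
    if "hyperbolic_covering X A \<pi>" "semiclassical_measure_along \<psi> J (u_B u0 B \<pi>) \<mu>" for \<pi> \<mu>
    by (rule covered_surface.ex1_descends_to[OF cs[OF that(1)] sets inv[OF that]])
  have deck: "distr (mu_low B \<mu>) bundle_borel (tangent_map \<gamma>) = mu_low B \<mu>"
    if \<pi>: "hyperbolic_covering X A \<pi>" and \<mu>: "semiclassical_measure_along \<psi> J (u_B u0 B \<pi>) \<mu>" and \<gamma>: "\<gamma> \<in> deck_group \<pi>" for \<pi> \<mu> \<gamma>
  proof -
    obtain f g where f: "isometry_pair f g" "\<And>x. x \<in> UHP \<Longrightarrow> \<pi> (f x) = \<pi> x" "\<And>x. x \<in> UHP \<Longrightarrow> \<gamma> x = f x"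
      using covered_surface.deck_group_isometry[OF cs[OF \<pi>] \<gamma>] by blast
    have "tangent_map \<gamma> x = tangent_map f x" if x: "x \<in> UHP \<times> UNIV" for x
    proof -
      obtain z v where zv: "x = (z, v)" "z \<in> UHP" using x by auto
      have "(\<gamma> has_field_derivative deriv f z) (at z)"
        by (rule has_field_derivative_transform_within_open[OF
              hyp_local_isometryD(3)[OF isometry_pairD(1)[OF f(1)] open_UHP zv(2)] open_UHP zv(2)]) (simp add: f(3))
      then show ?thesis
        using frechet_derivative_field f(3)[OF zv(2)] by (simp add: zv tangent_map_isometry[OF f(1)]) (simp add: tangent_map_def)
    qed
    then have "distr (mu_low B \<mu>) bundle_borel (tangent_map \<gamma>) = distr (mu_low B \<mu>) bundle_borel (tangent_map f)"
      by (intro distr_cong) (auto simp: space)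
    then show ?thesis using inv[OF \<pi> \<mu> f(1,2)] by simp
  qed
  have indep: "\<nu>\<^sub>I = \<nu>\<^sub>I\<^sub>I"
    if I: "hyperbolic_covering X A \<pi>\<^sub>I" "semiclassical_measure_along \<psi> J (u_B u0 B \<pi>\<^sub>I) \<mu>\<^sub>I"
      and II: "hyperbolic_covering X A \<pi>\<^sub>I\<^sub>I" "semiclassical_measure_along \<psi> J (u_B u0 B \<pi>\<^sub>I\<^sub>I) \<mu>\<^sub>I\<^sub>I"
      and d: "descends_to X A \<pi>\<^sub>I (mu_low B \<mu>\<^sub>I) \<nu>\<^sub>I" "descends_to X A \<pi>\<^sub>I\<^sub>I (mu_low B \<mu>\<^sub>I\<^sub>I) \<nu>\<^sub>I\<^sub>I"
    for \<pi>\<^sub>I \<pi>\<^sub>I\<^sub>I \<mu>\<^sub>I \<mu>\<^sub>I\<^sub>I \<nu>\<^sub>I \<nu>\<^sub>I\<^sub>I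
  proof -
    interpret p: covered_surface X A \<pi>\<^sub>I by (rule cs[OF I(1)])
    interpret q: covered_surface X A \<pi>\<^sub>I\<^sub>I by (rule cs[OF II(1)])
    obtain w where w: "w \<in> UHP" "\<pi>\<^sub>I w = \<pi>\<^sub>I\<^sub>I \<i>" using p.pi_props(2) q.pi_props(3)[OF i_UHP] by (metis imageE)
    obtain f g where fg: "isometry_pair f g" "f \<i> = w" "\<And>x. x \<in> UHP \<Longrightarrow> \<pi>\<^sub>I (f x) = \<pi>\<^sub>I\<^sub>I x"
      using two_coverings_lift[OF p.covered_surface_axioms q.covered_surface_axioms i_UHP w] by blast
    have \<mu>: "mu_low B \<mu>\<^sub>I\<^sub>I = distr (mu_low B \<mu>\<^sub>I) bundle_borel (tangent_map g)"
      by (rule mu_low_coverings[OF p.covered_surface_axioms q.covered_surface_axioms assms(3,4,5) eig fg(1,3) I(2) II(2)])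
    have gf: "isometry_pair g f" using fg(1) by (rule isometry_pair_sym)
    \<comment> \<open>By uniqueness it suffices that \<open>\<nu>\<^sub>I\<^sub>I\<close> also
      represents the measure obtained from the first covering. Sets are carried over by the
      differential of \<open>g\<close>, which intertwines the two covering differentials.\<close>
    have "descends_to X A \<pi>\<^sub>I (mu_low B \<mu>\<^sub>I) \<nu>\<^sub>I\<^sub>I"
      unfolding descends_to_def
    proof (intro conjI ballI impI)
      show "sets \<nu>\<^sub>I\<^sub>I = sets (tangent_bundle_borel X A)" using d(2) by (simp add: descends_to_def)
      fix E assume E: "E \<in> sets bundle_borel" "inj_on p.dpi E"
      have EU: "E \<subseteq> UHP \<times> UNIV" using E(1) by (simp add: bundle_borel_iff)
      let ?E = "tangent_map g ` E"
      have ch: "q.dpi (tangent_map g e) = p.dpi e" if "e \<in> E" for e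
      proof -
        have e: "e \<in> UHP \<times> UNIV" using that EU by blast
        show ?thesis
          using covering_differential_lift[OF p.covered_surface_axioms q.covered_surface_axioms fg(1,3) tangent_map_inverse(1)[OF gf e]]
            tangent_map_inverse(2)[OF gf e] by simp
      qed
      then have img: "q.dpi ` ?E = p.dpi ` E" by (force simp: image_image)
      have inj: "inj_on q.dpi ?E"
        using E(2) ch by (auto simp: inj_on_def)
      have Em: "?E \<in> sets bundle_borel" by (rule tangent_map_image_measurable[OF gf E(1)])
      have "emeasure \<nu>\<^sub>I\<^sub>I (p.dpi ` E) = emeasure (mu_low B \<mu>\<^sub>I\<^sub>I) ?E"
        using d(2) Em inj unfolding descends_to_def img[symmetric] by blast
      also have "\<dots> = emeasure (mu_low B \<mu>\<^sub>I) E"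
      proof (rule emeasure_tangent_map_image[OF gf sets _ E(1)])
        have m: "tangent_map g \<in> mu_low B \<mu>\<^sub>I \<rightarrow>\<^sub>M bundle_borel"
          using tangent_map_measurable[OF fg(1)] measurable_cong_sets[OF sets refl] by blast
        have "distr (mu_low B \<mu>\<^sub>I\<^sub>I) bundle_borel (tangent_map f) = distr (mu_low B \<mu>\<^sub>I) bundle_borel (tangent_map f \<circ> tangent_map g)"
          unfolding \<mu> by (rule distr_distr[OF tangent_map_measurable[OF gf] m])
        also have "\<dots> = distr (mu_low B \<mu>\<^sub>I) (mu_low B \<mu>\<^sub>I) (\<lambda>x. x)"
          by (rule distr_cong) (auto simp: sets space tangent_map_inverse(2)[OF gf])
        also have "\<dots> = mu_low B \<mu>\<^sub>I" by (rule distr_id)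
        finally show "mu_low B \<mu>\<^sub>I = distr (mu_low B \<mu>\<^sub>I\<^sub>I) bundle_borel (tangent_map f)" by simp
      qed
      finally show "emeasure \<nu>\<^sub>I\<^sub>I (p.dpi ` E) = emeasure (mu_low B \<mu>\<^sub>I) E" .
    qed
    then show ?thesis using ex1[OF I] d(1) by blast
  qed
  show ?thesis
    using deck ex1 indep by blast
qed

end
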